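(* Let $p$ be a prime. There exists a (3-nilpotent)-by-abelian finitely generated group $\Gamma$, which is a quotient of $A_4(\mathbf{F}_p[t,t^{-1},(t-1)^{-1}])$ by a central subgroup, such that for every nonprincipal ultrafilter $\omega$ on the set of positive integers, the group $\pi_1(\mathrm{Cone}_\omega(\Gamma))$ is either trivial or isomorphic to $\mathbf{F}_p$ (the cyclic group on $p$ elements), and such that $\pi_1(\mathrm{Cone}_\omega(\Gamma))$ is isomorphic to $\mathbf{F}_p$ for at least one nonprincipal ultrafilter $\omega$.
   Context: For a commutative ring $R$, $A_4(R)$ denotes the group of upper triangular $4\times 4$ matrices over $R$ with diagonal $(1,t_{22},t_{33},1)$, where $t_{22},t_{33}\in R^\times$, and with arbitrary entries $x_{ij}\in R$ for $i<j$. (3-nilpotent)-by-abelian means having a normal subgroup that is nilpotent of class at most $3$ with abelian quotient. A finitely generated group is endowed with a word metric for a finite generating subset. Asymptotic cone: for a metric space $(X,d)$ with base-point $x_0$ and a nonprincipal ultrafilter $\omega$ on the set $\mathbf{N}$ of positive integers, let $\mathrm{Precone}(X)$ be the set of sequences $(x_n)$ in $X$ with $\limsup_n d(x_n,x_0)/n<\infty$, with pseudo-distance $d_\omega(x,y)=\lim_\omega \frac1n d(x_n,y_n)$. Then $\mathrm{Cone}_\omega(X)$ is the metric space obtained by identifying points at pseudo-distance $0$. *)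

theory Defs
  imports
    "HOL-Analysis.Analysis"
    "HOL-Algebra.Elementary_Groups"
    "Jordan_Normal_Form.Matrix"
    "Berlekamp_Zassenhaus.Finite_Field"
    "HOL-Computational_Algebra.Fraction_Field"
begin

section \<open>The matrix groups\<close>

text \<open>
  The ring \<open>K[t, 1/t, 1/(t - 1)]\<close>, realised inside the field \<open>K(t)\<close> of rational functions.
\<close>

definition localized_polys :: "'k::field poly fract set" where
  "localized_polys = {Fract f ([:0, 1:] ^ k * [:-1, 1:] ^ m) | f k m. True}"

text \<open>
  \<open>A4 R\<close> for a subring \<open>R\<close> of a commutative ring type (with \<open>R = UNIV\<close> for the type itself).
  Matrix indices start at \<open>0\<close>, so the diagonal entries \<open>t\<^sub>2\<^sub>2\<close> and \<open>t\<^sub>3\<^sub>3\<close> have index \<open>1\<close> and \<open>2\<close>.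
\<close>

definition A4 :: "'r::comm_ring_1 set \<Rightarrow> 'r mat monoid" where
  "A4 R = \<lparr>carrier = {A \<in> carrier_mat 4 4. upper_triangular A \<and>
              (\<forall>i<4. \<forall>j<4. A $$ (i, j) \<in> R) \<and>
              A $$ (0, 0) = 1 \<and> A $$ (3, 3) = 1 \<and>
              (\<exists>u\<in>R. A $$ (1, 1) * u = 1) \<and> (\<exists>u\<in>R. A $$ (2, 2) * u = 1)},
           monoid.mult = (*), one = 1\<^sub>m 4\<rparr>"


section \<open>Group-theoretic notions\<close>

definition central_subgroup :: "'a set \<Rightarrow> ('a, 'b) monoid_scheme \<Rightarrow> bool" where
  "central_subgroup Z G \<longleftrightarrow> subgroup Z G \<and>
     (\<forall>z\<in>Z. \<forall>g\<in>carrier G. z \<otimes>\<^bsub>G\<^esub> g = g \<otimes>\<^bsub>G\<^esub> z)"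

text \<open>The indexing starts at \<open>0\<close>: \<open>lower_central G n\<close> is the term usually written \<open>\<gamma>\<^sub>n\<^sub>+\<^sub>1(G)\<close>.\<close>

primrec lower_central :: "('a, 'b) monoid_scheme \<Rightarrow> nat \<Rightarrow> 'a set" where
  "lower_central G 0 = carrier G"
| "lower_central G (Suc n) = generate G
     {x \<otimes>\<^bsub>G\<^esub> y \<otimes>\<^bsub>G\<^esub> inv\<^bsub>G\<^esub> x \<otimes>\<^bsub>G\<^esub> inv\<^bsub>G\<^esub> y | x y. x \<in> carrier G \<and> y \<in> lower_central G n}"

definition nilpotent_of_class_at_most :: "nat \<Rightarrow> ('a, 'b) monoid_scheme \<Rightarrow> bool" where
  "nilpotent_of_class_at_most c G \<longleftrightarrow> group G \<and> lower_central G c = {\<one>\<^bsub>G\<^esub>}"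

definition nilpotent_by_abelian :: "nat \<Rightarrow> ('a, 'b) monoid_scheme \<Rightarrow> bool" where
  "nilpotent_by_abelian c G \<longleftrightarrow>
     (\<exists>N. N \<lhd> G \<and> nilpotent_of_class_at_most c (G\<lparr>carrier := N\<rparr>) \<and> comm_group (G Mod N))"

definition finite_generating_set :: "('a, 'b) monoid_scheme \<Rightarrow> 'a set \<Rightarrow> bool" where
  "finite_generating_set G S \<longleftrightarrow> finite S \<and> S \<subseteq> carrier G \<and> generate G S = carrier G"

definition finitely_generated_group :: "('a, 'b) monoid_scheme \<Rightarrow> bool" where
  "finitely_generated_group G \<longleftrightarrow> group G \<and> (\<exists>S. finite_generating_set G S)"


section \<open>Word metrics\<close>

definition is_word_for ::
    "('a, 'b) monoid_scheme \<Rightarrow> 'a set \<Rightarrow> 'a list \<Rightarrow> 'a \<Rightarrow> bool" where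
  "is_word_for G S ws g \<longleftrightarrow>
     set ws \<subseteq> S \<union> (m_inv G) ` S \<and> foldr (monoid.mult G) ws \<one>\<^bsub>G\<^esub> = g"

definition word_length :: "('a, 'b) monoid_scheme \<Rightarrow> 'a set \<Rightarrow> 'a \<Rightarrow> nat" where
  "word_length G S g = (LEAST n. \<exists>ws. length ws = n \<and> is_word_for G S ws g)"

text \<open>
  The library's \<^const>\<open>Metric_space\<close> asks for symmetry and nonnegativity also outside the carrier,
  hence the default value \<open>0\<close> there (and in \<open>cone_dist\<close> below).
\<close>

definition word_dist :: "('a, 'b) monoid_scheme \<Rightarrow> 'a set \<Rightarrow> 'a \<Rightarrow> 'a \<Rightarrow> real" where
  "word_dist G S g h =
     (if g \<in> carrier G \<and> h \<in> carrier G then real (word_length G S (inv\<^bsub>G\<^esub> g \<otimes>\<^bsub>G\<^esub> h)) else 0)"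

definition word_metric :: "('a, 'b) monoid_scheme \<Rightarrow> 'a set \<Rightarrow> 'a metric" where
  "word_metric G S = metric (carrier G, word_dist G S)"

lemma word_metric_is_metric:
  assumes "group G" and "S \<subseteq> carrier G" and gen: "generate G S = carrier G"
  shows "Metric_space (carrier G) (word_dist G S)"
proof -
  interpret group G by fact
  let ?A = "S \<union> (m_inv G) ` S"
  have A: "?A \<subseteq> carrier G" using assms(2) by auto
  have closed: "foldr (\<otimes>\<^bsub>G\<^esub>) ws \<one>\<^bsub>G\<^esub> \<in> carrier G" if "set ws \<subseteq> ?A" for ws
    using that A by (induction ws) auto
  have app: "foldr (\<otimes>\<^bsub>G\<^esub>) (us @ vs) \<one>\<^bsub>G\<^esub> = foldr (\<otimes>\<^bsub>G\<^esub>) us \<one>\<^bsub>G\<^esub> \<otimes>\<^bsub>G\<^esub> foldr (\<otimes>\<^bsub>G\<^esub>) vs \<one>\<^bsub>G\<^esub>"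
    if "set us \<subseteq> ?A" "set vs \<subseteq> ?A" for us vs
    using that(1)
  proof (induction us)
    case (Cons a us)
    then have "a \<in> carrier G" "set us \<subseteq> ?A" using A by auto
    with Cons show ?case using closed[of us] closed[OF that(2)] by (simp add: m_assoc)
  qed (use closed[OF that(2)] in simp)
  have Ainv: "inv\<^bsub>G\<^esub> a \<in> ?A" if "a \<in> ?A" for a
    using that assms(2) by (auto simp: image_iff subset_iff)
  have revinv: "is_word_for G S (rev (map (m_inv G) ws)) (inv\<^bsub>G\<^esub> g)" if "is_word_for G S ws g" for ws g
  proof -
    have 1: "set ws \<subseteq> ?A" "g = foldr (\<otimes>\<^bsub>G\<^esub>) ws \<one>\<^bsub>G\<^esub>" using that by (auto simp: is_word_for_def)
    have "set (rev (map (m_inv G) ws)) \<subseteq> ?A \<and>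
        foldr (\<otimes>\<^bsub>G\<^esub>) (rev (map (m_inv G) ws)) \<one>\<^bsub>G\<^esub> = inv\<^bsub>G\<^esub> (foldr (\<otimes>\<^bsub>G\<^esub>) ws \<one>\<^bsub>G\<^esub>)" using 1(1)
    proof (induction ws)
      case (Cons a ws)
      then have a: "a \<in> carrier G" "a \<in> ?A" "set ws \<subseteq> ?A" using A by auto
      have b: "set (rev (map (m_inv G) ws)) \<subseteq> ?A" "set [inv\<^bsub>G\<^esub> a] \<subseteq> ?A"
        using Cons.IH a(3) Ainv[OF a(2)] by auto
      have "foldr (\<otimes>\<^bsub>G\<^esub>) (rev (map (m_inv G) (a # ws))) \<one>\<^bsub>G\<^esub>
          = foldr (\<otimes>\<^bsub>G\<^esub>) (rev (map (m_inv G) ws)) \<one>\<^bsub>G\<^esub> \<otimes>\<^bsub>G\<^esub> foldr (\<otimes>\<^bsub>G\<^esub>) [inv\<^bsub>G\<^esub> a] \<one>\<^bsub>G\<^esub>"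
        using app[OF b] by simp
      also have "\<dots> = inv\<^bsub>G\<^esub> (foldr (\<otimes>\<^bsub>G\<^esub>) ws \<one>\<^bsub>G\<^esub>) \<otimes>\<^bsub>G\<^esub> inv\<^bsub>G\<^esub> a"
        using Cons.IH a by simp
      also have "\<dots> = inv\<^bsub>G\<^esub> (foldr (\<otimes>\<^bsub>G\<^esub>) (a # ws) \<one>\<^bsub>G\<^esub>)"
        using a closed[of ws] by (simp add: inv_mult_group)
      finally show ?case using b by auto
    qed simp
    then show ?thesis using 1 by (simp add: is_word_for_def)
  qed
  have ex: "\<exists>ws. is_word_for G S ws g" if "g \<in> carrier G" for g
  proof -
    have "g \<in> generate G S" using gen that by simp
    then show ?thesis
    proof (induction rule: generate.induct)
      case one
      show ?case by (rule exI[of _ "[]"]) (simp add: is_word_for_def)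
    next
      case (incl h)
      then show ?case using assms(2) by (intro exI[of _ "[h]"]) (auto simp: is_word_for_def)
    next
      case (inv h)
      then show ?case using assms(2) by (intro exI[of _ "[inv\<^bsub>G\<^esub> h]"]) (auto simp: is_word_for_def)
    next
      case (eng g h)
      then obtain us vs where "is_word_for G S us g" "is_word_for G S vs h" by blast
      then have "is_word_for G S (us @ vs) (g \<otimes>\<^bsub>G\<^esub> h)"
        using app[of us vs] by (auto simp: is_word_for_def)
      then show ?case by blast
    qed
  qed
  have wl: "\<exists>ws. length ws = word_length G S g \<and> is_word_for G S ws g" if "g \<in> carrier G" for g
    unfolding word_length_def
    by (rule LeastI_ex[where P = "\<lambda>n. \<exists>ws. length ws = n \<and> is_word_for G S ws g"]) (use ex[OF that] in blast)
  have wl_le: "word_length G S g \<le> length ws" if "is_word_for G S ws g" for ws g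
    unfolding word_length_def by (rule Least_le, rule exI[of _ ws]) (simp add: that)
  have wl_inv_le: "word_length G S (inv\<^bsub>G\<^esub> g) \<le> word_length G S g" if g: "g \<in> carrier G" for g
  proof -
    obtain ws where ws: "length ws = word_length G S g" "is_word_for G S ws g" using wl[OF g] by blast
    show ?thesis using wl_le[OF revinv[OF ws(2)]] ws(1) by simp
  qed
  have wl_inv: "word_length G S (inv\<^bsub>G\<^esub> g) = word_length G S g" if "g \<in> carrier G" for g
    using wl_inv_le[OF that] wl_inv_le[of "inv\<^bsub>G\<^esub> g"] that by simp
  have wl_mult: "word_length G S (g \<otimes>\<^bsub>G\<^esub> h) \<le> word_length G S g + word_length G S h"
    if gh: "g \<in> carrier G" "h \<in> carrier G" for g h
  proof -
    obtain us where "length us = word_length G S g" "is_word_for G S us g" using wl[OF gh(1)] by blast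
    moreover obtain vs where "length vs = word_length G S h" "is_word_for G S vs h" using wl[OF gh(2)] by blast
    moreover from calculation have "is_word_for G S (us @ vs) (g \<otimes>\<^bsub>G\<^esub> h)"
      using app[of us vs] by (auto simp: is_word_for_def)
    ultimately show ?thesis using wl_le[of "us @ vs"] by simp
  qed
  have wl_0: "word_length G S g = 0 \<longleftrightarrow> g = \<one>\<^bsub>G\<^esub>" if "g \<in> carrier G" for g
  proof
    assume "word_length G S g = 0"
    with wl[OF that] show "g = \<one>\<^bsub>G\<^esub>" by (auto simp: is_word_for_def)
  next
    assume "g = \<one>\<^bsub>G\<^esub>"
    then have "is_word_for G S [] g" by (simp add: is_word_for_def)
    from wl_le[OF this] show "word_length G S g = 0" by simp
  qed
  show ?thesis
  proof
    show "0 \<le> word_dist G S g h" for g h by (simp add: word_dist_def)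
    show "word_dist G S g h = word_dist G S h g" for g h
    proof (cases "g \<in> carrier G \<and> h \<in> carrier G")
      case True
      then have "inv\<^bsub>G\<^esub> (inv\<^bsub>G\<^esub> g \<otimes>\<^bsub>G\<^esub> h) = inv\<^bsub>G\<^esub> h \<otimes>\<^bsub>G\<^esub> g" by (simp add: inv_mult_group)
      with wl_inv[of "inv\<^bsub>G\<^esub> g \<otimes>\<^bsub>G\<^esub> h"] True show ?thesis by (simp add: word_dist_def)
    qed (auto simp: word_dist_def)
    show "word_dist G S g h = 0 \<longleftrightarrow> g = h" if "g \<in> carrier G" "h \<in> carrier G" for g h
    proof -
      have "inv\<^bsub>G\<^esub> g \<otimes>\<^bsub>G\<^esub> h = \<one>\<^bsub>G\<^esub> \<longleftrightarrow> g = h"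
        using that by (metis inv_closed inv_equality inv_inv l_inv)
      then show ?thesis using that wl_0[of "inv\<^bsub>G\<^esub> g \<otimes>\<^bsub>G\<^esub> h"] by (simp add: word_dist_def)
    qed
    show "word_dist G S g k \<le> word_dist G S g h + word_dist G S h k"
      if "g \<in> carrier G" "h \<in> carrier G" "k \<in> carrier G" for g h k
    proof -
      have "(inv\<^bsub>G\<^esub> g \<otimes>\<^bsub>G\<^esub> h) \<otimes>\<^bsub>G\<^esub> (inv\<^bsub>G\<^esub> h \<otimes>\<^bsub>G\<^esub> k) = inv\<^bsub>G\<^esub> g \<otimes>\<^bsub>G\<^esub> k"
        using that by (metis inv_closed m_assoc m_closed r_inv r_one)
      with wl_mult[of "inv\<^bsub>G\<^esub> g \<otimes>\<^bsub>G\<^esub> h" "inv\<^bsub>G\<^esub> h \<otimes>\<^bsub>G\<^esub> k"] that show ?thesis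
        by (simp add: word_dist_def flip: of_nat_add)
    qed
  qed
qed


section \<open>Asymptotic cones\<close>

text \<open>
  Ultrafilters on the set of positive integers are represented as filters on \<^typ>\<open>nat\<close> that
  contain that set. Accordingly, the term with index \<open>0\<close> of a sequence plays no role below.
\<close>

definition nonprincipal_ultrafilter :: "nat filter \<Rightarrow> bool" where
  "nonprincipal_ultrafilter \<omega> \<longleftrightarrow>
     \<omega> \<noteq> bot \<and> eventually (\<lambda>n. n > 0) \<omega> \<and>
     (\<forall>P. eventually P \<omega> \<or> eventually (\<lambda>n. \<not> P n) \<omega>) \<and>
     (\<forall>m. \<omega> \<noteq> principal {m})"

lemma ultrafilter_bounded_tendsto_Lim:
  fixes f :: "nat \<Rightarrow> real"
  assumes u: "nonprincipal_ultrafilter \<omega>" and b: "eventually (\<lambda>n. \<bar>f n\<bar> \<le> B) \<omega>"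
  shows "(f \<longlongrightarrow> Lim \<omega> f) \<omega>"
proof -
  have nb: "\<omega> \<noteq> bot" using u by (simp add: nonprincipal_ultrafilter_def)
  have "compact {-B..B}" by (rule compact_Icc)
  moreover have "filtermap f \<omega> \<noteq> bot" using nb by (simp add: filtermap_bot_iff)
  moreover have "eventually (\<lambda>x. x \<in> {-B..B}) (filtermap f \<omega>)"
    unfolding eventually_filtermap using b by (rule eventually_mono) auto
  ultimately obtain l where l: "inf (nhds l) (filtermap f \<omega>) \<noteq> bot"
    unfolding compact_filter by blast
  have "eventually (\<lambda>n. f n \<in> U) \<omega>" if U: "open U" "l \<in> U" for U
  proof (rule ccontr)
    assume "\<not> eventually (\<lambda>n. f n \<in> U) \<omega>"
    then have "eventually (\<lambda>n. f n \<notin> U) \<omega>"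
      using u unfolding nonprincipal_ultrafilter_def by blast
    then have "eventually (\<lambda>x. x \<notin> U) (filtermap f \<omega>)" by (simp add: eventually_filtermap)
    moreover have "eventually (\<lambda>x. x \<in> U) (nhds l)" using U by (auto simp: eventually_nhds)
    ultimately have "eventually (\<lambda>x. False) (inf (nhds l) (filtermap f \<omega>))"
      unfolding eventually_inf by blast
    with l show False by (simp add: trivial_limit_def)
  qed
  then have "(f \<longlongrightarrow> l) \<omega>" by (auto intro: topological_tendstoI)
  with tendsto_Lim[OF nb this] show ?thesis by simp
qed

lemma nonprincipal_ultrafilter_le_sequentially:
  assumes u: "nonprincipal_ultrafilter \<omega>"
  shows "\<omega> \<le> sequentially"
proof -
  have ne: "eventually (\<lambda>n. n \<noteq> m) \<omega>" for m
  proof (rule ccontr)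
    assume "\<not> eventually (\<lambda>n. n \<noteq> m) \<omega>"
    then have *: "eventually (\<lambda>n. n = m) \<omega>" using u unfolding nonprincipal_ultrafilter_def by force
    have "eventually P \<omega> \<longleftrightarrow> P m" for P
    proof
      assume "eventually P \<omega>"
      then have "eventually (\<lambda>n. P m) \<omega>" using * by eventually_elim simp
      then show "P m" using u by (auto simp: nonprincipal_ultrafilter_def eventually_const)
    next
      assume "P m"
      with * show "eventually P \<omega>" by (auto elim: eventually_mono)
    qed
    then have "\<omega> = principal {m}" by (simp add: filter_eq_iff eventually_principal)
    then show False using u by (simp add: nonprincipal_ultrafilter_def)
  qed
  have "eventually (\<lambda>n. N \<le> n) \<omega>" for N
  proof (induction N)
    case (Suc N)
    then show ?case using ne[of N] by eventually_elim simp
  qed simp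
  then show ?thesis
    unfolding le_filter_def eventually_sequentially by (metis (mono_tags, lifting) eventually_mono)
qed

definition precone :: "'a metric \<Rightarrow> 'a \<Rightarrow> (nat \<Rightarrow> 'a) set" where
  "precone M x0 = {x. (\<forall>n. x n \<in> mspace M) \<and>
     limsup (\<lambda>n. ereal (mdist M (x n) x0 / real n)) < \<infinity>}"

definition precone_dist :: "'a metric \<Rightarrow> nat filter \<Rightarrow> (nat \<Rightarrow> 'a) \<Rightarrow> (nat \<Rightarrow> 'a) \<Rightarrow> real" where
  "precone_dist M \<omega> x y = Lim \<omega> (\<lambda>n. 1 / real n * mdist M (x n) (y n))"

definition cone_rel ::
    "'a metric \<Rightarrow> 'a \<Rightarrow> nat filter \<Rightarrow> ((nat \<Rightarrow> 'a) \<times> (nat \<Rightarrow> 'a)) set" where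
  "cone_rel M x0 \<omega> = {(x, y). x \<in> precone M x0 \<and> y \<in> precone M x0 \<and> precone_dist M \<omega> x y = 0}"

definition cone_points :: "'a metric \<Rightarrow> 'a \<Rightarrow> nat filter \<Rightarrow> (nat \<Rightarrow> 'a) set set" where
  "cone_points M x0 \<omega> = precone M x0 // cone_rel M x0 \<omega>"

definition cone_dist ::
    "'a metric \<Rightarrow> 'a \<Rightarrow> nat filter \<Rightarrow> (nat \<Rightarrow> 'a) set \<Rightarrow> (nat \<Rightarrow> 'a) set \<Rightarrow> real" where
  "cone_dist M x0 \<omega> a b =
     (if a \<in> cone_points M x0 \<omega> \<and> b \<in> cone_points M x0 \<omega>
      then precone_dist M \<omega> (SOME x. x \<in> a) (SOME y. y \<in> b) else 0)"

definition asymptotic_cone :: "'a metric \<Rightarrow> 'a \<Rightarrow> nat filter \<Rightarrow> (nat \<Rightarrow> 'a) set metric" where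
  "asymptotic_cone M x0 \<omega> = metric (cone_points M x0 \<omega>, cone_dist M x0 \<omega>)"

lemma precone_bound:
  assumes u: "nonprincipal_ultrafilter \<omega>" and x: "x \<in> precone M x0"
  shows "\<exists>B. eventually (\<lambda>n. mdist M (x n) x0 / real n \<le> B) \<omega>"
proof -
  have "limsup (\<lambda>n. ereal (mdist M (x n) x0 / real n)) < \<infinity>"
    using x by (simp add: precone_def)
  then obtain B where "limsup (\<lambda>n. ereal (mdist M (x n) x0 / real n)) < ereal B"
    by (metis ereal_dense2 less_ereal.simps(1))
  then have "eventually (\<lambda>n. ereal (mdist M (x n) x0 / real n) < ereal B) sequentially"
    by (rule Limsup_lessD)
  then have "eventually (\<lambda>n. mdist M (x n) x0 / real n \<le> B) sequentially"
    by (rule eventually_mono) simp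
  then show ?thesis
    using nonprincipal_ultrafilter_le_sequentially[OF u] by (auto simp: le_filter_def)
qed

lemma precone_dist_tendsto:
  assumes u: "nonprincipal_ultrafilter \<omega>" and x0: "x0 \<in> mspace M"
    and x: "x \<in> precone M x0" and y: "y \<in> precone M x0"
  shows "((\<lambda>n. 1 / real n * mdist M (x n) (y n)) \<longlongrightarrow> precone_dist M \<omega> x y) \<omega>"
proof -
  obtain B C where B: "eventually (\<lambda>n. mdist M (x n) x0 / real n \<le> B) \<omega>"
    and C: "eventually (\<lambda>n. mdist M (y n) x0 / real n \<le> C) \<omega>"
    using precone_bound[OF u x] precone_bound[OF u y] by blast
  have "eventually (\<lambda>n. \<bar>1 / real n * mdist M (x n) (y n)\<bar> \<le> B + C) \<omega>"
    using B C
  proof eventually_elim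
    case (elim n)
    have "mdist M (x n) (y n) \<le> mdist M (x n) x0 + mdist M x0 (y n)"
      using x y x0 by (intro mdist_triangle) (auto simp: precone_def)
    then have "mdist M (x n) (y n) / real n \<le> mdist M (x n) x0 / real n + mdist M (y n) x0 / real n"
      by (simp add: mdist_commute divide_right_mono flip: add_divide_distrib)
    with elim show ?case by simp
  qed
  then show ?thesis
    unfolding precone_dist_def by (rule ultrafilter_bounded_tendsto_Lim[OF u])
qed

lemma precone_dist_pseudometric:
  assumes u: "nonprincipal_ultrafilter \<omega>" and x0: "x0 \<in> mspace M"
    and x: "x \<in> precone M x0" and y: "y \<in> precone M x0" and z: "z \<in> precone M x0"
  shows "0 \<le> precone_dist M \<omega> x y" and "precone_dist M \<omega> x x = 0"
    and "precone_dist M \<omega> x z \<le> precone_dist M \<omega> x y + precone_dist M \<omega> y z"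
proof -
  note T = precone_dist_tendsto[OF u x0]
  have nb: "\<omega> \<noteq> bot" using u by (simp add: nonprincipal_ultrafilter_def)
  show "0 \<le> precone_dist M \<omega> x y"
    by (rule tendsto_lowerbound[OF T[OF x y] _ nb]) simp
  have "(\<lambda>n. 1 / real n * mdist M (x n) (x n)) = (\<lambda>n. 0)"
    using x by (auto simp: precone_def)
  with T[OF x x] have "((\<lambda>n. 0 :: real) \<longlongrightarrow> precone_dist M \<omega> x x) \<omega>" by simp
  then show "precone_dist M \<omega> x x = 0" using nb by (simp add: tendsto_const_iff)
  show "precone_dist M \<omega> x z \<le> precone_dist M \<omega> x y + precone_dist M \<omega> y z"
  proof (rule tendsto_le[OF nb tendsto_add[OF T[OF x y] T[OF y z]] T[OF x z]], rule always_eventually, rule allI)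
    fix n
    have "mdist M (x n) (z n) \<le> mdist M (x n) (y n) + mdist M (y n) (z n)"
      using x y z by (intro mdist_triangle) (auto simp: precone_def)
    then show "1 / real n * mdist M (x n) (z n)
        \<le> 1 / real n * mdist M (x n) (y n) + 1 / real n * mdist M (y n) (z n)"
      by (simp add: divide_right_mono flip: add_divide_distrib)
  qed
qed

lemma precone_dist_commute: "precone_dist M \<omega> x y = precone_dist M \<omega> y x"
  by (simp add: precone_dist_def mdist_commute)

lemma equiv_cone_rel:
  assumes "nonprincipal_ultrafilter \<omega>" and "x0 \<in> mspace M"
  shows "equiv (precone M x0) (cone_rel M x0 \<omega>)"
proof (rule equivI)
  note P = precone_dist_pseudometric[OF assms]
  show "cone_rel M x0 \<omega> \<subseteq> precone M x0 \<times> precone M x0" by (auto simp: cone_rel_def)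
  show "refl_on (precone M x0) (cone_rel M x0 \<omega>)" by (auto simp: refl_on_def cone_rel_def P(2))
  show "sym (cone_rel M x0 \<omega>)" by (auto simp: sym_def cone_rel_def precone_dist_commute)
  show "trans (cone_rel M x0 \<omega>)"
  proof (rule transI)
    fix x y z assume "(x, y) \<in> cone_rel M x0 \<omega>" "(y, z) \<in> cone_rel M x0 \<omega>"
    then show "(x, z) \<in> cone_rel M x0 \<omega>"
      using P(3)[of x y z] P(1)[of x z] by (auto simp: cone_rel_def)
  qed
qed

lemma cone_dist_class:
  assumes "nonprincipal_ultrafilter \<omega>" and "x0 \<in> mspace M"
    and x: "x \<in> precone M x0" and y: "y \<in> precone M x0"
  shows "cone_dist M x0 \<omega> (cone_rel M x0 \<omega> `` {x}) (cone_rel M x0 \<omega> `` {y}) = precone_dist M \<omega> x y"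
proof -
  note P = precone_dist_pseudometric[OF assms(1,2)]
  let ?c = "\<lambda>x. cone_rel M x0 \<omega> `` {x}"
  define x' y' where "x' = (SOME u. u \<in> ?c x)" and "y' = (SOME v. v \<in> ?c y)"
  have "x \<in> ?c x" "y \<in> ?c y"
    using equiv_class_self[OF equiv_cone_rel[OF assms(1,2)]] x y by blast+
  then have "x' \<in> ?c x" "y' \<in> ?c y" unfolding x'_def y'_def by (metis someI)+
  then have x': "x' \<in> precone M x0" "precone_dist M \<omega> x x' = 0"
    and y': "y' \<in> precone M x0" "precone_dist M \<omega> y y' = 0" by (auto simp: cone_rel_def)
  have "precone_dist M \<omega> x' y' = precone_dist M \<omega> x y"
    using P(3)[OF x' (1) x y'(1)] P(3)[OF x y y'(1)] P(3)[OF x x'(1) y] P(3)[OF x'(1) y'(1) y]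
      x'(2) y'(2) precone_dist_commute[of M \<omega> x x'] precone_dist_commute[of M \<omega> y y'] by linarith
  moreover have "?c x \<in> cone_points M x0 \<omega>" "?c y \<in> cone_points M x0 \<omega>"
    using x y by (auto simp: cone_points_def quotientI)
  ultimately show ?thesis by (simp add: cone_dist_def x'_def y'_def)
qed

lemma asymptotic_cone_is_metric:
  assumes "nonprincipal_ultrafilter \<omega>" and "x0 \<in> mspace M"
  shows "Metric_space (cone_points M x0 \<omega>) (cone_dist M x0 \<omega>)"
proof -
  note P = precone_dist_pseudometric[OF assms] and D = cone_dist_class[OF assms]
    and E = equiv_cone_rel[OF assms]
  let ?c = "\<lambda>x. cone_rel M x0 \<omega> `` {x}"
  have rep: "\<exists>x \<in> precone M x0. a = ?c x" if "a \<in> cone_points M x0 \<omega>" for a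
    using that by (auto simp: cone_points_def quotient_def)
  show ?thesis
  proof
    show "0 \<le> cone_dist M x0 \<omega> a b" for a b
    proof (cases "a \<in> cone_points M x0 \<omega> \<and> b \<in> cone_points M x0 \<omega>")
      case True
      obtain x where x: "x \<in> precone M x0" "a = ?c x" using rep True by blast
      obtain y where y: "y \<in> precone M x0" "b = ?c y" using rep True by blast
      show ?thesis unfolding x(2) y(2) D[OF x(1) y(1)] by (rule P(1)[OF x(1) y(1) x(1)])
    qed (auto simp: cone_dist_def)
    show "cone_dist M x0 \<omega> a b = cone_dist M x0 \<omega> b a" for a b
      by (auto simp: cone_dist_def precone_dist_commute)
    show "cone_dist M x0 \<omega> a b = 0 \<longleftrightarrow> a = b"
      if abc: "a \<in> cone_points M x0 \<omega>" "b \<in> cone_points M x0 \<omega>" for a b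
    proof -
      obtain x where x: "x \<in> precone M x0" "a = ?c x" using rep[OF abc(1)] by blast
      obtain y where y: "y \<in> precone M x0" "b = ?c y" using rep[OF abc(2)] by blast
      have "cone_dist M x0 \<omega> a b = 0 \<longleftrightarrow> (x, y) \<in> cone_rel M x0 \<omega>"
        unfolding x(2) y(2) D[OF x(1) y(1)] using x(1) y(1) by (simp add: cone_rel_def)
      also have "\<dots> \<longleftrightarrow> a = b" unfolding x(2) y(2) by (rule eq_equiv_class_iff[OF E x(1) y(1), symmetric])
      finally show ?thesis .
    qed
    show "cone_dist M x0 \<omega> a c \<le> cone_dist M x0 \<omega> a b + cone_dist M x0 \<omega> b c"
      if abc: "a \<in> cone_points M x0 \<omega>" "b \<in> cone_points M x0 \<omega>" "c \<in> cone_points M x0 \<omega>" for a b c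
    proof -
      obtain x where x: "x \<in> precone M x0" "a = ?c x" using rep[OF abc(1)] by blast
      obtain y where y: "y \<in> precone M x0" "b = ?c y" using rep[OF abc(2)] by blast
      obtain z where z: "z \<in> precone M x0" "c = ?c z" using rep[OF abc(3)] by blast
      show ?thesis
        unfolding x(2) y(2) z(2) D[OF x(1) y(1)] D[OF x(1) z(1)] D[OF y(1) z(1)]
        by (rule P(3)[OF x(1) y(1) z(1)])
    qed
  qed
qed

definition cone_basepoint :: "'a metric \<Rightarrow> 'a \<Rightarrow> nat filter \<Rightarrow> (nat \<Rightarrow> 'a) set" where
  "cone_basepoint M x0 \<omega> = cone_rel M x0 \<omega> `` {\<lambda>n. x0}"


section \<open>The fundamental group of a pointed topological space\<close>

definition loops_at :: "'a topology \<Rightarrow> 'a \<Rightarrow> (real \<Rightarrow> 'a) set" where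
  "loops_at T b = {f. pathin T f \<and> f 0 = b \<and> f 1 = b}"

definition loop_homotopy_rel :: "'a topology \<Rightarrow> 'a \<Rightarrow> ((real \<Rightarrow> 'a) \<times> (real \<Rightarrow> 'a)) set" where
  "loop_homotopy_rel T b = {(f, g). f \<in> loops_at T b \<and> g \<in> loops_at T b \<and>
     homotopic_with (\<lambda>h. h 0 = b \<and> h 1 = b) (top_of_set {0..1}) T f g}"

text \<open>
  The library's \<^const>\<open>joinpaths\<close> is the same function, but only for paths in a topological space
  given by a type class.
\<close>

definition loop_concat :: "(real \<Rightarrow> 'a) \<Rightarrow> (real \<Rightarrow> 'a) \<Rightarrow> real \<Rightarrow> 'a" where
  "loop_concat f g = (\<lambda>s. if s \<le> 1 / 2 then f (2 * s) else g (2 * s - 1))"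

definition fundamental_group :: "'a topology \<Rightarrow> 'a \<Rightarrow> (real \<Rightarrow> 'a) set monoid" where
  "fundamental_group T b =
     \<lparr>carrier = loops_at T b // loop_homotopy_rel T b,
      monoid.mult = (\<lambda>A B. loop_homotopy_rel T b `` {loop_concat f g | f g. f \<in> A \<and> g \<in> B}),
      one = loop_homotopy_rel T b `` {\<lambda>s. b}\<rparr>"


definition pi1_cone :: "('a, 'b) monoid_scheme \<Rightarrow> 'a set \<Rightarrow> nat filter \<Rightarrow>
    (real \<Rightarrow> (nat \<Rightarrow> 'a) set) set monoid" where
  "pi1_cone G S \<omega> =
     fundamental_group (mtopology_of (asymptotic_cone (word_metric G S) \<one>\<^bsub>G\<^esub> \<omega>))
       (cone_basepoint (word_metric G S) \<one>\<^bsub>G\<^esub> \<omega>)"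

end

theory Submission
  imports Defs "HOL-Probability.Discrete_Topology" "HOL-Library.Function_Algebras"
begin

text \<open>Let K be the field with p elements and \<open>R = K[t, 1/t, 1/(t - 1)]\<close>. The (1,4) entries form a
central copy of the additive group of R in \<open>A\<^sub>4(R)\<close>. The group \<open>\<Gamma>\<close> is the quotient by the polynomials in which
every exponent is a factorial. Size is measured at the places 0, 1, \<open>\<infinity>\<close> of K(t), and for a polynomial it
is the degree. Seen from distance n, the factorials are so sparse that at most one exponent \<open>k!\<close> is
comparable to n: the killed elements leave in the cone a copy of K, given by the coefficient at that exponent,
if there is such an exponent along \<open>\<omega>\<close>, and nothing otherwise (deck_exists). So the cone of \<open>\<Gamma>\<close> is the
quotient of a simply connected space by a free action of K or of the trivial group, and this group is its fundamental
group (fundamental_group_of_quotient). An ultrafilter containing the set of factorials realises the first case.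

The simply connected space is the cone of a larger group PG, with the same diagonal entries but with
entries above the diagonal chosen independently at the three places. \<open>A\<^sub>4(R)\<close> is coarsely dense in PG
(TR_coarsely_dense), and the logarithmic size len dominates every length function of \<open>A\<^sub>4(R)\<close> that is bounded
on a fixed finite set (W_le_len), so that the cone of \<open>\<Gamma>\<close> is bilipschitz to the quotient of the cone of PG by the
killed sequences (fundamental_group_of_cone, pi1_cone_Gam).

Loops in the cone of PG contract for the following reason. It suffices to choose for every group element
g a path w g from the base point to its image, of size \<open>O(|g|)\<close>, such that w g followed by g (w h) is homotopic to
w (g h) within distance \<open>O(|g| + |h|)\<close>: triangles are then filled at their own scale, and a dyadic subdivision
of a loop fills the loop (null_homotopic_if_triangles_fill, null_homotopic_if_words). Families of such
paths modulo such homotopies form a group, so it suffices to find a homomorphic section (Phi_mult). The diagonal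
matrices move the base point inside a flat \<open>\<real>\<^sup>4\<close>. A root element fixes a half-space of the flat; it is
represented by the path that goes out to a fixed point and comes back along the translated flat. Elements with a common
fixed point multiply correctly inside one translated flat. This yields all relations between root subgroups at
different places, and enough of them at each single place to force the remaining ones, including the centrality
of the (1,4) commutators, which fix no half-space. That last step is Abels' commutator calculus for \<open>A\<^sub>4\<close> (unip_mult).\<close>

section \<open>Loops in spaces whose triangles have fillings of linear size\<close>

text \<open>For t between 0 and 1/2 the chord of f is deformed into the two chords of its halves by a triangle;
the remaining time is spent on both halves separately. At time \<open>1 - 1/2\<^sup>n\<close> the result is the polygon with \<open>2\<^sup>n\<close> sides.\<close>

primrec dyadic_homotopy ::
    "('a => 'a => real => 'a) => ('a => 'a => 'a => real => real => 'a) => nat => (real => 'a) => real => real => 'a"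
  where
  "dyadic_homotopy c K 0 f t s = c (f 0) (f 1) s"
| "dyadic_homotopy c K (Suc n) f t s =
     (if t <= 1/2 then K (f 0) (f (1/2)) (f 1) (2 * t) s
      else if s <= 1/2 then dyadic_homotopy c K n (%x. f (x/2)) (2 * t - 1) (2 * s)
      else dyadic_homotopy c K n (%x. f ((x + 1)/2)) (2 * t - 1) (2 * s - 1))"

text \<open>Here c a b is a chord from a to b and K a b d fills the triangle with corners a, b, d.\<close>

locale triangle_filling =
  fixes S :: "'a::metric_space set" and c :: "'a => 'a => real => 'a"
    and K :: "'a => 'a => 'a => real => real => 'a" and C :: real
  assumes C_nonneg: "0 <= C"
    and c_path: "!!a b. [|a \<in> S; b \<in> S|] ==> continuous_on {0..1} (c a b)"
    and c_in: "!!a b s. [|a \<in> S; b \<in> S; s \<in> {0..1}|] ==> c a b s \<in> S \<and> dist a (c a b s) <= C * dist a b"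
    and c_ends: "!!a b. [|a \<in> S; b \<in> S|] ==> c a b 0 = a \<and> c a b 1 = b"
    and K_cont: "!!a b d. [|a \<in> S; b \<in> S; d \<in> S|] ==> continuous_on ({0..1} \<times> {0..1}) (%z. K a b d (fst z) (snd z))"
    and K_in: "!!a b d t s. [|a \<in> S; b \<in> S; d \<in> S; t \<in> {0..1}; s \<in> {0..1}|]
        ==> K a b d t s \<in> S \<and> dist a (K a b d t s) <= C * (dist a b + dist b d)"
    and K_0: "!!a b d s. [|a \<in> S; b \<in> S; d \<in> S; s \<in> {0..1}|] ==> K a b d 0 s = c a d s"
    and K_1: "!!a b d s. [|a \<in> S; b \<in> S; d \<in> S; s \<in> {0..1}|] ==> K a b d 1 s = (c a b +++ c b d) s"
    and K_ends: "!!a b d t. [|a \<in> S; b \<in> S; d \<in> S; t \<in> {0..1}|] ==> K a b d t 0 = a \<and> K a b d t 1 = d"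
begin

abbreviation D where "D \<equiv> dyadic_homotopy c K"

lemma halves_in:
  assumes "f ` {0..1::real} \<subseteq> S" shows "(%x. f (x/2)) ` {0..1} \<subseteq> S" "(%x. f ((x + 1)/2)) ` {0..1} \<subseteq> S"
  using assms by (auto simp: image_subset_iff)

lemma corners_in:
  assumes "f ` {0..1::real} \<subseteq> S" shows "f 0 \<in> S" "f (1/2) \<in> S" "f 1 \<in> S" using assms by (auto simp: image_subset_iff)

lemma D_ends:
  assumes "f ` {0..1} \<subseteq> S" "t \<in> {0..1}" shows "D n f t 0 = f 0" "D n f t 1 = f 1"
proof -
  have "D n f t 0 = f 0 \<and> D n f t 1 = f 1" using assms
  proof (induction n arbitrary: f t)
    case 0
    then show ?case using c_ends corners_in[OF 0(1)] by simp
  next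
    case (Suc n)
    then show ?case using K_ends[OF corners_in[OF Suc(2)], of "2 * t"] Suc.IH[OF halves_in(1)[OF Suc(2)], of "2 * t-1"]
        Suc.IH[OF halves_in(2)[OF Suc(2)], of "2 * t-1"] by auto
  qed
  then show "D n f t 0 = f 0" "D n f t 1 = f 1" by auto
qed

lemma D_start:
  assumes "f ` {0..1} \<subseteq> S" "s \<in> {0..1}" shows "D n f 0 s = c (f 0) (f 1) s"
  using assms K_0[OF corners_in[OF assms(1)]] by (cases n) auto

text \<open>At \<open>t = 1/2\<close> both branches of the recursion agree, which the case distinction of the definition hides.\<close>

lemma D_half:
  assumes "f ` {0..1} \<subseteq> S" "s \<in> {0..1}" "1/2 <= t" "t <= 1"
  shows "D (Suc n) f t s = (if s <= 1/2 then D n (%x. f (x/2)) (2 * t - 1) (2 * s)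
      else D n (%x. f ((x + 1)/2)) (2 * t - 1) (2 * s - 1))"
proof (cases "t = 1/2")
  case True
  show ?thesis unfolding True
    using assms(1,2) D_start[OF halves_in(1)[OF assms(1)], of "2 * s" n] D_start[OF halves_in(2)[OF assms(1)], of "2 * s-1" n]
      K_1[OF corners_in[OF assms(1)], of s] by (auto simp: joinpaths_def)
next
  case False
  then show ?thesis using assms by auto
qed

lemma D_in:
  assumes "f ` {0..1} \<subseteq> S" "t \<in> {0..1}" "s \<in> {0..1}" shows "D n f t s \<in> S" using assms
proof (induction n arbitrary: f t s)
  case 0
  then show ?case using c_in corners_in[OF 0(1)] by simp
next
  case (Suc n)
  then show ?case using K_in[OF corners_in[OF Suc(2)], of "2 * t" s] Suc.IH[OF halves_in(1)[OF Suc(2)], of "2 * t-1" "2 * s"]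
      Suc.IH[OF halves_in(2)[OF Suc(2)], of "2 * t-1" "2 * s-1"] by auto
qed

lemma continuous_on_square_compose:
  fixes g :: "real => real => 'a"
  assumes "continuous_on ({0..1} \<times> {0..1}) (%z. g (fst z) (snd z))"
    and "continuous_on B u" "continuous_on B v"
    and "!!z. z \<in> B ==> u z \<in> {0..1} \<and> v z \<in> {0..1}" shows "continuous_on B (%z. g (u z) (v z))"
proof -
  have "continuous_on B (%z. (u z, v z))" using assms(2,3) by (intro continuous_intros)
  moreover have "(%z. (u z, v z)) ` B \<subseteq> {0..1} \<times> {0..1}" using assms(4) by auto
  ultimately show ?thesis using continuous_on_compose2[OF assms(1)] by fastforce
qed

lemma D_cont:
  assumes "f ` {0..1} \<subseteq> S" shows "continuous_on ({0..1} \<times> {0..1}) (%z. D n f (fst z) (snd z))" using assms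
proof (induction n arbitrary: f)
  case 0
  have "continuous_on ({0..1::real} \<times> {0..1}) (%z. c (f 0) (f 1) (snd z))"
    by (rule continuous_on_compose2[OF c_path[OF corners_in(1,3)[OF 0]]]) (auto intro!: continuous_intros)
  then show ?case by simp
next
  case (Suc n)
  let ?A = "{0..1::real} \<times> {0..1::real}"
  note hl = halves_in(1)[OF Suc(2)] and hr = halves_in(2)[OF Suc(2)]
  have 1: "continuous_on {z \<in> ?A. fst z <= 1/2} (%z. K (f 0) (f (1/2)) (f 1) (2 * fst z) (snd z))"
    by (rule continuous_on_square_compose[OF K_cont[OF corners_in[OF Suc(2)]]]) (auto intro!: continuous_intros)
  have 2: "continuous_on {z \<in> {z \<in> ?A. 1/2 <= fst z}. snd z <= 1/2} (%z. D n (%x. f (x/2)) (2 * fst z - 1) (2 * snd z))"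
    by (rule continuous_on_square_compose[OF Suc.IH[OF hl]]) (auto intro!: continuous_intros)
  have 3: "continuous_on {z \<in> {z \<in> ?A. 1/2 <= fst z}. 1/2 <= snd z} (%z. D n (%x. f ((x+1)/2)) (2 * fst z - 1) (2 * snd z - 1))"
    by (rule continuous_on_square_compose[OF Suc.IH[OF hr]]) (auto intro!: continuous_intros)
  have 23: "continuous_on {z \<in> ?A. 1/2 <= fst z} (%z. if snd z <= 1/2 then D n (%x. f (x/2)) (2 * fst z - 1) (2 * snd z)
      else D n (%x. f ((x + 1)/2)) (2 * fst z - 1) (2 * snd z - 1))"
  proof (rule continuous_on_cases_le[OF 2 3])
    show "continuous_on {z \<in> ?A. 1/2 <= fst z} snd" by (intro continuous_intros)
    show "D n (%x. f (x / 2)) (2 * fst t - 1) (2 * snd t) = D n (%x. f ((x + 1) / 2)) (2 * fst t - 1) (2 * snd t - 1)"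
      if "t \<in> {z \<in> ?A. 1/2 <= fst z}" "snd t = 1/2" for t
    proof -
      have "2 * fst t - 1 \<in> {0..1}" using that by auto
      from D_ends(2)[OF hl this, of n] D_ends(1)[OF hr this, of n] show ?thesis unfolding that(2) by simp
    qed
  qed
  have "continuous_on ?A (%z. if fst z <= 1/2 then K (f 0) (f (1/2)) (f 1) (2 * fst z) (snd z)
      else if snd z <= 1/2 then D n (%x. f (x/2)) (2 * fst z - 1) (2 * snd z)
      else D n (%x. f ((x + 1)/2)) (2 * fst z - 1) (2 * snd z - 1))"
  proof (rule continuous_on_cases_le[OF 1 23])
    show "continuous_on ?A fst" by (intro continuous_intros)
    fix z assume z: "z \<in> ?A" "fst z = 1/2"
    then have "snd z \<in> {0..1}" "fst z <= 1" "1/2 <= fst z" by auto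
    from D_half[OF Suc(2) this(1,3,2), of n]
    show "K (f 0) (f (1/2)) (f 1) (2 * fst z) (snd z) = (if snd z <= 1/2 then D n (%x. f (x/2)) (2 * fst z - 1) (2 * snd z)
      else D n (%x. f ((x + 1)/2)) (2 * fst z - 1) (2 * snd z - 1))" unfolding z(2) by simp
  qed
  then show ?case by simp
qed

lemma D_near:
  assumes "f ` {0..1} \<subseteq> S" "t \<in> {0..1}" "s \<in> {0..1}"
    and "!!x y. [|x \<in> {0..1}; y \<in> {0..1}|] ==> dist (f x) (f y) <= \<delta>" shows "dist (D n f t s) (f s) <= (2 * C + 1) * \<delta>"
  using assms
proof (induction n arbitrary: f t s)
  case 0
  have "dist (f 0) (f 1) <= \<delta>" "dist (f 0) (f s) <= \<delta>" using 0 by auto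
  moreover have "dist (f 0) (c (f 0) (f 1) s) <= C * dist (f 0) (f 1)" using c_in[OF corners_in(1,3)[OF 0(1)] 0(3)] by simp
  moreover have "C * dist (f 0) (f 1) <= C * \<delta>" using calculation(1) C_nonneg by (rule mult_left_mono)
  moreover have "0 <= C * \<delta>" using calculation C_nonneg by (meson order_trans zero_le_dist mult_nonneg_nonneg)
  ultimately show ?case using dist_triangle3[of "c (f 0) (f 1) s" "f s" "f 0"] by (simp add: algebra_simps)
next
  case (Suc n)
  show ?case
  proof (cases "t <= 1/2")
    case True
    have d: "dist (f 0) (f (1/2)) <= \<delta>" "dist (f (1/2)) (f 1) <= \<delta>" "dist (f 0) (f s) <= \<delta>" using Suc by auto
    have "dist (f 0) (K (f 0) (f (1/2)) (f 1) (2 * t) s) <= C * (dist (f 0) (f (1/2)) + dist (f (1/2)) (f 1))"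
      using K_in[OF corners_in[OF Suc(2)], of "2 * t" s] Suc.prems True by simp
    also have "... <= C * (\<delta> + \<delta>)" using d C_nonneg by (intro mult_left_mono) auto
    finally show ?thesis using d True dist_triangle3[of "K (f 0) (f (1/2)) (f 1) (2 * t) s" "f s" "f 0"] by (simp add: algebra_simps)
  next
    case False
    have hl: "dist (f (x/2)) (f (y/2)) <= \<delta>" "dist (f ((x+1)/2)) (f ((y+1)/2)) <= \<delta>" if "x \<in> {0..1}" "y \<in> {0..1}" for x y
      using that by (auto intro!: Suc.prems(4))
    show ?thesis using Suc.IH[OF halves_in(1)[OF Suc(2)] _ _ hl(1), of "2 * t-1" "2 * s"]
        Suc.IH[OF halves_in(2)[OF Suc(2)] _ _ hl(2), of "2 * t-1" "2 * s-1"] Suc.prems(2,3) False by auto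
  qed
qed

text \<open>Deeper levels of the recursion only change times after \<open>1 - 1/2\<^sup>n\<close>.\<close>

lemma D_stable:
  assumes "f ` {0..1} \<subseteq> S" "0 <= t" "s \<in> {0..1}" "t <= 1 - 1/2^n" "n <= m" shows "D m f t s = D n f t s" using assms
proof (induction n arbitrary: f t s m)
  case 0
  then have "t = 0" by simp
  then show ?case using D_start[OF 0(1,3)] by simp
next
  case (Suc n)
  then obtain m' where m: "m = Suc m'" "n <= m'" by (cases m) auto
  show ?case
  proof (cases "t <= 1/2")
    case False
    have "2 * t - 1 <= 1 - 1/2^n" using Suc.prems(4) by (simp add: field_simps)
    then show ?thesis using Suc.IH[OF halves_in(1)[OF Suc(2)], of "2 * t-1" "2 * s" m'] Suc.IH[OF halves_in(2)[OF Suc(2)], of "2 * t-1" "2 * s-1" m']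
        Suc.prems(2,3) m False by auto
  qed (simp add: m)
qed

text \<open>After time \<open>1 - 1/2\<^sup>n\<close> everything happens in triangles over arcs of length at most \<open>1/2\<^sup>n\<close>. So the deviation
from f is controlled by the modulus of continuity of f on such arcs.\<close>

lemma D_close:
  assumes "f ` {0..1} \<subseteq> S" "t <= 1" "s \<in> {0..1}" "1 - 1/2^n <= t" "n <= m"
    and "!!x y. [|x \<in> {0..1}; y \<in> {0..1}; \<bar>x - y\<bar> <= 1/2^n|] ==> dist (f x) (f y) <= \<delta>"
  shows "dist (D m f t s) (f s) <= (2 * C + 1) * \<delta>" using assms
proof (induction n arbitrary: f t s m)
  case 0
  then show ?case by (intro D_near) auto
next
  case (Suc n)
  then obtain m' where m: "m = Suc m'" "n <= m'" by (cases m) auto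
  have "(1::real)/2^Suc n <= 1/2" by (simp add: field_simps)
  then have t: "1/2 <= t" using Suc.prems(4) by linarith
  have "1 - 1/2^n <= 2 * t - 1" using Suc.prems(4) by (simp add: field_simps)
  moreover have hl: "dist (f (x/2)) (f (y/2)) <= \<delta>" "dist (f ((x+1)/2)) (f ((y+1)/2)) <= \<delta>"
    if "x \<in> {0..1}" "y \<in> {0..1}" "\<bar>x - y\<bar> <= 1/2^n" for x y
  proof -
    have "\<bar>x/2 - y/2\<bar> = \<bar>x - y\<bar> / 2" "\<bar>(x+1)/2 - (y+1)/2\<bar> = \<bar>x - y\<bar> / 2"
      by (simp_all add: abs_divide flip: diff_divide_distrib)
    moreover have "\<bar>x - y\<bar> / 2 <= 1/2^Suc n" using that(3) by simp
    ultimately show "dist (f (x/2)) (f (y/2)) <= \<delta>" "dist (f ((x+1)/2)) (f ((y+1)/2)) <= \<delta>"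
      using that(1,2) by (auto intro!: Suc.prems(6))
  qed
  ultimately have IH: "s <= 1/2 ==> dist (D m' (%x. f (x/2)) (2 * t - 1) (2 * s)) (f (2 * s/2)) <= (2 * C + 1) * \<delta>"
      "\<not> s <= 1/2 ==> dist (D m' (%x. f ((x+1)/2)) (2 * t - 1) (2 * s - 1)) (f ((2 * s - 1 + 1)/2)) <= (2 * C + 1) * \<delta>"
    using Suc.IH[OF halves_in(1)[OF Suc(2)], of "2 * t-1" "2 * s" m'] Suc.IH[OF halves_in(2)[OF Suc(2)], of "2 * t-1" "2 * s-1" m']
      Suc.prems(2,3) m(2) by simp_all
  show ?case unfolding m(1) D_half[OF Suc.prems(1,3) t Suc.prems(2)] using IH by (simp split: if_split)
qed

text \<open>The dyadic homotopies converge uniformly, by stability before and closeness after time \<open>1 - 1/2\<^sup>n\<close>. The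
limit is therefore continuous, also at the time 1 where it equals f.\<close>

proposition homotopic_to_chord:
  assumes f: "path f" "path_image f \<subseteq> S" shows "homotopic_paths S (c (pathstart f) (pathfinish f)) f"
proof -
  have fS: "f ` {0..1} \<subseteq> S" using f(2) by (simp add: path_image_def)
  define N where "N t = (LEAST n. t <= 1 - 1/2^n)" for t :: real
  have N: "t <= 1 - 1/2^N t" if t1: "t < 1" for t :: real
  proof -
    have "\<exists>n. (1/2::real)^n < 1 - t" using t1 by (intro real_arch_pow_inv) auto
    then obtain n where "(1/2)^n < 1 - t" by blast
    then have "t <= 1 - 1/2^n" by (simp add: power_one_over)
    then show ?thesis unfolding N_def by (rule LeastI)
  qed
  define H where "H t s = (if t = 1 then f s else D (N t) f t s)" for t s
  let ?A = "{0..1::real} \<times> {0..1::real}"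
  have "uniform_limit ?A (%n z. D n f (fst z) (snd z)) (%z. H (fst z) (snd z)) sequentially"
  proof (rule uniform_limitI)
    fix e :: real assume "e > 0"
    define \<delta> where "\<delta> = e / (4 * (2 * C + 1))"
    have \<delta>: "\<delta> > 0" "(2 * C + 1) * \<delta> = e / 4"
      using \<open>e > 0\<close> C_nonneg by (auto simp: \<delta>_def field_simps intro!: divide_pos_pos add_pos_nonneg)
    have "uniformly_continuous_on {0..1} f" using f(1) by (intro compact_uniformly_continuous) (auto simp: path_def)
    then obtain d where d: "d > 0" "!!x y. [|x \<in> {0..1}; y \<in> {0..1}; dist y x < d|] ==> dist (f y) (f x) < \<delta>"
      using \<delta>(1) unfolding uniformly_continuous_on_def by metis
    have "\<exists>n. (1/2::real)^n < d" using d(1) by (intro real_arch_pow_inv) auto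
    then obtain n0 where n0: "(1/2::real)^n0 < d" by blast
    have "dist (D n f t s) (H t s) < e" if n: "n \<ge> n0" and t: "t \<in> {0..1}" and s: "s \<in> {0..1}" for n t s
    proof (cases "t <= 1 - 1/2^n")
      case True
      then have "t < 1" by (smt (verit) divide_pos_pos zero_less_power)
      have "D n f t s = D (max n (N t)) f t s" using D_stable[OF fS _ s True, of "max n (N t)"] t by simp
      also have "... = D (N t) f t s" using D_stable[OF fS _ s N[OF \<open>t < 1\<close>], of "max n (N t)"] t by simp
      finally show ?thesis using \<open>t < 1\<close> \<open>e > 0\<close> by (simp add: H_def)
    next
      case False
      have mod: "dist (f x) (f y) <= \<delta>" if "x \<in> {0..1}" "y \<in> {0..1}" "\<bar>x - y\<bar> <= 1/2^n" for x y
      proof -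
        have "(1/2::real)^n <= (1/2)^n0" using n by (intro power_decreasing) auto
        then have "dist x y < d" using that(3) n0 by (simp add: dist_real_def power_one_over)
        then show ?thesis using d(2)[of y x] that by (simp add: less_imp_le)
      qed
      have cl: "dist (D m f t s) (f s) <= e / 4" if "m \<ge> n" for m using D_close[OF fS _ s _ that mod] t False \<delta>(2) by auto
      show ?thesis
      proof (cases "t = 1")
        case True
        then show ?thesis using cl[of n] \<open>e > 0\<close> by (simp add: H_def)
      next
        case False
        then have "t < 1" using t by simp
        have "D (N t) f t s = D (max n (N t)) f t s" using D_stable[OF fS _ s N[OF \<open>t < 1\<close>], of "max n (N t)"] t by simp
        then have "dist (H t s) (f s) <= e / 4" using cl[of "max n (N t)"] False by (simp add: H_def)
        then show ?thesis using cl[of n] \<open>e > 0\<close> dist_triangle2[of "D n f t s" "H t s" "f s"] by simp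
      qed
    qed
    then show "\<forall>\<^sub>F n in sequentially. \<forall>z\<in>?A. dist (D n f (fst z) (snd z)) (H (fst z) (snd z)) < e"
      unfolding eventually_sequentially by (intro exI[of _ n0]) auto
  qed
  then have contH: "continuous_on ?A (%z. H (fst z) (snd z))" by (rule uniform_limit_theorem[rotated]) (auto intro!: always_eventually D_cont[OF fS])
  show ?thesis unfolding homotopic_paths
  proof (intro exI[of _ "%z. H (fst z) (snd z)"] conjI ballI contH)
    show "(%z. H (fst z) (snd z)) \<in> ?A \<rightarrow> S" using D_in[OF fS] fS by (auto simp: H_def)
    show "H (fst (0, x)) (snd (0, x)) = c (pathstart f) (pathfinish f) x" if "x \<in> {0..1}" for x
      using D_start[OF fS that] by (simp add: H_def pathstart_def pathfinish_def)
    show "H (fst (1, x)) (snd (1, x)) = f x" for x by (simp add: H_def)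
    have e: "c (pathstart f) (pathfinish f) 0 = f 0" "c (pathstart f) (pathfinish f) 1 = f 1"
      using c_ends corners_in[OF fS] by (simp_all add: pathstart_def pathfinish_def)
    show "pathstart ((%z. H (fst z) (snd z)) o Pair t) = pathstart (c (pathstart f) (pathfinish f))" if "t \<in> {0..1}" for t
      using D_ends[OF fS that] e by (simp add: H_def pathstart_def)
    show "pathfinish ((%z. H (fst z) (snd z)) o Pair t) = pathfinish (c (pathstart f) (pathfinish f))" if "t \<in> {0..1}" for t
      using D_ends[OF fS that] e by (simp add: H_def pathfinish_def)
  qed
qed

end

text \<open>A loop is homotopic to the chord from its base point a to a, which is constant since it stays within distance
\<open>C * dist a a = 0\<close> of a.\<close>

theorem null_homotopic_if_triangles_fill:
  fixes S :: "'a::metric_space set"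
  assumes C: "0 <= C"
    and c: "!!a b. [|a \<in> S; b \<in> S|] ==> path (c a b) \<and> path_image (c a b) \<subseteq> S \<inter> cball a (C * dist a b) \<and>
              pathstart (c a b) = a \<and> pathfinish (c a b) = b"
    and tri: "!!a b d. [|a \<in> S; b \<in> S; d \<in> S|] ==>
              homotopic_paths (S \<inter> cball a (C * (dist a b + dist b d))) (c a d) (c a b +++ c b d)"
    and f: "path f" "path_image f \<subseteq> S" "pathfinish f = pathstart f" shows "homotopic_paths S f (%_. pathstart f)"
proof -
  define fills where "fills a b d h \<longleftrightarrow>
      continuous_on ({0..1::real} \<times> {0..1::real}) h \<and>
      h \<in> {0..1} \<times> {0..1} \<rightarrow> S \<inter> cball a (C * (dist a b + dist b d)) \<and>
      (\<forall>x\<in>{0..1}. h (0, x) = c a d x) \<and> (\<forall>x\<in>{0..1}. h (1, x) = (c a b +++ c b d) x) \<and>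
      (\<forall>t\<in>{0..1::real}. pathstart (h o Pair t) = pathstart (c a d) \<and> pathfinish (h o Pair t) = pathfinish (c a d))"
    for a b d h
  define K where "K a b d = (SOME h. fills a b d h)" for a b d
  have K: "fills a b d (K a b d)" if "a \<in> S" "b \<in> S" "d \<in> S" for a b d
  proof -
    have "\<exists>h. fills a b d h" using tri[OF that] by (simp add: homotopic_paths fills_def)
    then show ?thesis unfolding K_def by (rule someI_ex)
  qed
  interpret triangle_filling S c "%a b d t s. K a b d (t, s)" C
  proof
    show "0 <= C" by fact
    show "continuous_on {0..1} (c a b)" if "a \<in> S" "b \<in> S" for a b using c[OF that] by (simp add: path_def)
    show "c a b s \<in> S \<and> dist a (c a b s) <= C * dist a b" if "a \<in> S" "b \<in> S" "s \<in> {0..1}" for a b s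
      using c[OF that(1,2)] that(3) by (auto simp: path_image_def image_subset_iff)
    show "c a b 0 = a \<and> c a b 1 = b" if "a \<in> S" "b \<in> S" for a b using c[OF that] by (simp add: pathstart_def pathfinish_def)
    fix a b d assume abd: "a \<in> S" "b \<in> S" "d \<in> S"
    note KK = K[OF abd, unfolded fills_def]
    show "continuous_on ({0..1} \<times> {0..1}) (%z. K a b d (fst z, snd z))" using KK by simp
    show "K a b d (t, s) \<in> S \<and> dist a (K a b d (t, s)) <= C * (dist a b + dist b d)"
      if "t \<in> {0..1}" "s \<in> {0..1}" for t s using KK that by (auto simp: Pi_iff)
    show "K a b d (0, s) = c a d s" if "s \<in> {0..1}" for s using KK that by simp
    show "K a b d (1, s) = (c a b +++ c b d) s" if "s \<in> {0..1}" for s using KK that by simp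
    show "K a b d (t, 0) = a \<and> K a b d (t, 1) = d" if "t \<in> {0..1}" for t
      using KK that c[OF abd(1,3)] by (auto simp: pathstart_def pathfinish_def)
  qed
  have b: "pathstart f \<in> S" using f(2) pathstart_in_path_image by blast
  have "homotopic_paths S (c (pathstart f) (pathstart f)) f" using homotopic_to_chord[OF f(1,2)] f(3) by simp
  moreover have "path_image (c (pathstart f) (pathstart f)) \<subseteq> {pathstart f}" using c[OF b b] by auto
  then have "c (pathstart f) (pathstart f) x = pathstart f" if "x \<in> {0..1}" for x
    using that by (auto simp: path_image_def image_subset_iff linepath_refl)
  ultimately show ?thesis
    by (smt (verit, best) homotopic_paths_eq homotopic_paths_imp_path homotopic_paths_imp_subset homotopic_paths_sym homotopic_paths_trans)
qed

section \<open>Isometric embedding of pseudometrics into bounded functions\<close>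

text \<open>The map \<open>g \<mapsto> d(g, \<cdot>) - d(e, \<cdot>)\<close> is an isometry into a space of bounded functions and identifies points at
distance zero. It makes every pseudometric space a subset of a normed space, where the theory of paths and
homotopies applies.\<close>

definition kuratowski :: "'h set => ('h => 'h => real) => 'h => 'h => ('h discrete \<Rightarrow>\<^sub>C real)" where
  "kuratowski A d b x =
     Bcontfun (%h. if of_discrete h \<in> A then d x (of_discrete h) - d b (of_discrete h) else 0)"

lemma continuous_on_discrete: "continuous_on UNIV (f :: 'h discrete => 'b::topological_space)" by (auto simp: continuous_on_open_vimage open_discrete)

lemma dist_kuratowski:
  assumes sym: "!!x y. [|x \<in> A; y \<in> A|] ==> d x y = d y x"
    and refl: "!!x. x \<in> A ==> d x x = (0::real)"
    and tri: "!!x y z. [|x \<in> A; y \<in> A; z \<in> A|] ==> d x z <= d x y + d y z"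
    and "b \<in> A" "x \<in> A" "y \<in> A" shows "dist (kuratowski A d b x) (kuratowski A d b y) = d x y"
proof -
  let ?f = "%x h. if of_discrete h \<in> A then d x (of_discrete h) - d b (of_discrete h) else 0"
  have lip: "\<bar>d u h - d v h\<bar> <= d u v" if "u \<in> A" "v \<in> A" "h \<in> A" for u v h
    using tri[OF that(1,2,3)] tri[OF that(2,1,3)] sym[OF that(1,2)] by linarith
  have pos: "0 <= d u v" if "u \<in> A" "v \<in> A" for u v using lip[OF that that(1)] by linarith
  have bc: "?f u \<in> bcontfun" if "u \<in> A" for u
  proof -
    have "norm (?f u h) <= d u b" for h using lip[OF that \<open>b \<in> A\<close>] pos[OF that \<open>b \<in> A\<close>] by auto
    then have "bounded (range (?f u))" by (metis (no_types, lifting) boundedI imageE)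
    then show ?thesis using continuous_on_discrete by (auto simp: bcontfun_def)
  qed
  have app: "apply_bcontfun (kuratowski A d b u) h = ?f u h" if "u \<in> A" for u h
    using Bcontfun_inverse[OF bc[OF that]] by (simp add: kuratowski_def)
  show ?thesis
  proof (rule antisym)
    show "dist (kuratowski A d b x) (kuratowski A d b y) <= d x y" using lip assms(5,6) pos by (intro dist_bound) (auto simp: app dist_real_def)
    have "dist (kuratowski A d b x (discrete y)) (kuratowski A d b y (discrete y)) <= dist (kuratowski A d b x) (kuratowski A d b y)"
      by (rule dist_bounded)
    then show "d x y <= dist (kuratowski A d b x) (kuratowski A d b y)" using assms(5,6) refl by (simp add: app dist_real_def discrete_inverse)
  qed
qed

section \<open>Fundamental groups of quotients by free isometric actions\<close>

text \<open>The quotient map is only required to have the quotient distance, so that X may be any model of the orbit space.\<close>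

locale free_isometric_quotient = group D for D (structure) +
  fixes Y :: "'y::real_normed_vector set" and X :: "'x::real_normed_vector set"
    and q :: "'y => 'x" and act :: "'a => 'y => 'y" and c :: real
  assumes surj: "q ` Y = X"
    and act_in: "!!j y. [|j \<in> carrier D; y \<in> Y|] ==> act j y \<in> Y"
    and act_one: "!!y. y \<in> Y ==> act \<one> y = y"
    and act_mult: "!!j k y. [|j \<in> carrier D; k \<in> carrier D; y \<in> Y|] ==> act (j \<otimes> k) y = act j (act k y)"
    and act_isom: "!!j y z. [|j \<in> carrier D; y \<in> Y; z \<in> Y|] ==> dist (act j y) (act j z) = dist y z"
    and act_free: "!!j y. [|j \<in> carrier D; j ~= \<one>; y \<in> Y|] ==> c <= dist y (act j y)"
    and c_pos: "0 < c"
    and q_le: "!!j y z. [|j \<in> carrier D; y \<in> Y; z \<in> Y|] ==> dist (q y) (q z) <= dist y (act j z)"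
    and q_ex: "!!y z. [|y \<in> Y; z \<in> Y|] ==> \<exists>j\<in>carrier D. dist (q y) (q z) = dist y (act j z)"
begin

lemma q_act: "[|j \<in> carrier D; y \<in> Y|] ==> q (act j y) = q y" using q_le[of j "act j y" y] act_in by simp

lemma q_eq_iff: "[|y \<in> Y; z \<in> Y|] ==> q y = q z \<longleftrightarrow> (\<exists>j\<in>carrier D. y = act j z)"
  using q_ex[of y z] q_act by fastforce

lemma act_unique: "[|j \<in> carrier D; k \<in> carrier D; y \<in> Y; act j y = act k y|] ==> j = k"
proof (rule ccontr)
  assume a: "j \<in> carrier D" "k \<in> carrier D" "y \<in> Y" "act j y = act k y" "j ~= k"
  have "act (inv j \<otimes> k) y = act (inv j \<otimes> j) y" using a by (simp only: act_mult inv_closed)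
  then have "act (inv j \<otimes> k) y = y" using a by (simp add: act_one)
  moreover have "j \<otimes> (inv j \<otimes> k) = k" using a by (simp add: m_assoc[symmetric])
  then have "inv j \<otimes> k ~= \<one>" using a by auto
  ultimately show False using act_free[of "inv j \<otimes> k" y] a c_pos by simp
qed

lemma q_dist_near:
  assumes "y \<in> Y" "z \<in> Y" "dist y z < c/2" shows "dist (q y) (q z) = dist y z"
proof -
  obtain j where j: "j \<in> carrier D" "dist (q y) (q z) = dist y (act j z)" using q_ex assms by blast
  show ?thesis
  proof (cases "j = \<one>")
    case True
    then show ?thesis using j act_one assms by simp
  next
    case False
    then have "c <= dist z (act j z)" using act_free j assms by simp
    also have "... <= dist y z + dist y (act j z)" by (metis dist_commute dist_triangle3)
    finally have "dist y z <= dist (q y) (q z)" using j assms by simp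
    moreover have "dist (q y) (q z) <= dist y z" using q_le[of \<one> y z] act_one assms by simp
    ultimately show ?thesis by simp
  qed
qed

text \<open>Orbits are c-separated, so the preimage of a ball of radius c/4 is a disjoint union of balls on which q is an
isometry.\<close>

lemma covering: "covering_space Y q X"
proof
  show "continuous_on Y q" unfolding continuous_on_iff
  proof (intro ballI allI impI)
    fix y e assume "y \<in> Y" "(e::real) > 0"
    then show "\<exists>d>0. \<forall>z\<in>Y. dist z y < d \<longrightarrow> dist (q z) (q y) < e"
      using q_le[of \<one>] act_one by (intro exI[of _ e]) fastforce
  qed
  show "q ` Y = X" by (rule surj)
  fix x assume "x \<in> X"
  then obtain y0 where y0: "y0 \<in> Y" "x = q y0" using surj by blast
  define B where "B j = Y \<inter> ball (act j y0) (c/4)" for j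
  let ?T = "X \<inter> ball x (c/4)"
  have aY: "act j y0 \<in> Y" if "j \<in> carrier D" for j using act_in that y0 by simp
  have img: "q y \<in> ?T" if "j \<in> carrier D" "y \<in> B j" for j y
  proof -
    have "dist (q y0) (q y) = dist (q (act j y0)) (q y)" using q_act that y0 by simp
    also have "... <= dist (act j y0) y" using q_le[of \<one> "act j y0" y] act_one that aY by (auto simp: B_def)
    finally show ?thesis using that y0 surj by (auto simp: B_def)
  qed
  have isom: "dist (q y) (q z) = dist y z" if "j \<in> carrier D" "y \<in> B j" "z \<in> B j" for j y z
    using that dist_triangle3[of y z "act j y0"] by (intro q_dist_near) (auto simp: B_def)
  have cover: "\<exists>j\<in>carrier D. y \<in> B j" if yT: "y \<in> Y" "q y \<in> ?T" for y
  proof -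
    obtain j where j: "j \<in> carrier D" "dist (q y) (q y0) = dist y (act j y0)" using q_ex[OF yT(1) y0(1)] by blast
    then show ?thesis using yT y0 by (auto simp: B_def dist_commute)
  qed
  have onto: "q ` B j = ?T" if j: "j \<in> carrier D" for j
  proof
    show "q ` B j \<subseteq> ?T" using img j by blast
    show "?T \<subseteq> q ` B j"
    proof
      fix x' assume x': "x' \<in> ?T"
      then obtain y where y: "y \<in> Y" "x' = q y" using surj by blast
      then obtain k where k: "k \<in> carrier D" "y \<in> B k" using cover x' by blast
      let ?z = "act (j \<otimes> inv k) y"
      have "act (j \<otimes> inv k) (act k y0) = act (j \<otimes> inv k \<otimes> k) y0" using j k y0 by (simp add: act_mult)
      also have "j \<otimes> inv k \<otimes> k = j" using j k by (simp add: m_assoc)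
      finally have "dist (act j y0) ?z = dist (act k y0) y" using act_isom[of "j \<otimes> inv k" "act k y0" y] j k y aY by simp
      then have "?z \<in> B j" using k j y act_in by (auto simp: B_def)
      moreover have "q ?z = x'" using q_act j k y by simp
      ultimately show "x' \<in> q ` B j" by blast
    qed
  qed
  show "\<exists>T. x \<in> T \<and> openin (top_of_set X) T \<and>
            (\<exists>v. \<Union> v = Y \<inter> q -` T \<and> (\<forall>u\<in>v. openin (top_of_set Y) u) \<and> pairwise disjnt v \<and> (\<forall>u\<in>v. \<exists>r. homeomorphism u T q r))"
  proof (intro exI[of _ ?T] conjI exI[of _ "B ` carrier D"])
    show "x \<in> ?T" using \<open>x \<in> X\<close> c_pos by simp
    show "openin (top_of_set X) ?T" by (simp add: openin_open_Int)
    show "\<Union> (B ` carrier D) = Y \<inter> q -` ?T" using img cover by (auto simp: B_def)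
    show "\<forall>u\<in>B ` carrier D. openin (top_of_set Y) u" by (auto simp: B_def openin_open_Int)
    show "pairwise disjnt (B ` carrier D)"
    proof (intro pairwiseI)
      fix u v assume "u \<in> B ` carrier D" "v \<in> B ` carrier D" "u ~= v"
      then obtain j k where jk: "j \<in> carrier D" "k \<in> carrier D" "u = B j" "v = B k" "j ~= k" by blast
      have "act k y0 = act (k \<otimes> inv j) (act j y0)" using jk y0 by (simp add: m_assoc flip: act_mult)
      moreover have "(k \<otimes> inv j) \<otimes> j = k" using jk by (simp add: m_assoc)
      then have "k \<otimes> inv j ~= \<one>" using jk by auto
      ultimately have "c <= dist (act j y0) (act k y0)" using act_free[of "k \<otimes> inv j" "act j y0"] jk aY by simp
      moreover have "dist (act j y0) (act k y0) < c" if "z \<in> B j" "z \<in> B k" for z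
        using that c_pos dist_triangle2[of "act j y0" "act k y0" z] by (simp add: B_def)
      ultimately show "disjnt u v" unfolding disjnt_iff jk(3,4) by force
    qed
    show "\<forall>u\<in>B ` carrier D. \<exists>r. homeomorphism u ?T q r"
    proof
      fix u assume "u \<in> B ` carrier D"
      then obtain j where j: "j \<in> carrier D" "u = B j" by blast
      have inj: "inj_on q u" using isom[OF j(1)] j(2) by (metis dist_eq_0_iff inj_onI)
      have "continuous_on u q" using isom[OF j(1)] j(2) unfolding continuous_on_iff by metis
      moreover have "continuous_on ?T (inv_into u q)" unfolding continuous_on_iff
      proof (intro ballI allI impI)
        fix x e assume "x \<in> ?T" "(e::real) > 0"
        have *: "inv_into u q w \<in> u \<and> q (inv_into u q w) = w" if "w \<in> ?T" for w
          using that onto[OF j(1)] j(2) by (metis f_inv_into_f inv_into_into)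
        show "\<exists>d>0. \<forall>x'\<in>?T. dist x' x < d \<longrightarrow> dist (inv_into u q x') (inv_into u q x) < e"
          using isom[OF j(1)] * \<open>x \<in> ?T\<close> \<open>e > 0\<close> j(2) by (intro exI[of _ e]) metis
      qed
      moreover have "inv_into u q ` (q ` u) = u" using inj by (rule inv_into_image_cancel) simp
      then have "inv_into u q ` ?T = u" using onto[OF j(1)] j(2) by simp
      moreover have "\<forall>y\<in>u. inv_into u q (q y) = y" using inj by (simp add: inv_into_f_f)
      moreover have "\<forall>w\<in>?T. q (inv_into u q w) = w" using onto[OF j(1)] j(2) by (metis f_inv_into_f)
      ultimately have "homeomorphism u ?T q (inv_into u q)" using onto[OF j(1)] j(2) by (simp add: homeomorphism_def)
      then show "\<exists>r. homeomorphism u ?T q r" by blast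
    qed
  qed
qed

end

lemma quotient_monoid_iso:
  assumes R: "!!f g. (f, g) \<in> R \<longleftrightarrow> f \<in> L \<and> g \<in> L \<and> \<Phi> f = \<Phi> g"
    and surj: "\<Phi> ` L = carrier D"
    and mult: "!!f g. [|f \<in> L; g \<in> L|] ==> m f g \<in> L \<and> \<Phi> (m f g) = \<Phi> f \<otimes>\<^bsub>D\<^esub> \<Phi> g"
  shows "\<lparr>carrier = L // R, monoid.mult = (%A B. R `` {m f g | f g. f \<in> A \<and> g \<in> B}), one = e\<rparr> \<cong> D"
proof -
  have cls: "R `` {f} = {g \<in> L. \<Phi> g = \<Phi> f}" if "f \<in> L" for f using that by (auto simp: R)
  have the: "the_elem (\<Phi> ` (R `` {f})) = \<Phi> f" if "f \<in> L" for f
  proof -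
    have "\<Phi> ` (R `` {f}) = {\<Phi> f}" unfolding cls[OF that] using that by blast
    then show ?thesis by simp
  qed
  have prod: "R `` {m f' g' | f' g'. f' \<in> R `` {f} \<and> g' \<in> R `` {g}} = R `` {m f g}"
    if "f \<in> L" "g \<in> L" for f g unfolding cls[OF that(1)] cls[OF that(2)] using that mult by (auto simp: R)
  have "(%A. the_elem (\<Phi> ` A)) \<in> iso \<lparr>carrier = L // R, monoid.mult = (%A B. R `` {m f g | f g. f \<in> A \<and> g \<in> B}), one = e\<rparr> D"
    unfolding iso_def hom_def bij_betw_def
  proof (safe; simp?)
    fix A assume "A \<in> L // R"
    then show "the_elem (\<Phi> ` A) \<in> carrier D" using the surj by (auto simp: quotient_def)
  next
    fix A B assume "A \<in> L // R" "B \<in> L // R"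
    then obtain f g where fg: "f \<in> L" "g \<in> L" "A = R `` {f}" "B = R `` {g}" by (auto simp: quotient_def)
    show "the_elem (\<Phi> ` R `` {m f g |f g. f \<in> A \<and> g \<in> B}) = the_elem (\<Phi> ` A) \<otimes>\<^bsub>D\<^esub> the_elem (\<Phi> ` B)"
      unfolding fg(3,4) prod[OF fg(1,2)] using the mult fg(1,2) by simp
  next
    show "inj_on (%A. the_elem (\<Phi> ` A)) (L // R)"
    proof (rule inj_onI)
      fix A B assume "A \<in> L // R" "B \<in> L // R" and eq: "the_elem (\<Phi> ` A) = the_elem (\<Phi> ` B)"
      then obtain f g where fg: "f \<in> L" "g \<in> L" "A = R `` {f}" "B = R `` {g}" by (auto simp: quotient_def)
      then show "A = B" using eq the cls by simp
    qed
  next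
    fix A assume "A \<in> L // R"
    then show "the_elem (\<Phi> ` A) \<in> carrier D" using the surj by (auto simp: quotient_def)
  next
    fix j assume "j \<in> carrier D"
    then obtain f where "f \<in> L" "j = \<Phi> f" using surj by blast
    then show "j \<in> (%A. the_elem (\<Phi> ` A)) ` (L // R)" using the by (intro image_eqI[of _ _ "R `` {f}"]) (auto simp: quotientI)
  qed
  then show ?thesis by (auto simp: is_iso_def)
qed

context free_isometric_quotient
begin

text \<open>A loop lifts to a path from y0 to act j y0 for a unique j. Monodromy shows that j depends only on the homotopy class, simple
connectedness that it determines the class, and path connectedness that every j occurs.\<close>

theorem fundamental_group_of_quotient:
  assumes hom: "homeomorphic_maps T (top_of_set X) h h'"
    and y0: "y0 \<in> Y" and b: "b \<in> topspace T" "h b = q y0"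
    and pc: "!!y. y \<in> Y ==> \<exists>g. path g \<and> path_image g \<subseteq> Y \<and> pathstart g = y0 \<and> pathfinish g = y"
    and sc: "!!g. [|path g; path_image g \<subseteq> Y; pathfinish g = pathstart g|]
               ==> homotopic_paths Y g (%_. pathstart g)" shows "fundamental_group T b \<cong> D"
proof -
  have h: "continuous_map T (top_of_set X) h" and h': "continuous_map (top_of_set X) T h'"
    and hh: "!!x. x \<in> topspace T ==> h' (h x) = x" and hh': "!!x. x \<in> X ==> h (h' x) = x" using hom by (auto simp: homeomorphic_maps_def)
  have ftop: "f s \<in> topspace T" if "pathin T f" "s \<in> {0..1}" for f s using that by (auto simp: pathin_def continuous_map_def)
  have push: "path (h o f) \<and> path_image (h o f) \<subseteq> X \<and> pathstart (h o f) = q y0 \<and> pathfinish (h o f) = q y0"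
    if "f \<in> loops_at T b" for f
  proof -
    have "pathin (top_of_set X) (h o f)" using that h by (auto simp: loops_at_def intro: pathin_compose)
    then show ?thesis using that b(2) by (auto simp: loops_at_def pathin_canon_iff pathstart_def pathfinish_def path_image_def)
  qed
  define lifts where "lifts f g \<longleftrightarrow> path g \<and> path_image g \<subseteq> Y \<and> pathstart g = y0 \<and> (\<forall>t\<in>{0..1}. q (g t) = h (f t))" for f g
  have lift_ex: "\<exists>g. lifts f g" if "f \<in> loops_at T b" for f
  proof -
    have 1: "path (h o f)" and 2: "path_image (h o f) \<subseteq> X" and 3: "pathstart (h o f) = q y0" using push[OF that] by auto
    obtain g where "path g" "path_image g \<subseteq> Y" "pathstart g = y0" "!!t. t \<in> {0..1} ==> q (g t) = (h o f) t"
      using covering_space_lift_path_strong[OF covering y0 1 2 3] by blast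
    then have "lifts f g" by (simp add: lifts_def)
    then show ?thesis by blast
  qed
  have finY: "pathfinish g \<in> Y" if "path_image g \<subseteq> Y" for g :: "real => 'y" using that pathfinish_in_path_image by blast
  define \<Phi> where "\<Phi> f = (SOME j. j \<in> carrier D \<and> (\<exists>g. lifts f g \<and> pathfinish g = act j y0))" for f
  have \<Phi>: "\<Phi> f \<in> carrier D \<and> (\<exists>g. lifts f g \<and> pathfinish g = act (\<Phi> f) y0)" if f: "f \<in> loops_at T b" for f
  proof -
    obtain g where g: "lifts f g" using lift_ex f by blast
    then have "q (pathfinish g) = q y0" using push[OF f] by (auto simp: lifts_def pathfinish_def)
    then obtain j where "j \<in> carrier D" "pathfinish g = act j y0" using q_eq_iff[of "pathfinish g" y0] y0 g finY by (auto simp: lifts_def)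
    then show ?thesis unfolding \<Phi>_def using g by (intro someI_ex[where P = "%j. j \<in> carrier D \<and> (\<exists>g. lifts f g \<and> pathfinish g = act j y0)"]) blast
  qed
  have mono: "pathfinish g = pathfinish g'"
    if fg: "lifts f g" "lifts f' g'" "homotopic_paths X (h o f) (h o f')" for f f' g g'
  proof -
    have "path (h o f)" "path_image (h o f) \<subseteq> X" "path (h o f')" "path_image (h o f') \<subseteq> X"
      using fg(3) homotopic_paths_imp_path homotopic_paths_imp_subset by blast+
    then show ?thesis using fg by (intro covering_space_monodromy[OF covering _ _ _ _ fg(3)]) (auto simp: lifts_def)
  qed
  have \<Phi>_eqI: "\<Phi> f = j" if fL: "f \<in> loops_at T b" and fg: "lifts f g" and j: "j \<in> carrier D" "pathfinish g = act j y0" for f g j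
  proof -
    obtain g' where g': "lifts f g'" "pathfinish g' = act (\<Phi> f) y0" using \<Phi>[OF fL] by blast
    have "pathfinish g = pathfinish g'" using mono[OF fg g'(1)] push[OF fL] by simp
    then have "act (\<Phi> f) y0 = act j y0" using j(2) g'(2) by (simp only:)
    then show ?thesis using \<Phi>[OF fL] j(1) y0 by (intro act_unique) auto
  qed
  have R: "(f, g) \<in> loop_homotopy_rel T b \<longleftrightarrow> f \<in> loops_at T b \<and> g \<in> loops_at T b \<and> \<Phi> f = \<Phi> g" for f g
  proof (intro iffI; (elim conjE)?)
    assume fg: "(f, g) \<in> loop_homotopy_rel T b"
    then have L: "f \<in> loops_at T b" "g \<in> loops_at T b"
      and H: "homotopic_with (%h. h 0 = b \<and> h 1 = b) (top_of_set {0..1}) T f g" by (auto simp: loop_homotopy_rel_def)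
    have "homotopic_with (%r. pathstart r = pathstart (h o f) \<and> pathfinish r = pathfinish (h o f))
       (top_of_set {0..1}) (top_of_set X) (h o f) (h o g)" by (rule homotopic_with_compose_continuous_map_left[OF H h])
        (use push[OF L(1)] b(2) in \<open>auto simp: pathstart_def pathfinish_def\<close>)
    then have hp: "homotopic_paths X (h o f) (h o g)" by (simp add: homotopic_paths_def)
    obtain l where l: "lifts g l" "pathfinish l = act (\<Phi> g) y0" using \<Phi>[OF L(2)] by blast
    obtain k where k: "lifts f k" "pathfinish k = act (\<Phi> f) y0" using \<Phi>[OF L(1)] by blast
    have "act (\<Phi> f) y0 = act (\<Phi> g) y0" using mono[OF k(1) l(1) hp] k l by simp
    then have "\<Phi> f = \<Phi> g" using \<Phi>[OF L(1)] \<Phi>[OF L(2)] y0 by (intro act_unique) auto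
    then show "f \<in> loops_at T b \<and> g \<in> loops_at T b \<and> \<Phi> f = \<Phi> g" using L by simp
  next
    assume L: "f \<in> loops_at T b" "g \<in> loops_at T b" and eq: "\<Phi> f = \<Phi> g"
    obtain l where l: "lifts g l" "pathfinish l = act (\<Phi> g) y0" using \<Phi>[OF L(2)] by blast
    obtain k where k: "lifts f k" "pathfinish k = act (\<Phi> f) y0" using \<Phi>[OF L(1)] by blast
    have "homotopic_paths Y (k +++ reversepath l) (%_. pathstart (k +++ reversepath l))"
      using k l eq by (intro sc) (auto simp: lifts_def path_image_join)
    then have "homotopic_paths Y (k +++ reversepath l) (linepath y0 y0)" using k by (simp add: lifts_def linepath_refl)
    then have "homotopic_loops Y (k +++ reversepath l) (linepath y0 y0)"
      using k l by (intro homotopic_paths_imp_homotopic_loops) (auto simp: lifts_def)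
    then have "homotopic_paths Y k l" by (rule homotopic_paths_loop_parts) (use l in \<open>simp add: lifts_def\<close>)
    then have "homotopic_paths X (q o k) (q o l)" using covering surj by (intro homotopic_paths_continuous_image) (auto simp: covering_space_def)
    then have H1: "homotopic_with (%r. pathstart r = pathstart (q o k) \<and> pathfinish r = pathfinish (q o k))
       (top_of_set {0..1}) (top_of_set X) (q o k) (q o l)" by (simp add: homotopic_paths_def)
    have ends: "pathstart (q o k) = q y0" "pathfinish (q o k) = q y0"
      using k \<Phi>[OF L(1)] y0 by (simp_all add: lifts_def pathstart_compose pathfinish_compose q_act)
    have "h' (q y0) = b" using hh[OF b(1)] b(2) by simp
    then have "homotopic_with (%r. r 0 = b \<and> r 1 = b) (top_of_set {0..1}) T (h' o (q o k)) (h' o (q o l))"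
      by (intro homotopic_with_compose_continuous_map_left[OF H1 h'])
        (use ends in \<open>simp add: pathstart_def pathfinish_def\<close>)
    moreover have "f s = (h' o (q o k)) s" "g s = (h' o (q o l)) s" if "s \<in> {0..1}" for s
      using k l that L hh ftop by (auto simp: lifts_def loops_at_def)
    ultimately have "homotopic_with (%h. h 0 = b \<and> h 1 = b) (top_of_set {0..1}) T f g" by (elim homotopic_with_eq) auto
    then show "(f, g) \<in> loop_homotopy_rel T b" using L by (simp add: loop_homotopy_rel_def)
  qed
  have "\<Phi> ` loops_at T b = carrier D"
  proof
    show "\<Phi> ` loops_at T b \<subseteq> carrier D" using \<Phi> by blast
    show "carrier D \<subseteq> \<Phi> ` loops_at T b"
    proof
      fix j assume j: "j \<in> carrier D"
      obtain g where g: "path g" "path_image g \<subseteq> Y" "pathstart g = y0" "pathfinish g = act j y0" using pc[OF act_in[OF j y0]] by blast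
      have gY: "g t \<in> Y" if "t \<in> {0..1}" for t using g(2) that by (auto simp: path_image_def)
      have "path (q o g)" using g(1,2) covering by (intro path_continuous_image) (auto simp: covering_space_def intro: continuous_on_subset)
      then have "pathin (top_of_set X) (q o g)" using gY surj by (auto simp: pathin_canon_iff path_image_def)
      then have "pathin T (h' o (q o g))" using h' by (rule pathin_compose)
      moreover have "h' (q y0) = b" using hh[OF b(1)] b(2) by simp
      then have "h' (q (g 0)) = b" "h' (q (g 1)) = b" using g(3,4) q_act[OF j y0] by (simp_all add: pathstart_def pathfinish_def)
      ultimately have L: "h' o (q o g) \<in> loops_at T b" by (simp add: loops_at_def)
      have "lifts (h' o (q o g)) g" using g gY surj hh' by (auto simp: lifts_def)
      then have "\<Phi> (h' o (q o g)) = j" using \<Phi>_eqI[OF L _ j] g(4) by blast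
      then show "j \<in> \<Phi> ` loops_at T b" using L by blast
    qed
  qed
  moreover have "loop_concat f g \<in> loops_at T b \<and> \<Phi> (loop_concat f g) = \<Phi> f \<otimes> \<Phi> g"
    if L: "f \<in> loops_at T b" "g \<in> loops_at T b" for f g
  proof -
    have ph: "path ((h o f) +++ (h o g))" "path_image ((h o f) +++ (h o g)) \<subseteq> X"
      using push[OF L(1)] push[OF L(2)] by (auto simp: path_image_join)
    then have "pathin (top_of_set X) ((h o f) +++ (h o g))" unfolding pathin_canon_iff by (simp add: path_image_def image_subset_iff Pi_iff)
    then have "pathin T (h' o ((h o f) +++ (h o g)))" using h' by (rule pathin_compose)
    moreover have eq: "(h' o ((h o f) +++ (h o g))) s = loop_concat f g s" if "s \<in> {0..1}" for s
      using that L hh ftop[of f "2 * s"] ftop[of g "2 * s - 1"] by (auto simp: joinpaths_def loop_concat_def loops_at_def)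
    ultimately have "pathin T (loop_concat f g)" unfolding pathin_def by (elim continuous_map_eq) auto
    then have LC: "loop_concat f g \<in> loops_at T b" using L by (auto simp: loops_at_def loop_concat_def)
    obtain l where l: "lifts g l" "pathfinish l = act (\<Phi> g) y0" using \<Phi>[OF L(2)] by blast
    obtain k where k: "lifts f k" "pathfinish k = act (\<Phi> f) y0" using \<Phi>[OF L(1)] by blast
    let ?j = "\<Phi> f"
    have j: "?j \<in> carrier D" "\<Phi> g \<in> carrier D" using \<Phi> L by auto
    have lY: "l t \<in> Y" if "t \<in> {0..1}" for t using l(1) that by (auto simp: lifts_def path_image_def)
    have "continuous_on Y (act ?j)" unfolding continuous_on_iff using act_isom[OF j(1)] by metis
    then have pl: "path (act ?j o l)" using l by (intro path_continuous_image) (auto simp: lifts_def intro: continuous_on_subset)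
    have pil: "path_image (act ?j o l) \<subseteq> Y" using lY act_in[OF j(1)] by (auto simp: path_image_def)
    have psl: "pathstart (act ?j o l) = pathfinish k" using k l by (simp add: lifts_def pathstart_compose)
    have "lifts (loop_concat f g) (k +++ (act ?j o l))" unfolding lifts_def
    proof (intro conjI ballI)
      show "path (k +++ (act ?j o l))" using pl psl k by (simp add: lifts_def)
      show "path_image (k +++ (act ?j o l)) \<subseteq> Y" using pil psl k by (simp add: lifts_def path_image_join)
      show "pathstart (k +++ (act ?j o l)) = y0" using k by (simp add: lifts_def)
      show "q ((k +++ (act ?j o l)) t) = h (loop_concat f g t)" if "t \<in> {0..1}" for t
        using that k l q_act[OF j(1)] lY by (auto simp: lifts_def joinpaths_def loop_concat_def)
    qed
    moreover have "pathfinish (k +++ (act ?j o l)) = act (?j \<otimes> \<Phi> g) y0" using l(2) j y0 by (simp add: pathfinish_compose act_mult)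
    ultimately show ?thesis using LC \<Phi>_eqI[OF LC] j by blast
  qed
  ultimately show ?thesis unfolding fundamental_group_def by (intro quotient_monoid_iso[where \<Phi> = \<Phi>] R) auto
qed

end

section \<open>Groups of path families for an isometric action\<close>

text \<open>A structure that satisfies the group axioms up to a congruence becomes a group modulo it.\<close>

lemma quotient_group:
  assumes eq: "equiv L R"
    and m: "!!f g. [|f \<in> L; g \<in> L|] ==> m f g \<in> L"
    and cong: "!!f f' g g'. [|(f, f') \<in> R; (g, g') \<in> R|] ==> (m f g, m f' g') \<in> R"
    and assoc: "!!f g h. [|f \<in> L; g \<in> L; h \<in> L|] ==> (m (m f g) h, m f (m g h)) \<in> R"
    and e: "e \<in> L" "!!f. f \<in> L ==> (m e f, f) \<in> R"
    and inv: "!!f. f \<in> L ==> i f \<in> L \<and> (m (i f) f, e) \<in> R"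
  defines "Q \<equiv> \<lparr>carrier = L // R, monoid.mult = (%A B. R `` {m f g | f g. f \<in> A \<and> g \<in> B}), one = R `` {e}\<rparr>"
  shows "group Q" and "!!f g. [|f \<in> L; g \<in> L|] ==> R `` {f} \<otimes>\<^bsub>Q\<^esub> R `` {g} = R `` {m f g}"
proof -
  have RL: "f \<in> L \<and> g \<in> L" if "(f, g) \<in> R" for f g using that equiv_type[OF eq] by blast
  have self: "(f, f) \<in> R" if "f \<in> L" for f using that eq by (simp add: equiv_def refl_on_def)
  have sym: "(g, f) \<in> R" if "(f, g) \<in> R" for f g using that eq by (meson equivE symD)
  have tr: "(f, h) \<in> R" if "(f, g) \<in> R" "(g, h) \<in> R" for f g h using that eq by (meson equivE transD)
  have mult: "R `` {f} \<otimes>\<^bsub>Q\<^esub> R `` {g} = R `` {m f g}" if "f \<in> L" "g \<in> L" for f g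
  proof -
    have "R `` {m f' g' | f' g'. f' \<in> R `` {f} \<and> g' \<in> R `` {g}} = R `` {m f g}" (is "?A = _")
    proof
      show "?A \<subseteq> R `` {m f g}" using cong tr by blast
      show "R `` {m f g} \<subseteq> ?A" using self that by blast
    qed
    then show ?thesis by (simp add: Q_def)
  qed
  then show "!!f g. [|f \<in> L; g \<in> L|] ==> R `` {f} \<otimes>\<^bsub>Q\<^esub> R `` {g} = R `` {m f g}" .
  have car: "A \<in> carrier Q \<longleftrightarrow> (\<exists>f\<in>L. A = R `` {f})" for A by (auto simp: Q_def quotient_def)
  have eqc: "R `` {f} = R `` {g}" if "(f, g) \<in> R" for f g using that eq by (rule equiv_class_eq[rotated])
  have one: "\<one>\<^bsub>Q\<^esub> = R `` {e}" by (simp add: Q_def)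
  show "group Q"
  proof (rule groupI)
    show "A \<otimes>\<^bsub>Q\<^esub> B \<in> carrier Q" if "A \<in> carrier Q" "B \<in> carrier Q" for A B using that m mult unfolding car by blast
    show "\<one>\<^bsub>Q\<^esub> \<in> carrier Q" using e car one by blast
    show "A \<otimes>\<^bsub>Q\<^esub> B \<otimes>\<^bsub>Q\<^esub> C = A \<otimes>\<^bsub>Q\<^esub> (B \<otimes>\<^bsub>Q\<^esub> C)" if ABC: "A \<in> carrier Q" "B \<in> carrier Q" "C \<in> carrier Q" for A B C
    proof -
      obtain f g h where fgh: "f \<in> L" "g \<in> L" "h \<in> L" "A = R `` {f}" "B = R `` {g}" "C = R `` {h}" using ABC unfolding car by blast
      then show ?thesis using mult m eqc[OF assoc[OF fgh(1-3)]] by simp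
    qed
    show "\<one>\<^bsub>Q\<^esub> \<otimes>\<^bsub>Q\<^esub> A = A" if A: "A \<in> carrier Q" for A
    proof -
      obtain f where f: "f \<in> L" "A = R `` {f}" using A unfolding car by blast
      then show ?thesis using mult e eqc[OF e(2)[OF f(1)]] one by simp
    qed
    show "\<exists>B\<in>carrier Q. B \<otimes>\<^bsub>Q\<^esub> A = \<one>\<^bsub>Q\<^esub>" if A: "A \<in> carrier Q" for A
    proof -
      obtain f where f: "f \<in> L" "A = R `` {f}" using A unfolding car by blast
      then have "R `` {i f} \<otimes>\<^bsub>Q\<^esub> A = \<one>\<^bsub>Q\<^esub>" using mult inv[OF f(1)] eqc[of "m (i f) f" e] one by simp
      then show ?thesis using inv[OF f(1)] car by blast
    qed
  qed
qed

lemma homotopic_paths_cancel_middle: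
  fixes p q r :: "real => 'a::real_normed_vector"
  assumes "path p" "path q" "path r" "path_image p \<subseteq> S" "path_image q \<subseteq> S" "path_image r \<subseteq> S"
    and "pathfinish p = pathfinish q" "pathfinish q = pathstart r" shows "homotopic_paths S ((p +++ reversepath q) +++ (q +++ r)) (p +++ r)"
proof -
  have "homotopic_paths S ((p +++ reversepath q) +++ (q +++ r)) (((p +++ reversepath q) +++ q) +++ r)"
    using assms by (intro homotopic_paths_assoc) (auto simp: path_image_join)
  moreover have "homotopic_paths S ((p +++ reversepath q) +++ q) (p +++ (reversepath q +++ q))"
    using assms by (intro homotopic_paths_sym[OF homotopic_paths_assoc]) (auto simp: path_image_join)
  moreover have "homotopic_paths S (p +++ (reversepath q +++ q)) (p +++ linepath (pathfinish q) (pathfinish q))"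
    using assms by (intro homotopic_paths_join homotopic_paths_linv) (auto simp: path_image_join)
  moreover have "homotopic_paths S (p +++ linepath (pathfinish q) (pathfinish q)) p" using assms homotopic_paths_rid[of p S] by simp
  ultimately have "homotopic_paths S ((p +++ reversepath q) +++ q) p" by (blast intro: homotopic_paths_trans)
  then have "homotopic_paths S (((p +++ reversepath q) +++ q) +++ r) (p +++ r)" using assms by (intro homotopic_paths_join) auto
  with \<open>homotopic_paths S ((p +++ reversepath q) +++ (q +++ r)) (((p +++ reversepath q) +++ q) +++ r)\<close>
  show ?thesis by (rule homotopic_paths_trans)
qed

text \<open>The path groups consist of classes of pairs of a group element g and a path from b to L g b. Such pairs
multiply by translating the second path by the first group element.\<close>

locale isometric_action = group H for H (structure) +
  fixes Y :: "'y::real_normed_vector set" and L :: "'a => 'y => 'y" and b :: 'y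
  assumes base_in: "b \<in> Y"
    and L_in: "!!g y. [|g \<in> carrier H; y \<in> Y|] ==> L g y \<in> Y"
    and L_isom: "!!g y z. [|g \<in> carrier H; y \<in> Y; z \<in> Y|] ==> dist (L g y) (L g z) = dist y z"
    and L_one: "!!y. y \<in> Y ==> L \<one> y = y"
    and L_mult: "!!g h y. [|g \<in> carrier H; h \<in> carrier H; y \<in> Y|] ==> L (g \<otimes> h) y = L g (L h y)"
begin

lemma L_cont: "g \<in> carrier H ==> continuous_on Y (L g)" unfolding continuous_on_iff using L_isom by metis

text \<open>Paths are required to stay in Y outside the unit interval too: the laws of the action hold on Y, and the equations
between composed paths are equations of functions on the whole line.\<close>

definition path_ok :: "real => 'a \<times> (real => 'y) => bool" where
  "path_ok r f \<longleftrightarrow> fst f \<in> carrier H \<and> path (snd f) \<and> range (snd f) \<subseteq> Y \<and> path_image (snd f) \<subseteq> cball b r \<and>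
     pathstart (snd f) = b \<and> pathfinish (snd f) = L (fst f) b"

definition pmult :: "'a \<times> (real => 'y) => 'a \<times> (real => 'y) => 'a \<times> (real => 'y)" where
  "pmult f g = (fst f \<otimes> fst g, snd f +++ (L (fst f) o snd g))"

definition pinv :: "'a \<times> (real => 'y) => 'a \<times> (real => 'y)" where
  "pinv f = (inv (fst f), L (inv (fst f)) o reversepath (snd f))"

definition pone :: "'a \<times> (real => 'y)" where
  "pone = (\<one>, linepath b b)"

definition phom :: "real => 'a \<times> (real => 'y) => 'a \<times> (real => 'y) => bool" where
  "phom r f g \<longleftrightarrow> fst f = fst g \<and> homotopic_paths (Y \<inter> cball b r) (snd f) (snd g)"

lemma path_ok_mono: "path_ok r f ==> r <= s ==> path_ok s f" by (auto simp: path_ok_def)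

lemma phom_mono: "phom r f g ==> r <= s ==> phom s f g"
  unfolding phom_def using homotopic_paths_subset[of "Y \<inter> cball b r" _ _ "Y \<inter> cball b s"] by fastforce

lemma path_ok_image: "path_ok r f ==> path_image (snd f) \<subseteq> Y \<inter> cball b r" by (auto simp: path_ok_def path_image_def)

lemma path_ok_base: "path_ok r f ==> dist b (L (fst f) b) <= r" using pathfinish_in_path_image[of "snd f"] by (auto simp: path_ok_def)

lemma translate_path:
  assumes "g \<in> carrier H" "path p" "path_image p \<subseteq> Y" shows "path (L g o p)"
  using assms L_cont by (intro path_continuous_image) (auto intro: continuous_on_subset)

lemma translate_image:
  assumes "g \<in> carrier H" "dist b (L g b) <= r" "path_image p \<subseteq> Y \<inter> cball b s"
  shows "path_image (L g o p) \<subseteq> Y \<inter> cball b (r + s)"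
proof
  fix y assume "y \<in> path_image (L g o p)"
  then obtain t where t: "t \<in> {0..1}" "y = L g (p t)" by (auto simp: path_image_def)
  define z where "z = p t"
  have "z \<in> path_image p" using t(1) by (auto simp: path_image_def z_def)
  then have "z \<in> Y \<inter> cball b s" using assms(3) by blast
  then have z: "z \<in> Y" "dist b z <= s" "y = L g z" using t(2) by (auto simp: z_def)
  have "dist b y <= dist b (L g b) + dist (L g b) (L g z)" using z by (simp add: dist_triangle)
  then show "y \<in> Y \<inter> cball b (r + s)" using assms z L_in L_isom base_in by auto
qed

lemma translate_homotopic:
  assumes "g \<in> carrier H" "dist b (L g b) <= r" "homotopic_paths (Y \<inter> cball b s) p q"
  shows "homotopic_paths (Y \<inter> cball b (r + s)) (L g o p) (L g o q)"
proof (rule homotopic_paths_continuous_image[OF assms(3)])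
  show "continuous_on (Y \<inter> cball b s) (L g)" using L_cont[OF assms(1)] by (rule continuous_on_subset) auto
  show "L g \<in> Y \<inter> cball b s \<rightarrow> Y \<inter> cball b (r + s)"
  proof
    fix z assume z: "z \<in> Y \<inter> cball b s"
    have "dist b (L g z) <= dist b (L g b) + dist (L g b) (L g z)" by (simp add: dist_triangle)
    then show "L g z \<in> Y \<inter> cball b (r + s)" using assms z L_in L_isom base_in by auto
  qed
qed

lemma translate_ends:
  assumes "path_ok r f" "g \<in> carrier H" shows "pathstart (L g o snd f) = L g b" "pathfinish (L g o snd f) = L (g \<otimes> fst f) b"
  using assms base_in by (auto simp: path_ok_def pathstart_compose pathfinish_compose L_mult)

lemma path_ok_mult:
  assumes f: "path_ok r f" and g: "path_ok s g" shows "path_ok (r + s) (pmult f g)"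
proof -
  have gf: "fst f \<in> carrier H" "fst g \<in> carrier H" using f g by (auto simp: path_ok_def)
  have "path_image (L (fst f) o snd g) \<subseteq> Y \<inter> cball b (r + s)"
    by (rule translate_image[OF gf(1) path_ok_base[OF f] path_ok_image[OF g]])
  moreover have "path (L (fst f) o snd g)" using g path_ok_image[OF g] by (intro translate_path gf) (auto simp: path_ok_def)
  moreover have "snd f t \<in> Y" "L (fst f) (snd g t) \<in> Y" for t using f g by (auto simp: path_ok_def intro!: L_in[OF gf(1)])
  then have "range (snd f +++ (L (fst f) o snd g)) \<subseteq> Y" by (auto simp: joinpaths_def)
  moreover have "0 <= s" using path_ok_base[OF g] order_trans zero_le_dist by blast
  ultimately show ?thesis using translate_ends[OF g gf(1)] f gf path_ok_image[OF f] by (fastforce simp: path_ok_def pmult_def path_image_join)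
qed

lemma path_ok_nonneg: "path_ok r f ==> 0 <= r" using path_ok_base order_trans zero_le_dist by blast

lemma path_ok_inv:
  assumes f: "path_ok r f" shows "path_ok (2 * r) (pinv f)"
proof -
  let ?g = "fst f"
  have g: "?g \<in> carrier H" "inv ?g \<in> carrier H" using f by (auto simp: path_ok_def)
  have "dist b (L (inv ?g) b) = dist (L ?g b) (L ?g (L (inv ?g) b))" using g base_in L_in by (simp add: L_isom)
  also have "... = dist b (L ?g b)" using g base_in by (simp add: L_one dist_commute flip: L_mult)
  finally have d: "dist b (L (inv ?g) b) <= r" using path_ok_base[OF f] by simp
  have i: "path_image (L (inv ?g) o reversepath (snd f)) \<subseteq> Y \<inter> cball b (r + r)"
    by (rule translate_image[OF g(2) d]) (use path_ok_image[OF f] in simp)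
  moreover have "path (L (inv ?g) o reversepath (snd f))" using f path_ok_image[OF f] by (intro translate_path g) (auto simp: path_ok_def)
  moreover have "snd f t \<in> Y" for t using f by (auto simp: path_ok_def)
  then have "range (L (inv ?g) o reversepath (snd f)) \<subseteq> Y" using L_in[OF g(2)] by (auto simp: reversepath_def)
  moreover have "L (inv ?g) (L ?g b) = b" using g base_in by (simp add: L_one flip: L_mult)
  ultimately show ?thesis using f g by (auto simp: path_ok_def pinv_def pathstart_compose pathfinish_compose)
qed

lemma path_ok_one: "0 <= r ==> path_ok r pone"
  using base_in by (auto simp: path_ok_def pone_def L_one linepath_refl path_image_def path_const[unfolded pathstart_def] pathstart_def pathfinish_def path_def)

lemma phom_refl: "path_ok r f ==> phom r f f" using path_ok_image[of r f] by (simp add: phom_def path_ok_def)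

lemma phom_sym: "phom r f g ==> phom r g f" by (auto simp: phom_def homotopic_paths_sym)

lemma phom_trans: "phom r f g ==> phom r g h ==> phom r f h" by (auto simp: phom_def intro: homotopic_paths_trans)

lemma phom_mult:
  assumes f: "path_ok r f" "path_ok r f'" "phom r f f'" and g: "path_ok s g" "path_ok s g'" "phom s g g'"
  shows "phom (r + s) (pmult f g) (pmult f' g')"
proof -
  have fst: "fst f \<in> carrier H" "fst f = fst f'" "fst g = fst g'" using f g by (auto simp: path_ok_def phom_def)
  have "homotopic_paths (Y \<inter> cball b (r + s)) (snd f +++ (L (fst f) o snd g)) (snd f' +++ (L (fst f) o snd g'))"
  proof (rule homotopic_paths_join)
    show "homotopic_paths (Y \<inter> cball b (r + s)) (snd f) (snd f')"
      using phom_mono[OF f(3), of "r + s"] path_ok_nonneg[OF g(1)] by (simp add: phom_def)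
    show "homotopic_paths (Y \<inter> cball b (r + s)) (L (fst f) o snd g) (L (fst f) o snd g')"
      using g(3) by (intro translate_homotopic fst path_ok_base[OF f(1)]) (simp add: phom_def)
    show "pathfinish (snd f) = pathstart (L (fst f) o snd g)" using translate_ends(1)[OF g(1) fst(1)] f(1) by (simp add: path_ok_def)
  qed
  then show ?thesis using fst by (simp add: phom_def pmult_def)
qed

lemma translate_twice:
  assumes "range p \<subseteq> Y" "g \<in> carrier H" "h \<in> carrier H" shows "L g o (L h o p) = L (g \<otimes> h) o p"
proof -
  have "p t \<in> Y" for t using assms(1) by blast
  then show ?thesis using assms(2,3) by (simp add: fun_eq_iff L_mult)
qed

lemma phom_assoc:
  assumes f: "path_ok r f" and g: "path_ok s g" and h: "path_ok t h" shows "phom (r + s + t) (pmult (pmult f g) h) (pmult f (pmult g h))"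
proof -
  have c: "fst f \<in> carrier H" "fst g \<in> carrier H" "fst h \<in> carrier H" using f g h by (auto simp: path_ok_def)
  have fg: "path_ok (r + s) (pmult f g)" by (rule path_ok_mult[OF f g])
  note nn = path_ok_nonneg[OF f] path_ok_nonneg[OF g] path_ok_nonneg[OF h]
  let ?W = "Y \<inter> cball b (r + s + t)"
  let ?P = "snd f" and ?Q = "L (fst f) o snd g" and ?R = "L (fst f \<otimes> fst g) o snd h"
  have 1: "path_image ?P \<subseteq> ?W" using path_ok_image[OF f] nn by fastforce
  have "path_image ?Q \<subseteq> Y \<inter> cball b (r + s)" by (rule translate_image[OF c(1) path_ok_base[OF f] path_ok_image[OF g]])
  then have 2: "path_image ?Q \<subseteq> ?W" using nn by fastforce
  have 3: "path_image ?R \<subseteq> ?W" using translate_image[OF _ path_ok_base[OF fg] path_ok_image[OF h]] c by (simp add: pmult_def)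
  have p: "path ?P" "path ?Q" "path ?R" using f g h c path_ok_image[OF g] path_ok_image[OF h] by (auto simp: path_ok_def intro!: translate_path)
  have e: "pathfinish ?P = pathstart ?Q" "pathfinish ?Q = pathstart ?R"
    using translate_ends[OF g c(1)] translate_ends[OF h, of "fst f \<otimes> fst g"] f c by (auto simp: path_ok_def)
  have "L (fst f) o (snd g +++ (L (fst g) o snd h)) = ?Q +++ ?R"
    using translate_twice[OF _ c(1,2), of "snd h"] h by (simp add: path_compose_join path_ok_def)
  then show ?thesis using homotopic_paths_assoc[OF p(1) 1 p(2) 2 p(3) 3 e] c by (simp add: phom_def pmult_def m_assoc homotopic_paths_sym)
qed

lemma phom_one:
  assumes f: "path_ok r f" shows "phom r (pmult pone f) f"
proof -
  have "snd f t \<in> Y" for t using f by (auto simp: path_ok_def)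
  then have "L \<one> o snd f = snd f" by (simp add: L_one fun_eq_iff)
  then show ?thesis using f path_ok_image[OF f] homotopic_paths_lid[of "snd f" "Y \<inter> cball b r"]
    by (simp add: phom_def pmult_def pone_def path_ok_def)
qed

lemma phom_inv:
  assumes f: "path_ok r f" shows "phom (2 * r) (pmult (pinv f) f) pone"
proof -
  let ?g = "fst f"
  have g: "?g \<in> carrier H" "inv ?g \<in> carrier H" using f by (auto simp: path_ok_def)
  let ?p = "L (inv ?g) o snd f"
  have "path_image (L (inv ?g) o reversepath (snd f)) \<subseteq> Y \<inter> cball b (2 * r)"
    using path_ok_image[OF path_ok_inv[OF f]] by (simp add: pinv_def)
  moreover have rc: "L (inv ?g) o reversepath (snd f) = reversepath ?p" by (simp add: reversepath_def fun_eq_iff)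
  ultimately have "path_image ?p \<subseteq> Y \<inter> cball b (2 * r)" by simp
  moreover have "path ?p" using f path_ok_image[OF f] by (intro translate_path g) (auto simp: path_ok_def)
  moreover have "pathfinish ?p = b" using f g base_in by (simp add: path_ok_def pathfinish_compose L_one flip: L_mult)
  ultimately have "homotopic_paths (Y \<inter> cball b (2 * r)) (reversepath ?p +++ ?p) (linepath b b)"
    using homotopic_paths_linv[of ?p "Y \<inter> cball b (2 * r)"] by simp
  then show ?thesis using g by (simp add: phom_def pmult_def pinv_def pone_def rc)
qed

text \<open>A family is indexed by an arbitrary type and its member at j lives at scale rho j up to one constant for the whole family. One identity in
the group of families is therefore a uniform statement about homotopies at all scales at once.\<close>

definition families :: "('j => real) => ('j => 'a \<times> (real => 'y)) set" where
  "families rho = {F. \<exists>C\<ge>0. \<forall>j. path_ok (C * rho j) (F j)}"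

definition family_rel where
  "family_rel rho = {(F, G). F \<in> families rho \<and> G \<in> families rho \<and> (\<exists>C\<ge>0. \<forall>j. phom (C * rho j) (F j) (G j))}"

definition path_group :: "('j => real) => ('j => 'a \<times> (real => 'y)) set monoid" where
  "path_group rho = \<lparr>carrier = families rho // family_rel rho,
     monoid.mult = (%A B. family_rel rho `` {(%j. pmult (F j) (G j)) | F G. F \<in> A \<and> G \<in> B}),
     one = family_rel rho `` {%j. pone}\<rparr>"

lemma path_group:
  assumes rho: "!!j. 0 <= rho j" shows "group (path_group rho)"
    and path_group_mult: "!!F G. [|F \<in> families rho; G \<in> families rho|]
      ==> family_rel rho `` {F} \<otimes>\<^bsub>path_group rho\<^esub> family_rel rho `` {G} = family_rel rho `` {%j. pmult (F j) (G j)}"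
    and families_mult: "!!F G. [|F \<in> families rho; G \<in> families rho|] ==> (%j. pmult (F j) (G j)) \<in> families rho"
    and equiv_family_rel: "equiv (families rho) (family_rel rho)"
proof -
  have up: "C * rho j <= C' * rho j" if "C <= C'" for C C' j using that rho by (rule mult_right_mono)
  have m: "(%j. pmult (F j) (G j)) \<in> families rho" if FG: "F \<in> families rho" "G \<in> families rho" for F G
  proof -
    obtain C C' where CC: "C \<ge> 0" "C' \<ge> 0" "!!j. path_ok (C * rho j) (F j)" "!!j. path_ok (C' * rho j) (G j)"
      using FG unfolding families_def by blast
    have "path_ok ((C + C') * rho j) (pmult (F j) (G j))" for j using path_ok_mult[OF CC(3,4)] by (simp add: distrib_right)
    then show ?thesis using CC(1,2) unfolding families_def by (auto intro!: exI[of _ "C + C'"])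
  qed
  then show "!!F G. [|F \<in> families rho; G \<in> families rho|] ==> (%j. pmult (F j) (G j)) \<in> families rho" .
  show eq: "equiv (families rho) (family_rel rho)"
  proof (rule equivI)
    show "family_rel rho \<subseteq> families rho \<times> families rho" by (auto simp: family_rel_def)
    show "refl_on (families rho) (family_rel rho)" unfolding refl_on_def family_rel_def families_def using phom_refl by blast
    show "sym (family_rel rho)" unfolding sym_def family_rel_def using phom_sym by blast
    show "trans (family_rel rho)"
    proof (rule transI)
      fix F G E assume "(F, G) \<in> family_rel rho" "(G, E) \<in> family_rel rho"
      then obtain C C' where CC: "C \<ge> 0" "C' \<ge> 0" "!!j. phom (C * rho j) (F j) (G j)" "!!j. phom (C' * rho j) (G j) (E j)"
        and FG: "F \<in> families rho" "E \<in> families rho" unfolding family_rel_def by blast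
      have "phom (max C C' * rho j) (F j) (E j)" for j by (rule phom_trans[OF phom_mono[OF CC(3)] phom_mono[OF CC(4)]]) (auto intro: up)
      then show "(F, E) \<in> family_rel rho" using FG CC(1) unfolding family_rel_def by (auto intro!: exI[of _ "max C C'"])
    qed
  qed
  have cong: "(%j. pmult (F j) (G j), %j. pmult (F' j) (G' j)) \<in> family_rel rho"
    if FF: "(F, F') \<in> family_rel rho" and GG: "(G, G') \<in> family_rel rho" for F F' G G'
  proof -
    obtain C1 C2 C3 where 1: "C1 \<ge> 0" "!!j. path_ok (C1 * rho j) (F j)" "!!j. path_ok (C2 * rho j) (F' j)" "!!j. phom (C3 * rho j) (F j) (F' j)"
      using FF unfolding family_rel_def families_def by blast
    obtain C4 C5 C6 where 2: "C4 \<ge> 0" "!!j. path_ok (C4 * rho j) (G j)" "!!j. path_ok (C5 * rho j) (G' j)" "!!j. phom (C6 * rho j) (G j) (G' j)"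
      using GG unfolding family_rel_def families_def by blast
    define C where "C = Max {C1, C2, C3}"
    define C' where "C' = Max {C4, C5, C6}"
    have le: "C1 <= C" "C2 <= C" "C3 <= C" "C4 <= C'" "C5 <= C'" "C6 <= C'" by (auto simp: C_def C'_def)
    have "phom (C * rho j + C' * rho j) (pmult (F j) (G j)) (pmult (F' j) (G' j))" for j
      by (intro phom_mult path_ok_mono[OF 1(2)] path_ok_mono[OF 1(3)] phom_mono[OF 1(4)]
         path_ok_mono[OF 2(2)] path_ok_mono[OF 2(3)] phom_mono[OF 2(4)] up le)
    then have "\<exists>C\<ge>0. \<forall>j. phom (C * rho j) (pmult (F j) (G j)) (pmult (F' j) (G' j))"
      using le(1,4) 1(1) 2(1) by (intro exI[of _ "C + C'"]) (auto simp: distrib_right)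
    then show ?thesis using FF GG m unfolding family_rel_def by blast
  qed
  have assoc: "(%j. pmult (pmult (F j) (G j)) (E j), %j. pmult (F j) (pmult (G j) (E j))) \<in> family_rel rho"
    if FGE: "F \<in> families rho" "G \<in> families rho" "E \<in> families rho" for F G E
  proof -
    obtain C1 C2 C3 where C: "C1 \<ge> 0" "C2 \<ge> 0" "C3 \<ge> 0" "!!j. path_ok (C1 * rho j) (F j)" "!!j. path_ok (C2 * rho j) (G j)"
       "!!j. path_ok (C3 * rho j) (E j)" using FGE unfolding families_def by blast
    have "\<exists>C\<ge>0. \<forall>j. phom (C * rho j) (pmult (pmult (F j) (G j)) (E j)) (pmult (F j) (pmult (G j) (E j)))"
      using phom_assoc[OF C(4,5,6)] C(1-3) by (intro exI[of _ "C1 + C2 + C3"]) (auto simp: distrib_right)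
    moreover have "(%j. pmult (pmult (F j) (G j)) (E j)) \<in> families rho" "(%j. pmult (F j) (pmult (G j) (E j))) \<in> families rho"
      using m[OF m[OF FGE(1,2)] FGE(3)] m[OF FGE(1) m[OF FGE(2,3)]] by simp_all
    ultimately show ?thesis unfolding family_rel_def by blast
  qed
  have one: "(%j. pone) \<in> families rho" unfolding families_def using path_ok_one by (auto intro!: exI[of _ 0])
  have lone: "(%j. pmult pone (F j), F) \<in> family_rel rho" if F: "F \<in> families rho" for F
  proof -
    have "\<exists>C\<ge>0. \<forall>j. phom (C * rho j) (pmult pone (F j)) (F j)" using F phom_one unfolding families_def by blast
    then show ?thesis using F m[OF one F] unfolding family_rel_def by blast
  qed
  have linv: "(%j. pinv (F j)) \<in> families rho \<and> (%j. pmult (pinv (F j)) (F j), %j. pone) \<in> family_rel rho"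
    if F: "F \<in> families rho" for F
  proof -
    obtain C where C: "C \<ge> 0" "!!j. path_ok (C * rho j) (F j)" using F unfolding families_def by blast
    have i: "(%j. pinv (F j)) \<in> families rho"
      using path_ok_inv[OF C(2)] C(1) unfolding families_def by (auto intro!: exI[of _ "2 * C"] simp: mult.assoc)
    moreover have "\<exists>C\<ge>0. \<forall>j. phom (C * rho j) (pmult (pinv (F j)) (F j)) pone"
      using phom_inv[OF C(2)] C(1) by (intro exI[of _ "2 * C"]) (auto simp: mult.assoc)
    ultimately show ?thesis using m[OF i F] one unfolding family_rel_def by blast
  qed
  note Q = quotient_group[OF eq, of "%F G j. pmult (F j) (G j)" "%j. pone" "%F j. pinv (F j)", folded path_group_def]
  show "group (path_group rho)" by (rule Q(1)) (use m cong assoc one lone linv in auto)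
  show "family_rel rho `` {F} \<otimes>\<^bsub>path_group rho\<^esub> family_rel rho `` {G} = family_rel rho `` {%j. pmult (F j) (G j)}"
    if "F \<in> families rho" "G \<in> families rho" for F G by (rule Q(2)) (use m cong assoc one lone linv that in auto)
qed

lemma path_group_carrier: "F \<in> families rho ==> family_rel rho `` {F} \<in> carrier (path_group rho)" by (simp add: path_group_def quotientI)

lemma path_group_eqI:
  assumes "!!j. 0 <= rho j" "F \<in> families rho" "G \<in> families rho" "C \<ge> 0" "!!j. phom (C * rho j) (F j) (G j)"
  shows "family_rel rho `` {F} = family_rel rho `` {G}" using assms by (intro equiv_class_eq[OF equiv_family_rel]) (auto simp: family_rel_def)

lemma path_group_eqD:
  assumes "!!j. 0 <= rho j" "F \<in> families rho" "G \<in> families rho" "family_rel rho `` {F} = family_rel rho `` {G}"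
  shows "\<exists>C\<ge>0. \<forall>j. phom (C * rho j) (F j) (G j)"
  using eq_equiv_class[OF assms(4) equiv_family_rel[OF assms(1)]] assms(3) by (auto simp: family_rel_def)

end

section \<open>Letters along a flat\<close>

lemma homotopic_paths_image_of_ball:
  fixes p q :: "real => 'v::real_normed_vector" and f :: "'v => 'y::topological_space"
  assumes "continuous_on (cball 0 R) f" "f ` cball 0 R \<subseteq> W" "path p" "path q"
    "path_image p \<subseteq> cball 0 R" "path_image q \<subseteq> cball 0 R" "pathstart q = pathstart p" "pathfinish q = pathfinish p"
  shows "homotopic_paths W (f o p) (f o q)"
proof (rule homotopic_paths_continuous_image[OF _ assms(1)])
  have "closed_segment (p t) (q t) \<subseteq> cball 0 R" if "t \<in> {0..1}" for t
    using that assms(5,6) by (intro closed_segment_subset) (auto simp: path_image_def simp del: mem_cball mem_cball_0)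
  then show "homotopic_paths (cball 0 R) p q" using assms by (intro homotopic_paths_linear) auto
  show "f \<in> cball 0 R \<rightarrow> W" using assms(2) by blast
qed

text \<open>The flat E is a Lipschitz image of a normed space. Homotopies inside a flat or a translated flat are images of straight-line
homotopies, which keeps them at the scale of their end points.\<close>

locale flat_action = isometric_action +
  fixes E :: "'v::real_normed_vector => 'c" and K :: real
  assumes E_0: "E 0 = b" and E_in: "!!x. E x \<in> Y" and K_nonneg: "0 <= K"
    and E_lip: "!!x y. dist (E x) (E y) <= K * dist x y"
begin

definition stab :: "'v => 'a set" where
  "stab x = {u \<in> carrier H. L u (E x) = E x}"

definition translates :: "'a => 'v => bool" where
  "translates a v \<longleftrightarrow> a \<in> carrier H \<and> (\<forall>x. L a (E x) = E (v + x))"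

text \<open>If u fixes E x, walking out to E x and returning along the flat translated by u leads from b to L u b.\<close>

definition letter :: "'a => 'v => 'a \<times> (real => 'c)" where
  "letter u x = (u, (E o linepath 0 x) +++ (L u o (E o linepath x 0)))"

definition straight :: "'a => 'v => 'a \<times> (real => 'c)" where
  "straight a v = (a, E o linepath 0 v)"

lemma E_cont: "continuous_on A E" unfolding continuous_on_iff
proof (intro ballI allI impI)
  fix x e assume "(e::real) > 0"
  then have "dist (E y) (E x) < e" if "dist y x < e / (K + 1)" for y
  proof -
    have "dist (E y) (E x) <= K * dist y x" by (rule E_lip)
    also have "... <= (K + 1) * dist y x" by (simp add: mult_right_mono)
    also have "... < e" using that K_nonneg by (simp add: field_simps)
    finally show ?thesis .
  qed
  then show "\<exists>d>0. \<forall>x'\<in>A. dist x' x < d \<longrightarrow> dist (E x') (E x) < e"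
    using \<open>e > 0\<close> K_nonneg by (intro exI[of _ "e / (K + 1)"]) auto
qed

lemma stab_carrier: "u \<in> stab x ==> u \<in> carrier H" by (simp add: stab_def)

lemma stab_mult: "u \<in> stab x ==> w \<in> stab x ==> u \<otimes> w \<in> stab x" using E_in by (simp add: stab_def L_mult)

lemma stab_one: "\<one> \<in> stab x" using E_in by (simp add: stab_def L_one)

abbreviation W where "W R \<equiv> Y \<inter> cball b (3 * K * R)"

lemma translated_flat:
  assumes "u \<in> stab x" "norm x <= R" shows "continuous_on (cball 0 R) (L u o E)" and "(L u o E) ` cball 0 R \<subseteq> W R"
proof -
  have u: "u \<in> carrier H" using assms by (simp add: stab_def)
  show "continuous_on (cball 0 R) (L u o E)" using E_cont L_cont[OF u] E_in by (intro continuous_on_compose) (auto intro: continuous_on_subset)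
  show "(L u o E) ` cball 0 R \<subseteq> W R"
  proof
    fix z assume "z \<in> (L u o E) ` cball 0 R"
    then obtain y where y: "norm y <= R" "z = L u (E y)" by auto
    have "dist b z <= dist (E 0) (E x) + dist (L u (E x)) (L u (E y))" using dist_triangle[of b z "E x"] assms(1) y(2) by (simp add: stab_def E_0)
    also have "... <= K * norm x + K * dist x y" using E_lip[of 0 x] E_lip[of x y] L_isom[OF u E_in E_in] by (simp add: add_mono)
    also have "... <= K * R + K * (2 * R)" using assms(2) y(1) K_nonneg dist_triangle2[of x y 0] by (intro add_mono mult_left_mono) auto
    finally show "z \<in> W R" using y L_in[OF u E_in] by simp
  qed
qed

lemma flat_path:
  assumes "u \<in> stab x" "norm x <= R" "path p" "path_image p \<subseteq> cball 0 R"
  shows "path (L u o (E o p))" "path_image (L u o (E o p)) \<subseteq> W R"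
proof -
  note t = translated_flat[OF assms(1,2)]
  have "path ((L u o E) o p)" by (intro path_continuous_image assms(3) continuous_on_subset[OF t(1) assms(4)])
  then show "path (L u o (E o p))" by (simp add: comp_assoc)
  have "path_image (L u o (E o p)) = (L u o E) ` path_image p" by (auto simp: path_image_def)
  also have "... \<subseteq> (L u o E) ` cball 0 R" using assms(4) by (rule image_mono)
  finally show "path_image (L u o (E o p)) \<subseteq> W R" using t(2) by blast
qed

lemma flat_homotopic:
  assumes "u \<in> stab x" "norm x <= R" "path p" "path q" "path_image p \<subseteq> cball 0 R" "path_image q \<subseteq> cball 0 R"
    "pathstart q = pathstart p" "pathfinish q = pathfinish p" shows "homotopic_paths (W R) (L u o (E o p)) (L u o (E o q))"
  using homotopic_paths_image_of_ball[OF translated_flat[OF assms(1,2)] assms(3-8)] by (simp add: comp_assoc)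

lemma L_one_E: "L \<one> o (E o p) = E o p" using E_in by (simp add: fun_eq_iff L_one)

lemma flat_path':
  assumes "0 <= R" "path p" "path_image p \<subseteq> cball 0 R" shows "path (E o p)" "path_image (E o p) \<subseteq> W R"
  using flat_path[OF stab_one[of 0] _ assms(2,3)] assms(1) by (auto simp: L_one_E)

lemma flat_homotopic':
  assumes "0 <= R" "path p" "path q" "path_image p \<subseteq> cball 0 R" "path_image q \<subseteq> cball 0 R"
    "pathstart q = pathstart p" "pathfinish q = pathfinish p" shows "homotopic_paths (W R) (E o p) (E o q)"
  using flat_homotopic[OF stab_one[of 0] _ assms(2-7)] assms(1) by (simp add: L_one_E)

lemma segment_in_ball:
  fixes x y :: 'v
  assumes "norm x <= R" "norm y <= R" shows "path_image (linepath x y) \<subseteq> cball 0 R" "0 <= R"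
proof -
  have "closed_segment x y \<subseteq> cball 0 R" using assms by (intro closed_segment_subset) auto
  then show "path_image (linepath x y) \<subseteq> cball 0 R" by simp
  show "0 <= R" using assms(1) norm_ge_zero order_trans by blast
qed

lemma join_in_ball:
  fixes p q :: "real => 'v"
  shows "path_image p \<subseteq> cball 0 R ==> path_image q \<subseteq> cball 0 R ==> path_image (p +++ q) \<subseteq> cball 0 R"
  using path_image_join_subset[of p q] by blast

lemma E_translate:
  assumes "translates a v" shows "L a o (E o p) = E o (%t. v + p t)" using assms by (simp add: translates_def fun_eq_iff)

lemma L_twice_E: "u \<in> carrier H ==> w \<in> carrier H ==> L u o (L w o (E o p)) = L (u \<otimes> w) o (E o p)"
  using E_in by (simp add: fun_eq_iff L_mult)

lemma reverse_E: "reversepath (L u o (E o linepath x y)) = L u o (E o linepath y x)"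
  by (simp add: fun_eq_iff reversepath_def linepath_def algebra_simps)

lemma reverse_E': "reversepath (E o linepath x y) = E o linepath y x" by (simp add: fun_eq_iff reversepath_def linepath_def algebra_simps)

lemma stab_point: "u \<in> stab x ==> L u (E x) = E x" by (simp add: stab_def)

lemma letter_ok:
  assumes u: "u \<in> stab x" and R: "norm x <= R" shows "path_ok (3 * K * R) (letter u x)"
proof -
  have R0: "0 <= R" using R norm_ge_zero order_trans by blast
  have s: "path_image (linepath 0 x) \<subseteq> cball 0 R" "path_image (linepath x 0) \<subseteq> cball 0 R" using segment_in_ball R R0 by simp_all
  have e: "pathfinish (E o linepath 0 x) = pathstart (L u o (E o linepath x 0))"
    using stab_point[OF u] by (simp add: pathstart_compose pathfinish_compose)
  have "(E o linepath 0 x) +++ (L u o (E o linepath x 0)) \<in> UNIV \<rightarrow> Y"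
    using E_in L_in[OF stab_carrier[OF u]] by (auto simp: joinpaths_def)
  then have "range ((E o linepath 0 x) +++ (L u o (E o linepath x 0))) \<subseteq> Y" by blast
  then show ?thesis using flat_path[OF u R _ s(2)] flat_path'[OF R0 _ s(1)] e E_0 stab_carrier[OF u]
    by (auto simp: path_ok_def letter_def path_image_join pathstart_compose pathfinish_compose)
qed

lemma straight_ok:
  assumes "translates a v" and R: "norm v <= R" shows "path_ok (3 * K * R) (straight a v)"
proof -
  have R0: "0 <= R" using R norm_ge_zero order_trans by blast
  have s: "path_image (linepath 0 v) \<subseteq> cball 0 R" using segment_in_ball R R0 by (metis norm_zero)
  have "L a b = E v" "a \<in> carrier H" using assms(1) E_0 by (metis translates_def add.right_neutral)+
  moreover have "range (E o linepath 0 v) \<subseteq> Y" using E_in by auto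
  ultimately show ?thesis using flat_path'[OF R0 _ s] E_0 by (auto simp: path_ok_def straight_def pathstart_compose pathfinish_compose)
qed

text \<open>The return path of the first letter and the translated outward path of the second are inverse to each other.\<close>

lemma letter_mult:
  assumes u: "u \<in> stab x" and w: "w \<in> stab x" and R: "norm x <= R"
  shows "phom (3 * K * R) (pmult (letter u x) (letter w x)) (letter (u \<otimes> w) x)"
proof -
  have R0: "0 <= R" using R norm_ge_zero order_trans by blast
  have s: "path_image (linepath 0 x) \<subseteq> cball 0 R" "path_image (linepath x 0) \<subseteq> cball 0 R" using segment_in_ball R R0 by simp_all
  have c: "u \<in> carrier H" "w \<in> carrier H" using u w by (auto simp: stab_def)
  let ?p = "E o linepath 0 x" and ?q = "L u o (E o linepath 0 x)" and ?r = "L (u \<otimes> w) o (E o linepath x 0)"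
  have "homotopic_paths (W R) ((?p +++ reversepath ?q) +++ (?q +++ ?r)) (?p +++ ?r)"
    using flat_path[OF u R _ s(1)] flat_path'[OF R0 _ s(1)] flat_path[OF stab_mult[OF u w] R _ s(2)]
      stab_point[OF u] stab_point[OF stab_mult[OF u w]] by (intro homotopic_paths_cancel_middle) (auto simp: pathstart_compose pathfinish_compose)
  moreover have "snd (pmult (letter u x) (letter w x)) = (?p +++ reversepath ?q) +++ (?q +++ ?r)"
    using c by (simp add: pmult_def letter_def path_compose_join L_twice_E reverse_E)
  ultimately show ?thesis by (simp add: phom_def pmult_def letter_def)
qed

text \<open>Along a segment of points fixed by u the flat and its translate coincide, so the turning point may slide.\<close>

lemma letter_move:
  assumes u: "!!z. z \<in> closed_segment x y ==> u \<in> stab z" and R: "norm x <= R" "norm y <= R"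
  shows "phom (3 * K * R) (letter u x) (letter u y)"
proof -
  have R0: "0 <= R" using R norm_ge_zero order_trans by blast
  have s: "path_image (linepath 0 x) \<subseteq> cball 0 R" "path_image (linepath x 0) \<subseteq> cball 0 R"
      "path_image (linepath x y) \<subseteq> cball 0 R" "path_image (linepath y x) \<subseteq> cball 0 R"
      "path_image (linepath 0 y) \<subseteq> cball 0 R" "path_image (linepath y 0) \<subseteq> cball 0 R" using segment_in_ball R R0 by simp_all
  have ux: "u \<in> stab x" "u \<in> stab y" using u by auto
  let ?s = "E o linepath y x"
  let ?us = "L u o (E o linepath y x)"
  have eq: "?us t = ?s t" if "t \<in> {0..1}" for t
  proof -
    have "linepath y x t \<in> closed_segment y x" using that linepath_in_path by blast
    then have "linepath y x t \<in> closed_segment x y" by (simp add: closed_segment_commute)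
    from u[OF this] show ?thesis by (simp add: stab_def)
  qed
  note P = flat_path'[OF R0 _ s(1)] flat_path'[OF R0 _ s(3)] flat_path'[OF R0 _ s(4)] flat_path'[OF R0 _ s(5)]
    flat_path[OF ux(1) R(1) _ s(2)] flat_path[OF ux(2) R(2) _ s(6)] flat_path[OF ux(1) R(1) _ s(4)]
  have 1: "homotopic_paths (W R) (E o linepath 0 y) ((E o linepath 0 x) +++ reversepath ?s)"
  proof -
    have "homotopic_paths (W R) (E o linepath 0 y) (E o (linepath 0 x +++ linepath x y))"
      by (rule flat_homotopic'[OF R0 _ _ s(5) join_in_ball[OF s(1,3)]]) auto
    then show ?thesis by (simp add: path_compose_join reverse_E')
  qed
  have 2: "homotopic_paths (W R) (L u o (E o linepath y 0)) (?s +++ (L u o (E o linepath x 0)))"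
  proof -
    have "homotopic_paths (W R) (L u o (E o linepath y 0)) (L u o (E o (linepath y x +++ linepath x 0)))"
      by (rule flat_homotopic[OF ux(2) R(2) _ _ s(6) join_in_ball[OF s(4,2)]]) auto
    then have "homotopic_paths (W R) (L u o (E o linepath y 0)) (?us +++ (L u o (E o linepath x 0)))" by (simp add: path_compose_join)
    moreover have "homotopic_paths (W R) ?us ?s" using P eq by (intro homotopic_paths_eq) auto
    then have "homotopic_paths (W R) (?us +++ (L u o (E o linepath x 0))) (?s +++ (L u o (E o linepath x 0)))"
      using P by (intro homotopic_paths_join) (auto simp: pathstart_compose pathfinish_compose)
    ultimately show ?thesis by (rule homotopic_paths_trans)
  qed
  have "homotopic_paths (W R) ((E o linepath 0 y) +++ (L u o (E o linepath y 0)))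
     (((E o linepath 0 x) +++ reversepath ?s) +++ (?s +++ (L u o (E o linepath x 0))))"
    using stab_point[OF ux(2)] by (intro homotopic_paths_join 1 2) (simp add: pathstart_compose pathfinish_compose)
  moreover have "homotopic_paths (W R) (((E o linepath 0 x) +++ reversepath ?s) +++ (?s +++ (L u o (E o linepath x 0))))
      ((E o linepath 0 x) +++ (L u o (E o linepath x 0)))"
    using P stab_point[OF ux(1)] by (intro homotopic_paths_cancel_middle) (auto simp: pathstart_compose pathfinish_compose)
  ultimately have "homotopic_paths (W R) ((E o linepath 0 y) +++ (L u o (E o linepath y 0)))
     ((E o linepath 0 x) +++ (L u o (E o linepath x 0)))" by (rule homotopic_paths_trans)
  then show ?thesis by (simp add: phom_def letter_def homotopic_paths_sym)
qed

lemma translates_mult: "translates a v ==> translates c w ==> translates (a \<otimes> c) (v + w)"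
  using E_in by (simp add: translates_def L_mult add.assoc)

lemma straight_mult:
  assumes a: "translates a v" and c: "translates c w" and R: "norm v + norm w <= R"
  shows "phom (3 * K * R) (pmult (straight a v) (straight c w)) (straight (a \<otimes> c) (v + w))"
proof -
  have R': "norm v <= R" "norm (v + w) <= R" "0 <= R" using R norm_triangle_ineq[of v w] norm_ge_zero[of v] norm_ge_zero[of w] by linarith+
  have s: "path_image (linepath 0 v) \<subseteq> cball 0 R" "path_image (linepath v (v + w)) \<subseteq> cball 0 R" "path_image (linepath 0 (v + w)) \<subseteq> cball 0 R"
    using segment_in_ball R' by simp_all
  have "L a o (E o linepath 0 w) = E o linepath v (v + w)" unfolding E_translate[OF a] by (simp add: fun_eq_iff linepath_def algebra_simps)
  moreover have "homotopic_paths (W R) (E o (linepath 0 v +++ linepath v (v + w))) (E o linepath 0 (v + w))"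
    by (rule flat_homotopic'[OF R'(3) _ _ join_in_ball[OF s(1,2)] s(3)]) auto
  ultimately show ?thesis by (simp add: phom_def pmult_def straight_def path_compose_join)
qed

lemma stab_conj:
  assumes a: "translates a v" and u: "u \<in> stab x" shows "a \<otimes> u \<otimes> inv a \<in> stab (v + x)"
proof -
  have c: "a \<in> carrier H" "u \<in> carrier H" using assms by (auto simp: translates_def stab_def)
  have "L (a \<otimes> u \<otimes> inv a) (E (v + x)) = L (a \<otimes> u \<otimes> inv a) (L a (E x))" using a by (simp add: translates_def)
  also have "... = L a (L u (E x))" using c E_in by (simp add: m_assoc flip: L_mult)
  also have "... = E (v + x)" using a u by (simp add: translates_def stab_def)
  finally show ?thesis using c by (simp add: stab_def)
qed

text \<open>An element translating the flat carries the letter of u to that of its conjugate, based at the shifted fixed point; the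
two sides differ by paths within the flat and within one translate of it.\<close>

lemma letter_conj:
  assumes a: "translates a v" and u: "u \<in> stab x" and R: "norm v + norm x <= R"
  shows "phom (3 * K * R) (pmult (straight a v) (letter u x)) (pmult (letter (a \<otimes> u \<otimes> inv a) (v + x)) (straight a v))"
proof -
  have R': "norm v <= R" "norm (v + x) <= R" "0 <= R" using R norm_triangle_ineq[of v x] norm_ge_zero[of v] norm_ge_zero[of x] by linarith+
  let ?u = "a \<otimes> u \<otimes> inv a"
  have c: "a \<in> carrier H" "u \<in> carrier H" using a u by (auto simp: translates_def stab_def)
  have u': "?u \<in> stab (v + x)" by (rule stab_conj[OF a u])
  have s: "path_image (linepath 0 v) \<subseteq> cball 0 R" "path_image (linepath v 0) \<subseteq> cball 0 R"
    "path_image (linepath v (v + x)) \<subseteq> cball 0 R" "path_image (linepath (v + x) v) \<subseteq> cball 0 R"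
    "path_image (linepath 0 (v + x)) \<subseteq> cball 0 R" "path_image (linepath (v + x) 0) \<subseteq> cball 0 R"
    using segment_in_ball R' by simp_all
  note P = flat_path'[OF R'(3) _ s(1)] flat_path'[OF R'(3) _ s(3)] flat_path'[OF R'(3) _ s(5)]
    flat_path[OF u' R'(2) _ s(1)] flat_path[OF u' R'(2) _ s(4)] flat_path[OF u' R'(2) _ s(2)] flat_path[OF u' R'(2) _ s(6)]
  let ?T = "E o linepath 0 v" and ?Q = "E o linepath v (v + x)" and ?Q' = "L ?u o (E o linepath (v + x) v)"
    and ?A = "E o linepath 0 (v + x)" and ?B = "L ?u o (E o linepath (v + x) 0)" and ?T' = "L ?u o (E o linepath 0 v)"
  have e: "pathfinish ?T = pathstart ?Q" "pathfinish ?Q = pathstart ?Q'" "pathfinish ?A = pathstart ?B" "pathfinish ?B = pathstart ?T'"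
    "pathstart ?A = pathstart ?T" "pathfinish ?Q' = pathfinish ?T'" "pathfinish ?A = pathstart ?Q'"
    using stab_point[OF u'] by (simp_all add: pathstart_compose pathfinish_compose)
  have "L ?u (L a (E y)) = L a (L u (E y))" for y using c E_in by (simp add: m_assoc flip: L_mult)
  then have "L a o (L u o (E o linepath x 0)) = L ?u o (L a o (E o linepath x 0))" by (simp add: fun_eq_iff)
  also have "... = ?Q'" unfolding E_translate[OF a] by (simp add: fun_eq_iff linepath_def algebra_simps)
  finally have "L a o (L u o (E o linepath x 0)) = ?Q'" .
  moreover have "L a o (E o linepath 0 x) = ?Q" unfolding E_translate[OF a] by (simp add: fun_eq_iff linepath_def algebra_simps)
  ultimately have lhs: "snd (pmult (straight a v) (letter u x)) = ?T +++ (?Q +++ ?Q')"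
    by (simp add: pmult_def straight_def letter_def path_compose_join)
  have rhs: "snd (pmult (letter ?u (v + x)) (straight a v)) = (?A +++ ?B) +++ ?T'" by (simp add: pmult_def straight_def letter_def)
  have 1: "homotopic_paths (W R) (?T +++ (?Q +++ ?Q')) ((?T +++ ?Q) +++ ?Q')" using P e by (intro homotopic_paths_assoc) auto
  have "homotopic_paths (W R) (E o (linepath 0 v +++ linepath v (v + x))) ?A"
    by (rule flat_homotopic'[OF R'(3) _ _ join_in_ball[OF s(1,3)] s(5)]) auto
  then have "homotopic_paths (W R) ((?T +++ ?Q) +++ ?Q') (?A +++ ?Q')" using P e by (intro homotopic_paths_join) (auto simp: path_compose_join)
  moreover have "homotopic_paths (W R) (L ?u o (E o linepath (v + x) v)) (L ?u o (E o (linepath (v + x) 0 +++ linepath 0 v)))"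
    by (rule flat_homotopic[OF u' R'(2) _ _ s(4) join_in_ball[OF s(6,1)]]) auto
  then have "homotopic_paths (W R) (?A +++ ?Q') (?A +++ (?B +++ ?T'))" using P e by (intro homotopic_paths_join) (auto simp: path_compose_join)
  moreover have "homotopic_paths (W R) (?A +++ (?B +++ ?T')) ((?A +++ ?B) +++ ?T')" using P e by (intro homotopic_paths_assoc) auto
  ultimately have "homotopic_paths (W R) (?T +++ (?Q +++ ?Q')) ((?A +++ ?B) +++ ?T')" using 1 by (blast intro: homotopic_paths_trans)
  moreover have "fst (pmult (straight a v) (letter u x)) = fst (pmult (letter ?u (v + x)) (straight a v))"
    using c by (simp add: pmult_def straight_def letter_def m_assoc)
  ultimately show ?thesis by (simp add: phom_def lhs rhs)
qed

definition bounded_by :: "('j => real) => ('j => 'v) => bool" where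
  "bounded_by rho x \<longleftrightarrow> (\<exists>C\<ge>0. \<forall>j. norm (x j) <= C * rho j)"

definition letter_class :: "('j => real) => ('j => 'a) => ('j => 'v) => ('j => 'a \<times> (real => 'c)) set" where
  "letter_class rho u x = family_rel rho `` {%j. letter (u j) (x j)}"

definition straight_class :: "('j => real) => ('j => 'a) => ('j => 'v) => ('j => 'a \<times> (real => 'c)) set" where
  "straight_class rho a v = family_rel rho `` {%j. straight (a j) (v j)}"

context
  fixes rho :: "'j => real"
  assumes rho: "!!j. 0 <= rho j"
begin

lemma bounded_by_add: "bounded_by rho x ==> bounded_by rho y ==> bounded_by rho (%j. x j + y j)"
proof -
  assume "bounded_by rho x" "bounded_by rho y"
  then obtain C C' where C: "C \<ge> 0" "C' \<ge> 0" "!!j. norm (x j) <= C * rho j" "!!j. norm (y j) <= C' * rho j" unfolding bounded_by_def by blast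
  have "norm (x j + y j) <= (C + C') * rho j" for j using norm_triangle_ineq[of "x j" "y j"] C(3)[of j] C(4)[of j] by (simp only: distrib_right)
  then show ?thesis using C unfolding bounded_by_def by (intro exI[of _ "C + C'"]) auto
qed

lemma letter_families:
  assumes "!!j. u j \<in> stab (x j)" "bounded_by rho x" shows "(%j. letter (u j) (x j)) \<in> families rho"
proof -
  obtain C where "C \<ge> 0" "!!j. norm (x j) <= C * rho j" using assms(2) unfolding bounded_by_def by blast
  then show ?thesis using letter_ok[OF assms(1)] K_nonneg unfolding families_def by (auto intro!: exI[of _ "3 * K * C"] simp: mult.assoc)
qed

lemma straight_families:
  assumes "!!j. translates (a j) (v j)" "bounded_by rho v" shows "(%j. straight (a j) (v j)) \<in> families rho"
proof -
  obtain C where "C \<ge> 0" "!!j. norm (v j) <= C * rho j" using assms(2) unfolding bounded_by_def by blast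
  then show ?thesis using straight_ok[OF assms(1)] K_nonneg unfolding families_def by (auto intro!: exI[of _ "3 * K * C"] simp: mult.assoc)
qed

lemma letter_class_carrier:
  "(!!j. u j \<in> stab (x j)) ==> bounded_by rho x ==> letter_class rho u x \<in> carrier (path_group rho)"
  unfolding letter_class_def by (intro path_group_carrier letter_families)

lemma straight_class_carrier:
  "(!!j. translates (a j) (v j)) ==> bounded_by rho v ==> straight_class rho a v \<in> carrier (path_group rho)"
  unfolding straight_class_def by (intro path_group_carrier straight_families)

lemma letter_class_mult:
  assumes u: "!!j. u j \<in> stab (x j)" and w: "!!j. w j \<in> stab (x j)" and x: "bounded_by rho x"
  shows "letter_class rho u x \<otimes>\<^bsub>path_group rho\<^esub> letter_class rho w x = letter_class rho (%j. u j \<otimes> w j) x"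
proof -
  obtain C where C: "C \<ge> 0" "!!j. norm (x j) <= C * rho j" using x unfolding bounded_by_def by blast
  have "phom ((3 * K * C) * rho j) (pmult (letter (u j) (x j)) (letter (w j) (x j))) (letter (u j \<otimes> w j) (x j))" for j
    using letter_mult[OF u w C(2)] by (simp add: mult.assoc)
  then show ?thesis unfolding letter_class_def path_group_mult[OF rho letter_families[OF u x] letter_families[OF w x]] using C K_nonneg
    by (intro path_group_eqI[OF rho families_mult[OF rho letter_families[OF u x] letter_families[OF w x]]
          letter_families[OF stab_mult[OF u w] x], of "3 * K * C"]) auto
qed

lemma letter_class_move:
  assumes u: "!!j z. z \<in> closed_segment (x j) (y j) ==> u j \<in> stab z" and x: "bounded_by rho x" and y: "bounded_by rho y"
  shows "letter_class rho u x = letter_class rho u y"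
proof -
  have ux: "!!j. u j \<in> stab (x j)" "!!j. u j \<in> stab (y j)" using u by auto
  obtain C where C: "C \<ge> 0" "!!j. norm (x j) <= C * rho j" using x unfolding bounded_by_def by blast
  obtain C' where C': "C' \<ge> 0" "!!j. norm (y j) <= C' * rho j" using y unfolding bounded_by_def by blast
  let ?C = "max C C'"
  have "norm (x j) <= ?C * rho j" "norm (y j) <= ?C * rho j" for j
    using C(2)[of j] C'(2)[of j] mult_right_mono[OF _ rho, of C ?C j] mult_right_mono[OF _ rho, of C' ?C j] by auto
  then have "phom ((3 * K * ?C) * rho j) (letter (u j) (x j)) (letter (u j) (y j))" for j
    using letter_move[OF u, where R = "?C * rho j"] by (simp add: mult.assoc)
  then show ?thesis unfolding letter_class_def using C K_nonneg
    by (intro path_group_eqI[OF rho letter_families[OF ux(1) x] letter_families[OF ux(2) y], of "3 * K * ?C"]) auto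
qed

lemma straight_class_mult:
  assumes a: "!!j. translates (a j) (v j)" and v: "bounded_by rho v" and c: "!!j. translates (c j) (w j)" and w: "bounded_by rho w"
  shows "straight_class rho a v \<otimes>\<^bsub>path_group rho\<^esub> straight_class rho c w = straight_class rho (%j. a j \<otimes> c j) (%j. v j + w j)"
proof -
  obtain C where C: "C \<ge> 0" "!!j. norm (v j) <= C * rho j" using v unfolding bounded_by_def by blast
  obtain C' where C': "C' \<ge> 0" "!!j. norm (w j) <= C' * rho j" using w unfolding bounded_by_def by blast
  have "norm (v j) + norm (w j) <= (C + C') * rho j" for j using C(2)[of j] C'(2)[of j] by (simp add: distrib_right)
  then have "phom ((3 * K * (C + C')) * rho j) (pmult (straight (a j) (v j)) (straight (c j) (w j))) (straight (a j \<otimes> c j) (v j + w j))" for j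
    using straight_mult[OF a c] by (simp add: mult.assoc)
  then show ?thesis unfolding straight_class_def path_group_mult[OF rho straight_families[OF a v] straight_families[OF c w]] using C C' K_nonneg
    by (intro path_group_eqI[OF rho families_mult[OF rho straight_families[OF a v] straight_families[OF c w]]
          straight_families[OF translates_mult[OF a c] bounded_by_add[OF v w]], of "3 * K * (C + C')"]) auto
qed

lemma letter_class_conj:
  assumes a: "!!j. translates (a j) (v j)" and v: "bounded_by rho v" and u: "!!j. u j \<in> stab (x j)" and x: "bounded_by rho x"
  shows "straight_class rho a v \<otimes>\<^bsub>path_group rho\<^esub> letter_class rho u x =
    letter_class rho (%j. a j \<otimes> u j \<otimes> inv (a j)) (%j. v j + x j) \<otimes>\<^bsub>path_group rho\<^esub> straight_class rho a v"
proof -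
  obtain C where C: "C \<ge> 0" "!!j. norm (v j) <= C * rho j" using v unfolding bounded_by_def by blast
  obtain C' where C': "C' \<ge> 0" "!!j. norm (x j) <= C' * rho j" using x unfolding bounded_by_def by blast
  have "norm (v j) + norm (x j) <= (C + C') * rho j" for j using C(2)[of j] C'(2)[of j] by (simp add: distrib_right)
  then have ph: "phom ((3 * K * (C + C')) * rho j) (pmult (straight (a j) (v j)) (letter (u j) (x j)))
     (pmult (letter (a j \<otimes> u j \<otimes> inv (a j)) (v j + x j)) (straight (a j) (v j)))" for j
    using letter_conj[OF a u] by (simp add: mult.assoc)
  note fam = straight_families[OF a v] letter_families[OF u x] letter_families[OF stab_conj[OF a u] bounded_by_add[OF v x]]
  show ?thesis unfolding straight_class_def letter_class_def path_group_mult[OF rho fam(1,2)] path_group_mult[OF rho fam(3,1)]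
    using C C' K_nonneg ph by (intro path_group_eqI[OF rho families_mult[OF rho fam(1,2)] families_mult[OF rho fam(3,1)], of "3 * K * (C + C')"]) auto
qed

end

end

section \<open>The commutator calculus of Abels\<close>

context group
begin

definition commutes :: "'a => 'a => bool" where
  "commutes x y \<longleftrightarrow> x \<otimes> y = y \<otimes> x"

lemma commutes_sym: "commutes x y ==> commutes y x" by (simp add: commutes_def)

lemma commutes_mult:
  assumes "commutes x y" "commutes x z" "x \<in> carrier G" "y \<in> carrier G" "z \<in> carrier G" shows "commutes x (y \<otimes> z)"
proof -
  have "x \<otimes> (y \<otimes> z) = (x \<otimes> y) \<otimes> z" using assms by (simp add: m_assoc)
  also have "... = y \<otimes> (x \<otimes> z)" using assms by (simp add: commutes_def m_assoc)
  also have "... = (y \<otimes> z) \<otimes> x" using assms by (simp add: commutes_def m_assoc)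
  finally show ?thesis by (simp add: commutes_def)
qed

lemma commutes_inv:
  assumes "commutes x y" "x \<in> carrier G" "y \<in> carrier G" shows "commutes x (inv y)"
proof -
  have "inv y \<otimes> x = inv y \<otimes> (x \<otimes> y) \<otimes> inv y" using assms by (simp add: m_assoc)
  also have "... = inv y \<otimes> (y \<otimes> x) \<otimes> inv y" using assms by (simp add: commutes_def)
  also have "... = x \<otimes> inv y" using assms by (simp flip: m_assoc)
  finally have "inv y \<otimes> x = x \<otimes> inv y" .
  then show ?thesis by (simp add: commutes_def)
qed

definition commutator :: "'a => 'a => 'a" where
  "commutator x y = x \<otimes> y \<otimes> inv x \<otimes> inv y"

lemma commutator_closed: "x \<in> carrier G ==> y \<in> carrier G ==> commutator x y \<in> carrier G" by (simp add: commutator_def)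

lemma commutes_commutator:
  assumes "commutes c x" "commutes c y" "c \<in> carrier G" "x \<in> carrier G" "y \<in> carrier G" shows "commutes c (commutator x y)"
  unfolding commutator_def using assms by (intro commutes_mult commutes_inv) auto

lemma swap_commutator:
  assumes "x \<in> carrier G" "y \<in> carrier G" shows "x \<otimes> y = commutator x y \<otimes> (y \<otimes> x)"
proof -
  have "inv y \<otimes> (y \<otimes> x) = x" using assms by (simp flip: m_assoc)
  then show ?thesis using assms by (simp add: commutator_def m_assoc)
qed

lemma commutatorI:
  assumes "x \<otimes> y = c \<otimes> (y \<otimes> x)" "x \<in> carrier G" "y \<in> carrier G" "c \<in> carrier G" shows "commutator x y = c"
proof -
  have "commutator x y \<otimes> (y \<otimes> x) = c \<otimes> (y \<otimes> x)" using swap_commutator assms by metis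
  then show ?thesis using assms commutator_closed by simp
qed

lemma tail:
  assumes "x \<otimes> y = w" "x \<in> carrier G" "y \<in> carrier G" "c \<in> carrier G" shows "x \<otimes> (y \<otimes> c) = w \<otimes> c"
  using assms by (simp flip: m_assoc)

end

text \<open>The relations between the root subgroups of upper unitriangular 4 by 4 matrices other than the corner (1,4): the missing
relations are exactly those in which the corner occurs.\<close>

locale abels_relations = group P for P (structure) +
  fixes B :: "'r::comm_ring_1 set" and X12 X13 X23 X24 X34 :: "'r => 'a"
  assumes B_add: "!!r s. [|r \<in> B; s \<in> B|] ==> r + s \<in> B"
    and B_mult: "!!r s. [|r \<in> B; s \<in> B|] ==> r * s \<in> B"
    and B_one: "1 \<in> B"
    and X_closed: "!!r. r \<in> B ==> X12 r \<in> carrier P" "!!r. r \<in> B ==> X13 r \<in> carrier P" "!!r. r \<in> B ==> X23 r \<in> carrier P"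
      "!!r. r \<in> B ==> X24 r \<in> carrier P" "!!r. r \<in> B ==> X34 r \<in> carrier P"
    and X_add: "!!r s. [|r \<in> B; s \<in> B|] ==> X12 r \<otimes> X12 s = X12 (r + s)"
      "!!r s. [|r \<in> B; s \<in> B|] ==> X13 r \<otimes> X13 s = X13 (r + s)"
      "!!r s. [|r \<in> B; s \<in> B|] ==> X23 r \<otimes> X23 s = X23 (r + s)"
      "!!r s. [|r \<in> B; s \<in> B|] ==> X24 r \<otimes> X24 s = X24 (r + s)"
      "!!r s. [|r \<in> B; s \<in> B|] ==> X34 r \<otimes> X34 s = X34 (r + s)"
    and X_comm: "!!r s. [|r \<in> B; s \<in> B|] ==> X12 r \<otimes> X13 s = X13 s \<otimes> X12 r"
      "!!r s. [|r \<in> B; s \<in> B|] ==> X12 r \<otimes> X34 s = X34 s \<otimes> X12 r"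
      "!!r s. [|r \<in> B; s \<in> B|] ==> X23 r \<otimes> X13 s = X13 s \<otimes> X23 r"
      "!!r s. [|r \<in> B; s \<in> B|] ==> X13 r \<otimes> X24 s = X24 s \<otimes> X13 r"
      "!!r s. [|r \<in> B; s \<in> B|] ==> X23 r \<otimes> X24 s = X24 s \<otimes> X23 r"
      "!!r s. [|r \<in> B; s \<in> B|] ==> X34 r \<otimes> X24 s = X24 s \<otimes> X34 r"
    and X12_X23: "!!r s. [|r \<in> B; s \<in> B|] ==> X12 r \<otimes> X23 s = X13 (r * s) \<otimes> (X23 s \<otimes> X12 r)"
    and X23_X34: "!!r s. [|r \<in> B; s \<in> B|] ==> X23 r \<otimes> X34 s = X24 (r * s) \<otimes> (X34 s \<otimes> X23 r)"
begin

text \<open>The corner subgroup is not given, so its elements are defined as commutators.\<close>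

definition Z where "Z r = commutator (X13 r) (X34 1)"

lemma X_commutes:
  assumes "r \<in> B" "s \<in> B" shows "commutes (X12 r) (X13 s)" "commutes (X12 r) (X34 s)" "commutes (X23 r) (X13 s)" "commutes (X13 r) (X24 s)"
    "commutes (X23 r) (X24 s)" "commutes (X34 r) (X24 s)"
    "commutes (X13 r) (X12 s)" "commutes (X34 r) (X12 s)" "commutes (X13 r) (X23 s)" "commutes (X24 r) (X13 s)"
    "commutes (X24 r) (X23 s)" "commutes (X24 r) (X34 s)" using X_comm assms by (simp_all add: commutes_def)

text \<open>This is the Hall--Witt identity for the roots 12, 23, 34, obtained by collecting X12 r X23 s X34 t in two orders.\<close>

lemma commutator_12_24:
  assumes B: "r \<in> B" "s \<in> B" "t \<in> B" shows "commutator (X12 r) (X24 (s * t)) = commutator (X13 (r * s)) (X34 t)"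
proof -
  note [simp] = X_closed B B_mult commutator_closed
  let ?F = "commutator (X12 r) (X24 (s * t))" and ?G = "commutator (X13 (r * s)) (X34 t)"
  have "commutes (X24 (s * t)) ?G" by (intro commutes_commutator X_commutes) auto
  then have com: "X24 (s * t) \<otimes> ?G = ?G \<otimes> X24 (s * t)" by (simp add: commutes_def)
  let ?e = "X34 t \<otimes> (X13 (r * s) \<otimes> (X23 s \<otimes> X12 r))"
  have "X12 r \<otimes> (X23 s \<otimes> X34 t) = X12 r \<otimes> X23 s \<otimes> X34 t" by (simp add: m_assoc)
  also have "... = X13 (r * s) \<otimes> (X23 s \<otimes> (X12 r \<otimes> X34 t))" by (simp add: X12_X23 m_assoc)
  also have "... = X13 (r * s) \<otimes> (X23 s \<otimes> X34 t \<otimes> X12 r)" by (simp add: X_comm m_assoc)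
  also have "... = X13 (r * s) \<otimes> X24 (s * t) \<otimes> (X34 t \<otimes> (X23 s \<otimes> X12 r))" by (simp add: X23_X34 m_assoc)
  also have "... = X24 (s * t) \<otimes> ((X13 (r * s) \<otimes> X34 t) \<otimes> (X23 s \<otimes> X12 r))" by (simp add: X_comm m_assoc)
  also have "X13 (r * s) \<otimes> X34 t = ?G \<otimes> (X34 t \<otimes> X13 (r * s))" by (rule swap_commutator) auto
  also have "X24 (s * t) \<otimes> (?G \<otimes> (X34 t \<otimes> X13 (r * s)) \<otimes> (X23 s \<otimes> X12 r)) = (X24 (s * t) \<otimes> ?G) \<otimes> ?e" by (simp add: m_assoc)
  finally have 1: "X12 r \<otimes> (X23 s \<otimes> X34 t) = (X24 (s * t) \<otimes> ?G) \<otimes> ?e" .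
  have "X12 r \<otimes> (X23 s \<otimes> X34 t) = (X12 r \<otimes> X24 (s * t)) \<otimes> (X34 t \<otimes> X23 s)" by (simp add: X23_X34 m_assoc)
  also have "X12 r \<otimes> X24 (s * t) = ?F \<otimes> (X24 (s * t) \<otimes> X12 r)" by (rule swap_commutator) auto
  also have "?F \<otimes> (X24 (s * t) \<otimes> X12 r) \<otimes> (X34 t \<otimes> X23 s) = ?F \<otimes> (X24 (s * t) \<otimes> ((X12 r \<otimes> X34 t) \<otimes> X23 s))" by (simp add: m_assoc)
  also have "... = ?F \<otimes> (X24 (s * t) \<otimes> (X34 t \<otimes> (X12 r \<otimes> X23 s)))" by (simp add: X_comm m_assoc)
  also have "... = (?F \<otimes> X24 (s * t)) \<otimes> ?e" by (simp add: X12_X23 m_assoc)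
  finally have "(?F \<otimes> X24 (s * t)) \<otimes> ?e = (?G \<otimes> X24 (s * t)) \<otimes> ?e" using 1 com by simp
  then show ?thesis by simp
qed

lemma commutators_eq_Z:
  assumes "r \<in> B" "s \<in> B" shows "commutator (X12 r) (X24 s) = Z (r * s)" "commutator (X13 r) (X34 s) = Z (r * s)"
  using commutator_12_24[OF assms(1,2) B_one] commutator_12_24[OF assms(1) B_one assms(2)] by (simp_all add: Z_def)

lemma Z_closed: "r \<in> B ==> Z r \<in> carrier P" using X_closed B_one by (simp add: Z_def commutator_closed)

lemma X12_X24: "[|r \<in> B; s \<in> B|] ==> X12 r \<otimes> X24 s = Z (r * s) \<otimes> (X24 s \<otimes> X12 r)"
  using swap_commutator[of "X12 r" "X24 s"] X_closed by (simp add: commutators_eq_Z)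

lemma X13_X34: "[|r \<in> B; s \<in> B|] ==> X13 r \<otimes> X34 s = Z (r * s) \<otimes> (X34 s \<otimes> X13 r)"
  using swap_commutator[of "X13 r" "X34 s"] X_closed by (simp add: commutators_eq_Z)

text \<open>A commutator commutes with whatever commutes with both its entries. Each of 12, 13, 24, 34 commutes
with both roots of (13, 34) or of (12, 24); only 23 needs an argument.\<close>

lemma Z_central:
  assumes "r \<in> B" "s \<in> B"
  shows "commutes (X12 s) (Z r)" "commutes (X13 s) (Z r)" "commutes (X23 s) (Z r)" "commutes (X24 s) (Z r)" "commutes (X34 s) (Z r)"
proof -
  note [simp] = X_closed assms B_one B_mult Z_closed
  have Z': "Z r = commutator (X12 r) (X24 1)" using commutators_eq_Z(1)[of r 1] by simp
  show "commutes (X12 s) (Z r)" unfolding Z_def by (intro commutes_commutator X_commutes) auto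
  show "commutes (X13 s) (Z r)" unfolding Z' by (intro commutes_commutator X_commutes) auto
  show "commutes (X24 s) (Z r)" unfolding Z_def by (intro commutes_commutator X_commutes) auto
  show "commutes (X34 s) (Z r)" unfolding Z' by (intro commutes_commutator X_commutes) auto
  have 1: "commutes (X13 (s * r)) (Z r)" unfolding Z' by (intro commutes_commutator X_commutes) auto
  \<comment> \<open>Moving \<open>X23 s\<close> through the product of \<open>X13 r\<close> and \<open>X34 1\<close> produces the factor \<open>X24 s\<close> on the left in both orders.\<close>
  have "X23 s \<otimes> (X13 r \<otimes> X34 1) = X13 r \<otimes> (X23 s \<otimes> X34 1)" by (simp add: X_comm flip: m_assoc)
  also have "... = X13 r \<otimes> X24 s \<otimes> (X34 1 \<otimes> X23 s)" by (simp add: X23_X34 m_assoc)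
  also have "... = X24 s \<otimes> (X13 r \<otimes> X34 1) \<otimes> X23 s" by (simp add: X_comm m_assoc)
  finally have a: "X23 s \<otimes> (X13 r \<otimes> X34 1) = X24 s \<otimes> (X13 r \<otimes> X34 1) \<otimes> X23 s" .
  have "X23 s \<otimes> (X34 1 \<otimes> X13 r) = X24 s \<otimes> (X34 1 \<otimes> X13 r) \<otimes> X23 s"
    by (simp add: X23_X34 X_comm m_assoc flip: m_assoc) (simp add: X_comm m_assoc)
  then have b: "X23 s \<otimes> (X34 1 \<otimes> X13 r) = X24 s \<otimes> (X34 1 \<otimes> X13 r) \<otimes> X23 s" .
  let ?w = "X34 1 \<otimes> X13 r"
  have zw: "X13 r \<otimes> X34 1 = Z r \<otimes> ?w" by (simp add: X13_X34)
  have "X24 s \<otimes> Z r = Z r \<otimes> X24 s" using \<open>commutes (X24 s) (Z r)\<close> by (simp add: commutes_def)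
  then have "X23 s \<otimes> (Z r \<otimes> ?w) = Z r \<otimes> (X24 s \<otimes> ?w \<otimes> X23 s)" using a unfolding zw by (simp flip: m_assoc)
  also have "... = Z r \<otimes> (X23 s \<otimes> ?w)" using b by simp
  finally have "(X23 s \<otimes> Z r) \<otimes> ?w = (Z r \<otimes> X23 s) \<otimes> ?w" by (simp add: m_assoc)
  then have "X23 s \<otimes> Z r = Z r \<otimes> X23 s" by (subst (asm) right_cancel) auto
  then show "commutes (X23 s) (Z r)" by (simp add: commutes_def)
qed

lemma Z_Z: "[|r \<in> B; s \<in> B|] ==> Z s \<otimes> Z r = Z r \<otimes> Z s"
proof -
  assume rs: "r \<in> B" "s \<in> B"
  have "commutes (Z r) (Z s)" unfolding Z_def[of s]
    using rs X_closed B_one Z_closed Z_central by (intro commutes_commutator) (auto intro: commutes_sym)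
  then show ?thesis by (simp add: commutes_def)
qed

lemma Z_add:
  assumes "r \<in> B" "s \<in> B" shows "Z r \<otimes> Z s = Z (r + s)"
proof -
  note [simp] = X_closed assms B_one B_mult B_add Z_closed
  have "X13 (r + s) \<otimes> X34 1 = X13 r \<otimes> (X13 s \<otimes> X34 1)" by (simp add: m_assoc flip: X_add)
  also have "... = (X13 r \<otimes> Z s) \<otimes> (X34 1 \<otimes> X13 s)" by (simp add: X13_X34 m_assoc)
  also have "X13 r \<otimes> Z s = Z s \<otimes> X13 r" using Z_central(2)[of s r] by (simp add: commutes_def)
  also have "Z s \<otimes> X13 r \<otimes> (X34 1 \<otimes> X13 s) = Z s \<otimes> ((X13 r \<otimes> X34 1) \<otimes> X13 s)" by (simp add: m_assoc)
  also have "... = (Z s \<otimes> Z r) \<otimes> (X34 1 \<otimes> (X13 r \<otimes> X13 s))" by (simp add: X13_X34 m_assoc)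
  also have "... = (Z r \<otimes> Z s) \<otimes> (X34 1 \<otimes> X13 (r + s))" by (simp add: X_add Z_Z)
  finally show ?thesis unfolding Z_def[of "r + s"] by (intro commutatorI[symmetric]) auto
qed

text \<open>This order of the factors makes unip the matrix with the given entries.\<close>

definition unip :: "'r => 'r => 'r => 'r => 'r => 'r => 'a" where
  "unip a12 a13 a14 a23 a24 a34 = Z a14 \<otimes> (X24 a24 \<otimes> (X34 a34 \<otimes> (X13 a13 \<otimes> (X23 a23 \<otimes> X12 a12))))"

lemma unip_closed:
  "[|a12 \<in> B; a13 \<in> B; a14 \<in> B; a23 \<in> B; a24 \<in> B; a34 \<in> B|] ==> unip a12 a13 a14 a23 a24 a34 \<in> carrier P"
  by (simp add: unip_def X_closed Z_closed)

lemma unip_mult: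
  assumes a: "a12 \<in> B" "a13 \<in> B" "a14 \<in> B" "a23 \<in> B" "a24 \<in> B" "a34 \<in> B"
    and b: "b12 \<in> B" "b13 \<in> B" "b14 \<in> B" "b23 \<in> B" "b24 \<in> B" "b34 \<in> B"
  shows "unip a12 a13 a14 a23 a24 a34 \<otimes> unip b12 b13 b14 b23 b24 b34 =
    unip (a12 + b12) (a13 + b13 + a12 * b23) (a14 + b14 + a12 * b24 + a13 * b34) (a23 + b23)
      (a24 + b24 + a23 * b34) (a34 + b34)"
proof -
  note cl [simp] = X_closed B_add B_mult Z_closed a b
  have zc: "!!r s. [|r \<in> B; s \<in> B|] ==> X12 s \<otimes> Z r = Z r \<otimes> X12 s" "!!r s. [|r \<in> B; s \<in> B|] ==> X13 s \<otimes> Z r = Z r \<otimes> X13 s"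
    "!!r s. [|r \<in> B; s \<in> B|] ==> X23 s \<otimes> Z r = Z r \<otimes> X23 s" "!!r s. [|r \<in> B; s \<in> B|] ==> X24 s \<otimes> Z r = Z r \<otimes> X24 s"
    "!!r s. [|r \<in> B; s \<in> B|] ==> X34 s \<otimes> Z r = Z r \<otimes> X34 s" using Z_central by (simp_all add: commutes_def)
  note rules = X_comm zc X12_X23 X23_X34 X12_X24 X13_X34 X_add Z_add
  have tails: "x \<otimes> (y \<otimes> c) = w \<otimes> c" if "x \<otimes> y = w" "x \<in> carrier P" "y \<in> carrier P" "c \<in> carrier P" for x y w c
    using that by (rule tail)
  show ?thesis unfolding unip_def by (simp add: rules rules[THEN tails] m_assoc add_ac)
qed

text \<open>The hypothesis \<open>k13 * k34 = 1\<close> says that the torus acts trivially on the corner; it gives invariance of Z.\<close>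

lemma unip_conj:
  assumes t: "t \<in> carrier P" and k: "k12 \<in> B" "k13 \<in> B" "k23 \<in> B" "k24 \<in> B" "k34 \<in> B" "k13 * k34 = 1"
    and tX: "!!r. r \<in> B ==> t \<otimes> X12 r = X12 (k12 * r) \<otimes> t" "!!r. r \<in> B ==> t \<otimes> X13 r = X13 (k13 * r) \<otimes> t"
      "!!r. r \<in> B ==> t \<otimes> X23 r = X23 (k23 * r) \<otimes> t" "!!r. r \<in> B ==> t \<otimes> X24 r = X24 (k24 * r) \<otimes> t"
      "!!r. r \<in> B ==> t \<otimes> X34 r = X34 (k34 * r) \<otimes> t"
    and a: "a12 \<in> B" "a13 \<in> B" "a14 \<in> B" "a23 \<in> B" "a24 \<in> B" "a34 \<in> B"
  shows "t \<otimes> unip a12 a13 a14 a23 a24 a34 = unip (k12 * a12) (k13 * a13) a14 (k23 * a23) (k24 * a24) (k34 * a34) \<otimes> t"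
proof -
  note cl [simp] = X_closed B_add B_mult Z_closed a k(1-5) t B_one
  have tails: "x \<otimes> (y \<otimes> c) = w \<otimes> c" if "x \<otimes> y = w" "x \<in> carrier P" "y \<in> carrier P" "c \<in> carrier P" for x y w c
    using that by (rule tail)
  have tZ: "t \<otimes> Z r = Z r \<otimes> t" if r [simp]: "r \<in> B" for r
  proof -
    have "(t \<otimes> Z r) \<otimes> (X34 1 \<otimes> X13 r) = t \<otimes> (X13 r \<otimes> X34 1)" by (simp add: X13_X34 m_assoc)
    also have "... = (X13 (k13 * r) \<otimes> X34 k34) \<otimes> t" by (simp add: tX tX[THEN tails] m_assoc)
    also have "... = Z (k13 * k34 * r) \<otimes> (X34 k34 \<otimes> (X13 (k13 * r) \<otimes> t))" by (simp add: X13_X34 m_assoc mult_ac)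
    also have "... = (Z r \<otimes> t) \<otimes> (X34 1 \<otimes> X13 r)" by (simp add: tX tX[THEN tails] m_assoc k(6))
    finally show ?thesis by (subst (asm) right_cancel) auto
  qed
  show ?thesis unfolding unip_def by (simp add: tX tZ tX[THEN tails] tZ[THEN tails] m_assoc)
qed

end

section \<open>The cone of a group with a length function\<close>

locale length_group = group G for G (structure) +
  fixes len :: "'a => real" and \<omega> :: "nat filter"
  assumes len_nonneg: "!!g. g \<in> carrier G ==> 0 <= len g"
    and len_one: "len \<one> = 0"
    and len_inv: "!!g. g \<in> carrier G ==> len (inv g) = len g"
    and len_mult: "!!g h. [|g \<in> carrier G; h \<in> carrier G|] ==> len (g \<otimes> h) <= len g + len h"
    and ultra: "nonprincipal_ultrafilter \<omega>"
begin

text \<open>The bound is uniform in n and uses n + 1, so that the value at 0 is not restricted; the cone only depends on values along \<open>\<omega>\<close>.\<close>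

definition seqs :: "(nat => 'a) monoid" where
  "seqs = \<lparr>carrier = {g. (\<forall>n. g n \<in> carrier G) \<and> (\<exists>B. \<forall>n. len (g n) <= B * real (n + 1))},
     monoid.mult = (%g h n. g n \<otimes> h n), one = (%n. \<one>)\<rparr>"

abbreviation \<S> where "\<S> \<equiv> carrier seqs"
abbreviation seq_mult (infixl "\<cdot>" 70) where "g \<cdot> h \<equiv> g \<otimes>\<^bsub>seqs\<^esub> h"
abbreviation seq_inv ("inv\<^sub>s _" [81] 80) where "inv\<^sub>s g \<equiv> m_inv seqs g"

lemma seqsI: "(!!n. g n \<in> carrier G) ==> (!!n. len (g n) <= B * real (n + 1)) ==> g \<in> \<S>" by (auto simp: seqs_def)

lemma seqs_in: "g \<in> \<S> ==> g n \<in> carrier G" by (simp add: seqs_def)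

lemma seqs_bound:
  assumes "g \<in> \<S>" obtains B where "B \<ge> 0" "!!n. len (g n) <= B * real (n + 1)"
proof -
  obtain B where B: "!!n. len (g n) <= B * real (n + 1)" using assms by (auto simp: seqs_def)
  have "0 <= B" using B[of 0] len_nonneg[OF seqs_in[OF assms, of 0]] by simp
  then show ?thesis using B that by blast
qed

lemma seqs_mult [simp]: "(g \<cdot> h) n = g n \<otimes> h n" by (simp add: seqs_def)

lemma seqs_one [simp]: "\<one>\<^bsub>seqs\<^esub> n = \<one>" by (simp add: seqs_def)

lemma seqs_inv_closed: "g \<in> \<S> ==> (%n. inv (g n)) \<in> \<S>" by (auto simp: seqs_def len_inv)

lemma seqs_group: "group seqs"
proof (rule groupI)
  show "g \<cdot> h \<in> \<S>" if gh: "g \<in> \<S>" "h \<in> \<S>" for g h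
  proof -
    obtain B where B: "B \<ge> 0" "!!n. len (g n) <= B * real (n + 1)" using seqs_bound[OF gh(1)] by blast
    obtain C where C: "C \<ge> 0" "!!n. len (h n) <= C * real (n + 1)" using seqs_bound[OF gh(2)] by blast
    have "len (g n \<otimes> h n) <= (B + C) * real (n + 1)" for n
      using len_mult[OF seqs_in[OF gh(1)] seqs_in[OF gh(2)], of n n] B(2)[of n] C(2)[of n] by (simp only: distrib_right)
    then show ?thesis using gh by (intro seqsI) (auto simp: seqs_in)
  qed
  show "\<one>\<^bsub>seqs\<^esub> \<in> \<S>" by (rule seqsI[of _ 0]) (auto simp: len_one)
  show "x \<cdot> y \<cdot> z = x \<cdot> (y \<cdot> z)"
    if "x \<in> \<S>" "y \<in> \<S>" "z \<in> \<S>" for x y z using that by (auto simp: fun_eq_iff seqs_in m_assoc)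
  show "\<one>\<^bsub>seqs\<^esub> \<cdot> x = x" if "x \<in> \<S>" for x using that by (auto simp: fun_eq_iff seqs_in)
  show "\<exists>y\<in>\<S>. y \<cdot> x = \<one>\<^bsub>seqs\<^esub>" if "x \<in> \<S>" for x
    using that seqs_inv_closed[OF that] by (intro bexI[of _ "%n. inv (x n)"]) (auto simp: fun_eq_iff seqs_in)
qed

sublocale S: group seqs by (rule seqs_group)

lemma seqs_inv: "g \<in> \<S> ==> inv\<^sub>s g = (%n. inv (g n))" by (rule S.inv_equality) (auto simp: fun_eq_iff seqs_in seqs_inv_closed)

definition size :: "(nat => 'a) => real" where
  "size g = Lim \<omega> (%n. len (g n) / real n)"

lemma nb: "\<omega> ~= bot" and pos: "\<forall>\<^sub>F n in \<omega>. n > 0" using ultra by (auto simp: nonprincipal_ultrafilter_def)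

lemma size_tendsto:
  assumes "g \<in> \<S>" shows "((%n. len (g n) / real n) \<longlongrightarrow> size g) \<omega>"
proof -
  obtain B where B: "B \<ge> 0" "!!n. len (g n) <= B * real (n + 1)" using seqs_bound[OF assms] by blast
  have "\<forall>\<^sub>F n in \<omega>. \<bar>len (g n) / real n\<bar> <= 2 * B" using pos
  proof eventually_elim
    case (elim n)
    have "len (g n) <= B * real (n + 1)" by (rule B)
    also have "... <= B * (2 * real n)" using elim B(1) by (intro mult_left_mono) auto
    finally show ?case using elim len_nonneg[OF seqs_in[OF assms, of n]] by (simp add: field_simps)
  qed
  then show ?thesis unfolding size_def by (rule ultrafilter_bounded_tendsto_Lim[OF ultra])
qed

lemma size_le:
  assumes "g \<in> \<S>" "!!e. e > 0 ==> \<forall>\<^sub>F n in \<omega>. len (g n) <= (s + e) * real n" shows "size g <= s"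
proof (rule field_le_epsilon)
  fix e :: real assume "e > 0"
  have "\<forall>\<^sub>F n in \<omega>. len (g n) / real n <= s + e"
    using assms(2)[OF \<open>e > 0\<close>] pos by eventually_elim (simp add: field_simps)
  then show "size g <= s + e" by (rule tendsto_upperbound[OF size_tendsto[OF assms(1)] _ nb])
qed

lemma size_bound:
  assumes "g \<in> \<S>" "size g < s" shows "\<forall>\<^sub>F n in \<omega>. len (g n) <= s * real n"
proof -
  have "\<forall>\<^sub>F n in \<omega>. len (g n) / real n < s" using order_tendstoD(2)[OF size_tendsto[OF assms(1)] assms(2)] .
  then show ?thesis using pos by eventually_elim (simp add: field_simps)
qed

lemma size_nonneg: "g \<in> \<S> ==> 0 <= size g" by (rule tendsto_lowerbound[OF size_tendsto _ nb]) (auto simp: len_nonneg seqs_in)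

lemma size_one: "size \<one>\<^bsub>seqs\<^esub> = 0"
  using size_le[of "\<one>\<^bsub>seqs\<^esub>" 0] size_nonneg[of "\<one>\<^bsub>seqs\<^esub>"] by (force simp: len_one)

lemma size_inv: "g \<in> \<S> ==> size (inv\<^sub>s g) = size g" by (simp add: size_def seqs_inv len_inv seqs_in)

lemma size_mult:
  assumes "g \<in> \<S>" "h \<in> \<S>" shows "size (g \<cdot> h) <= size g + size h"
proof (rule tendsto_le[OF nb tendsto_add[OF size_tendsto[OF assms(1)] size_tendsto[OF assms(2)]] size_tendsto])
  show "g \<cdot> h \<in> \<S>" using assms by simp
  show "\<forall>\<^sub>F n in \<omega>. len ((g \<cdot> h) n) / real n <= len (g n) / real n + len (h n) / real n"
    using assms by (intro always_eventually) (auto simp: seqs_in len_mult divide_right_mono simp flip: add_divide_distrib)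
qed

definition sdist :: "(nat => 'a) => (nat => 'a) => real" where
  "sdist g h = size (inv\<^sub>s g \<cdot> h)"

lemma cancel_inv_mult:
  assumes "k \<in> \<S>" "g \<in> \<S>" "h \<in> \<S>" shows "inv\<^sub>s (k \<cdot> g) \<cdot> (k \<cdot> h) = inv\<^sub>s g \<cdot> h"
proof -
  have "inv\<^sub>s k \<cdot> (k \<cdot> h) = h" using assms by (simp flip: S.m_assoc)
  then show ?thesis using assms by (simp add: S.inv_mult_group S.m_assoc)
qed

lemma sdist_left: "[|k \<in> \<S>; g \<in> \<S>; h \<in> \<S>|]
    ==> sdist (k \<cdot> g) (k \<cdot> h) = sdist g h" by (simp add: sdist_def cancel_inv_mult)

lemma sdist_refl: "g \<in> \<S> ==> sdist g g = 0" by (simp add: sdist_def size_one)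

lemma sdist_sym: "[|g \<in> \<S>; h \<in> \<S>|] ==> sdist g h = sdist h g"
  unfolding sdist_def using size_inv[of "inv\<^sub>s g \<cdot> h"] by (simp add: S.inv_mult_group)

lemma sdist_triangle:
  assumes "g \<in> \<S>" "h \<in> \<S>" "k \<in> \<S>" shows "sdist g k <= sdist g h + sdist h k"
proof -
  have "h \<cdot> (inv\<^sub>s h \<cdot> k) = k" using assms by (simp flip: S.m_assoc)
  then have "inv\<^sub>s g \<cdot> k = (inv\<^sub>s g \<cdot> h) \<cdot> (inv\<^sub>s h \<cdot> k)" using assms by (simp add: S.m_assoc)
  then show ?thesis unfolding sdist_def using assms by (simp add: size_mult)
qed

definition point :: "(nat => 'a) => (nat => 'a) discrete \<Rightarrow>\<^sub>C real" where
  "point = kuratowski (\<S>) sdist \<one>\<^bsub>seqs\<^esub>"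

definition cone :: "((nat => 'a) discrete \<Rightarrow>\<^sub>C real) set" where
  "cone = point ` \<S>"

definition rep :: "((nat => 'a) discrete \<Rightarrow>\<^sub>C real) => nat => 'a" where
  "rep y = (SOME g. g \<in> \<S> \<and> point g = y)"

text \<open>The group of sequences acts by left multiplication on representatives of points of the cone.\<close>

definition move :: "(nat => 'a) => ((nat => 'a) discrete \<Rightarrow>\<^sub>C real) => ((nat => 'a) discrete \<Rightarrow>\<^sub>C real)" where
  "move g y = point (g \<cdot> rep y)"

lemma dist_point: "[|g \<in> \<S>; h \<in> \<S>|] ==> dist (point g) (point h) = sdist g h"
  unfolding point_def by (rule dist_kuratowski) (auto simp: sdist_refl intro: sdist_sym sdist_triangle)

lemma point_in: "g \<in> \<S> ==> point g \<in> cone" by (simp add: cone_def)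

lemma rep: assumes "y \<in> cone" shows "rep y \<in> \<S>" "point (rep y) = y"
proof -
  have "\<exists>g. g \<in> \<S> \<and> point g = y" using assms by (auto simp: cone_def)
  from someI_ex[OF this] show "rep y \<in> \<S>" "point (rep y) = y" by (simp_all add: rep_def)
qed

lemma move_point:
  assumes "g \<in> \<S>" "h \<in> \<S>" shows "move g (point h) = point (g \<cdot> h)"
proof -
  note r = rep[OF point_in[OF assms(2)]]
  have "dist (point (g \<cdot> rep (point h))) (point (g \<cdot> h)) = dist (point (rep (point h))) (point h)"
    using assms r(1) by (simp add: dist_point sdist_left)
  then show ?thesis using r(2) by (simp add: move_def)
qed

lemma point_eq_iff: "[|g \<in> \<S>; h \<in> \<S>|] ==> point g = point h \<longleftrightarrow> sdist g h = 0" by (metis dist_eq_0_iff dist_point)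

sublocale isometric_action seqs cone move "point \<one>\<^bsub>seqs\<^esub>"
proof
  show "point \<one>\<^bsub>seqs\<^esub> \<in> cone" by (simp add: point_in)
  show "move g y \<in> cone" if "g \<in> \<S>" "y \<in> cone" for g y using that rep[OF that(2)] by (simp add: move_def point_in)
  show "dist (move g y) (move g z) = dist y z" if "g \<in> \<S>" "y \<in> cone" "z \<in> cone" for g y z
    using that by (auto simp: cone_def move_point dist_point sdist_left)
  show "move \<one>\<^bsub>seqs\<^esub> y = y" if "y \<in> cone" for y using that by (auto simp: cone_def move_point)
  show "move (g \<cdot> h) y = move g (move h y)" if "g \<in> \<S>" "h \<in> \<S>" "y \<in> cone" for g h y
    using that by (auto simp: cone_def move_point S.m_assoc)
qed

end

section \<open>Quotients of the cone by a finite central group of sequences\<close>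

locale central_deck = length_group + D: group D for D (structure) +
  fixes z :: "'c => nat => 'a" and c :: real
  assumes fin: "finite (carrier D)"
    and z_in: "!!j. j \<in> carrier D ==> z j \<in> \<S>"
    and z_central: "!!j g. [|j \<in> carrier D; g \<in> \<S>|] ==> z j \<cdot> g = g \<cdot> z j"
    and z_one: "z \<one>\<^bsub>D\<^esub> = \<one>\<^bsub>seqs\<^esub>"
    and z_mult: "!!j k. [|j \<in> carrier D; k \<in> carrier D|] ==> z (j \<otimes>\<^bsub>D\<^esub> k) = z j \<cdot> z k"
    and z_size: "!!j. [|j \<in> carrier D; j ~= \<one>\<^bsub>D\<^esub>|] ==> c <= size (z j)"
    and c_pos: "0 < c"
begin

definition qdist :: "(nat => 'a) => (nat => 'a) => real" where
  "qdist g h = Min ((%j. sdist g (h \<cdot> z j)) ` carrier D)"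

lemma qdist_le: "j \<in> carrier D ==> qdist g h <= sdist g (h \<cdot> z j)" using fin by (simp add: qdist_def)

lemma qdist_ex: "\<exists>j\<in>carrier D. qdist g h = sdist g (h \<cdot> z j)"
proof -
  have "qdist g h \<in> (%j. sdist g (h \<cdot> z j)) ` carrier D" unfolding qdist_def using fin D.one_closed by (intro Min_in) auto
  then show ?thesis by blast
qed

lemma sdist_right: "[|j \<in> carrier D; g \<in> \<S>; h \<in> \<S>|]
    ==> sdist (g \<cdot> z j) (h \<cdot> z j) = sdist g h" using sdist_left[OF z_in, of j g h] by (simp add: z_central)

lemma z_inv: "j \<in> carrier D ==> z j \<cdot> z (inv\<^bsub>D\<^esub> j) = \<one>\<^bsub>seqs\<^esub>" by (simp add: z_one flip: z_mult)

lemma qdist_sym_le: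
  assumes "g \<in> \<S>" "h \<in> \<S>" shows "qdist h g <= qdist g h"
proof -
  obtain j where j: "j \<in> carrier D" "qdist g h = sdist g (h \<cdot> z j)" using qdist_ex by blast
  have "sdist g (h \<cdot> z j) = sdist (g \<cdot> z (inv\<^bsub>D\<^esub> j)) (h \<cdot> z j \<cdot> z (inv\<^bsub>D\<^esub> j))"
    using assms j z_in by (simp add: sdist_right)
  also have "h \<cdot> z j \<cdot> z (inv\<^bsub>D\<^esub> j) = h" using assms j z_in by (simp add: S.m_assoc z_inv)
  also have "sdist (g \<cdot> z (inv\<^bsub>D\<^esub> j)) h = sdist h (g \<cdot> z (inv\<^bsub>D\<^esub> j))"
    using assms j z_in by (simp add: sdist_sym)
  also have "... \<ge> qdist h g" using j by (simp add: qdist_le)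
  finally show ?thesis by (simp only: j(2))
qed

lemma qdist_triangle:
  assumes "g \<in> \<S>" "h \<in> \<S>" "k \<in> \<S>" shows "qdist g k <= qdist g h + qdist h k"
proof -
  obtain i where i: "i \<in> carrier D" "qdist g h = sdist g (h \<cdot> z i)" using qdist_ex by blast
  obtain j where j: "j \<in> carrier D" "qdist h k = sdist h (k \<cdot> z j)" using qdist_ex by blast
  have "sdist h (k \<cdot> z j) = sdist (h \<cdot> z i) (k \<cdot> z (j \<otimes>\<^bsub>D\<^esub> i))"
    using assms i j z_in by (simp add: z_mult sdist_right flip: S.m_assoc)
  moreover have "sdist g (k \<cdot> z (j \<otimes>\<^bsub>D\<^esub> i)) <=
      sdist g (h \<cdot> z i) + sdist (h \<cdot> z i) (k \<cdot> z (j \<otimes>\<^bsub>D\<^esub> i))"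
    using assms i j z_in by (intro sdist_triangle) auto
  moreover have "qdist g k <= sdist g (k \<cdot> z (j \<otimes>\<^bsub>D\<^esub> i))" using i j by (intro qdist_le) auto
  ultimately show ?thesis using i j by simp
qed

lemma sdist_nonneg: "[|g \<in> \<S>; h \<in> \<S>|] ==> 0 <= sdist g h" by (simp add: sdist_def size_nonneg)

lemma qdist_nonneg: "[|g \<in> \<S>; h \<in> \<S>|] ==> 0 <= qdist g h" using qdist_ex[of g h] z_in by (auto simp: sdist_nonneg)

lemma qdist_refl: "g \<in> \<S> ==> qdist g g = 0" using qdist_le[OF D.one_closed, of g g] qdist_nonneg[of g g] by (simp add: z_one sdist_refl)

definition qpoint :: "(nat => 'a) => (nat => 'a) discrete \<Rightarrow>\<^sub>C real" where
  "qpoint = kuratowski (\<S>) qdist \<one>\<^bsub>seqs\<^esub>"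

lemma dist_qpoint: "[|g \<in> \<S>; h \<in> \<S>|] ==> dist (qpoint g) (qpoint h) = qdist g h" unfolding qpoint_def
  by (rule dist_kuratowski) (auto simp: qdist_refl intro: qdist_triangle antisym qdist_sym_le)

definition qmap :: "((nat => 'a) discrete \<Rightarrow>\<^sub>C real) => ((nat => 'a) discrete \<Rightarrow>\<^sub>C real)" where
  "qmap y = qpoint (rep y)"

lemma qmap_point: "g \<in> \<S> ==> qmap (point g) = qpoint g"
proof -
  assume g: "g \<in> \<S>"
  note r = rep[OF point_in[OF g]]
  have "sdist (rep (point g)) g = 0" using r g by (simp flip: point_eq_iff)
  then have "qdist (rep (point g)) g = 0" using qdist_le[OF D.one_closed, of "rep (point g)" g] qdist_nonneg[OF r(1) g] g by (simp add: z_one)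
  then have "dist (qpoint (rep (point g))) (qpoint g) = 0" using g r by (simp add: dist_qpoint)
  then show ?thesis by (simp add: qmap_def)
qed

lemma move_z_point: "[|j \<in> carrier D; g \<in> \<S>|] ==> move (z j) (point g) = point (g \<cdot> z j)" by (simp add: move_point z_in z_central)

text \<open>Freeness with a uniform gap comes from the lower bound on the size of the nontrivial central sequences, because left and right
multiplication by them agree.\<close>

sublocale Q: free_isometric_quotient D cone "qpoint ` \<S>" qmap "%j. move (z j)" c
proof
  show "qmap ` cone = qpoint ` \<S>" by (force simp: cone_def qmap_point image_iff)
  show "move (z j) y \<in> cone" if "j \<in> carrier D" "y \<in> cone" for j y using that L_in z_in by simp
  show "move (z \<one>\<^bsub>D\<^esub>) y = y" if "y \<in> cone" for y using that L_one by (simp add: z_one)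
  show "move (z (j \<otimes>\<^bsub>D\<^esub> k)) y = move (z j) (move (z k) y)"
    if "j \<in> carrier D" "k \<in> carrier D" "y \<in> cone" for j k y using that z_in L_mult by (simp add: z_mult)
  show "dist (move (z j) y) (move (z j) y') = dist y y'" if "j \<in> carrier D" "y \<in> cone" "y' \<in> cone" for j y y'
    using that z_in L_isom by simp
  show "c <= dist y (move (z j) y)" if j: "j \<in> carrier D" "j ~= \<one>\<^bsub>D\<^esub>" "y \<in> cone" for j y
  proof -
    obtain g where g: "g \<in> \<S>" "y = point g" using j by (auto simp: cone_def)
    then have "dist y (move (z j) y) = sdist (g \<cdot> \<one>\<^bsub>seqs\<^esub>) (g \<cdot> z j)" using j z_in by (simp add: move_z_point dist_point)
    also have "... = size (z j)" using g j z_in by (subst sdist_left) (auto simp: sdist_def)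
    finally show ?thesis using z_size j by simp
  qed
  show "0 < c" by (rule c_pos)
  show "dist (qmap y) (qmap y') <= dist y (move (z j) y')" if "j \<in> carrier D" "y \<in> cone" "y' \<in> cone" for j y y'
    using that z_in by (auto simp: cone_def qmap_point dist_qpoint move_z_point dist_point qdist_le)
  show "\<exists>j\<in>carrier D. dist (qmap y) (qmap y') = dist y (move (z j) y')" if "y \<in> cone" "y' \<in> cone" for y y'
    using that z_in qdist_ex by (fastforce simp: cone_def qmap_point dist_qpoint move_z_point dist_point)
qed

end

section \<open>The places 0, 1 and infinity of the rational function field\<close>

text \<open>All three norms are normalised by e; then t and t - 1 have norm e at infinity and 1/e at their zero.\<close>

datatype place = At0 | At1 | AtInf

type_synonym 'k rf = "'k poly fract"

instance place :: finite
proof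
  have "UNIV = {At0, At1, AtInf}" using place.exhaust by blast
  then show "finite (UNIV :: place set)" by (metis finite.simps)
qed

fun pnorm :: "place => 'k::field poly => real" where
  "pnorm At0 f = (if f = 0 then 0 else exp (- real (Polynomial.order 0 f)))"
| "pnorm At1 f = (if f = 0 then 0 else exp (- real (Polynomial.order 1 f)))"
| "pnorm AtInf f = (if f = 0 then 0 else exp (real (degree f)))"

lemma pnorm_0 [simp]: "pnorm v 0 = 0" by (cases v) auto

lemma pnorm_pos: "f ~= 0 ==> 0 < pnorm v f" by (cases v) auto

lemma pnorm_nonneg: "0 <= pnorm v f" by (cases v) auto

lemma pnorm_mult: "pnorm v (f * g) = pnorm v f * pnorm v g" by (cases v) (auto simp: order_mult degree_mult_eq exp_add[symmetric])

lemma order_add_ge: "f + g ~= 0 ==> f ~= 0 ==> g ~= 0 ==> min (Polynomial.order a f) (Polynomial.order a g) <= Polynomial.order a (f + g)"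
  for f g :: "'k::field poly"
proof -
  assume "f + g ~= 0" "f ~= 0" "g ~= 0"
  let ?n = "min (Polynomial.order a f) (Polynomial.order a g)"
  have "[:-a, 1:] ^ ?n dvd f" "[:-a, 1:] ^ ?n dvd g" by (auto simp: order_divides)
  then have "[:-a, 1:] ^ ?n dvd f + g" by (rule dvd_add)
  then show ?thesis using \<open>f + g ~= 0\<close> by (simp add: order_divides)
qed

lemma pnorm_add: "pnorm v (f + g) <= max (pnorm v f) (pnorm v g)"
proof (cases "f = 0 \<or> g = 0 \<or> f + g = 0")
  case True
  then show ?thesis using pnorm_nonneg[of v f] pnorm_nonneg[of v g] by auto
next
  case False
  then show ?thesis using order_add_ge[of f g 0] order_add_ge[of f g 1] degree_add_le_max[of f g]
    by (cases v) (auto simp: le_max_iff_disj min_le_iff_disj)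
qed

definition fnorm :: "place => 'k::field rf => real" where
  "fnorm v x = (THE r. \<exists>a b. b ~= 0 \<and> x = Fract a b \<and> r = pnorm v a / pnorm v b)"

lemma fnorm_Fract: "b ~= 0 ==> fnorm v (Fract a b) = pnorm v a / pnorm v b" unfolding fnorm_def
proof (rule the_equality)
  assume "b ~= 0"
  then show "\<exists>a' b'. b' ~= 0 \<and> Fract a b = Fract a' b' \<and> pnorm v a / pnorm v b = pnorm v a' / pnorm v b'" by blast
  fix r assume "\<exists>a' b'. b' ~= 0 \<and> Fract a b = Fract a' b' \<and> r = pnorm v a' / pnorm v b'"
  then obtain a' b' where *: "b' ~= 0" "a * b' = a' * b" "r = pnorm v a' / pnorm v b'" using \<open>b ~= 0\<close> by (auto simp: eq_fract)
  then have "pnorm v a * pnorm v b' = pnorm v a' * pnorm v b" by (metis pnorm_mult)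
  then show "r = pnorm v a / pnorm v b" using * \<open>b ~= 0\<close> pnorm_pos[of b v] pnorm_pos[of b' v] by (simp add: frac_eq_eq)
qed

lemma fnorm_0 [simp]: "fnorm v 0 = 0" using fnorm_Fract[of 1 v 0] by (simp add: Zero_fract_def)

lemma pnorm_1 [simp]: "pnorm v 1 = 1" by (cases v) (auto simp: order_0I)

lemma fnorm_1 [simp]: "fnorm v 1 = 1" using fnorm_Fract[of 1 v 1] by (simp add: One_fract_def)

lemma fnorm_mult: "fnorm v (x * y) = fnorm v x * fnorm v y" by (cases x; cases y) (simp add: fnorm_Fract pnorm_mult)

lemma fnorm_pos: "x ~= 0 ==> 0 < fnorm v x"
proof (cases x)
  case (Fract a b)
  assume "x ~= 0"
  then have "a ~= 0" using Fract by (auto simp: fract_collapse)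
  then show ?thesis using Fract by (simp add: fnorm_Fract pnorm_pos)
qed

lemma fnorm_nonneg [simp]: "0 <= fnorm v x" using fnorm_pos[of x v] by (cases "x = 0") auto

lemma fnorm_eq_0 [simp]: "fnorm v x = 0 \<longleftrightarrow> x = 0" using fnorm_pos[of x v] by (cases "x = 0") auto

lemma fnorm_add: "fnorm v (x + y) <= max (fnorm v x) (fnorm v y)"
proof (cases x; cases y)
  fix a b c d :: "'a poly" assume *: "x = Fract a b" "b ~= 0" "y = Fract c d" "d ~= 0"
  have p: "0 < pnorm v b" "0 < pnorm v d" using * by (auto simp: pnorm_pos)
  have "pnorm v (a * d + c * b) <= max (pnorm v a * pnorm v d) (pnorm v c * pnorm v b)"
    using pnorm_add[of v "a * d" "c * b"] by (simp add: pnorm_mult)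
  then show ?thesis using * p by (simp add: fnorm_Fract pnorm_mult field_simps max_def split: if_splits)
qed

lemma pnorm_uminus [simp]: "pnorm v (- f) = pnorm v f"
proof -
  have c: "pnorm v [:- 1:] = 1" by (cases v) (auto simp: order_0I)
  have "- f = [:- 1:] * f" by simp
  then show ?thesis using c by (metis mult_1 pnorm_mult)
qed

lemma fnorm_uminus [simp]: "fnorm v (- x) = fnorm v x" by (cases x) (simp add: fnorm_Fract)

lemma fnorm_diff: "fnorm v (x - y) <= max (fnorm v x) (fnorm v y)" using fnorm_add[of v x "- y"] by simp

lemma fnorm_inverse: "fnorm v (inverse x) = inverse (fnorm v x)"
proof (cases "x = 0")
  case False
  then have "fnorm v x * fnorm v (inverse x) = 1" by (simp flip: fnorm_mult)
  then show ?thesis by (simp add: inverse_unique)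
qed simp

lemma fnorm_divide: "fnorm v (x / y) = fnorm v x / fnorm v y" by (simp add: divide_inverse fnorm_mult fnorm_inverse)

lemma fnorm_power: "fnorm v (x ^ n) = fnorm v x ^ n" by (induction n) (auto simp: fnorm_mult)

lemma fnorm_powi: "fnorm v (x powi k) = fnorm v x powi k" by (auto simp: power_int_def fnorm_power fnorm_inverse)

definition cst :: "'k::field => 'k rf" where "cst c = Fract [:c:] 1"
definition tt :: "'k::field rf" where "tt = Fract [:0, 1:] 1"
definition t1 :: "'k::field rf" where "t1 = Fract [:-1, 1:] 1"

lemma order_const: "c ~= 0 ==> Polynomial.order a [:c:] = 0" for c :: "'k::field" by (rule order_0I) simp

lemma order_linear: "Polynomial.order a [:-b, 1:] = (if a = b then 1 else 0)" for a :: "'k::field"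
  using order_power_n_n[of a 1] by (auto intro!: order_0I)

lemma fnorm_cst [simp]: "fnorm v (cst c) = (if c = 0 then 0 else 1)" by (cases v) (auto simp: cst_def fnorm_Fract order_const)

lemma cst_hom: "cst 0 = 0" "cst 1 = 1" "cst (a + b) = cst a + cst b" "cst (a * b) = cst a * cst b" "cst (- a) = - cst a"
  by (auto simp: cst_def fract_collapse One_fract_def one_pCons mult.commute)

lemma cst_eq_0 [simp]: "cst c = 0 \<longleftrightarrow> c = 0" by (auto simp: cst_def Zero_fract_def eq_fract)

lemma cst_inverse: "cst (inverse c) = inverse (cst c)"
proof (cases "c = 0")
  case False
  then have "cst c * cst (inverse c) = 1" by (simp flip: cst_hom)
  then show ?thesis by (simp add: inverse_unique)
qed (simp add: cst_hom)

lemma fnorm_tt: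
  fixes tt' :: "'k::field rf"
  defines "tt' \<equiv> tt" shows "fnorm At0 tt' = exp (-1)" "fnorm At1 tt' = 1" "fnorm AtInf tt' = exp 1" unfolding tt'_def
  using order_linear[of 0 "0::'k"] order_linear[of 1 "0::'k"] by (auto simp: tt_def fnorm_Fract)

lemma fnorm_t1:
  fixes tt' :: "'k::field rf"
  defines "tt' \<equiv> t1" shows "fnorm At0 tt' = 1" "fnorm At1 tt' = exp (-1)" "fnorm AtInf tt' = exp 1" unfolding tt'_def
  using order_linear[of 0 "1::'k"] order_linear[of 1 "1::'k"] by (auto simp: t1_def fnorm_Fract)

lemma tt_nonzero [simp]: "tt ~= 0" and t1_nonzero [simp]: "t1 ~= 0" using fnorm_tt(2) fnorm_t1(1) by (metis fnorm_0 zero_neq_one)+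

text \<open>The residue field of each of the three places is the field of constants. The constant is the quotient of the leading terms at the place.\<close>

lemma residue:
  assumes "fnorm v x <= 1" shows "\<exists>c. fnorm v (x - cst c) <= exp (-1)"
proof (cases "x = 0")
  case True
  then show ?thesis by (intro exI[of _ 0]) (simp add: cst_hom)
next
  case False
  show ?thesis
  proof (cases x)
    case (Fract f g)
    then have fg: "f ~= 0" "g ~= 0" using False by (auto simp: fract_collapse)
    have diff: "x - cst c = Fract (f - Polynomial.smult c g) g" for c using fg(2) unfolding Fract(1) cst_def by (simp add: diff_fract)
    have fin: "\<exists>c. Polynomial.order a (f - Polynomial.smult c g) \<ge> Polynomial.order a g + 1 \<or> f - Polynomial.smult c g = 0" if o: "Polynomial.order a g <= Polynomial.order a f" for a :: 'a
    proof -
      let ?n = "Polynomial.order a g"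
      obtain f' where f': "f = [:-a, 1:] ^ ?n * f'" using o by (metis dvdE order_divides)
      obtain g' where g': "g = [:-a, 1:] ^ ?n * g'" "\<not> [:-a, 1:] dvd g'" using order_decomp[OF fg(2)] by blast
      let ?c = "poly f' a / poly g' a"
      have "poly g' a ~= 0" using g'(2) by (simp add: poly_eq_0_iff_dvd)
      then have "poly (f' - Polynomial.smult ?c g') a = 0" by simp
      then have "[:-a, 1:] dvd f' - Polynomial.smult ?c g'" by (simp only: poly_eq_0_iff_dvd)
      then have "[:-a, 1:] ^ ?n * [:-a, 1:] dvd [:-a, 1:] ^ ?n * (f' - Polynomial.smult ?c g')" by (rule mult_dvd_mono[OF dvd_refl])
      moreover have "f - Polynomial.smult ?c g = [:-a, 1:] ^ ?n * (f' - Polynomial.smult ?c g')"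
        by (simp only: right_diff_distrib mult_smult_right f'[symmetric] g'(1)[symmetric])
      ultimately have "[:-a, 1:] ^ (?n + 1) dvd f - Polynomial.smult ?c g" by (simp add: mult.commute)
      then show ?thesis using order_divides by blast
    qed
    show ?thesis
    proof (cases v)
      case At0
      have "Polynomial.order 0 g <= Polynomial.order 0 f" using assms At0 Fract fg by (simp add: fnorm_Fract)
      then obtain c where c: "Polynomial.order 0 (f - Polynomial.smult c g) \<ge> Polynomial.order 0 g + 1 \<or> f - Polynomial.smult c g = 0" using fin by blast
      have "fnorm v (x - cst c) <= exp (-1)" unfolding diff using c At0 fg by (auto simp: fnorm_Fract simp flip: exp_diff)
      then show ?thesis by blast
    next
      case At1
      have "Polynomial.order 1 g <= Polynomial.order 1 f" using assms At1 Fract fg by (simp add: fnorm_Fract)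
      then obtain c where c: "Polynomial.order 1 (f - Polynomial.smult c g) \<ge> Polynomial.order 1 g + 1 \<or> f - Polynomial.smult c g = 0" using fin by blast
      have "fnorm v (x - cst c) <= exp (-1)" unfolding diff using c At1 fg by (auto simp: fnorm_Fract simp flip: exp_diff)
      then show ?thesis by blast
    next
      case AtInf
      have dg: "degree f <= degree g" using assms AtInf Fract fg by (simp add: fnorm_Fract)
      let ?c = "poly.coeff f (degree g) / lead_coeff g"
      have "poly.coeff (f - Polynomial.smult ?c g) (degree g) = 0" using fg by simp
      moreover have "degree (f - Polynomial.smult ?c g) <= degree g" using dg by (intro degree_diff_le) (auto simp: degree_smult_le)
      ultimately have "f - Polynomial.smult ?c g = 0 \<or> degree (f - Polynomial.smult ?c g) + 1 <= degree g"
        by (metis Suc_eq_plus1 Suc_leI le_neq_implies_less leading_coeff_0_iff)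
      then have "fnorm v (x - cst ?c) <= exp (-1)" unfolding diff using AtInf fg by (auto simp: fnorm_Fract simp flip: exp_diff)
      then show ?thesis by blast
    qed
  qed
qed

text \<open>These are inverses of uniformizers in the usual sense: they have norm e at v, are bounded at the other places and
lie in the ring.\<close>

definition uniformizer :: "place => 'k::field rf" where
  "uniformizer v = (case v of At0 => inverse tt | At1 => inverse t1 | AtInf => tt)"

lemma fnorm_uniformizer:
  fixes u :: "place => 'k::field rf"
  defines "u \<equiv> uniformizer" shows "fnorm v (u v) = exp 1" "w ~= v ==> fnorm w (u v) <= 1" unfolding u_def
  by (cases v; simp add: uniformizer_def fnorm_inverse fnorm_tt fnorm_t1 exp_minus)
     (cases v; cases w; simp add: uniformizer_def fnorm_inverse fnorm_tt fnorm_t1 flip: exp_minus)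

lemma uniformizer_nonzero [simp]: "uniformizer v ~= (0 :: 'k::field rf)" by (cases v) (auto simp: uniformizer_def)

text \<open>Polynomials of degree at most k in the pole at v, built by Horner's scheme. This shape is what turns into short words below.\<close>

primrec horner :: "place => nat => 'k::field rf set" where
  "horner v 0 = range cst"
| "horner v (Suc k) = {cst c + uniformizer v * r | c r. r \<in> horner v k}"

lemma horner_norm: "r \<in> horner v k ==> w ~= v ==> fnorm w r <= 1"
proof (induction k arbitrary: r)
  case (Suc k)
  then obtain c s where s: "r = cst c + uniformizer v * s" "s \<in> horner v k" by auto
  have "fnorm w (uniformizer v * s) <= 1"
    using Suc.IH[OF s(2) Suc.prems(2)] fnorm_uniformizer(2)[OF Suc.prems(2)] unfolding fnorm_mult by (intro mult_le_one) auto
  then show ?case unfolding s(1) by (intro order_trans[OF fnorm_add]) auto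
qed auto

text \<open>The principal part of x at v, found by peeling off one residue at a time.\<close>

lemma horner_approx: "fnorm v x <= exp (real k) ==> \<exists>r\<in>horner v k. fnorm v (x - r) <= exp (-1)"
proof (induction k arbitrary: x)
  case 0
  then show ?case using residue[of v x] by auto
next
  case (Suc k)
  let ?w = "uniformizer v"
  have "fnorm v (x / ?w) <= exp (real k)" using Suc.prems by (simp add: fnorm_divide fnorm_uniformizer exp_add field_simps)
  then obtain s where s: "s \<in> horner v k" "fnorm v (x / ?w - s) <= exp (-1)" using Suc.IH by blast
  have "x - ?w * s = ?w * (x / ?w - s)" by (simp add: right_diff_distrib)
  then have "fnorm v (x - ?w * s) = exp 1 * fnorm v (x / ?w - s)" by (simp only: fnorm_mult fnorm_uniformizer(1))
  also have "... <= exp 1 * exp (-1)" using s(2) by simp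
  finally have "fnorm v (x - ?w * s) <= 1" by (simp add: exp_minus)
  then obtain c where "fnorm v (x - ?w * s - cst c) <= exp (-1)" using residue by blast
  then have "fnorm v (x - (cst c + ?w * s)) <= exp (-1)" by (simp add: algebra_simps)
  then show ?case using s(1) by (intro bexI[of _ "cst c + ?w * s"]) auto
qed

lemma fnorm_int: "x ~= 0 ==> \<exists>i::int. fnorm v x = exp (of_int i)"
proof (cases x)
  case (Fract a b)
  assume "x ~= 0"
  then have ab: "a ~= 0" "b ~= 0" using Fract by (auto simp: fract_collapse)
  have p: "\<exists>i::int. pnorm v f = exp (of_int i)" if "f ~= 0" for f :: "'a poly"
  proof (cases v)
    case At0 then show ?thesis using that by (intro exI[of _ "- int (Polynomial.order 0 f)"]) simp
  next
    case At1 then show ?thesis using that by (intro exI[of _ "- int (Polynomial.order 1 f)"]) simp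
  next
    case AtInf then show ?thesis using that by (intro exI[of _ "int (degree f)"]) simp
  qed
  obtain i j :: int where ij: "pnorm v a = exp (of_int i)" "pnorm v b = exp (of_int j)" using p ab by blast
  then have "fnorm v x = exp (of_int (i - j))" using Fract by (simp add: fnorm_Fract exp_diff)
  then show ?thesis by blast
qed

section \<open>The ring of Laurent polynomials in two points\<close>

lemma Fract_frac: "b ~= 0 ==> Fract a b = Fract a 1 / Fract b 1" by (simp add: divide_fract)

lemma Fract_hom:
  fixes a b :: "'k::field poly"
  shows "Fract (a * b) 1 = Fract a 1 * Fract b 1" "Fract (a + b) 1 = Fract a 1 + Fract b 1" "Fract (a ^ n) 1 = Fract a 1 ^ n"
proof -
  have m: "Fract (c * d) 1 = Fract c 1 * Fract d 1" for c d :: "'k poly" by simp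
  show "Fract (a * b) 1 = Fract a 1 * Fract b 1" by (rule m)
  show "Fract (a + b) 1 = Fract a 1 + Fract b 1" by simp
  show "Fract (a ^ n) 1 = Fract a 1 ^ n" by (induction n) (simp_all only: m power_0 power_Suc One_fract_def)
qed

lemma linear_nonzero: "[:0, 1:] ^ k * [:-1, 1:] ^ m ~= (0 :: 'k::field poly)" by simp

abbreviation \<R> where "\<R> \<equiv> localized_polys"

lemma localized_polys_iff:
  "x \<in> \<R> \<longleftrightarrow> (\<exists>f k m. x = Fract f 1 / (tt ^ k * t1 ^ m))"
proof -
  have "Fract f ([:0, 1:] ^ k * [:-1, 1:] ^ m) = Fract f 1 / (tt ^ k * t1 ^ m)" for f :: "'a poly" and k m
    by (subst Fract_frac[OF linear_nonzero]) (simp add: Fract_hom tt_def t1_def)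
  then show ?thesis by (auto simp: localized_polys_def)
qed

lemma R_poly: "Fract f 1 \<in> \<R>" unfolding localized_polys_iff by (rule exI[of _ f], rule exI[of _ 0], rule exI[of _ 0]) simp

lemma R_mult: "x \<in> \<R> ==> y \<in> \<R> ==> x * y \<in> \<R>"
proof -
  assume "x \<in> \<R>" "y \<in> \<R>"
  then obtain f k m g k' m' where *: "x = Fract f 1 / (tt ^ k * t1 ^ m)" "y = Fract g 1 / (tt ^ k' * t1 ^ m')" unfolding localized_polys_iff by blast
  have "x * y = Fract (f * g) 1 / (tt ^ (k + k') * t1 ^ (m + m'))" unfolding * by (simp only: Fract_hom power_add times_divide_times_eq mult_ac)
  then show ?thesis unfolding localized_polys_iff by blast
qed

lemma R_add: "x \<in> \<R> ==> y \<in> \<R> ==> x + y \<in> \<R>"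
proof -
  assume "x \<in> \<R>" "y \<in> \<R>"
  then obtain f k m g k' m' where *: "x = Fract f 1 / (tt ^ k * t1 ^ m)" "y = Fract g 1 / (tt ^ k' * t1 ^ m')" unfolding localized_polys_iff by blast
  have "x + y = Fract (f * ([:0, 1:] ^ k' * [:-1, 1:] ^ m') + g * ([:0, 1:] ^ k * [:-1, 1:] ^ m)) 1 / (tt ^ (k + k') * t1 ^ (m + m'))"
    unfolding * Fract_hom tt_def[symmetric] t1_def[symmetric] by (simp add: field_simps power_add)
  then show ?thesis unfolding localized_polys_iff by blast
qed

lemma R_cst: "cst c \<in> \<R>" and R_tt: "tt \<in> \<R>" and R_t1: "t1 \<in> \<R>" by (auto simp: cst_def tt_def t1_def R_poly)

lemma R_0: "0 \<in> \<R>" and R_1: "1 \<in> \<R>" using R_cst[of 0] R_cst[of 1] by (simp_all add: cst_hom)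

lemma R_uminus: "x \<in> \<R> ==> - x \<in> \<R>" using R_mult[OF R_cst[of "-1"], of x] by (simp add: cst_hom)

lemma R_diff: "x \<in> \<R> ==> y \<in> \<R> ==> x - y \<in> \<R>" using R_add[OF _ R_uminus] by fastforce

lemma R_inverse_tt: "inverse tt \<in> \<R>"
  unfolding localized_polys_iff by (rule exI[of _ 1], rule exI[of _ 1], rule exI[of _ 0]) (simp add: One_fract_def[symmetric] divide_inverse)

lemma R_inverse_t1: "inverse t1 \<in> \<R>"
  unfolding localized_polys_iff by (rule exI[of _ 1], rule exI[of _ 0], rule exI[of _ 1]) (simp add: One_fract_def[symmetric] divide_inverse)

lemma R_power: "x \<in> \<R> ==> x ^ n \<in> \<R>" by (induction n) (auto simp: R_1 R_mult)

lemma R_powi: "x \<in> \<R> ==> inverse x \<in> \<R> ==> x powi k \<in> \<R>" by (simp add: power_int_def R_power)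

lemma R_uniformizer: "uniformizer v \<in> \<R>" by (cases v) (simp_all add: uniformizer_def R_inverse_tt R_inverse_t1 R_tt)

lemma R_horner: "r \<in> horner v k ==> r \<in> \<R>" by (induction k arbitrary: r) (auto simp: R_cst intro!: R_add R_mult R_uniformizer)

lemma split_at_roots:
  fixes f :: "'k::field poly" assumes f: "f ~= 0" and k: "k <= Polynomial.order 0 f" and m: "m <= Polynomial.order 1 f"
  shows "\<exists>h. f = [:0, 1:] ^ k * [:-1, 1:] ^ m * h \<and> h ~= 0 \<and> degree f = k + m + degree h"
proof -
  have "[:0, 1:] ^ k dvd f" using order_divides[of 0 k f] k by simp
  then obtain g where g: "f = [:0, 1:] ^ k * g" by (elim dvdE)
  then have g0: "g ~= 0" using f by auto
  have "Polynomial.order 1 ([:0, 1:] ^ k :: 'k poly) = 0" by (rule order_0I) simp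
  then have "Polynomial.order 1 f = Polynomial.order 1 g" using g f by (simp add: order_mult)
  then have "[:-1, 1:] ^ m dvd g" using order_divides[of 1 m g] m by simp
  then obtain h where h: "g = [:-1, 1:] ^ m * h" by (elim dvdE)
  then have h0: "h ~= 0" using g0 by auto
  have "degree f = k + m + degree h" unfolding g h using h0 by (simp add: degree_mult_eq degree_power_eq)
  then show ?thesis using g h h0 by (auto simp: mult.assoc)
qed

lemma R_form:
  assumes "x \<in> \<R>" "x ~= 0"
  obtains f k m where "x = Fract f 1 / (tt ^ k * t1 ^ m)" "f ~= 0"
    "fnorm At0 x = exp (real k - real (Polynomial.order 0 f))" "fnorm At1 x = exp (real m - real (Polynomial.order 1 f))"
    "fnorm AtInf x = exp (real (degree f) - real k - real m)"
proof -
  obtain f k m where x: "x = Fract f 1 / (tt ^ k * t1 ^ m)" using assms(1) unfolding localized_polys_iff by blast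
  then have f: "f ~= 0" using assms(2) by (auto simp: fract_collapse)
  have e: "exp (- 1) ^ n = exp (- real n)" "exp 1 ^ n = exp (real n)" for n by (simp_all flip: exp_of_nat_mult)
  show ?thesis by (rule that[OF x f]; unfold x)
      (use f in \<open>simp_all add: fnorm_divide fnorm_mult fnorm_power fnorm_tt fnorm_t1 fnorm_Fract e flip: exp_diff exp_add\<close>)
qed

text \<open>An element has at least as many poles as zeros among the three places, as its other zeros are not counted.\<close>

lemma R_product_formula:
  assumes "x \<in> \<R>" "x ~= 0" shows "1 <= fnorm At0 x * fnorm At1 x * fnorm AtInf x"
proof -
  obtain f k m where "x = Fract f 1 / (tt ^ k * t1 ^ m)" and *: "f ~= 0" "fnorm At0 x = exp (real k - real (Polynomial.order 0 f))"
    "fnorm At1 x = exp (real m - real (Polynomial.order 1 f))"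
    "fnorm AtInf x = exp (real (degree f) - real k - real m)" using R_form[OF assms] by metis
  have "Polynomial.order 0 f + Polynomial.order 1 f <= degree f" using split_at_roots[OF *(1) order_refl order_refl] by auto
  then show ?thesis unfolding *(2-4) by (simp flip: exp_add)
qed

text \<open>An element of the ring is regular away from the three places, so it is constant if it is regular there as well.\<close>

lemma R_bounded_is_constant:
  assumes x: "x \<in> \<R>" and le: "!!v. fnorm v x <= 1" shows "x \<in> range cst"
proof (cases "x = 0")
  case True
  then show ?thesis using cst_hom(1) by (metis rangeI)
next
  case False
  obtain f k m where *: "x = Fract f 1 / (tt ^ k * t1 ^ m)" "f ~= 0" "fnorm At0 x = exp (real k - real (Polynomial.order 0 f))"
    "fnorm At1 x = exp (real m - real (Polynomial.order 1 f))"
    "fnorm AtInf x = exp (real (degree f) - real k - real m)" using R_form[OF x False] by metis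
  have "k <= Polynomial.order 0 f" "m <= Polynomial.order 1 f" "degree f <= k + m"
    using le[of At0] le[of At1] le[of AtInf] unfolding *(3-5) by simp_all
  then obtain h where h: "f = [:0, 1:] ^ k * [:-1, 1:] ^ m * h" "degree h = 0" using split_at_roots[OF *(2), of k m] by auto
  then obtain c where "h = [:c:]" by (metis degree_eq_zeroE)
  then have "Fract f 1 = tt ^ k * t1 ^ m * cst c" using h(1) by (simp only: Fract_hom tt_def t1_def cst_def)
  then have "x = cst c" using *(1) by simp
  then show ?thesis by blast
qed

definition units :: "'k::field rf set" where
  "units = {cst c * tt powi i * t1 powi j | c i j. c ~= 0}"

lemma units_nonzero: "u \<in> units ==> u ~= 0" by (auto simp: units_def)

lemma units_mult: assumes "u \<in> units" "w \<in> units" shows "u * w \<in> units"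
proof -
  obtain c i j d k l where *: "u = cst c * tt powi i * t1 powi j" "c ~= 0" "w = cst d * tt powi k * t1 powi l" "d ~= 0"
    using assms unfolding units_def by blast
  have "u * w = cst (c * d) * tt powi (i + k) * t1 powi (j + l)" unfolding * by (simp add: cst_hom power_int_add mult_ac)
  then show ?thesis using * unfolding units_def by (metis (mono_tags, lifting) mem_Collect_eq mult_eq_0_iff)
qed

lemma units_inverse: assumes "u \<in> units" shows "inverse u \<in> units"
proof -
  obtain c i j where *: "u = cst c * tt powi i * t1 powi j" "c ~= 0" using assms unfolding units_def by blast
  have "inverse u = cst (inverse c) * tt powi (- i) * t1 powi (- j)" unfolding * by (simp add: cst_inverse power_int_minus mult_ac)
  then show ?thesis using * unfolding units_def by (metis (mono_tags, lifting) mem_Collect_eq inverse_nonzero_iff_nonzero)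
qed

lemma units_R: "u \<in> units ==> u \<in> \<R>" by (auto simp: units_def intro!: R_mult R_cst R_powi R_tt R_t1 R_inverse_tt R_inverse_t1)

lemma unitsI: "cst c * tt powi i * t1 powi j \<in> units" if "c ~= 0" using that by (auto simp: units_def)

lemma one_units: "1 \<in> units" using unitsI[of 1 0 0] by (simp add: cst_hom)

text \<open>After multiplying by a monomial, a unit has norm 1 at 0 and 1. The product formula for it and its inverse then
gives norm 1 at infinity.\<close>

lemma R_units:
  assumes x: "x \<in> \<R>" and y: "y \<in> \<R>" and xy: "x * y = 1" shows "x \<in> units"
proof -
  have nz: "x ~= 0" "y ~= 0" using xy by auto
  obtain i where i: "fnorm At0 x = exp (of_int i)" using fnorm_int[OF nz(1)] by blast
  obtain j where j: "fnorm At1 x = exp (of_int j)" using fnorm_int[OF nz(1)] by blast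
  have e: "exp (- 1) powi n = exp (- real_of_int n)" for n :: int using powr_real_of_int'[of "exp (-1)" n] exp_gt_zero by (simp add: powr_def)
  let ?u = "tt powi i * t1 powi j"
  have u: "?u ~= 0" "?u \<in> \<R>" "inverse ?u \<in> \<R>"
    using units_R[OF unitsI[of 1 i j]] units_R[OF units_inverse[OF unitsI[of 1 i j]]] by (simp_all add: cst_hom)
  have nu: "fnorm At0 ?u = exp (- of_int i)" "fnorm At1 ?u = exp (- of_int j)" by (simp_all add: fnorm_mult fnorm_powi fnorm_tt fnorm_t1 e)
  let ?x = "x * ?u" and ?y = "y * inverse ?u"
  have X: "?x \<in> \<R>" "?x ~= 0" "fnorm At0 ?x = 1" "fnorm At1 ?x = 1"
    using u x nz R_mult[OF x u(2)] by (auto simp: fnorm_mult[of _ x] nu i j simp flip: exp_add)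
  have XY: "?x * ?y = 1" using xy u(1) by (simp add: field_simps)
  have nxy: "fnorm v ?x * fnorm v ?y = 1" for v using XY by (simp only: fnorm_mult[symmetric] fnorm_1)
  have Y: "?y \<in> \<R>" "?y ~= 0" "fnorm At0 ?y = 1" "fnorm At1 ?y = 1"
    using R_mult[OF y u(3)] nz u(1) nxy[of At0] nxy[of At1] unfolding X(3,4) by simp_all
  have "1 <= fnorm AtInf ?x" "1 <= fnorm AtInf ?y" "fnorm AtInf ?x * fnorm AtInf ?y = 1"
    using R_product_formula[OF X(1,2)] R_product_formula[OF Y(1,2)] nxy[of AtInf] unfolding X(3,4) Y(3,4) by simp_all
  then have "fnorm AtInf ?x <= 1" by (metis fnorm_nonneg mult_left_mono mult.right_neutral)
  then have "fnorm v ?x <= 1" for v using X(3,4) by (cases v) auto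
  then obtain c where c: "?x = cst c" using R_bounded_is_constant[OF X(1)] by blast
  then have "c ~= 0" using X(2) by auto
  have "x = cst c * tt powi (- i) * t1 powi (- j)" unfolding c[symmetric] by (simp add: power_int_minus field_simps)
  then show ?thesis using unitsI[OF \<open>c ~= 0\<close>] by simp
qed

section \<open>Triangular matrices over the three places\<close>

text \<open>The diagonal entries in rows 1 and 4 are 1 and therefore not recorded.\<close>

datatype 'f tri = Tri (d2: 'f) (d3: 'f) (e12: 'f) (e13: 'f) (e14: 'f) (e23: 'f) (e24: 'f) (e34: 'f)

definition tmul :: "'f::field tri => 'f tri => 'f tri" where
  "tmul a b = Tri (d2 a * d2 b) (d3 a * d3 b) (e12 b + e12 a * d2 b) (e13 b + e12 a * e23 b + e13 a * d3 b)
     (e14 b + e12 a * e24 b + e13 a * e34 b + e14 a) (d2 a * e23 b + e23 a * d3 b)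
     (d2 a * e24 b + e23 a * e34 b + e24 a) (d3 a * e34 b + e34 a)"

definition tone :: "'f::field tri" where
  "tone = Tri 1 1 0 0 0 0 0 0"

definition tinv :: "'f::field tri => 'f tri" where
  "tinv a = Tri (inverse (d2 a)) (inverse (d3 a)) (- e12 a / d2 a) (e12 a * e23 a / (d2 a * d3 a) - e13 a / d3 a)
     (e12 a * (e24 a / d2 a - e23 a * e34 a / (d2 a * d3 a)) + e13 a * e34 a / d3 a - e14 a) (- e23 a / (d2 a * d3 a))
     (e23 a * e34 a / (d2 a * d3 a) - e24 a / d2 a) (- e34 a / d3 a)"

lemma tmul_assoc: "tmul (tmul a b) c = tmul a (tmul b c)" by (simp add: tmul_def algebra_simps)

lemma tmul_one [simp]: "tmul tone a = a" "tmul a tone = a" by (cases a; simp add: tmul_def tone_def)+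

lemma tinv_left: "d2 a ~= 0 ==> d3 a ~= 0 ==> tmul (tinv a) a = tone" by (simp add: tmul_def tinv_def tone_def field_simps)

text \<open>The diagonal is common to all places and a unit of the ring, while the entries above it are independent at the three places. Rational
functions stand in for elements of the completions, in which they are dense.\<close>

definition PG :: "(place => 'k::field rf tri) monoid" where
  "PG = \<lparr>carrier = {g. (\<forall>v. d2 (g v) = d2 (g At0)) \<and> (\<forall>v. d3 (g v) = d3 (g At0)) \<and> d2 (g At0) \<in> units \<and> d3 (g At0) \<in> units},
     monoid.mult = (%g h v. tmul (g v) (h v)), one = (%v. tone)\<rparr>"

abbreviation PG_mul (infixl "\<star>" 70) where "g \<star> h \<equiv> g \<otimes>\<^bsub>PG\<^esub> h"

lemma PG_iff: "g \<in> carrier PG \<longleftrightarrow>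
   (\<forall>v. d2 (g v) = d2 (g At0)) \<and> (\<forall>v. d3 (g v) = d3 (g At0)) \<and> d2 (g At0) \<in> units \<and> d3 (g At0) \<in> units"
  by (simp add: PG_def)

lemma PG_mult [simp]: "(g \<star> h) v = tmul (g v) (h v)" by (simp add: PG_def)

lemma PG_one [simp]: "\<one>\<^bsub>PG\<^esub> v = tone" by (simp add: PG_def)

lemma PG_diag: "g \<in> carrier PG ==> d2 (g v) \<in> units \<and> d3 (g v) \<in> units" unfolding PG_iff by metis

lemma PG_nonzero: "g \<in> carrier PG ==> d2 (g v) ~= 0 \<and> d3 (g v) ~= 0" using PG_diag[of g v] units_nonzero by blast

lemma PGI:
  assumes "!!v. d2 (g v) = a" "!!v. d3 (g v) = b" "a \<in> units" "b \<in> units" shows "g \<in> carrier PG" using assms by (simp add: PG_iff)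

lemma PG_tinv:
  assumes g: "g \<in> carrier PG" shows "(%v. tinv (g v)) \<star> g = \<one>\<^bsub>PG\<^esub>" "(%v. tinv (g v)) \<in> carrier PG"
proof -
  show "(%v. tinv (g v)) \<star> g = \<one>\<^bsub>PG\<^esub>" using PG_nonzero[OF g] by (simp add: fun_eq_iff tinv_left)
  have "d2 (g v) = d2 (g At0)" "d3 (g v) = d3 (g At0)" for v using g unfolding PG_iff by blast+
  then show "(%v. tinv (g v)) \<in> carrier PG"
    using PG_diag[OF g] by (intro PGI[of _ "inverse (d2 (g At0))" "inverse (d3 (g At0))"]) (auto simp: tinv_def units_inverse)
qed

lemma PG_group: "group (PG :: (place => 'k::field rf tri) monoid)"
proof (rule groupI)
  fix g h k :: "place => 'k rf tri"
  show "g \<star> h \<in> carrier PG" if gh: "g \<in> carrier PG" "h \<in> carrier PG"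
  proof -
    have e: "d2 (g v) = d2 (g At0)" "d3 (g v) = d3 (g At0)" "d2 (h v) = d2 (h At0)" "d3 (h v) = d3 (h At0)" for v using gh unfolding PG_iff by blast+
    show ?thesis
    proof (rule PGI)
      show "d2 ((g \<star> h) v) = d2 (g At0) * d2 (h At0)" "d3 ((g \<star> h) v) = d3 (g At0) * d3 (h At0)" for v
        using e(1)[of v] e(2)[of v] e(3)[of v] e(4)[of v] by (simp_all add: tmul_def)
    qed (use PG_diag[OF gh(1)] PG_diag[OF gh(2)] units_mult in auto)
  qed
  show "\<one>\<^bsub>PG\<^esub> \<in> carrier (PG :: (place => 'k::field rf tri) monoid)" by (simp add: PG_iff tone_def one_units)
  show "g \<star> h \<star> k = g \<star> (h \<star> k)" by (simp add: fun_eq_iff tmul_assoc)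
  show "\<one>\<^bsub>PG\<^esub> \<star> g = g" by (simp add: fun_eq_iff)
  show "\<exists>h\<in>carrier PG. h \<star> g = \<one>\<^bsub>PG\<^esub>" if g: "g \<in> carrier PG" using PG_tinv[OF g] by blast
qed

lemma PG_inv:
  fixes g :: "place => 'k::field rf tri"
  assumes g: "g \<in> carrier PG" shows "inv\<^bsub>PG\<^esub> g = (%v. tinv (g v))"
proof -
  interpret group "PG :: (place => 'k rf tri) monoid" by (rule PG_group)
  show ?thesis by (rule inv_equality[OF PG_tinv(1)[OF g] g PG_tinv(2)[OF g]])
qed

definition entries :: "('f::field tri => 'f) set" where
  "entries = {%_. 1, d2, d3, e12, e13, e14, e23, e24, e34}"

definition nrm :: "(place => 'k::field rf tri) => real" where
  "nrm g = Max ((%(v, e). fnorm v (e (g v))) ` (UNIV \<times> entries))"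

lemma nrm_le_iff: "nrm g <= c \<longleftrightarrow> (\<forall>v. 1 <= c \<and> fnorm v (d2 (g v)) <= c \<and> fnorm v (d3 (g v)) <= c \<and> fnorm v (e12 (g v)) <= c \<and>
    fnorm v (e13 (g v)) <= c \<and> fnorm v (e14 (g v)) <= c \<and> fnorm v (e23 (g v)) <= c \<and> fnorm v (e24 (g v)) <= c \<and> fnorm v (e34 (g v)) <= c)"
proof -
  have "finite ((%(v, e). fnorm v (e (g v))) ` (UNIV \<times> entries))" by (simp add: entries_def)
  moreover have "((%(v, e). fnorm v (e (g v))) ` (UNIV \<times> entries)) ~= {}" by (simp add: entries_def)
  ultimately have "nrm g <= c \<longleftrightarrow> (\<forall>x\<in>(%(v, e). fnorm v (e (g v))) ` (UNIV \<times> entries). x <= c)"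
    unfolding nrm_def by (rule Max_le_iff)
  then show ?thesis by (simp add: entries_def ball_Un split_beta)
qed

lemma nrm_ge:
  "1 <= nrm g" "fnorm v (d2 (g v)) <= nrm g" "fnorm v (d3 (g v)) <= nrm g" "fnorm v (e12 (g v)) <= nrm g"
  "fnorm v (e13 (g v)) <= nrm g" "fnorm v (e14 (g v)) <= nrm g" "fnorm v (e23 (g v)) <= nrm g" "fnorm v (e24 (g v)) <= nrm g"
  "fnorm v (e34 (g v)) <= nrm g" using nrm_le_iff[of g "nrm g"] by simp_all

lemma nrm_pos: "0 < nrm g" using nrm_ge(1)[of g] by linarith

lemma fnorm_add_le: "fnorm v x <= c ==> fnorm v y <= c ==> fnorm v (x + y) <= c" using fnorm_add[of v x y] by linarith

lemma fnorm_diff_le: "fnorm v x <= c ==> fnorm v y <= c ==> fnorm v (x - y) <= c" using fnorm_diff[of v x y] by linarith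

lemma fnorm_mult_le: "fnorm v x <= b ==> fnorm v y <= c ==> fnorm v (x * y) <= b * c"
  unfolding fnorm_mult by (intro mult_mono) (auto intro: order_trans[OF fnorm_nonneg])

lemma nrm_mult: "nrm (%v. tmul (g v) (h v)) <= nrm g * nrm h"
proof -
  have 1: "x <= nrm g ==> x <= nrm g * nrm h" "y <= nrm h ==> y <= nrm g * nrm h" for x y
    using nrm_ge(1)[of g] nrm_ge(1)[of h] mult_left_mono[of 1 "nrm h" "nrm g"] mult_right_mono[of 1 "nrm g" "nrm h"] by linarith+
  show ?thesis unfolding nrm_le_iff tmul_def tri.sel
    by (intro allI conjI; (rule 1(1)[OF nrm_ge(1)])?; (intro fnorm_add_le fnorm_mult_le nrm_ge 1(1)[OF nrm_ge(6)] 1(1)[OF nrm_ge(8)] 1(1)[OF nrm_ge(9)]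
       1(2)[OF nrm_ge(4)] 1(2)[OF nrm_ge(5)] 1(2)[OF nrm_ge(6)])?)
qed

text \<open>Taking the inverse into account makes the length symmetric.\<close>

definition len :: "(place => 'k::field rf tri) => real" where
  "len g = max (ln (nrm g)) (ln (nrm (%v. tinv (g v))))"

lemma len_nonneg: "0 <= len g" using nrm_ge(1)[of g] by (simp add: len_def le_max_iff_disj)

lemma nrm_le_exp_len: "nrm g <= exp (len g)"
proof -
  have "ln (nrm g) <= len g" by (simp add: len_def)
  then show ?thesis using nrm_pos[of g] by (metis exp_le_cancel_iff exp_ln)
qed

lemma len_le_iff: "len g <= s \<longleftrightarrow> nrm g <= exp s \<and> nrm (%v. tinv (g v)) <= exp s"
  using nrm_pos[of g] nrm_pos[of "%v. tinv (g v)"] by (simp add: len_def ln_le_cancel_iff[symmetric] del: ln_le_cancel_iff)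

lemma length_group_PG:
  assumes "nonprincipal_ultrafilter \<omega>" shows "length_group (PG :: (place => 'k::field rf tri) monoid) len \<omega>"
proof -
  interpret group "PG :: (place => 'k rf tri) monoid" by (rule PG_group)
  have inv_inv': "(%v. tinv (tinv (g v))) = g" if g: "g \<in> carrier PG" for g :: "place => 'k rf tri"
    using inv_inv[OF g] PG_inv[OF g] PG_inv[OF inv_closed[OF g]] by simp
  show ?thesis
  proof (unfold_locales)
    fix g h :: "place => 'k rf tri"
    show "0 <= len g" by (rule len_nonneg)
    have "nrm (\<one>\<^bsub>PG\<^esub> :: place => 'k rf tri) <= 1" by (simp add: nrm_le_iff tone_def)
    moreover have "nrm (%v. tinv (\<one>\<^bsub>PG\<^esub> v) :: 'k rf tri) <= 1" by (simp add: nrm_le_iff tone_def tinv_def)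
    ultimately have "len (\<one>\<^bsub>PG\<^esub> :: place => 'k rf tri) <= 0" by (simp add: len_le_iff)
    then show "len (\<one>\<^bsub>PG\<^esub> :: place => 'k rf tri) = 0" using len_nonneg by (metis order_antisym)
    show "len (inv\<^bsub>PG\<^esub> g) = len g" if g: "g \<in> carrier PG" by (simp add: len_def PG_inv[OF g] inv_inv'[OF g] max.commute)
    show "len (g \<star> h) <= len g + len h" if g: "g \<in> carrier PG" and h: "h \<in> carrier PG" unfolding len_le_iff
    proof
      have eq: "g \<star> h = (%v. tmul (g v) (h v))" by (simp add: fun_eq_iff)
      have "nrm (g \<star> h) <= nrm g * nrm h" unfolding eq by (rule nrm_mult)
      also have "... <= exp (len g) * exp (len h)" using nrm_pos[of g] nrm_pos[of h] by (intro mult_mono nrm_le_exp_len) auto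
      finally show "nrm (g \<star> h) <= exp (len g + len h)" by (simp add: exp_add)
      have "inv\<^bsub>PG\<^esub> (g \<star> h) = inv\<^bsub>PG\<^esub> h \<star> inv\<^bsub>PG\<^esub> g" using g h by (rule inv_mult_group)
      then have eq': "(%v. tinv ((g \<star> h) v)) = (%v. tmul (tinv (h v)) (tinv (g v)))"
        using g h PG_inv by (metis (no_types, lifting) PG_mult ext m_closed)
      have "nrm (%v. tinv ((g \<star> h) v)) <= nrm (%v. tinv (h v)) * nrm (%v. tinv (g v))" unfolding eq' by (rule nrm_mult)
      also have "... <= exp (len h) * exp (len g)"
        using nrm_pos[of "%v. tinv (g v)"] nrm_pos[of "%v. tinv (h v)"] len_le_iff[of g "len g"] len_le_iff[of h "len h"] by (intro mult_mono) auto
      finally show "nrm (%v. tinv ((g \<star> h) v)) <= exp (len g + len h)" by (simp add: exp_add mult.commute)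
    qed
    show "nonprincipal_ultrafilter \<omega>" by fact
  qed
qed

section \<open>Monomials, and the growth of sequences of functions\<close>

definition tmono :: "int => int => 'k::field rf" where
  "tmono i j = tt powi i * t1 powi j"

text \<open>The exponents of t and t - 1 determine those at the three places. Any two of the three linear forms are independent and their sum is zero.\<close>

fun lam :: "place => real \<times> real => real" where
  "lam At0 a = fst a" | "lam At1 a = snd a" | "lam AtInf a = - fst a - snd a"

lemma lam_linear: "lam v (a + b) = lam v a + lam v b" "lam v (c *\<^sub>R a) = c * lam v a" "lam v (- a) = - lam v a" "lam v 0 = 0"
  "lam v (a - b) = lam v a - lam v b" by (cases v; simp add: algebra_simps)+

lemma tmono_nonzero [simp]: "tmono i j ~= 0" by (simp add: tmono_def)

lemma tmono_add: "tmono (i + k) (j + l) = tmono i j * tmono k l" by (simp add: tmono_def power_int_add mult_ac)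

lemma tmono_minus: "tmono (- i) (- j) = inverse (tmono i j)" by (simp add: tmono_def power_int_minus)

lemma tmono_diff: "tmono (i - k) (j - l) = tmono i j / tmono k l" by (simp add: tmono_def power_int_diff field_simps)

lemma tmono_units: "tmono i j \<in> units" using unitsI[of 1 i j] by (simp add: tmono_def cst_hom)

lemma cst_tmono_units: "c ~= 0 ==> cst c * tmono i j \<in> units" using unitsI[of c i j] by (simp add: tmono_def mult_ac)

lemma unitsE: assumes "u \<in> units" obtains c i j where "c ~= 0" "u = cst c * tmono i j" using assms by (auto simp: units_def tmono_def mult_ac)

lemma exp_powi: "exp (x::real) powi n = exp (x * of_int n)"
  using powr_real_of_int'[of "exp x" n] exp_gt_zero[of x] by (simp add: powr_def mult.commute)

lemma fnorm_mono: "fnorm v (tmono i j) = exp (- lam v (of_int i, of_int j))"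
  by (cases v) (simp_all add: tmono_def fnorm_mult fnorm_powi fnorm_tt fnorm_t1 exp_powi flip: exp_add)

definition diag :: "'f::field => 'f => 'f tri" where
  "diag p q = Tri p q 0 0 0 0 0 0"

lemma tinv_diag: "tinv (diag p q) = diag (inverse p) (inverse q)" by (simp add: tinv_def diag_def)

lemma tmul_diag: "tmul (diag p q) (diag r s) = diag (p * r) (q * s)" by (simp add: tmul_def diag_def)

lemma diag_PG: "p \<in> units ==> q \<in> units ==> (%v. diag p q) \<in> carrier PG" by (rule PGI[of _ p q]) (auto simp: diag_def)

lemma lam_le: "\<bar>lam v (of_int i, of_int j)\<bar> <= \<bar>real_of_int i\<bar> + \<bar>real_of_int j\<bar>" by (cases v) auto

lemma len_diag:
  fixes c d :: "'k::field"
  assumes "c ~= 0" "d ~= 0"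
  shows "len (%v. diag (cst c * tmono i j) (cst d * tmono k l)) <= \<bar>real_of_int i\<bar> + \<bar>real_of_int j\<bar> + \<bar>real_of_int k\<bar> + \<bar>real_of_int l\<bar>"
proof -
  have n: "fnorm v (cst c * tmono i j) <= exp M" if "c ~= 0" "\<bar>real_of_int i\<bar> + \<bar>real_of_int j\<bar> <= M" for v i j M and c :: 'k
    using abs_le_D2[OF lam_le[of v i j]] that by (simp add: fnorm_mult fnorm_mono)
  have inv: "inverse (cst c * tmono i j) = cst (inverse c) * tmono (-i) (-j)" for c :: 'k and i j by (simp add: cst_inverse tmono_minus)
  show ?thesis unfolding len_le_iff tinv_diag inv nrm_le_iff unfolding diag_def tri.sel using assms by (intro conjI allI n) auto
qed

lemma len_ge_diag:
  assumes "g = (%v. diag (cst c * tmono i j) (cst d * tmono k l))" "c ~= 0" "d ~= 0"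
  shows "\<bar>real_of_int i\<bar> <= len g" "\<bar>real_of_int j\<bar> <= len g" "\<bar>real_of_int k\<bar> <= len g" "\<bar>real_of_int l\<bar> <= len g"
proof -
  have inv: "tinv (g v) = diag (cst (inverse c) * tmono (-i) (-j)) (cst (inverse d) * tmono (-k) (-l))" for v
    by (simp add: assms(1) tinv_diag cst_inverse tmono_minus)
  have n: "nrm g <= exp (len g)" "nrm (%v. tinv (g v)) <= exp (len g)" using len_le_iff[of g "len g"] by auto
  have "exp (- lam v (of_int i, of_int j)) <= exp (len g)" "exp (- lam v (of_int k, of_int l)) <= exp (len g)" for v
    using order_trans[OF nrm_ge(2)[of v g] n(1)] order_trans[OF nrm_ge(3)[of v g] n(1)] assms by (auto simp: diag_def fnorm_mult fnorm_mono)
  from this[of At0] this[of At1]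
  have 1: "- real_of_int i <= len g" "- real_of_int j <= len g" "- real_of_int k <= len g" "- real_of_int l <= len g" by auto
  have "exp (- lam v (of_int (-i), of_int (-j))) <= exp (len g)" "exp (- lam v (of_int (-k), of_int (-l))) <= exp (len g)" for v
    using order_trans[OF nrm_ge(2)[of v "%v. tinv (g v)"] n(2)] order_trans[OF nrm_ge(3)[of v "%v. tinv (g v)"] n(2)] assms(2,3)
    unfolding inv by (auto simp: diag_def fnorm_mult fnorm_mono)
  from this[of At0] this[of At1]
  have 2: "real_of_int i <= len g" "real_of_int j <= len g" "real_of_int k <= len g" "real_of_int l <= len g" by auto
  show "\<bar>real_of_int i\<bar> <= len g" "\<bar>real_of_int j\<bar> <= len g" "\<bar>real_of_int k\<bar> <= len g" "\<bar>real_of_int l\<bar> <= len g"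
    using 1 2 by auto
qed

definition ut :: "'f => 'f => 'f => 'f => 'f => 'f => 'f::field tri" where
  "ut r12 r13 r14 r23 r24 r34 = Tri 1 1 r12 r13 r14 r23 r24 r34"

lemma ut_PG: "(%v. ut (a v) (b v) (c v) (d v) (e v) (f v)) \<in> carrier PG" by (rule PGI[of _ 1 1]) (auto simp: ut_def one_units)

lemma nrm_tinv_ut:
  assumes g: "g = (%v. ut (a v) (b v) (c v) (d v) (e v) (f v))" shows "nrm (%v. tinv (g v)) <= nrm g ^ 3"
proof -
  let ?m = "nrm g"
  have m: "1 <= ?m" by (rule nrm_ge)
  have up: "x <= ?m ^ 3" if "x <= ?m \<or> x <= ?m ^ 2" for x using that power_increasing[OF _ m, of 1 3] power_increasing[OF _ m, of 2 3] by auto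
  have up2: "fnorm v x <= ?m ^ 2" if "fnorm v x <= ?m" for v x using that power_increasing[OF _ m, of 1 2] by auto
  have en: "fnorm v (a v) <= ?m" "fnorm v (b v) <= ?m" "fnorm v (c v) <= ?m" "fnorm v (d v) <= ?m" "fnorm v (e v) <= ?m" "fnorm v (f v) <= ?m" for v
    using nrm_ge(4-9)[of v g] by (simp_all add: g ut_def)
  have p2: "fnorm v (x * y) <= ?m ^ 2" if "fnorm v x <= ?m" "fnorm v y <= ?m" for v x y using fnorm_mult_le[OF that] by (simp add: power2_eq_square)
  have p3: "fnorm v (x * y) <= ?m ^ 3" if "fnorm v x <= ?m" "fnorm v y <= ?m ^ 2" for v x y
    using fnorm_mult_le[OF that] by (simp add: power2_eq_square power3_eq_cube)
  have 14: "fnorm v (a v * (e v - d v * f v) + b v * f v - c v) <= ?m ^ 3" for v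
    by (rule fnorm_diff_le[OF fnorm_add_le[OF p3[OF en(1) fnorm_diff_le[OF up2[OF en(5)] p2[OF en(4) en(6)]]]
          up[OF disjI2[OF p2[OF en(2) en(6)]]]] up[OF disjI1[OF en(3)]]])
  have 13: "fnorm v (a v * d v - b v) <= ?m ^ 3" "fnorm v (d v * f v - e v) <= ?m ^ 3" for v
    by (rule fnorm_diff_le[OF up[OF disjI2[OF p2[OF en(1) en(4)]]] up[OF disjI1[OF en(2)]]],
        rule fnorm_diff_le[OF up[OF disjI2[OF p2[OF en(4) en(6)]]] up[OF disjI1[OF en(5)]]])
  show ?thesis unfolding nrm_le_iff using 13 14 up[OF disjI1[OF m]] up[OF disjI1[OF en(1)]] up[OF disjI1[OF en(4)]] up[OF disjI1[OF en(6)]]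
    by (simp add: g ut_def tinv_def)
qed

lemma len_ut:
  assumes "g = (%v. ut (a v) (b v) (c v) (d v) (e v) (f v))" "nrm g <= exp s" shows "len g <= 3 * s"
proof -
  have "1 <= exp s" using nrm_ge(1)[of g] assms(2) by linarith
  then have s: "0 <= s" by simp
  have "nrm (%v. tinv (g v)) <= nrm g ^ 3" by (rule nrm_tinv_ut[OF assms(1)])
  also have "... <= exp s ^ 3" using nrm_pos[of g] assms(2) by (intro power_mono) auto
  also have "... = exp (3 * s)" by (simp flip: exp_of_nat_mult)
  finally show ?thesis using assms(2) s order_trans[of "nrm g" "exp s" "exp (3 * s)"] by (simp add: len_le_iff)
qed

type_synonym 'k rseq = "nat => place => 'k rf"
type_synonym 'k tseq = "nat => place => 'k rf tri"

definition linb :: "'k::field rseq => bool" where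
  "linb r \<longleftrightarrow> (\<exists>B. \<forall>n v. fnorm v (r n v) <= exp (B * real (n + 1)))"

lemma linb_obtain: assumes "linb r" obtains B where "0 <= B" "!!n v. fnorm v (r n v) <= exp (B * real (n + 1))"
proof -
  obtain B where B: "!!n v. fnorm v (r n v) <= exp (B * real (n + 1))" using assms unfolding linb_def by blast
  have "fnorm v (r n v) <= exp (max B 0 * real (n + 1))" for n v by (rule order_trans[OF B]) (simp add: mult_right_mono)
  then show ?thesis using that[of "max B 0"] by simp
qed

definition useq :: "'k::field rseq => 'k rseq => 'k rseq => 'k rseq => 'k rseq => 'k rseq => 'k tseq" where
  "useq a b c d e f = (%n v. ut (a n v) (b n v) (c n v) (d n v) (e n v) (f n v))"

text \<open>The torus of monomial diagonal matrices gives a flat of dimension 4; rounding the exponents costs O(1), which disappears in the cone.\<close>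

definition E_seq :: "(real \<times> real) \<times> (real \<times> real) => 'k::field tseq" where
  "E_seq x = (%n v. diag (tmono \<lfloor>fst (fst x) * real n\<rfloor> \<lfloor>snd (fst x) * real n\<rfloor>) (tmono \<lfloor>fst (snd x) * real n\<rfloor> \<lfloor>snd (snd x) * real n\<rfloor>))"

locale abels_cone = length_group "PG :: (place => 'k::field rf tri) monoid" len \<omega> for \<omega>
begin

notation seq_mult (infixl "\<cdot>" 70)
notation seq_inv ("inv\<^sub>s _" [81] 80)

text \<open>The exponential growth rate of r at v, along \<open>\<omega>\<close>, is at most s.\<close>

definition lbd :: "place => 'k rseq => real => bool" where
  "lbd v r s \<longleftrightarrow> (\<forall>e>0. \<forall>\<^sub>F n in \<omega>. fnorm v (r n v) <= exp ((s + e) * real n))"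

lemma large: "\<forall>\<^sub>F n in \<omega>. N <= n"
  using nonprincipal_ultrafilter_le_sequentially[OF ultra] eventually_ge_at_top[of N] by (simp add: le_filter_def)

lemma eventually_const_le: "0 < e ==> \<forall>\<^sub>F n in \<omega>. C <= e * real n"
proof -
  assume "0 < e"
  have "\<forall>\<^sub>F n in \<omega>. nat \<lceil>C / e\<rceil> <= n" by (rule large)
  then show ?thesis
  proof eventually_elim
    case (elim n)
    then have "C / e <= real n" by linarith
    then show ?case using \<open>0 < e\<close> by (simp add: field_simps)
  qed
qed

lemma lbd_mono: "lbd v r s ==> s <= s' ==> lbd v r s'" unfolding lbd_def
proof (intro allI impI)
  fix e :: real assume *: "\<forall>e>0. \<forall>\<^sub>F n in \<omega>. fnorm v (r n v) <= exp ((s + e) * real n)" "s <= s'" "0 < e"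
  have "\<forall>\<^sub>F n in \<omega>. fnorm v (r n v) <= exp ((s + e) * real n)" using * by blast
  then show "\<forall>\<^sub>F n in \<omega>. fnorm v (r n v) <= exp ((s' + e) * real n)"
    by eventually_elim (rule order_trans, assumption, use *(2) in \<open>simp add: mult_right_mono\<close>)
qed

lemma lbd_mult:
  assumes "lbd v r s" "lbd v r' s'" shows "lbd v (%n w. r n w * r' n w) (s + s')" unfolding lbd_def
proof (intro allI impI)
  fix e :: real assume "0 < e"
  then have "\<forall>\<^sub>F n in \<omega>. fnorm v (r n v) <= exp ((s + e/2) * real n)" "\<forall>\<^sub>F n in \<omega>. fnorm v (r' n v) <= exp ((s' + e/2) * real n)"
    using assms unfolding lbd_def by simp_all
  then show "\<forall>\<^sub>F n in \<omega>. fnorm v (r n v * r' n v) <= exp ((s + s' + e) * real n)"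
  proof eventually_elim
    case (elim n)
    have "fnorm v (r n v * r' n v) <= exp ((s + e/2) * real n) * exp ((s' + e/2) * real n)" using elim by (rule fnorm_mult_le)
    also have "... = exp ((s + s' + e) * real n)" by (simp add: algebra_simps flip: exp_add)
    finally show ?case .
  qed
qed

lemma lbd_add:
  assumes "lbd v r s" "lbd v r' s" shows "lbd v (%n w. r n w + r' n w) s" unfolding lbd_def
proof (intro allI impI)
  fix e :: real assume "0 < e"
  then have "\<forall>\<^sub>F n in \<omega>. fnorm v (r n v) <= exp ((s + e) * real n)" "\<forall>\<^sub>F n in \<omega>. fnorm v (r' n v) <= exp ((s + e) * real n)"
    using assms unfolding lbd_def by simp_all
  then show "\<forall>\<^sub>F n in \<omega>. fnorm v (r n v + r' n v) <= exp ((s + e) * real n)" by eventually_elim (rule fnorm_add_le)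
qed

lemma lbd_zero: "lbd v (%n w. 0) s" by (simp add: lbd_def)

lemma useq_in: "linb a ==> linb b ==> linb c ==> linb d ==> linb e ==> linb f ==> useq a b c d e f \<in> \<S>"
proof -
  assume "linb a" "linb b" "linb c" "linb d" "linb e" "linb f"
  then obtain Ba Bb Bc Bd Be Bf where B: "0 <= Ba" "!!n v. fnorm v (a n v) <= exp (Ba * real (n + 1))" "!!n v. fnorm v (b n v) <= exp (Bb * real (n + 1))"
    "!!n v. fnorm v (c n v) <= exp (Bc * real (n + 1))" "!!n v. fnorm v (d n v) <= exp (Bd * real (n + 1))"
    "!!n v. fnorm v (e n v) <= exp (Be * real (n + 1))" "!!n v. fnorm v (f n v) <= exp (Bf * real (n + 1))" by (metis linb_obtain)
  define M where "M = Max {Ba, Bb, Bc, Bd, Be, Bf}"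
  have M: "Ba <= M" "Bb <= M" "Bc <= M" "Bd <= M" "Be <= M" "Bf <= M" by (auto simp: M_def)
  have up: "x <= exp (M * real (n + 1))" if "x <= exp (B' * real (n + 1))" "B' <= M" for x B' n
    by (rule order_trans[OF that(1)]) (use that(2) in \<open>simp add: mult_right_mono\<close>)
  show ?thesis
  proof (rule seqsI[of _ "3 * M"])
    fix n
    have "nrm (useq a b c d e f n) <= exp (M * real (n + 1))" unfolding nrm_le_iff useq_def ut_def tri.sel
      using up[OF B(2) M(1)] up[OF B(3) M(2)] up[OF B(4) M(3)] up[OF B(5) M(4)] up[OF B(6) M(5)] up[OF B(7) M(6)] M(1) B(1) by simp
    then show "len (useq a b c d e f n) <= 3 * M * real (n + 1)" using len_ut[of "useq a b c d e f n"] by (simp add: useq_def mult.assoc)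
    show "useq a b c d e f n \<in> carrier PG" by (simp add: useq_def ut_PG)
  qed
qed

lemma size_zero_iff:
  assumes g: "useq a b c d e f \<in> \<S>"
  shows "size (useq a b c d e f) = 0 \<longleftrightarrow> (\<forall>v. lbd v a 0 \<and> lbd v b 0 \<and> lbd v c 0 \<and> lbd v d 0 \<and> lbd v e 0 \<and> lbd v f 0)"
proof (intro iffI allI)
  fix v assume s: "size (useq a b c d e f) = 0"
  have "\<forall>\<^sub>F n in \<omega>. fnorm v (a n v) <= exp (x * real n) \<and> fnorm v (b n v) <= exp (x * real n) \<and> fnorm v (c n v) <= exp (x * real n)
      \<and> fnorm v (d n v) <= exp (x * real n) \<and> fnorm v (e n v) <= exp (x * real n) \<and> fnorm v (f n v) <= exp (x * real n)" if x: "0 < x" for x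
  proof -
    have "\<forall>\<^sub>F n in \<omega>. len (useq a b c d e f n) <= x * real n" using size_bound[OF g, of x] s x by simp
    then show ?thesis
    proof eventually_elim
      case (elim n)
      then have "nrm (useq a b c d e f n) <= exp (x * real n)" by (simp add: len_le_iff)
      then show ?case unfolding nrm_le_iff by (simp add: useq_def ut_def)
    qed
  qed
  then show "lbd v a 0 \<and> lbd v b 0 \<and> lbd v c 0 \<and> lbd v d 0 \<and> lbd v e 0 \<and> lbd v f 0"
    by (simp add: lbd_def eventually_conj_iff)
next
  assume *: "\<forall>v. lbd v a 0 \<and> lbd v b 0 \<and> lbd v c 0 \<and> lbd v d 0 \<and> lbd v e 0 \<and> lbd v f 0"
  have "size (useq a b c d e f) <= 0"
  proof (rule size_le[OF g])
    fix x :: real assume "0 < x"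
    let ?P = "%v n. fnorm v (a n v) <= exp (x/3 * real n) \<and> fnorm v (b n v) <= exp (x/3 * real n) \<and> fnorm v (c n v) <= exp (x/3 * real n)
      \<and> fnorm v (d n v) <= exp (x/3 * real n) \<and> fnorm v (e n v) <= exp (x/3 * real n) \<and> fnorm v (f n v) <= exp (x/3 * real n)"
    have lb: "\<forall>\<^sub>F n in \<omega>. fnorm v (y n v) <= exp (x/3 * real n)" if "lbd v y 0" for v and y :: "'k rseq"
      using that \<open>0 < x\<close> unfolding lbd_def by (auto dest!: spec[of _ "x/3"])
    have "\<forall>\<^sub>F n in \<omega>. ?P v n" for v unfolding eventually_conj_iff using * lb by blast
    then have "\<forall>\<^sub>F n in \<omega>. \<forall>v\<in>UNIV. ?P v n" by (intro eventually_ball_finite) auto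
    then show "\<forall>\<^sub>F n in \<omega>. len (useq a b c d e f n) <= (0 + x) * real n"
    proof eventually_elim
      case (elim n)
      have "nrm (useq a b c d e f n) <= exp (x/3 * real n)" unfolding nrm_le_iff using elim \<open>0 < x\<close> by (simp add: useq_def ut_def)
      then show ?case using len_ut[of "useq a b c d e f n" "a n" "b n" "c n" "d n" "e n" "f n" "x/3 * real n"] by (simp add: useq_def)
    qed
  qed
  then show "size (useq a b c d e f) = 0" using size_nonneg[OF g] by simp
qed

end

section \<open>The flat and the root subgroups\<close>

abbreviation fl :: "real => nat => int" where "fl x n \<equiv> \<lfloor>x * real n\<rfloor>"

datatype root = R12 | R13 | R23 | R24 | R34

text \<open>The root \<open>\<alpha>\<close> as a linear form: conjugating by the point x of the flat divides an entry at v by \<open>exp (n * wt \<alpha> v x)\<close>, up to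
a bounded factor.\<close>

fun wt :: "root => place => (real \<times> real) \<times> (real \<times> real) => real" where
  "wt R12 v x = lam v (fst x)"
| "wt R13 v x = lam v (snd x)"
| "wt R23 v x = lam v (snd x) - lam v (fst x)"
| "wt R24 v x = - lam v (fst x)"
| "wt R34 v x = - lam v (snd x)"

fun relt :: "root => 'k::field rseq => 'k tseq" where
  "relt R12 r = useq r (%n v. 0) (%n v. 0) (%n v. 0) (%n v. 0) (%n v. 0)"
| "relt R13 r = useq (%n v. 0) r (%n v. 0) (%n v. 0) (%n v. 0) (%n v. 0)"
| "relt R23 r = useq (%n v. 0) (%n v. 0) (%n v. 0) r (%n v. 0) (%n v. 0)"
| "relt R24 r = useq (%n v. 0) (%n v. 0) (%n v. 0) (%n v. 0) r (%n v. 0)"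
| "relt R34 r = useq (%n v. 0) (%n v. 0) (%n v. 0) (%n v. 0) (%n v. 0) r"

lemma wt_linear: "wt \<alpha> v (x + y) = wt \<alpha> v x + wt \<alpha> v y" "wt \<alpha> v (c *\<^sub>R x) = c * wt \<alpha> v x"
  by (cases \<alpha>; simp add: lam_linear algebra_simps)+

lemma floor_close: "\<bar>real_of_int \<lfloor>x\<rfloor> - x\<bar> <= 1" by linarith

lemma lam_close:
  assumes "\<bar>p - fst a * m\<bar> <= 1" "\<bar>q - snd a * m\<bar> <= 1" shows "\<bar>lam v (p, q) - lam v a * m\<bar> <= 2"
  using assms by (cases v) (auto simp: algebra_simps abs_le_iff)

lemma lam_floor:
  "\<bar>lam v (real_of_int (fl (fst a) n), real_of_int (fl (snd a) n)) - lam v a * real n\<bar> <= 2" by (rule lam_close) (rule floor_close)+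

lemma linb_zero: "linb (%n v. 0)" unfolding linb_def by simp

definition Ep :: "real \<times> real => nat => 'k::field rf" where
  "Ep a n = tmono (fl (fst a) n) (fl (snd a) n)"

lemma E_seq_Ep: "E_seq x = (%n v. diag (Ep (fst x) n) (Ep (snd x) n))" by (simp add: E_seq_def Ep_def)

lemma Ep_nonzero [simp]: "Ep a n ~= 0" by (simp add: Ep_def)

lemma Ep_norm: "fnorm v (Ep a n) <= exp (- lam v a * real n + 2)" "fnorm v (inverse (Ep a n)) <= exp (lam v a * real n + 2)"
  using lam_floor[of v a n] by (auto simp: Ep_def fnorm_mono fnorm_inverse abs_le_iff simp flip: exp_minus)

lemma sum4_le: "[|x <= a + b + c + d; a <= s; b <= s; c <= s; d <= s|] ==> x <= 4 * s" for x s :: real by linarith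

context abels_cone
begin

lemma lbd_of_bound:
  assumes "!!n. fnorm v (m n v) <= exp (\<mu> * real n + C)" shows "lbd v m \<mu>" unfolding lbd_def
proof (intro allI impI)
  fix e :: real assume "0 < e"
  have "\<forall>\<^sub>F n in \<omega>. C <= e * real n" using \<open>0 < e\<close> by (rule eventually_const_le)
  then show "\<forall>\<^sub>F n in \<omega>. fnorm v (m n v) <= exp ((\<mu> + e) * real n)"
  proof eventually_elim
    case (elim n)
    show ?case by (rule order_trans[OF assms]) (use elim in \<open>simp add: algebra_simps\<close>)
  qed
qed

lemma lbd_scale:
  assumes "!!n. m n v ~= 0" "!!n. fnorm v (m n v) <= exp (\<mu> * real n + C)" "!!n. fnorm v (inverse (m n v)) <= exp (- \<mu> * real n + C)"
  shows "lbd v (%n w. r n w * m n w) s \<longleftrightarrow> lbd v r (s - \<mu>)"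
proof
  assume "lbd v r (s - \<mu>)"
  from lbd_mult[OF this lbd_of_bound[where m = m and \<mu> = \<mu> and C = C, OF assms(2)]] show "lbd v (%n w. r n w * m n w) s" by simp
next
  assume "lbd v (%n w. r n w * m n w) s"
  moreover have "lbd v (%n w. inverse (m n w)) (- \<mu>)" by (rule lbd_of_bound[where C = C]) (rule assms(3))
  ultimately have "lbd v (%n w. r n w * m n w * inverse (m n w)) (s + - \<mu>)" by (rule lbd_mult)
  then show "lbd v r (s - \<mu>)" using assms(1) by (simp add: lbd_def mult.assoc)
qed

lemma E_seq_in: "E_seq x \<in> \<S>"
proof (rule seqsI)
  let ?s = "\<bar>fst (fst x)\<bar> + \<bar>snd (fst x)\<bar> + \<bar>fst (snd x)\<bar> + \<bar>snd (snd x)\<bar>"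
  show "E_seq x n \<in> carrier PG" for n by (simp add: E_seq_def diag_PG tmono_units)
  fix n
  have fl: "\<bar>real_of_int (fl a n)\<bar> <= \<bar>a\<bar> * real n + 1" for a
    using floor_close[of "a * real n"] abs_mult[of a "real n"] by linarith
  have "len (E_seq x n :: place => 'k rf tri) <= \<bar>real_of_int (fl (fst (fst x)) n)\<bar> + \<bar>real_of_int (fl (snd (fst x)) n)\<bar> + \<bar>real_of_int (fl (fst (snd x)) n)\<bar> + \<bar>real_of_int (fl (snd (snd x)) n)\<bar>"
    using len_diag[of "1::'k" 1 "fl (fst (fst x)) n" "fl (snd (fst x)) n" "fl (fst (snd x)) n" "fl (snd (snd x)) n"]
    unfolding E_seq_def by (simp add: cst_hom)
  also have "... <= ?s * real n + 4"
    using fl[of "fst (fst x)"] fl[of "snd (fst x)"] fl[of "fst (snd x)"] fl[of "snd (snd x)"] by (simp add: algebra_simps)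
  also have "... <= (?s + 4) * real (n + 1)" by (simp add: algebra_simps)
  finally show "len (E_seq x n :: place => 'k rf tri) <= (?s + 4) * real (n + 1)" .
qed

definition E :: "(real \<times> real) \<times> (real \<times> real) => _" where
  "E x = point (E_seq x)"

lemma seqs_inv_PG: "g \<in> \<S> ==> (inv\<^sub>s g) n = (%v. tinv (g n v))" by (simp add: seqs_inv PG_inv seqs_in)

lemma sdist_E: "sdist (E_seq x) (E_seq y) <= 4 * dist x y"
proof -
  let ?g = "inv\<^sub>s (E_seq x) \<cdot> E_seq y"
  have g: "?g \<in> \<S>" using E_seq_in by simp
  have eq: "?g n = (%v. diag (cst 1 * tmono (fl (fst (fst y)) n - fl (fst (fst x)) n) (fl (snd (fst y)) n - fl (snd (fst x)) n))
     (cst 1 * tmono (fl (fst (snd y)) n - fl (fst (snd x)) n) (fl (snd (snd y)) n - fl (snd (snd x)) n)))" for n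
    by (simp add: seqs_inv_PG E_seq_in fun_eq_iff) (simp add: E_seq_def tinv_diag tmul_diag tmono_diff cst_hom field_simps)
  have co: "\<bar>fst (fst y) - fst (fst x)\<bar> <= dist x y" "\<bar>snd (fst y) - snd (fst x)\<bar> <= dist x y"
    "\<bar>fst (snd y) - fst (snd x)\<bar> <= dist x y" "\<bar>snd (snd y) - snd (snd x)\<bar> <= dist x y"
    using dist_fst_le[of x y] dist_snd_le[of x y] dist_fst_le[of "fst x" "fst y"] dist_snd_le[of "fst x" "fst y"]
      dist_fst_le[of "snd x" "snd y"] dist_snd_le[of "snd x" "snd y"] by (auto simp: dist_real_def)
  have fl: "\<bar>real_of_int (fl b n - fl a n)\<bar> <= dist x y * real n + 2" if "\<bar>b - a\<bar> <= dist x y" for a b n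
  proof -
    have "\<bar>real_of_int (fl b n - fl a n)\<bar> <= \<bar>(b - a) * real n\<bar> + 2"
      using floor_close[of "b * real n"] floor_close[of "a * real n"] unfolding of_int_diff left_diff_distrib by linarith
    also have "\<bar>(b - a) * real n\<bar> <= dist x y * real n" using that by (simp add: abs_mult mult_right_mono)
    finally show ?thesis by simp
  qed
  have "size ?g <= 4 * dist x y"
  proof (rule size_le[OF g])
    fix e :: real assume "0 < e"
    have "\<forall>\<^sub>F n in \<omega>. 8 <= e * real n" using \<open>0 < e\<close> by (rule eventually_const_le)
    then show "\<forall>\<^sub>F n in \<omega>. len (?g n) <= (4 * dist x y + e) * real n"
    proof eventually_elim
      case (elim n)
      have "len (?g n) <= 4 * (dist x y * real n + 2)"
        unfolding eq by (rule sum4_le[OF len_diag fl[OF co(1)] fl[OF co(2)] fl[OF co(3)] fl[OF co(4)]]) auto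
      then show ?case using elim by (simp add: algebra_simps)
    qed
  qed
  then show ?thesis by (simp add: sdist_def)
qed

sublocale flat_action seqs cone move "point \<one>\<^bsub>seqs\<^esub>" E 4
proof
  have "E_seq 0 = (\<one>\<^bsub>seqs\<^esub> :: 'k tseq)" by (simp add: fun_eq_iff E_seq_def diag_def tone_def tmono_def)
  then show "E 0 = point \<one>\<^bsub>seqs\<^esub>" by (simp add: E_def)
  show "E x \<in> cone" for x by (simp add: E_def point_in E_seq_in)
  show "dist (E x) (E y) <= 4 * dist x y" for x y by (simp add: E_def dist_point E_seq_in sdist_E)
qed simp

lemma stab_size: "u \<in> stab x \<longleftrightarrow> u \<in> \<S> \<and> size (inv\<^sub>s (E_seq x) \<cdot> (u \<cdot> E_seq x)) = 0"
proof (cases "u \<in> \<S>")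
  case True
  have "u \<in> stab x \<longleftrightarrow> sdist (u \<cdot> E_seq x) (E_seq x) = 0"
    using True E_seq_in by (simp add: stab_def E_def move_point point_eq_iff)
  also have "... \<longleftrightarrow> sdist (E_seq x) (u \<cdot> E_seq x) = 0" using sdist_sym True E_seq_in by simp
  finally show ?thesis using True by (simp add: sdist_def)
qed (simp add: stab_def)

text \<open>Conjugating by E_seq x rescales each entry by a monomial, and a unipotent sequence acts trivially on the base point iff all its entries
have growth rate at most zero. The corner is not rescaled at all.\<close>

lemma stab_iff:
  assumes u: "useq a b c d e f \<in> \<S>"
  shows "useq a b c d e f \<in> stab x \<longleftrightarrow> (\<forall>v. lbd v a (wt R12 v x) \<and> lbd v b (wt R13 v x) \<and> lbd v c 0 \<and> lbd v d (wt R23 v x)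
     \<and> lbd v e (wt R24 v x) \<and> lbd v f (wt R34 v x))"
proof -
  let ?P = "%n (v::place). Ep (fst x) n :: 'k rf" and ?Q = "%n (v::place). Ep (snd x) n :: 'k rf"
  let ?g = "inv\<^sub>s (E_seq x) \<cdot> (useq a b c d e f \<cdot> E_seq x)"
  have eq: "?g = useq (%n v. a n v * ?P n v) (%n v. b n v * ?Q n v) c (%n v. d n v * (?Q n v * inverse (?P n v)))
     (%n v. e n v * inverse (?P n v)) (%n v. f n v * inverse (?Q n v))"
    by (simp add: fun_eq_iff seqs_inv_PG E_seq_in) (simp add: E_seq_Ep useq_def tinv_diag, simp add: tmul_def diag_def ut_def field_simps)
  have g: "?g \<in> \<S>" using u E_seq_in by simp
  have sc: "!!r m v rate C. [|!!n. m n v ~= 0; !!n. fnorm v (m n v) <= exp (rate * real n + C);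
      !!n. fnorm v (inverse (m n v)) <= exp (- rate * real n + C)|] ==> lbd v (%n v. r n v * m n v) 0 \<longleftrightarrow> lbd v r (- rate)"
    by (subst lbd_scale) (assumption+, simp)
  have 1: "lbd v (%n v. a n v * ?P n v) 0 \<longleftrightarrow> lbd v a (wt R12 v x)" for v
    using Ep_norm[of v "fst x"] by (subst sc[of _ _ "- lam v (fst x)" 2]) auto
  have 2: "lbd v (%n v. b n v * ?Q n v) 0 \<longleftrightarrow> lbd v b (wt R13 v x)" for v
    using Ep_norm[of v "snd x"] by (subst sc[of _ _ "- lam v (snd x)" 2]) auto
  have 3: "lbd v (%n v. e n v * inverse (?P n v)) 0 \<longleftrightarrow> lbd v e (wt R24 v x)" for v
    using Ep_norm[of v "fst x"] by (subst sc[of _ _ "lam v (fst x)" 2]) auto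
  have 4: "lbd v (%n v. f n v * inverse (?Q n v)) 0 \<longleftrightarrow> lbd v f (wt R34 v x)" for v
    using Ep_norm[of v "snd x"] by (subst sc[of _ _ "lam v (snd x)" 2]) auto
  have m: "fnorm v (y * z) <= exp (s + t)" if "fnorm v y <= exp s" "fnorm v z <= exp t" for v s t and y z :: "'k rf"
    using fnorm_mult_le[OF that] by (simp add: exp_add)
  have 5: "lbd v (%n v. d n v * (?Q n v * inverse (?P n v))) 0 \<longleftrightarrow> lbd v d (wt R23 v x)" for v
    using m[OF Ep_norm(1)[of v "snd x"] Ep_norm(2)[of v "fst x"]] m[OF Ep_norm(2)[of v "snd x"] Ep_norm(1)[of v "fst x"]]
    by (subst sc[of _ _ "lam v (fst x) - lam v (snd x)" 4]) (auto simp: algebra_simps)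
  show ?thesis unfolding stab_size eq using size_zero_iff[OF g[unfolded eq]] 1 2 3 4 5 u by simp
qed

lemma relt_in: "linb r ==> relt \<alpha> r \<in> \<S>" by (cases \<alpha>) (simp_all add: useq_in linb_zero)

lemma relt_stab: "linb r ==> relt \<alpha> r \<in> stab x \<longleftrightarrow> (\<forall>v. lbd v r (wt \<alpha> v x))"
  using stab_iff relt_in[of r \<alpha>] by (cases \<alpha>) (simp_all add: lbd_zero)

text \<open>The fixed set is an intersection of half-spaces.\<close>

lemma relt_stab_convex:
  assumes r: "linb r" and xy: "relt \<alpha> r \<in> stab x" "relt \<alpha> r \<in> stab y" and z: "z \<in> closed_segment x y"
  shows "relt \<alpha> r \<in> stab z"
proof -
  obtain t where t: "0 <= t" "t <= 1" "z = (1 - t) *\<^sub>R x + t *\<^sub>R y" using z by (auto simp: closed_segment_def)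
  have "lbd v r (wt \<alpha> v z)" for v
  proof -
    have w: "wt \<alpha> v z = (1 - t) * wt \<alpha> v x + t * wt \<alpha> v y" by (simp only: t(3) wt_linear)
    have l: "lbd v r (wt \<alpha> v x)" "lbd v r (wt \<alpha> v y)" using xy relt_stab[OF r] by auto
    show ?thesis
    proof (cases "wt \<alpha> v x <= wt \<alpha> v y")
      case True
      then have "wt \<alpha> v x <= wt \<alpha> v z" using t(1) mult_left_mono[OF True t(1)] unfolding w by (simp add: algebra_simps)
      then show ?thesis using l lbd_mono by blast
    next
      case False
      then have "(1 - t) * wt \<alpha> v y <= (1 - t) * wt \<alpha> v x" using t(2) by (intro mult_left_mono) auto
      then have "wt \<alpha> v y <= wt \<alpha> v z" unfolding w by (simp add: algebra_simps)
      then show ?thesis using l lbd_mono by blast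
    qed
  qed
  then show ?thesis using relt_stab[OF r] by simp
qed

definition expo :: "place => 'k rf => real" where
  "expo v u = - ln (fnorm v u)"

definition vec :: "(nat => 'k rf) => (nat => 'k rf) => (real \<times> real) \<times> (real \<times> real)" where
  "vec p q = ((Lim \<omega> (%n. expo At0 (p n) / real n), Lim \<omega> (%n. expo At1 (p n) / real n)),
     (Lim \<omega> (%n. expo At0 (q n) / real n), Lim \<omega> (%n. expo At1 (q n) / real n)))"

lemma expo_mono: "c ~= 0 ==> expo At0 (cst c * tmono i j) = of_int i" "c ~= 0 ==> expo At1 (cst c * tmono i j) = of_int j"
  by (simp_all add: expo_def fnorm_mult fnorm_mono)

lemma diag_seq_exponents:
  assumes a: "(%n v. diag (p n) (q n)) \<in> \<S>"
  obtains c d i j k l where "!!n. c n ~= 0" "!!n. d n ~= 0" "!!n. p n = cst (c n) * tmono (i n) (j n)" "!!n. q n = cst (d n) * tmono (k n) (l n)"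
proof -
  have "p n \<in> units \<and> q n \<in> units" for n using PG_diag[OF seqs_in[OF a, of n]] by (simp add: diag_def)
  then have "\<exists>c i j d k l. c ~= 0 \<and> d ~= 0 \<and> p n = cst c * tmono i j \<and> q n = cst d * tmono k l" for n by (metis unitsE)
  then show ?thesis using that by metis
qed

lemma rate_tendsto:
  assumes h: "h \<in> \<S>" and y: "!!n. \<bar>y n\<bar> <= len (h n)"
  shows "((%n. y n / real n) \<longlongrightarrow> Lim \<omega> (%n. y n / real n)) \<omega>"
proof -
  obtain B where B: "B \<ge> 0" "!!n. len (h n) <= B * real (n + 1)" using seqs_bound[OF h] by blast
  have "\<forall>\<^sub>F n in \<omega>. \<bar>y n / real n\<bar> <= 2 * B" using pos
  proof eventually_elim
    case (elim n)
    have "\<bar>y n\<bar> <= B * real (n + 1)" using y[of n] B(2)[of n] by linarith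
    also have "... <= B * (2 * real n)" using elim B(1) by (intro mult_left_mono) auto
    finally show ?case using elim by (simp add: field_simps)
  qed
  then show ?thesis by (rule ultrafilter_bounded_tendsto_Lim[OF ultra])
qed

text \<open>A sequence of diagonal matrices with exponents i n moves the flat by the limit of i n / n along \<open>\<omega>\<close>. Constant factors have norm 1 and disappear.\<close>

lemma diag_seq_translates:
  assumes a: "(%n v. diag (p n) (q n)) \<in> \<S>"
  shows "translates (%n v. diag (p n) (q n)) (vec p q)" and "norm (vec p q) <= 4 * size (%n v. diag (p n) (q n))"
proof -
  let ?a = "%n (v::place). diag (p n) (q n)"
  obtain c d i j k l where cd: "!!n. c n ~= 0" "!!n. d n ~= 0"
    and pq: "!!n. p n = cst (c n) * tmono (i n) (j n)" "!!n. q n = cst (d n) * tmono (k n) (l n)" using diag_seq_exponents[OF a] by metis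
  have le: "\<bar>real_of_int (i n)\<bar> <= len (?a n)" "\<bar>real_of_int (j n)\<bar> <= len (?a n)" "\<bar>real_of_int (k n)\<bar> <= len (?a n)" "\<bar>real_of_int (l n)\<bar> <= len (?a n)" for n
    using len_ge_diag[of "?a n" "c n" "i n" "j n" "d n" "k n" "l n"] cd by (auto simp: pq)
  define V where "V y = Lim \<omega> (%n. real_of_int (y n) / real n)" for y :: "nat => int"
  have vec: "vec p q = ((V i, V j), (V k, V l))" using cd by (simp add: vec_def pq expo_mono V_def)
  have lim: "((%n. real_of_int (y n) / real n) \<longlongrightarrow> V y) \<omega>" if y: "!!n. \<bar>real_of_int (y n)\<bar> <= len (?a n)" for y
    unfolding V_def by (rule rate_tendsto[OF a y])
  have Vle: "\<bar>V y\<bar> <= size ?a" if y: "!!n. \<bar>real_of_int (y n)\<bar> <= len (?a n)" for y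
  proof (rule tendsto_le[OF nb size_tendsto[OF a] tendsto_rabs[OF lim[OF y]]])
    show "\<forall>\<^sub>F n in \<omega>. \<bar>real_of_int (y n) / real n\<bar> <= len (?a n) / real n"
      using y by (intro always_eventually) (simp add: divide_right_mono)
  qed
  have "norm (vec p q) <= (\<bar>V i\<bar> + \<bar>V j\<bar>) + (\<bar>V k\<bar> + \<bar>V l\<bar>)"
    unfolding vec using norm_Pair_le[of "(V i, V j)" "(V k, V l)"] norm_Pair_le[of "V i" "V j"] norm_Pair_le[of "V k" "V l"] by simp
  then show "norm (vec p q) <= 4 * size ?a" using Vle[OF le(1)] Vle[OF le(2)] Vle[OF le(3)] Vle[OF le(4)] by linarith
  have close: "\<forall>\<^sub>F n in \<omega>. \<bar>real_of_int (fl (V y + t) n - (y n + fl t n))\<bar> <= e * real n"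
    if y: "!!n. \<bar>real_of_int (y n)\<bar> <= len (?a n)" and "0 < e" for y e t
  proof -
    have "\<forall>\<^sub>F n in \<omega>. dist (real_of_int (y n) / real n) (V y) < e / 2" using lim[OF y] \<open>0 < e\<close> by (intro tendstoD) auto
    moreover have "\<forall>\<^sub>F n in \<omega>. 2 <= e / 2 * real n" using \<open>0 < e\<close> by (intro eventually_const_le) auto
    ultimately show ?thesis using pos
    proof eventually_elim
      case (elim n)
      have "\<bar>real_of_int (y n) - V y * real n\<bar> = \<bar>real_of_int (y n) / real n - V y\<bar> * real n"
        using elim(3) by (simp add: abs_mult_pos' field_simps flip: abs_mult_pos)
      also have "... <= e / 2 * real n" using elim by (intro mult_right_mono) (auto simp: dist_real_def)
      finally have a: "\<bar>real_of_int (y n) - V y * real n\<bar> <= e / 2 * real n" .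
      have "\<bar>real_of_int (fl (V y + t) n) - (V y * real n + t * real n)\<bar> <= 1"
        using floor_close[of "(V y + t) * real n"] by (simp only: distrib_right)
      moreover have "e / 2 * real n + e / 2 * real n = e * real n" by simp
      ultimately show ?case using floor_close[of "t * real n"] elim(2) a unfolding of_int_diff of_int_add by linarith
    qed
  qed
  show "translates ?a (vec p q)" unfolding translates_def
  proof (intro conjI allI a)
    fix x
    let ?v = "vec p q"
    let ?g = "inv\<^sub>s (?a \<cdot> E_seq x) \<cdot> E_seq (?v + x)"
    have aE: "?a \<cdot> E_seq x \<in> \<S>" using a E_seq_in by simp
    let ?K = "%n. fl (V i + fst (fst x)) n - (i n + fl (fst (fst x)) n)"
    let ?L = "%n. fl (V j + snd (fst x)) n - (j n + fl (snd (fst x)) n)"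
    let ?M = "%n. fl (V k + fst (snd x)) n - (k n + fl (fst (snd x)) n)"
    let ?N = "%n. fl (V l + snd (snd x)) n - (l n + fl (snd (snd x)) n)"
    have eq: "?g n = (%v. diag (cst (inverse (c n)) * tmono (?K n) (?L n)) (cst (inverse (d n)) * tmono (?M n) (?N n)))" for n
      using cd by (simp add: seqs_inv_PG aE fun_eq_iff) (simp add: E_seq_def pq vec tinv_diag tmul_diag tmono_diff tmono_add cst_inverse, simp add: field_simps)
    have g: "?g \<in> \<S>" using aE E_seq_in by simp
    have "size ?g <= 0"
    proof (rule size_le[OF g])
      fix e :: real assume "0 < e"
      then have e: "0 < e / 4" by simp
      show "\<forall>\<^sub>F n in \<omega>. len (?g n) <= (0 + e) * real n"
        using close[OF le(1) e, of "fst (fst x)"] close[OF le(2) e, of "snd (fst x)"] close[OF le(3) e, of "fst (snd x)"] close[OF le(4) e, of "snd (snd x)"]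
      proof eventually_elim
        case (elim n)
        have "len (?g n) <= \<bar>real_of_int (?K n)\<bar> + \<bar>real_of_int (?L n)\<bar> + \<bar>real_of_int (?M n)\<bar> + \<bar>real_of_int (?N n)\<bar>"
          unfolding eq using cd by (intro len_diag) auto
        from sum4_le[OF this elim] show ?case by simp
      qed
    qed
    then have "sdist (?a \<cdot> E_seq x) (E_seq (?v + x)) = 0" using size_nonneg[OF g] by (simp add: sdist_def)
    then show "move ?a (E x) = E (?v + x)" using a aE E_seq_in by (simp add: E_def move_point point_eq_iff)
  qed
qed

end

lemma tmul_ut: "tmul (ut a b c d e f) (ut a' b' c' d' e' f') = ut (a' + a) (b' + a * d' + b) (c' + a * e' + b * f' + c) (d' + d) (e' + d * f' + e) (f' + f)"
  by (simp add: tmul_def ut_def)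

section \<open>Reindexing path families\<close>

context isometric_action
begin

text \<open>Pulling a family back along \<open>\<phi>\<close> requires a choice of representatives, whose class does not depend on it.\<close>

definition reindex :: "('i => 'j) => ('i => real) => ('j => 'a \<times> (real => 'y)) set => ('i => 'a \<times> (real => 'y)) set" where
  "reindex \<phi> rho A = family_rel rho `` {%j. (SOME F. F \<in> A) (\<phi> j)}"

definition endpoint :: "('j => 'a \<times> (real => 'y)) set => 'j => 'a" where
  "endpoint A j = fst ((SOME F. F \<in> A) j)"

lemma class_rep:
  assumes "!!j. 0 <= rho j" "F \<in> families rho" shows "(F, SOME G. G \<in> family_rel rho `` {F}) \<in> family_rel rho"
proof -
  have "F \<in> family_rel rho `` {F}" using equiv_class_self[OF equiv_family_rel[OF assms(1)] assms(2)] .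
  then have "(SOME G. G \<in> family_rel rho `` {F}) \<in> family_rel rho `` {F}" by (rule someI[where P = "%G. G \<in> family_rel rho `` {F}"])
  then show ?thesis by simp
qed

lemma endpoint_class:
  assumes "!!j. 0 <= rho j" "F \<in> families rho" shows "endpoint (family_rel rho `` {F}) = (%j. fst (F j))"
proof -
  let ?G = "SOME G. G \<in> family_rel rho `` {F}"
  obtain C where "!!j. phom (C * rho j) (F j) (?G j)" using class_rep[OF assms] unfolding family_rel_def by blast
  then show ?thesis by (auto simp: endpoint_def phom_def fun_eq_iff)
qed

lemma path_group_cases:
  assumes "A \<in> carrier (path_group rho)" obtains F where "F \<in> families rho" "A = family_rel rho `` {F}"
  using assms by (auto simp: path_group_def quotient_def)

lemma endpoint_mult:
  assumes rho: "!!j. 0 <= rho j" and "A \<in> carrier (path_group rho)" "B \<in> carrier (path_group rho)"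
  shows "endpoint (A \<otimes>\<^bsub>path_group rho\<^esub> B) = (%j. endpoint A j \<otimes> endpoint B j)"
proof -
  obtain F where F: "F \<in> families rho" "A = family_rel rho `` {F}" using path_group_cases[OF assms(2)] .
  obtain G where G: "G \<in> families rho" "B = family_rel rho `` {G}" using path_group_cases[OF assms(3)] .
  show ?thesis unfolding F(2) G(2) path_group_mult[OF rho F(1) G(1)] endpoint_class[OF rho families_mult[OF rho F(1) G(1)]]
      endpoint_class[OF rho F(1)] endpoint_class[OF rho G(1)] by (simp add: pmult_def)
qed

lemma endpoint_closed:
  assumes rho: "!!j. 0 <= rho j" and "A \<in> carrier (path_group rho)" shows "endpoint A j \<in> carrier H"
proof -
  obtain F where F: "F \<in> families rho" "A = family_rel rho `` {F}" using path_group_cases[OF assms(2)] .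
  then show ?thesis using endpoint_class[OF rho F(1)] unfolding families_def path_ok_def by auto
qed

lemma endpoint_commutator:
  assumes rho: "!!j. 0 <= rho j" and A: "A \<in> carrier (path_group rho)" and B: "B \<in> carrier (path_group rho)"
  shows "endpoint (group.commutator (path_group rho) A B) = (%j. commutator (endpoint A j) (endpoint B j))"
proof
  fix j
  interpret P: group "path_group rho" by (rule path_group[OF rho])
  have "A \<otimes>\<^bsub>path_group rho\<^esub> B = P.commutator A B \<otimes>\<^bsub>path_group rho\<^esub> (B \<otimes>\<^bsub>path_group rho\<^esub> A)" by (rule P.swap_commutator[OF A B])
  from arg_cong[OF this, of "%X. endpoint X j"]
  have "endpoint A j \<otimes> endpoint B j = endpoint (P.commutator A B) j \<otimes> (endpoint B j \<otimes> endpoint A j)"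
    using A B P.commutator_closed[OF A B] by (simp add: endpoint_mult[OF rho])
  then show "endpoint (P.commutator A B) j = commutator (endpoint A j) (endpoint B j)"
    using endpoint_closed[where rho = rho, OF rho] A B P.commutator_closed[OF A B] by (intro commutatorI[symmetric]) auto
qed

context
  fixes rho :: "'i => real" and rho' :: "'j => real" and \<phi> :: "'i => 'j" and C :: real
  assumes rho: "!!i. 0 <= rho i" and rho': "!!j. 0 <= rho' j" and C: "0 <= C" and \<phi>: "!!i. rho' (\<phi> i) <= C * rho i"
begin

lemma scale_le: "0 <= D ==> D * rho' (\<phi> i) <= (D * C) * rho i" using mult_left_mono[OF \<phi>, of D i] by (simp add: mult.assoc)

lemma families_reindex: "F \<in> families rho' ==> (%i. F (\<phi> i)) \<in> families rho"
proof -
  assume "F \<in> families rho'"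
  then obtain D where D: "0 <= D" "!!j. path_ok (D * rho' j) (F j)" unfolding families_def by blast
  have "path_ok ((D * C) * rho i) (F (\<phi> i))" for i by (rule path_ok_mono[OF D(2) scale_le[OF D(1)]])
  then show ?thesis using D C unfolding families_def by (auto intro!: exI[of _ "D * C"])
qed

lemma rel_reindex: "(F, G) \<in> family_rel rho' ==> (%i. F (\<phi> i), %i. G (\<phi> i)) \<in> family_rel rho"
proof -
  assume FG: "(F, G) \<in> family_rel rho'"
  then obtain D where D: "0 <= D" "!!j. phom (D * rho' j) (F j) (G j)" unfolding family_rel_def by blast
  have "phom ((D * C) * rho i) (F (\<phi> i)) (G (\<phi> i))" for i by (rule phom_mono[OF D(2) scale_le[OF D(1)]])
  then have "\<exists>D\<ge>0. \<forall>i. phom (D * rho i) (F (\<phi> i)) (G (\<phi> i))" using D C by (intro exI[of _ "D * C"]) auto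
  then show ?thesis using FG families_reindex unfolding family_rel_def by blast
qed

lemma reindex_class: "F \<in> families rho' ==> reindex \<phi> rho (family_rel rho' `` {F}) = family_rel rho `` {%i. F (\<phi> i)}"
  unfolding reindex_def using equiv_class_eq[OF equiv_family_rel[OF rho] rel_reindex[OF class_rep[OF rho']]] by auto

lemma reindex_hom: "group_hom (path_group rho') (path_group rho) (reindex \<phi> rho)"
proof -
  interpret P: group "path_group rho" by (rule path_group[OF rho])
  interpret P': group "path_group rho'" by (rule path_group[OF rho'])
  show ?thesis
  proof (unfold_locales, rule homI)
    fix A B assume A: "A \<in> carrier (path_group rho')"
    obtain F where F: "F \<in> families rho'" "A = family_rel rho' `` {F}" using path_group_cases[OF A] .
    show "reindex \<phi> rho A \<in> carrier (path_group rho)"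
      unfolding F(2) reindex_class[OF F(1)] by (rule path_group_carrier[OF families_reindex[OF F(1)]])
    assume B: "B \<in> carrier (path_group rho')"
    obtain G where G: "G \<in> families rho'" "B = family_rel rho' `` {G}" using path_group_cases[OF B] .
    show "reindex \<phi> rho (A \<otimes>\<^bsub>path_group rho'\<^esub> B) = reindex \<phi> rho A \<otimes>\<^bsub>path_group rho\<^esub> reindex \<phi> rho B"
      unfolding F(2) G(2) path_group_mult[OF rho' F(1) G(1)] reindex_class[OF F(1)] reindex_class[OF G(1)]
        reindex_class[OF families_mult[OF rho' F(1) G(1)]] path_group_mult[OF rho families_reindex[OF F(1)] families_reindex[OF G(1)]] ..
  qed
qed

lemma reindex_commutator:
  assumes A: "A \<in> carrier (path_group rho')" and B: "B \<in> carrier (path_group rho')"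
  shows "reindex \<phi> rho (group.commutator (path_group rho') A B) = group.commutator (path_group rho) (reindex \<phi> rho A) (reindex \<phi> rho B)"
proof -
  interpret h: group_hom "path_group rho'" "path_group rho" "reindex \<phi> rho" by (rule reindex_hom)
  show ?thesis using A B by (simp add: h.G.commutator_def h.H.commutator_def)
qed

end

end

context flat_action
begin

lemma reindex_letter:
  assumes "!!i. 0 <= rho i" "!!j. 0 <= rho' j" "0 <= C" "!!i. rho' (\<phi> i) <= C * rho i" "!!j. u j \<in> stab (x j)" "bounded_by rho' x"
  shows "reindex \<phi> rho (letter_class rho' u x) = letter_class rho (%i. u (\<phi> i)) (%i. x (\<phi> i))" unfolding letter_class_def
  by (rule reindex_class[where rho' = rho', OF assms(1,2,3,4) letter_families[where rho = rho', OF assms(2,5,6)]])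

lemma reindex_straight:
  assumes "!!i. 0 <= rho i" "!!j. 0 <= rho' j" "0 <= C" "!!i. rho' (\<phi> i) <= C * rho i" "!!j. translates (u j) (x j)" "bounded_by rho' x"
  shows "reindex \<phi> rho (straight_class rho' u x) = straight_class rho (%i. u (\<phi> i)) (%i. x (\<phi> i))" unfolding straight_class_def
  by (rule reindex_class[where rho' = rho', OF assms(1,2,3,4) straight_families[where rho = rho', OF assms(2,5,6)]])

lemma bounded_by_reindex:
  assumes "bounded_by rho' x" "0 <= C" "!!i. rho' (\<phi> i) <= C * rho i" shows "bounded_by rho (%i. x (\<phi> i))"
proof -
  obtain D where D: "0 <= D" "!!j. norm (x j) <= D * rho' j" using assms(1) unfolding bounded_by_def by blast
  have "norm (x (\<phi> i)) <= (D * C) * rho i" for i using order_trans[OF D(2) mult_left_mono[OF assms(3) D(1)]] by (simp add: mult.assoc)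
  then show ?thesis using D assms(2) unfolding bounded_by_def by (intro exI[of _ "D * C"]) auto
qed

lemma endpoint_letter:
  assumes "!!i. 0 <= rho i" "!!j. u j \<in> stab (x j)" "bounded_by rho x" shows "endpoint (letter_class rho u x) = u"
  unfolding letter_class_def endpoint_class[where rho = rho, OF assms(1) letter_families[where rho = rho, OF assms]] by (simp add: letter_def)

lemma endpoint_straight:
  assumes "!!i. 0 <= rho i" "!!j. translates (u j) (x j)" "bounded_by rho x" shows "endpoint (straight_class rho u x) = u"
  unfolding straight_class_def endpoint_class[where rho = rho, OF assms(1) straight_families[where rho = rho, OF assms]] by (simp add: straight_def)

end

section \<open>A homomorphic section of the path group\<close>

type_synonym ('j, 'k) fam = "'j => 'k rseq"

text \<open>Restricts a family to the place v, that is, to one factor of the product over the places.\<close>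

definition pr :: "place => ('j, 'k::field) fam => ('j, 'k) fam" where
  "pr v r = (%j n w. if w = v then r j n w else 0)"

lemma pr_hom: "pr v (r + s) = pr v r + pr v s" "pr v (r * s) = pr v r * pr v s" by (auto simp: pr_def fun_eq_iff)

text \<open>A direction in which the exponent at v grows while that at w stays put; for \<open>v = w\<close> any direction in which it grows.\<close>

fun dual :: "place => place => real \<times> real" where
  "dual At0 At1 = (1, 0)" | "dual At0 AtInf = (1, -1)" | "dual At1 At0 = (0, 1)" | "dual At1 AtInf = (-1, 1)"
| "dual AtInf At0 = (0, -1)" | "dual AtInf At1 = (-1, 0)"
| "dual At0 At0 = (1, 0)" | "dual At1 At1 = (0, 1)" | "dual AtInf AtInf = (-1, 0)"

lemma lam_dual: "lam v (dual v w) = 1" "v ~= w ==> lam w (dual v w) = 0" by (cases v; cases w; simp)+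

text \<open>A direction in the flat on which the root takes the value \<open>lam v \<xi>\<close>, and which is neutral for all roots at every place where \<open>\<xi>\<close> is.\<close>

fun direction :: "root => real \<times> real => (real \<times> real) \<times> (real \<times> real)" where
  "direction R12 \<xi> = (\<xi>, 0)" | "direction R13 \<xi> = (0, \<xi>)" | "direction R23 \<xi> = (0, \<xi>)"
| "direction R24 \<xi> = (- \<xi>, 0)" | "direction R34 \<xi> = (0, - \<xi>)"

lemma wt_direction: "wt \<alpha> v (direction \<alpha> \<xi>) = lam v \<xi>" "lam v \<xi> = 0 ==> wt \<alpha> v (direction \<beta> \<xi>) = 0"
  by (cases \<alpha>; simp add: lam_linear)(cases \<alpha>; cases \<beta>; simp add: lam_linear)

lemma linb_add: "linb r ==> linb s ==> linb (%n v. r n v + s n v)"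
proof -
  assume "linb r" "linb s"
  then obtain B C where B: "!!n v. fnorm v (r n v) <= exp (B * real (n + 1))" and C: "!!n v. fnorm v (s n v) <= exp (C * real (n + 1))"
    by (metis linb_obtain)
  have "fnorm v (r n v + s n v) <= exp (max B C * real (n + 1))" for n v
    by (intro fnorm_add_le order_trans[OF B] order_trans[OF C]) (simp_all add: mult_right_mono)
  then show ?thesis unfolding linb_def by blast
qed

lemma linb_mult: "linb r ==> linb s ==> linb (%n v. r n v * s n v)"
proof -
  assume "linb r" "linb s"
  then obtain B C where B: "!!n v. fnorm v (r n v) <= exp (B * real (n + 1))" and C: "!!n v. fnorm v (s n v) <= exp (C * real (n + 1))"
    by (metis linb_obtain)
  have "fnorm v (r n v * s n v) <= exp ((B + C) * real (n + 1))" for n v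
    using fnorm_mult_le[OF B[of v n] C[of v n]] by (simp add: exp_add distrib_right)
  then show ?thesis unfolding linb_def by blast
qed

lemma linb_pr: "linb (r j) ==> linb (pr v r j)"
proof -
  assume "linb (r j)"
  then obtain B where B: "!!n v. fnorm v (r j n v) <= exp (B * real (n + 1))" unfolding linb_def by blast
  have "fnorm w (pr v r j n w) <= exp (B * real (n + 1))" for n w using B[of w n] by (cases "w = v") (simp_all add: pr_def)
  then show ?thesis unfolding linb_def by blast
qed

context abels_cone
begin

definition dpart :: "('k tseq) => 'k tseq" where
  "dpart h = (%n v. diag (d2 (h n At0)) (d3 (h n At0)))"

definition dvec :: "('k tseq) => (real \<times> real) \<times> (real \<times> real)" where
  "dvec h = vec (%n. d2 (h n At0)) (%n. d3 (h n At0))"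

lemma seqs_diag: "h \<in> \<S> ==> d2 (h n v) = d2 (h n At0) \<and> d3 (h n v) = d3 (h n At0)" using seqs_in[of h n] unfolding PG_iff by blast

lemma seqs_nonzero: "h \<in> \<S> ==> d2 (h n v) ~= 0 \<and> d3 (h n v) ~= 0" using PG_nonzero[OF seqs_in[of h n]] by blast

lemma len_dpart:
  assumes h: "h \<in> \<S>" shows "len (dpart h n) <= len (h n)"
proof -
  have n: "nrm (h n) <= exp (len (h n))" "nrm (%v. tinv (h n v)) <= exp (len (h n))" using len_le_iff[of "h n" "len (h n)"] by auto
  have "fnorm v (d2 (tinv (h n v))) <= exp (len (h n))" "fnorm v (d3 (tinv (h n v))) <= exp (len (h n))" for v using n(2) unfolding nrm_le_iff by auto
  then have "fnorm v (inverse (d2 (h n v))) <= exp (len (h n))" "fnorm v (inverse (d3 (h n v))) <= exp (len (h n))" for v by (simp_all add: tinv_def)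
  then have i: "fnorm v (inverse (d2 (h n At0))) <= exp (len (h n))" "fnorm v (inverse (d3 (h n At0))) <= exp (len (h n))" for v
    using seqs_diag[OF h, of n v] by metis+
  have "fnorm v (d2 (h n v)) <= exp (len (h n))" "fnorm v (d3 (h n v)) <= exp (len (h n))" for v using n(1) unfolding nrm_le_iff by auto
  then have d: "fnorm v (d2 (h n At0)) <= exp (len (h n))" "fnorm v (d3 (h n At0)) <= exp (len (h n))" for v using seqs_diag[OF h, of n v] by metis+
  show ?thesis unfolding len_le_iff nrm_le_iff dpart_def tinv_diag using i d len_nonneg[OF seqs_in[OF h], of n] by (simp add: diag_def)
qed

lemma dpart_in: assumes h: "h \<in> \<S>" shows "dpart h \<in> \<S>" "size (dpart h) <= size h"
proof -
  obtain B where B: "B \<ge> 0" "!!n. len (h n) <= B * real (n + 1)" using seqs_bound[OF h] by blast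
  show d: "dpart h \<in> \<S>"
  proof (rule seqsI)
    show "dpart h n \<in> carrier PG" for n unfolding dpart_def using PG_diag[OF seqs_in[OF h, of n], of At0] by (intro diag_PG) auto
    show "len (dpart h n) <= B * real (n + 1)" for n using len_dpart[OF h, of n] B(2)[of n] by linarith
  qed
  show "size (dpart h) <= size h"
  proof (rule tendsto_le[OF nb size_tendsto[OF h] size_tendsto[OF d]])
    show "\<forall>\<^sub>F n in \<omega>. len (dpart h n) / real n <= len (h n) / real n"
      using len_dpart[OF h] by (intro always_eventually) (simp add: divide_right_mono)
  qed
qed

lemma dpart_translates: assumes h: "h \<in> \<S>" shows "translates (dpart h) (dvec h)" "norm (dvec h) <= 4 * size h"
  using diag_seq_translates[of "%n. d2 (h n At0)" "%n. d3 (h n At0)"] dpart_in[OF h] unfolding dpart_def dvec_def by auto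

lemma entry_sizes:
  assumes h: "h \<in> \<S>" and r: "!!n v. fnorm v (r n v) <= exp (len (h n))" shows "linb r" "lbd v r (size h)"
proof -
  obtain B where B: "B \<ge> 0" "!!n. len (h n) <= B * real (n + 1)" using seqs_bound[OF h] by blast
  have "fnorm v (r n v) <= exp (B * real (n + 1))" for n v by (rule order_trans[OF r]) (use B(2)[of n] in simp)
  then show "linb r" unfolding linb_def by blast
  show "lbd v r (size h)" unfolding lbd_def
  proof (intro allI impI)
    fix e :: real assume "0 < e"
    have "\<forall>\<^sub>F n in \<omega>. len (h n) <= (size h + e) * real n" using size_bound[OF h, of "size h + e"] \<open>0 < e\<close> by simp
    then show "\<forall>\<^sub>F n in \<omega>. fnorm v (r n v) <= exp ((size h + e) * real n)" by eventually_elim (rule order_trans[OF r], simp)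
  qed
qed

text \<open>The character by which conjugation with the diagonal part of g acts on a root subgroup.\<close>

fun chi :: "root => ('j => 'k tseq) => ('j, 'k) fam" where
  "chi R12 g = (%j n v. inverse (d2 (g j n v)))"
| "chi R13 g = (%j n v. inverse (d3 (g j n v)))"
| "chi R23 g = (%j n v. d2 (g j n v)) * (%j n v. inverse (d3 (g j n v)))"
| "chi R24 g = (%j n v. d2 (g j n v))"
| "chi R34 g = (%j n v. d3 (g j n v))"

text \<open>The functions f12 to f34 are the entries of the unipotent factor u in the decomposition \<open>g = u d\<close> with d diagonal.\<close>

definition f12 :: "('j => 'k tseq) => ('j, 'k) fam" where
  "f12 g = (%j n v. e12 (g j n v)) * (%j n v. inverse (d2 (g j n v)))"

definition f13 :: "('j => 'k tseq) => ('j, 'k) fam" where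
  "f13 g = (%j n v. e13 (g j n v)) * (%j n v. inverse (d3 (g j n v)))"

definition f14 :: "('j => 'k tseq) => ('j, 'k) fam" where
  "f14 g = (%j n v. e14 (g j n v))"

definition f23 :: "('j => 'k tseq) => ('j, 'k) fam" where
  "f23 g = (%j n v. e23 (g j n v)) * (%j n v. inverse (d3 (g j n v)))"

definition f24 :: "('j => 'k tseq) => ('j, 'k) fam" where
  "f24 g = (%j n v. e24 (g j n v))"

definition f34 :: "('j => 'k tseq) => ('j, 'k) fam" where
  "f34 g = (%j n v. e34 (g j n v))"

lemmas coords_def = f12_def f13_def f14_def f23_def f24_def f34_def

lemma conj_relt:
  assumes h: "h \<in> \<S>" and r: "linb (r j)" and g: "g j = h"
  shows "dpart h \<cdot> relt \<alpha> (pr v r j) \<cdot> inv\<^sub>s (dpart h) = relt \<alpha> (pr v (chi \<alpha> g * r) j)"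
proof (intro ext)
  fix n w
  have nz: "d2 (h n At0) ~= 0" "d3 (h n At0) ~= 0" using seqs_nonzero[OF h, of n At0] by auto
  have d: "d2 (h n w) = d2 (h n At0)" "d3 (h n w) = d3 (h n At0)" using seqs_diag[OF h, of n w] by auto
  have iv: "(inv\<^sub>s (dpart h)) n w = diag (inverse (d2 (h n At0))) (inverse (d3 (h n At0)))"
    unfolding seqs_inv_PG[OF dpart_in(1)[OF h]] by (simp add: dpart_def tinv_diag)
  show "(dpart h \<cdot> relt \<alpha> (pr v r j) \<cdot> inv\<^sub>s (dpart h)) n w = relt \<alpha> (pr v (chi \<alpha> g * r) j) n w"
    unfolding seqs_mult PG_mult iv using nz d by (cases "w = v"; cases \<alpha>) (simp_all add: dpart_def useq_def ut_def diag_def tmul_def pr_def g)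
qed

lemma useq_mult: "useq a b c d e f \<cdot> useq a' b' c' d' e' f' = useq (%n v. a' n v + a n v) (%n v. b' n v + a n v * d' n v + b n v)
    (%n v. c' n v + a n v * e' n v + b n v * f' n v + c n v) (%n v. d' n v + d n v) (%n v. e' n v + d n v * f' n v + e n v) (%n v. f' n v + f n v)"
  by (simp add: fun_eq_iff) (simp add: useq_def tmul_ut)

lemma expo_mult: "a ~= 0 ==> b ~= 0 ==> expo v (a * b) = expo v a + expo v b"
  using fnorm_pos[of a v] fnorm_pos[of b v] by (simp add: expo_def fnorm_mult ln_mult)

lemma expo_tendsto:
  assumes h: "h \<in> \<S>"
  shows "((%n. expo v (d2 (h n At0)) / real n) \<longlongrightarrow> Lim \<omega> (%n. expo v (d2 (h n At0)) / real n)) \<omega>"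
    "((%n. expo v (d3 (h n At0)) / real n) \<longlongrightarrow> Lim \<omega> (%n. expo v (d3 (h n At0)) / real n)) \<omega>"
proof -
  have ex: "\<bar>expo v x\<bar> <= s" if "fnorm v x <= exp s" "fnorm v (inverse x) <= exp s" "x ~= 0" for x s
  proof -
    have p: "0 < fnorm v x" using that(3) by (rule fnorm_pos)
    then have "ln (fnorm v x) <= s" using that(1) by (metis exp_gt_zero ln_exp ln_le_cancel_iff)
    moreover have "ln (fnorm v (inverse x)) <= s" using that(2,3) p by (metis exp_gt_zero ln_exp ln_le_cancel_iff fnorm_inverse positive_imp_inverse_positive)
    ultimately show ?thesis using p by (simp add: expo_def fnorm_inverse ln_inverse)
  qed
  have n: "nrm (h n) <= exp (len (h n))" "nrm (%v. tinv (h n v)) <= exp (len (h n))" for n using len_le_iff[of "h n" "len (h n)"] by auto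
  have e2: "\<bar>expo v (d2 (h n v))\<bar> <= len (h n)" "\<bar>expo v (d3 (h n v))\<bar> <= len (h n)" for n
    using n[unfolded nrm_le_iff, of n] seqs_nonzero[OF h, of n v] by (auto intro!: ex simp: tinv_def)
  have e: "\<bar>expo v (d2 (h n At0))\<bar> <= len (h n)" "\<bar>expo v (d3 (h n At0))\<bar> <= len (h n)" for n
    using e2[of n] seqs_diag[OF h, of n v] by auto
  show "((%n. expo v (d2 (h n At0)) / real n) \<longlongrightarrow> Lim \<omega> (%n. expo v (d2 (h n At0)) / real n)) \<omega>"
    "((%n. expo v (d3 (h n At0)) / real n) \<longlongrightarrow> Lim \<omega> (%n. expo v (d3 (h n At0)) / real n)) \<omega>"
    by (rule rate_tendsto[OF h], rule e)+
qed

lemma dvec_mult: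
  assumes g: "g \<in> \<S>" and h: "h \<in> \<S>" shows "dvec (g \<cdot> h) = dvec g + dvec h"
proof -
  have d: "d2 ((g \<cdot> h) n At0) = d2 (g n At0) * d2 (h n At0)" "d3 ((g \<cdot> h) n At0) = d3 (g n At0) * d3 (h n At0)" for n
    by (simp_all add: tmul_def)
  have ex: "expo v (d2 (g n At0) * d2 (h n At0)) / real n = expo v (d2 (g n At0)) / real n + expo v (d2 (h n At0)) / real n"
    "expo v (d3 (g n At0) * d3 (h n At0)) / real n = expo v (d3 (g n At0)) / real n + expo v (d3 (h n At0)) / real n" for v n
    using seqs_nonzero[OF g, of n At0] seqs_nonzero[OF h, of n At0] by (simp_all add: expo_mult add_divide_distrib)
  have "Lim \<omega> (%n. expo v (d2 ((g \<cdot> h) n At0)) / real n) = Lim \<omega> (%n. expo v (d2 (g n At0)) / real n) + Lim \<omega> (%n. expo v (d2 (h n At0)) / real n)" for v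
    using tendsto_Lim[OF nb tendsto_add[OF expo_tendsto(1)[OF g, of v] expo_tendsto(1)[OF h, of v]]] by (simp add: d ex del: seqs_mult)
  moreover have "Lim \<omega> (%n. expo v (d3 ((g \<cdot> h) n At0)) / real n) = Lim \<omega> (%n. expo v (d3 (g n At0)) / real n) + Lim \<omega> (%n. expo v (d3 (h n At0)) / real n)" for v
    using tendsto_Lim[OF nb tendsto_add[OF expo_tendsto(2)[OF g, of v] expo_tendsto(2)[OF h, of v]]] by (simp add: d ex del: seqs_mult)
  ultimately show ?thesis by (simp add: dvec_def vec_def del: seqs_mult)
qed

lemma dpart_mult: "dpart (g \<cdot> h) = dpart g \<cdot> dpart h" by (simp add: fun_eq_iff dpart_def tmul_diag) (simp add: tmul_def)

context
  fixes rho :: "'j => real"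
begin

abbreviation PC where "PC \<equiv> carrier (path_group rho)"
abbreviation pm (infixl "\<odot>" 70) where "x \<odot> y \<equiv> x \<otimes>\<^bsub>path_group rho\<^esub> y"

definition bnd :: "('j, 'k) fam => bool" where
  "bnd r \<longleftrightarrow> (\<forall>j. linb (r j)) \<and> (\<exists>C\<ge>0. \<forall>j v. lbd v (r j) (C * rho j))"

lemma bnd_linb: "bnd r ==> linb (r j)" by (simp add: bnd_def)

lemma linb_pr_bnd: "bnd r ==> linb (pr v r j)" using linb_pr[of r j v] by (simp add: bnd_linb)

lemma bnd_obtain: assumes "bnd r" obtains C where "0 <= C" "!!j v. lbd v (r j) (C * rho j)" using assms unfolding bnd_def by blast

definition admits :: "root => ('j, 'k) fam => ('j => (real \<times> real) \<times> (real \<times> real)) => bool" where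
  "admits \<alpha> r x \<longleftrightarrow> (\<forall>j. relt \<alpha> (r j) \<in> stab (x j)) \<and> bounded_by rho x"

text \<open>The class does not depend on the turning point, because the set of admissible ones is convex.\<close>

definition X :: "root => ('j, 'k) fam => _" where
  "X \<alpha> r = letter_class rho (%j. relt \<alpha> (r j)) (SOME x. admits \<alpha> r x)"

definition ZZ :: "place => ('j, 'k) fam => _" where
  "ZZ v r = group.commutator (path_group rho) (X R13 (pr v r)) (X R34 (pr v 1))"

definition psi :: "place => ('j, 'k) fam => ('j, 'k) fam => ('j, 'k) fam => ('j, 'k) fam => ('j, 'k) fam => ('j, 'k) fam => _" where
  "psi v a12 a13 a14 a23 a24 a34 = ZZ v a14 \<odot> (X R24 (pr v a24) \<odot> (X R34 (pr v a34) \<odot>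
     (X R13 (pr v a13) \<odot> (X R23 (pr v a23) \<odot> X R12 (pr v a12)))))"

definition Psi :: "('j, 'k) fam => ('j, 'k) fam => ('j, 'k) fam => ('j, 'k) fam => ('j, 'k) fam => ('j, 'k) fam => _" where
  "Psi a12 a13 a14 a23 a24 a34 = psi At0 a12 a13 a14 a23 a24 a34 \<odot>
     (psi At1 a12 a13 a14 a23 a24 a34 \<odot> psi AtInf a12 a13 a14 a23 a24 a34)"

definition okf :: "('j => 'k tseq) => bool" where
  "okf g \<longleftrightarrow> (\<forall>j. g j \<in> \<S>) \<and> (\<exists>C\<ge>0. \<forall>j. size (g j) <= C * rho j)"

definition T :: "('j => 'k tseq) => _" where
  "T g = straight_class rho (%j. dpart (g j)) (%j. dvec (g j))"

definition Phi :: "('j => 'k tseq) => _" where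
  "Phi g = Psi (f12 g) (f13 g) (f14 g) (f23 g) (f24 g) (f34 g) \<odot> T g"

lemma bnd_entries:
  assumes g: "okf g" and r: "!!j n v. fnorm v (r j n v) <= exp (len (g j n))" shows "bnd r"
proof -
  have s: "g j \<in> \<S>" for j using g by (simp add: okf_def)
  obtain C where C: "0 <= C" "!!j. size (g j) <= C * rho j" using g unfolding okf_def by blast
  have "linb (r j)" "lbd v (r j) (C * rho j)" for j v using entry_sizes(1)[OF s[of j] r] lbd_mono[OF entry_sizes(2)[OF s[of j] r] C(2)] by auto
  then show ?thesis using C(1) unfolding bnd_def by blast
qed

lemma okf_seqs: "okf g ==> g j \<in> \<S>" by (simp add: okf_def)

lemma okf_dvec: assumes g: "okf g" shows "bounded_by rho (%j. dvec (g j))"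
proof -
  obtain C where C: "0 <= C" "!!j. size (g j) <= C * rho j" using g unfolding okf_def by blast
  have "norm (dvec (g j)) <= 4 * C * rho j" for j using dpart_translates(2)[OF okf_seqs[OF g, of j]] C(2)[of j] by simp
  then show ?thesis using C(1) unfolding bounded_by_def by (intro exI[of _ "4 * C"]) auto
qed

context
  assumes rho: "!!j. 0 <= rho j"
begin

interpretation P: group "path_group rho" by (rule path_group[OF rho])

lemma bnd_common:
  assumes "bnd r" "bnd s"
  obtains C where "0 <= C" "!!j v. lbd v (r j) (C * rho j)" "!!j v. lbd v (s j) (C * rho j)"
proof -
  obtain C where C: "0 <= C" "!!j v. lbd v (r j) (C * rho j)" using bnd_obtain[OF assms(1)] by blast
  obtain D where D: "0 <= D" "!!j v. lbd v (s j) (D * rho j)" using bnd_obtain[OF assms(2)] by blast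
  show ?thesis
  proof (rule that[of "max C D"])
    show "lbd v (r j) (max C D * rho j)" for v j by (rule lbd_mono[OF C(2)]) (simp add: rho mult_right_mono)
    show "lbd v (s j) (max C D * rho j)" for v j by (rule lbd_mono[OF D(2)]) (simp add: rho mult_right_mono)
  qed (use C in auto)
qed

lemma bnd_add: assumes "bnd r" "bnd s" shows "bnd (r + s)"
proof -
  obtain C where C: "0 <= C" "!!j v. lbd v (r j) (C * rho j)" "!!j v. lbd v (s j) (C * rho j)" using bnd_common[OF assms] by blast
  have "lbd v ((r + s) j) (C * rho j)" for j v using lbd_add[OF C(2,3)] by (simp add: plus_fun_def)
  moreover have "linb ((r + s) j)" for j using linb_add[OF bnd_linb[OF assms(1)] bnd_linb[OF assms(2)], of j j] by (simp add: plus_fun_def)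
  ultimately show ?thesis using C(1) unfolding bnd_def by blast
qed

lemma bnd_mult: assumes "bnd r" "bnd s" shows "bnd (r * s)"
proof -
  obtain C where C: "0 <= C" "!!j v. lbd v (r j) (C * rho j)" "!!j v. lbd v (s j) (C * rho j)" using bnd_common[OF assms] by blast
  have "lbd v ((r * s) j) (2 * C * rho j)" for j v using lbd_mult[OF C(2)[of v j] C(3)[of v j]] by (simp add: times_fun_def mult.assoc)
  moreover have "linb ((r * s) j)" for j using linb_mult[OF bnd_linb[OF assms(1)] bnd_linb[OF assms(2)], of j j] by (simp add: times_fun_def)
  ultimately show ?thesis using C(1) unfolding bnd_def by (metis mult_nonneg_nonneg zero_le_numeral)
qed

lemma bnd_one: "bnd 1"
proof -
  have "lbd v ((1 :: ('j, 'k) fam) j) (0 * rho j)" for j v by (simp add: lbd_def one_fun_def)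
  moreover have "linb ((1 :: ('j, 'k) fam) j)" for j unfolding linb_def by (rule exI[of _ 0]) (simp add: one_fun_def)
  ultimately show ?thesis unfolding bnd_def by blast
qed

lemma admits_scaled:
  assumes r: "bnd r" and C: "0 <= C" "!!j. lbd v (r j) (C * rho j)" and V: "1 <= wt \<alpha> v V"
  shows "admits \<alpha> (pr v r) (%j. (C * rho j) *\<^sub>R V)" unfolding admits_def
proof (intro conjI allI)
  fix j
  have l: "linb (pr v r j)" by (rule linb_pr_bnd[OF r])
  have "C * rho j * 1 <= C * rho j * wt \<alpha> v V" using V C(1) rho[of j] by (intro mult_left_mono) auto
  then have "lbd v (r j) (wt \<alpha> v ((C * rho j) *\<^sub>R V))" using lbd_mono[OF C(2)] by (simp add: wt_linear)
  then have "lbd w (pr v r j) (wt \<alpha> w ((C * rho j) *\<^sub>R V))" for w by (cases "w = v") (simp_all add: lbd_def pr_def)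
  then show "relt \<alpha> (pr v r j) \<in> stab ((C * rho j) *\<^sub>R V)" using relt_stab[OF l] by blast
next
  show "bounded_by rho (%j. (C * rho j) *\<^sub>R V)" unfolding bounded_by_def using C(1) rho by (intro exI[of _ "C * norm V"]) (simp add: abs_mult)
qed

lemma admits_ex: "bnd r ==> \<exists>x. admits \<alpha> (pr v r) x"
proof -
  assume r: "bnd r"
  then obtain C where C: "0 <= C" "!!j v. lbd v (r j) (C * rho j)" using bnd_obtain by blast
  have "1 <= wt \<alpha> v (direction \<alpha> (dual v v))" by (simp only: wt_direction lam_dual)
  from admits_scaled[OF r C this] show ?thesis by blast
qed

lemma X_eq:
  assumes l: "!!j. linb (r j)" and x: "admits \<alpha> r x" shows "X \<alpha> r = letter_class rho (%j. relt \<alpha> (r j)) x"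
proof -
  define y where "y = (SOME x. admits \<alpha> r x)"
  have y: "admits \<alpha> r y" unfolding y_def using x by (rule someI[where P = "admits \<alpha> r"])
  show ?thesis unfolding X_def y_def[symmetric] using x y relt_stab_convex[OF l] unfolding admits_def
    by (intro letter_class_move[where rho = rho, OF rho]) blast+
qed

lemma X_closed: "bnd r ==> X \<alpha> (pr v r) \<in> PC"
proof -
  assume r: "bnd r"
  then obtain x where x: "admits \<alpha> (pr v r) x" using admits_ex by blast
  have "!!j. linb (pr v r j)" by (rule linb_pr_bnd[OF r])
  from X_eq[OF this x] show ?thesis using x letter_class_carrier[where rho = rho, OF rho] unfolding admits_def by simp
qed

lemma relt_add: "relt \<alpha> ((r + s) j) = relt \<alpha> (r j) \<cdot> relt \<alpha> (s j)"
  for r s :: "('j, 'k) fam" by (cases \<alpha>) (simp_all add: fun_eq_iff useq_def ut_def tmul_def add.commute)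

lemma X_mult:
  assumes "bnd r" "bnd s" "admits \<alpha> (pr v r) x" "admits \<beta> (pr w s) x"
  shows "X \<alpha> (pr v r) \<odot> X \<beta> (pr w s) = letter_class rho (%j. relt \<alpha> (pr v r j) \<cdot> relt \<beta> (pr w s j)) x"
proof -
  have l: "!!j. linb (pr v r j)" "!!j. linb (pr w s j)" by (rule linb_pr_bnd[OF assms(1)], rule linb_pr_bnd[OF assms(2)])
  show ?thesis unfolding X_eq[OF l(1) assms(3)] X_eq[OF l(2) assms(4)]
    using assms(3,4) by (intro letter_class_mult[where rho = rho, OF rho]) (auto simp: admits_def)
qed

lemma X_mult3:
  assumes "bnd r" "bnd s" "bnd t" "admits \<alpha> (pr v r) x" "admits \<beta> (pr w s) x" "admits \<gamma> (pr u t) x"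
  shows "X \<gamma> (pr u t) \<odot> (X \<alpha> (pr v r) \<odot> X \<beta> (pr w s)) =
    letter_class rho (%j. relt \<gamma> (pr u t j) \<cdot> (relt \<alpha> (pr v r j) \<cdot> relt \<beta> (pr w s j))) x"
proof -
  have l: "!!j. linb (pr u t j)" by (rule linb_pr_bnd[OF assms(3)])
  show ?thesis unfolding X_mult[OF assms(1,2,4,5)] X_eq[OF l assms(6)]
    using assms(4,5,6) by (intro letter_class_mult[where rho = rho, OF rho]) (auto simp: admits_def intro!: stab_mult)
qed

lemma X_add:
  assumes r: "bnd r" and s: "bnd s" shows "X \<alpha> (pr v r) \<odot> X \<alpha> (pr v s) = X \<alpha> (pr v (r + s))"
proof -
  obtain C where C: "0 <= C" "!!j v. lbd v (r j) (C * rho j)" "!!j v. lbd v (s j) (C * rho j)" using bnd_common[OF r s] by blast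
  let ?V = "direction \<alpha> (dual v v)"
  have V: "1 <= wt \<alpha> v ?V" by (simp only: wt_direction lam_dual)
  have rs: "bnd (r + s)" by (rule bnd_add[OF r s])
  have "lbd v ((r + s) j) (C * rho j)" for j using lbd_add[OF C(2,3)] by (simp add: plus_fun_def)
  note A = admits_scaled[OF r C(1,2) V] admits_scaled[OF s C(1,3) V] admits_scaled[OF rs C(1) this V]
  have l: "!!j. linb (pr v (r + s) j)" by (rule linb_pr_bnd[OF rs])
  show ?thesis unfolding X_mult[OF r s A(1,2)] X_eq[OF l A(3)] unfolding pr_hom relt_add ..
qed

lemma X_commute_common:
  assumes r: "bnd r" and s: "bnd s" and V: "1 <= wt \<alpha> v V" "1 <= wt \<beta> w V"
    and c: "!!j. relt \<alpha> (pr v r j) \<cdot> relt \<beta> (pr w s j) = relt \<beta> (pr w s j) \<cdot> relt \<alpha> (pr v r j)"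
  shows "X \<alpha> (pr v r) \<odot> X \<beta> (pr w s) = X \<beta> (pr w s) \<odot> X \<alpha> (pr v r)"
proof -
  obtain C where C: "0 <= C" "!!j v. lbd v (r j) (C * rho j)" "!!j v. lbd v (s j) (C * rho j)" using bnd_common[OF r s] by blast
  note A = admits_scaled[OF r C(1,2) V(1)] admits_scaled[OF s C(1,3) V(2)]
  show ?thesis unfolding X_mult[OF r s A] X_mult[OF s r A(2,1)] c ..
qed

text \<open>Going out far enough in a direction V on which all the weights involved are positive, one meets a point fixed by all the elements. A
relation between them in the group is then one between letters with a common turning point.\<close>

lemma X_commutator_common:
  assumes r: "bnd r" and s: "bnd s" and V: "1 <= wt \<alpha> v V" "1 <= wt \<beta> v V" "1 <= wt \<gamma> v V"
    and c: "!!j. relt \<alpha> (pr v r j) \<cdot> relt \<beta> (pr v s j) =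
       relt \<gamma> (pr v (r * s) j) \<cdot> (relt \<beta> (pr v s j) \<cdot> relt \<alpha> (pr v r j))"
  shows "X \<alpha> (pr v r) \<odot> X \<beta> (pr v s) =
    X \<gamma> (pr v (r * s)) \<odot> (X \<beta> (pr v s) \<odot> X \<alpha> (pr v r))"
proof -
  have rs: "bnd (r * s)" by (rule bnd_mult[OF r s])
  obtain C where C: "0 <= C" "!!j v. lbd v (r j) (C * rho j)" "!!j v. lbd v (s j) (C * rho j)" using bnd_common[OF r s] by blast
  obtain D where D: "0 <= D" "!!j v. lbd v ((r * s) j) (D * rho j)" using bnd_obtain[OF rs] by blast
  let ?M = "max C D"
  have le: "C * rho j <= ?M * rho j" "D * rho j <= ?M * rho j" for j by (simp_all add: rho mult_right_mono)
  have M: "0 <= ?M" "!!j. lbd v (r j) (?M * rho j)" "!!j. lbd v (s j) (?M * rho j)" "!!j. lbd v ((r * s) j) (?M * rho j)"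
    using C(1) lbd_mono[OF C(2) le(1)] lbd_mono[OF C(3) le(1)] lbd_mono[OF D(2) le(2)] by auto
  note A = admits_scaled[OF r M(1,2) V(1)] admits_scaled[OF s M(1,3) V(2)] admits_scaled[OF rs M(1,4) V(3)]
  show ?thesis unfolding X_mult[OF r s A(1,2)] X_mult3[OF s r rs A(2,1,3)] c ..
qed

text \<open>The facts V1 to V4 exhibit directions contracting both members of each pair of roots at v. There is none for the pairs (12, 24) and (13, 34), whose
weights are opposite: these are the commutators producing the corner.\<close>

lemma abels_relations_at:
  "abels_relations (path_group rho) {r. bnd r} (%r. X R12 (pr v r)) (%r. X R13 (pr v r)) (%r. X R23 (pr v r))
     (%r. X R24 (pr v r)) (%r. X R34 (pr v r))"
proof -
  interpret P: group "path_group rho" by (rule path_group[OF rho])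
  let ?\<xi> = "dual v v"
  note [simp] = lam_linear lam_dual
  have V1: "1 <= wt R12 v (?\<xi>, 2 *\<^sub>R ?\<xi>)" "1 <= wt R23 v (?\<xi>, 2 *\<^sub>R ?\<xi>)" "1 <= wt R13 v (?\<xi>, 2 *\<^sub>R ?\<xi>)" by simp_all
  have V2: "1 <= wt R23 v (- (2 *\<^sub>R ?\<xi>), - ?\<xi>)" "1 <= wt R34 v (- (2 *\<^sub>R ?\<xi>), - ?\<xi>)" "1 <= wt R24 v (- (2 *\<^sub>R ?\<xi>), - ?\<xi>)" by simp_all
  have V3: "1 <= wt R12 v (?\<xi>, - ?\<xi>)" "1 <= wt R34 v (?\<xi>, - ?\<xi>)" by simp_all
  have V4: "1 <= wt R13 v (- ?\<xi>, ?\<xi>)" "1 <= wt R24 v (- ?\<xi>, ?\<xi>)" by simp_all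
  note d = fun_eq_iff useq_def ut_def tmul_def pr_def
  show ?thesis
  proof
    fix r s :: "('j, 'k) fam" assume "r \<in> {r. bnd r}" "s \<in> {r. bnd r}"
    then have rs: "bnd r" "bnd s" by auto
    show "r + s \<in> {r. bnd r}" using rs bnd_add by simp
    show "r * s \<in> {r. bnd r}" using rs bnd_mult by simp
    note C = X_commute_common[OF rs]
    show "X R12 (pr v r) \<odot> X R13 (pr v s) = X R13 (pr v s) \<odot> X R12 (pr v r)" by (rule C[OF V1(1,3)]) (simp add: d)
    show "X R12 (pr v r) \<odot> X R34 (pr v s) = X R34 (pr v s) \<odot> X R12 (pr v r)" by (rule C[OF V3]) (simp add: d)
    show "X R23 (pr v r) \<odot> X R13 (pr v s) = X R13 (pr v s) \<odot> X R23 (pr v r)" by (rule C[OF V1(2,3)]) (simp add: d)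
    show "X R13 (pr v r) \<odot> X R24 (pr v s) = X R24 (pr v s) \<odot> X R13 (pr v r)" by (rule C[OF V4]) (simp add: d)
    show "X R23 (pr v r) \<odot> X R24 (pr v s) = X R24 (pr v s) \<odot> X R23 (pr v r)" by (rule C[OF V2(1,3)]) (simp add: d)
    show "X R34 (pr v r) \<odot> X R24 (pr v s) = X R24 (pr v s) \<odot> X R34 (pr v r)" by (rule C[OF V2(2,3)]) (simp add: d)
    show "X R12 (pr v r) \<odot> X R23 (pr v s) =
        X R13 (pr v (r * s)) \<odot> (X R23 (pr v s) \<odot> X R12 (pr v r))" by (rule X_commutator_common[OF rs V1]) (simp add: d)
    show "X R23 (pr v r) \<odot> X R34 (pr v s) =
        X R24 (pr v (r * s)) \<odot> (X R34 (pr v s) \<odot> X R23 (pr v r))" by (rule X_commutator_common[OF rs V2]) (simp add: d)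
  qed (use X_closed X_add bnd_one in auto)
qed

text \<open>The exponents at two different places can be prescribed independently, so a common contracting direction always exists.\<close>

lemma X_commute_places:
  assumes r: "bnd r" and s: "bnd s" and vw: "v ~= w"
  shows "X \<alpha> (pr v r) \<odot> X \<beta> (pr w s) = X \<beta> (pr w s) \<odot> X \<alpha> (pr v r)"
proof (rule X_commute_common[OF r s])
  let ?V = "direction \<alpha> (dual v w) + direction \<beta> (dual w v)"
  show "1 <= wt \<alpha> v ?V" using vw by (simp add: wt_linear wt_direction(1) wt_direction(2)[of v "dual w v" \<alpha> \<beta>] lam_dual)
  show "1 <= wt \<beta> w ?V" using vw by (simp add: wt_linear wt_direction(1) wt_direction(2)[of w "dual v w" \<beta> \<alpha>] lam_dual)
  show "relt \<alpha> (pr v r j) \<cdot> relt \<beta> (pr w s j) = relt \<beta> (pr w s j) \<cdot> relt \<alpha> (pr v r j)" for j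
    using vw by (cases \<alpha>; cases \<beta>) (auto simp: fun_eq_iff useq_def ut_def tmul_def pr_def)
qed

lemma endpoint_X:
  assumes r: "bnd r" shows "endpoint (X \<alpha> (pr v r)) = (%j. relt \<alpha> (pr v r j))"
proof -
  obtain x where x: "admits \<alpha> (pr v r) x" using admits_ex[OF r] by blast
  show ?thesis unfolding X_eq[OF linb_pr_bnd[OF r] x] using x unfolding admits_def by (intro endpoint_letter[where rho = rho, OF rho]) auto
qed

interpretation A: abels_relations "path_group rho" "{r. bnd r}" "%r. X R12 (pr v r)" "%r. X R13 (pr v r)" "%r. X R23 (pr v r)"
     "%r. X R24 (pr v r)" "%r. X R34 (pr v r)" for v by (rule abels_relations_at)

lemma ZZ_eq: "ZZ v = A.Z v" by (simp add: fun_eq_iff ZZ_def A.Z_def)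

lemma psi_eq: "psi v = A.unip v" by (simp add: fun_eq_iff psi_def A.unip_def ZZ_eq)

lemma psi_closed:
  "[|bnd a12; bnd a13; bnd a14; bnd a23; bnd a24; bnd a34|] ==> psi v a12 a13 a14 a23 a24 a34 \<in> PC" unfolding psi_eq by (rule A.unip_closed) auto

lemma Psi_closed:
  "[|bnd a12; bnd a13; bnd a14; bnd a23; bnd a24; bnd a34|] ==> Psi a12 a13 a14 a23 a24 a34 \<in> PC"
  unfolding Psi_def by (intro P.m_closed psi_closed)

lemma commutes_psi:
  assumes x: "x \<in> PC" and c: "!!\<alpha> r. bnd r ==> P.commutes x (X \<alpha> (pr v r))"
    and a: "bnd a12" "bnd a13" "bnd a14" "bnd a23" "bnd a24" "bnd a34" shows "P.commutes x (psi v a12 a13 a14 a23 a24 a34)" unfolding psi_def ZZ_def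
  by (intro P.commutes_mult P.commutes_commutator c a x X_closed P.m_closed P.commutator_closed bnd_one)

lemma psi_commute:
  assumes vw: "v ~= w" and a: "bnd a12" "bnd a13" "bnd a14" "bnd a23" "bnd a24" "bnd a34"
    and b: "bnd b12" "bnd b13" "bnd b14" "bnd b23" "bnd b24" "bnd b34" shows "psi v a12 a13 a14 a23 a24 a34 \<odot> psi w b12 b13 b14 b23 b24 b34 =
    psi w b12 b13 b14 b23 b24 b34 \<odot> psi v a12 a13 a14 a23 a24 a34"
proof -
  have 1: "P.commutes (X \<beta> (pr w s)) (X \<alpha> (pr v r))" if "bnd r" "bnd s" for \<alpha> \<beta> r s
    using X_commute_places[OF that(2,1)] vw by (simp add: P.commutes_def)
  have 2: "P.commutes (X \<beta> (pr w s)) (psi v a12 a13 a14 a23 a24 a34)" if "bnd s" for \<beta> s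
    using 1 that a by (intro commutes_psi X_closed) auto
  have "P.commutes (psi v a12 a13 a14 a23 a24 a34) (psi w b12 b13 b14 b23 b24 b34)"
    using 2 a b by (intro commutes_psi psi_closed) (auto intro: P.commutes_sym)
  then show ?thesis by (simp add: P.commutes_def)
qed

lemma psi_mult:
  assumes a: "bnd a12" "bnd a13" "bnd a14" "bnd a23" "bnd a24" "bnd a34"
    and b: "bnd b12" "bnd b13" "bnd b14" "bnd b23" "bnd b24" "bnd b34" shows "psi v a12 a13 a14 a23 a24 a34 \<odot> psi v b12 b13 b14 b23 b24 b34 =
    psi v (a12 + b12) (a13 + b13 + a12 * b23) (a14 + b14 + a12 * b24 + a13 * b34) (a23 + b23) (a24 + b24 + a23 * b34) (a34 + b34)"
  unfolding psi_eq using a b by (intro A.unip_mult) auto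

lemma Psi_mult:
  assumes a: "bnd a12" "bnd a13" "bnd a14" "bnd a23" "bnd a24" "bnd a34"
    and b: "bnd b12" "bnd b13" "bnd b14" "bnd b23" "bnd b24" "bnd b34" shows "Psi a12 a13 a14 a23 a24 a34 \<odot> Psi b12 b13 b14 b23 b24 b34 =
    Psi (a12 + b12) (a13 + b13 + a12 * b23) (a14 + b14 + a12 * b24 + a13 * b34) (a23 + b23) (a24 + b24 + a23 * b34) (a34 + b34)"
proof -
  define p where "p v = psi v a12 a13 a14 a23 a24 a34" for v
  define q where "q v = psi v b12 b13 b14 b23 b24 b34" for v
  have [simp]: "p v \<in> PC" "q v \<in> PC" for v using a b by (auto simp: p_def q_def psi_closed)
  have c: "p v \<odot> q w = q w \<odot> p v" if "v ~= w" for v w unfolding p_def q_def using psi_commute[OF that a b] .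
  have c2: "p v \<odot> (q w \<odot> y) = q w \<odot> (p v \<odot> y)"
    if "v ~= w" "y \<in> PC" for v w y using c[OF that(1)] that(2) by (simp flip: P.m_assoc)
  have "(p At0 \<odot> (p At1 \<odot> p AtInf)) \<odot> (q At0 \<odot> (q At1 \<odot> q AtInf))
    = (p At0 \<odot> q At0) \<odot> ((p At1 \<odot> q At1) \<odot> (p AtInf \<odot> q AtInf))" by (simp add: P.m_assoc c c2)
  then show ?thesis unfolding p_def q_def psi_mult[OF a b] Psi_def .
qed

lemma okf_bnd:
  assumes g: "okf g" shows "bnd (chi \<alpha> g)" "bnd (f12 g)" "bnd (f13 g)" "bnd (f14 g)" "bnd (f23 g)" "bnd (f24 g)" "bnd (f34 g)"
proof -
  have n: "nrm (g j n) <= exp (len (g j n))" "nrm (%v. tinv (g j n v)) <= exp (len (g j n))" for j n using len_le_iff[of "g j n" "len (g j n)"] by auto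
  note a = n(1)[unfolded nrm_le_iff] n(2)[unfolded nrm_le_iff]
  have b: "bnd (%j n v. d2 (g j n v))" "bnd (%j n v. d3 (g j n v))" "bnd (%j n v. e12 (g j n v))" "bnd (%j n v. e13 (g j n v))"
    "bnd (%j n v. e14 (g j n v))" "bnd (%j n v. e23 (g j n v))" "bnd (%j n v. e24 (g j n v))" "bnd (%j n v. e34 (g j n v))"
    using a(1) by (auto intro!: bnd_entries[OF g])
  have "bnd (%j n v. d2 (tinv (g j n v)))" "bnd (%j n v. d3 (tinv (g j n v)))" using a(2) by (auto intro!: bnd_entries[OF g])
  then have i: "bnd (%j n v. inverse (d2 (g j n v)))" "bnd (%j n v. inverse (d3 (g j n v)))" by (simp_all add: tinv_def)
  note m = bnd_mult
  show "bnd (chi \<alpha> g)" using b i m by (cases \<alpha>) auto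
  show "bnd (f12 g)" "bnd (f13 g)" "bnd (f14 g)" "bnd (f23 g)" "bnd (f24 g)" "bnd (f34 g)" unfolding coords_def using b i m by auto
qed

lemma T_closed: "okf g ==> T g \<in> PC" unfolding T_def by (intro straight_class_carrier[where rho = rho, OF rho] okf_dvec dpart_translates okf_seqs)

lemma Phi_closed: "okf g ==> Phi g \<in> PC" unfolding Phi_def by (intro P.m_closed T_closed Psi_closed okf_bnd)

text \<open>Conjugation by a diagonal element moves the half-space fixed by a root element by the translation vector of the diagonal element.\<close>

lemma T_X:
  assumes g: "okf g" and r: "bnd r" shows "T g \<odot> X \<alpha> (pr v r) = X \<alpha> (pr v (chi \<alpha> g * r)) \<odot> T g"
proof -
  obtain x where x: "admits \<alpha> (pr v r) x" using admits_ex[OF r] by blast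
  then have xs: "!!j. relt \<alpha> (pr v r j) \<in> stab (x j)" and xb: "bounded_by rho x" unfolding admits_def by auto
  have cr: "bnd (chi \<alpha> g * r)" using okf_bnd(1)[OF g] r by (rule bnd_mult)
  have tr: "!!j. translates (dpart (g j)) (dvec (g j))" using dpart_translates(1)[OF okf_seqs[OF g]] .
  have c: "dpart (g j) \<cdot> relt \<alpha> (pr v r j) \<cdot> inv\<^sub>s (dpart (g j)) = relt \<alpha> (pr v (chi \<alpha> g * r) j)" for j
    by (rule conj_relt[OF okf_seqs[OF g] bnd_linb[OF r] refl])
  have "relt \<alpha> (pr v (chi \<alpha> g * r) j) \<in> stab (dvec (g j) + x j)" for j using stab_conj[OF tr[of j] xs[of j]] by (simp only: c)
  then have x': "admits \<alpha> (pr v (chi \<alpha> g * r)) (%j. dvec (g j) + x j)"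
    unfolding admits_def using bounded_by_add[where rho = rho, OF rho okf_dvec[OF g] xb] by blast
  show ?thesis unfolding T_def X_eq[OF linb_pr_bnd[OF r] x] X_eq[OF linb_pr_bnd[OF cr] x']
      letter_class_conj[where rho = rho, OF rho tr okf_dvec[OF g] xs xb] c ..
qed

lemma T_psi:
  assumes g: "okf g" and a: "bnd a12" "bnd a13" "bnd a14" "bnd a23" "bnd a24" "bnd a34" shows "T g \<odot> psi v a12 a13 a14 a23 a24 a34 =
    psi v (chi R12 g * a12) (chi R13 g * a13) a14 (chi R23 g * a23) (chi R24 g * a24) (chi R34 g * a34) \<odot> T g"
proof -
  have "chi R13 g * chi R34 g = 1" using seqs_nonzero[OF okf_seqs[OF g]] by (simp add: fun_eq_iff)
  then show ?thesis unfolding psi_eq using a by (intro A.unip_conj T_X[OF g]) (simp_all del: chi.simps add: T_closed[OF g] okf_bnd[OF g])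
qed

lemma T_Psi:
  assumes g: "okf g" and a: "bnd a12" "bnd a13" "bnd a14" "bnd a23" "bnd a24" "bnd a34" shows "T g \<odot> Psi a12 a13 a14 a23 a24 a34 =
    Psi (chi R12 g * a12) (chi R13 g * a13) a14 (chi R23 g * a23) (chi R24 g * a24) (chi R34 g * a34) \<odot> T g"
proof -
  have [simp]: "psi v a12 a13 a14 a23 a24 a34 \<in> PC"
    "psi v (chi R12 g * a12) (chi R13 g * a13) a14 (chi R23 g * a23) (chi R24 g * a24) (chi R34 g * a34) \<in> PC"
    "T g \<in> PC" for v using g a by (auto simp del: chi.simps intro!: psi_closed bnd_mult okf_bnd T_closed)
  note t = T_psi[OF g a] P.tail[OF T_psi[OF g a]]
  show ?thesis unfolding Psi_def by (simp add: t P.m_assoc del: chi.simps)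
qed

lemma T_mult:
  assumes g: "okf g" and h: "okf h" shows "T g \<odot> T h = T (%j. g j \<cdot> h j)"
  unfolding T_def dpart_mult dvec_mult[OF okf_seqs[OF g] okf_seqs[OF h]]
  by (rule straight_class_mult[where rho = rho, OF rho dpart_translates(1)[OF okf_seqs[OF g]] okf_dvec[OF g] dpart_translates(1)[OF okf_seqs[OF h]] okf_dvec[OF h]])

lemma f_mult:
  assumes g: "okf g" and h: "okf h"
  defines "gh \<equiv> %j. g j \<cdot> h j" shows "f12 gh = f12 g + chi R12 g * f12 h"
    "f13 gh = f13 g + chi R13 g * f13 h + f12 g * (chi R23 g * f23 h)"
    "f14 gh = f14 g + f14 h + f12 g * (chi R24 g * f24 h) + f13 g * (chi R34 g * f34 h)"
    "f23 gh = f23 g + chi R23 g * f23 h"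
    "f24 gh = f24 g + chi R24 g * f24 h + f23 g * (chi R34 g * f34 h)"
    "f34 gh = f34 g + chi R34 g * f34 h" using seqs_nonzero[OF okf_seqs[OF g]] seqs_nonzero[OF okf_seqs[OF h]]
  by (auto simp: gh_def coords_def fun_eq_iff tmul_def field_simps)

text \<open>Writing g and h as unipotent times diagonal, the diagonal part of g is moved past the unipotent part of h.\<close>

lemma Phi_mult:
  assumes g: "okf g" and h: "okf h" shows "Phi g \<odot> Phi h = Phi (%j. g j \<cdot> h j)"
proof -
  note b = okf_bnd(2-7)[OF g] and b' = okf_bnd(2-7)[OF h]
  note m = bnd_mult[OF okf_bnd(1)[OF g]]
  let ?A = "Psi (f12 g) (f13 g) (f14 g) (f23 g) (f24 g) (f34 g)" and ?B = "Psi (f12 h) (f13 h) (f14 h) (f23 h) (f24 h) (f34 h)"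
  let ?C = "Psi (chi R12 g * f12 h) (chi R13 g * f13 h) (f14 h) (chi R23 g * f23 h) (chi R24 g * f24 h) (chi R34 g * f34 h)"
  have [simp]: "?A \<in> PC" "?B \<in> PC" "?C \<in> PC" by (intro Psi_closed b b' m)+
  have [simp]: "T g \<in> PC" "T h \<in> PC" using T_closed g h by auto
  have "Phi g \<odot> Phi h = ?A \<odot> ((T g \<odot> ?B) \<odot> T h)" unfolding Phi_def by (simp add: P.m_assoc del: chi.simps)
  also have "T g \<odot> ?B = ?C \<odot> T g" by (rule T_Psi[OF g b'])
  also have "?A \<odot> (?C \<odot> T g \<odot> T h) = (?A \<odot> ?C) \<odot> (T g \<odot> T h)" by (simp add: P.m_assoc del: chi.simps)
  also have "... = Phi (%j. g j \<cdot> h j)"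
    unfolding Phi_def T_mult[OF g h] f_mult[OF g h] by (subst Psi_mult[OF b]) (auto intro: m b' simp del: chi.simps)
  finally show ?thesis .
qed

lemma endpoint_ZZ:
  assumes r: "bnd r" shows "endpoint (ZZ v r) = (%j. useq (%n v. 0) (%n v. 0) (pr v r j) (%n v. 0) (%n v. 0) (%n v. 0))"
proof -
  have one: "bnd 1" by (rule bnd_one)
  have "S.commutator (relt R13 (pr v r j)) (relt R34 (pr v 1 j)) = useq (%n v. 0) (%n v. 0) (pr v r j) (%n v. 0) (%n v. 0) (%n v. 0)" for j
  proof (rule S.commutatorI)
    show "relt R13 (pr v r j) \<in> \<S>" "relt R34 (pr v 1 j) \<in> \<S>"
      by (rule relt_in[OF linb_pr_bnd[OF r]], rule relt_in[OF linb_pr_bnd[OF one]])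
    show "useq (%n v. 0) (%n v. 0) (pr v r j) (%n v. 0) (%n v. 0) (%n v. 0) \<in> \<S>" by (intro useq_in linb_zero linb_pr_bnd[OF r])
  qed (auto simp: fun_eq_iff useq_def ut_def tmul_def pr_def)
  then show ?thesis unfolding ZZ_def endpoint_commutator[where rho = rho, OF rho X_closed[OF r] X_closed[OF one]]
    by (simp add: endpoint_X[OF r] endpoint_X[OF one])
qed

lemma ZZ_closed: "bnd r ==> ZZ v r \<in> PC" unfolding ZZ_def by (intro P.commutator_closed X_closed bnd_one)

lemma endpoint_psi:
  assumes a: "bnd a12" "bnd a13" "bnd a14" "bnd a23" "bnd a24" "bnd a34"
  shows "endpoint (psi v a12 a13 a14 a23 a24 a34) = (%j. useq (pr v a12 j) (pr v a13 j) (pr v a14 j) (pr v a23 j) (pr v a24 j) (pr v a34 j))"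
proof -
  have c: "ZZ v a14 \<in> PC" "X R24 (pr v a24) \<in> PC" "X R34 (pr v a34) \<in> PC"
    "X R13 (pr v a13) \<in> PC" "X R23 (pr v a23) \<in> PC" "X R12 (pr v a12) \<in> PC" by (intro X_closed ZZ_closed a)+
  have m: "endpoint (A \<odot> B) j = endpoint A j \<cdot> endpoint B j" if "A \<in> PC" "B \<in> PC" for A B j
    using endpoint_mult[where rho = rho, OF rho that] by simp
  show ?thesis
  proof
    fix j
    have "endpoint (psi v a12 a13 a14 a23 a24 a34) j = useq (%n v. 0) (%n v. 0) (pr v a14 j) (%n v. 0) (%n v. 0) (%n v. 0) \<cdot>
        (relt R24 (pr v a24 j) \<cdot> (relt R34 (pr v a34 j) \<cdot> (relt R13 (pr v a13 j) \<cdot> (relt R23 (pr v a23 j) \<cdot> relt R12 (pr v a12 j)))))"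
      unfolding psi_def by (simp only: m c P.m_closed endpoint_ZZ[OF a(3)] endpoint_X[OF a(1)] endpoint_X[OF a(2)]
        endpoint_X[OF a(4)] endpoint_X[OF a(5)] endpoint_X[OF a(6)])
    also have "... = useq (pr v a12 j) (pr v a13 j) (pr v a14 j) (pr v a23 j) (pr v a24 j) (pr v a34 j)" by (simp add: useq_mult)
    finally show "endpoint (psi v a12 a13 a14 a23 a24 a34) j = useq (pr v a12 j) (pr v a13 j) (pr v a14 j) (pr v a23 j) (pr v a24 j) (pr v a34 j)" .
  qed
qed

text \<open>The section does lie over the given group elements: the end point is a homomorphism, so this is a matrix computation.\<close>

lemma endpoint_Phi:
  assumes g: "okf g" shows "endpoint (Phi g) = g"
proof -
  note b = okf_bnd(2-7)[OF g]
  note cl = psi_closed[OF b] Psi_closed[OF b] T_closed[OF g] P.m_closed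
  have "endpoint (T g) = (%j. dpart (g j))"
    unfolding T_def by (rule endpoint_straight[where rho = rho, OF rho dpart_translates(1)[OF okf_seqs[OF g]] okf_dvec[OF g]])
  then have e: "endpoint (Phi g) j = (useq (pr At0 (f12 g) j) (pr At0 (f13 g) j) (pr At0 (f14 g) j) (pr At0 (f23 g) j) (pr At0 (f24 g) j) (pr At0 (f34 g) j) \<cdot>
      (useq (pr At1 (f12 g) j) (pr At1 (f13 g) j) (pr At1 (f14 g) j) (pr At1 (f23 g) j) (pr At1 (f24 g) j) (pr At1 (f34 g) j) \<cdot>
       useq (pr AtInf (f12 g) j) (pr AtInf (f13 g) j) (pr AtInf (f14 g) j) (pr AtInf (f23 g) j) (pr AtInf (f24 g) j) (pr AtInf (f34 g) j))) \<cdot> dpart (g j)" for j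
    unfolding Phi_def by (simp only: endpoint_mult[where rho = rho, OF rho] cl) (simp only: Psi_def endpoint_mult[where rho = rho, OF rho] cl endpoint_psi[OF b])
  show ?thesis
  proof (intro ext)
    fix j n v
    have nz: "d2 (g j n v) ~= 0" "d3 (g j n v) ~= 0" "d2 (g j n At0) = d2 (g j n v)" "d3 (g j n At0) = d3 (g j n v)"
      using seqs_nonzero[OF okf_seqs[OF g, of j], of n v] seqs_diag[OF okf_seqs[OF g, of j], of n v] by auto
    have "(useq (pr At0 (f12 g) j) (pr At0 (f13 g) j) (pr At0 (f14 g) j) (pr At0 (f23 g) j) (pr At0 (f24 g) j) (pr At0 (f34 g) j) \<cdot>
      (useq (pr At1 (f12 g) j) (pr At1 (f13 g) j) (pr At1 (f14 g) j) (pr At1 (f23 g) j) (pr At1 (f24 g) j) (pr At1 (f34 g) j) \<cdot>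
       useq (pr AtInf (f12 g) j) (pr AtInf (f13 g) j) (pr AtInf (f14 g) j) (pr AtInf (f23 g) j) (pr AtInf (f24 g) j) (pr AtInf (f34 g) j))) n v
      = ut (f12 g j n v) (f13 g j n v) (f14 g j n v) (f23 g j n v) (f24 g j n v) (f34 g j n v)"
      unfolding useq_mult by (cases v) (simp_all add: useq_def pr_def)
    then have "endpoint (Phi g) j n v = tmul (ut (f12 g j n v) (f13 g j n v) (f14 g j n v) (f23 g j n v) (f24 g j n v) (f34 g j n v)) (diag (d2 (g j n v)) (d3 (g j n v)))"
      unfolding e seqs_mult[where g = "_ \<cdot> _"] PG_mult by (simp only: dpart_def nz(3,4))
    also have "... = g j n v" using nz(1,2) by (cases "g j n v") (simp add: ut_def diag_def tmul_def coords_def)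
    finally show "endpoint (Phi g) j n v = g j n v" .
  qed
qed

end

end

lemma reindex_X:
  assumes rho: "!!i. 0 <= rho i" "!!j. 0 <= rho' j" "0 <= C" "!!i. rho' (\<phi> i) <= C * rho i" and r: "bnd rho' r"
  shows "reindex \<phi> rho (X rho' \<alpha> (pr v r)) = X rho \<alpha> (pr v (%i. r (\<phi> i)))" and "bnd rho (%i. r (\<phi> i))"
proof -
  obtain x where x: "admits rho' \<alpha> (pr v r) x" using admits_ex[where rho = rho', OF rho(2) r] by blast
  have pr: "pr v (%i. r (\<phi> i)) = (%i. pr v r (\<phi> i))" by (simp add: pr_def)
  have x': "admits rho \<alpha> (%i. pr v r (\<phi> i)) (%i. x (\<phi> i))"
    using x bounded_by_reindex[of rho' x C \<phi> rho] rho(3,4) unfolding admits_def by auto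
  show "reindex \<phi> rho (X rho' \<alpha> (pr v r)) = X rho \<alpha> (pr v (%i. r (\<phi> i)))"
    unfolding pr X_eq[where rho = rho', OF rho(2) linb_pr_bnd[OF r] x] X_eq[where rho = rho, OF rho(1) linb_pr_bnd[OF r] x']
    using x unfolding admits_def by (intro reindex_letter[where rho' = rho' and C = C] rho) auto
  obtain D where D: "0 <= D" "!!j v. lbd v (r j) (D * rho' j)" using bnd_obtain[OF r] by blast
  have "lbd v (r (\<phi> i)) ((D * C) * rho i)" for v i
    using lbd_mono[OF D(2)[of v "\<phi> i"] mult_left_mono[OF rho(4) D(1)]] by (simp add: mult.assoc)
  then show "bnd rho (%i. r (\<phi> i))" using r D(1) rho(3) unfolding bnd_def by (auto intro!: exI[of _ "D * C"])
qed

end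

section \<open>Contractibility of loops in the cone\<close>

text \<open>The paths w g are turned into chords between arbitrary points by translation.\<close>

context isometric_action
begin

context
  fixes w :: "'a => 'a \<times> (real => 'y)" and A B :: real
  assumes A: "0 <= A" and B: "0 <= B"
    and transitive: "!!y. y \<in> Y ==> \<exists>g\<in>carrier H. L g b = y"
    and word_path: "!!g. g \<in> carrier H ==> path_ok (A * dist b (L g b)) (w g) \<and> fst (w g) = g"
    and word_mult: "!!g h. [|g \<in> carrier H; h \<in> carrier H|] ==>
      phom (B * (dist b (L g b) + dist b (L h b))) (pmult (w g) (w h)) (w (g \<otimes> h))"
begin

definition sect :: "'y => 'a" where
  "sect y = (SOME g. g \<in> carrier H \<and> L g b = y)"

definition connect :: "'y => 'y => real => 'y" where
  "connect x y = L (sect x) o snd (w (inv (sect x) \<otimes> sect y))"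

lemma sect: assumes "y \<in> Y" shows "sect y \<in> carrier H" "L (sect y) b = y"
proof -
  have "\<exists>g. g \<in> carrier H \<and> L g b = y" using transitive[OF assms] by blast
  from someI_ex[OF this] show "sect y \<in> carrier H" "L (sect y) b = y" by (simp_all add: sect_def)
qed

lemma dist_sect:
  assumes "x \<in> Y" "y \<in> Y" shows "dist b (L (inv (sect x) \<otimes> sect y) b) = dist x y"
proof -
  note s = sect[OF assms(1)] sect[OF assms(2)]
  have c: "inv (sect x) \<otimes> sect y \<in> carrier H" using s by simp
  have "dist b (L (inv (sect x) \<otimes> sect y) b) = dist (L (sect x) b) (L (sect x) (L (inv (sect x) \<otimes> sect y) b))"
    by (rule L_isom[OF s(1) base_in L_in[OF c base_in], symmetric])
  also have "L (sect x) (L (inv (sect x) \<otimes> sect y) b) = L (sect y) b" using s base_in by (simp add: m_assoc[symmetric] flip: L_mult)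
  finally show ?thesis using s by simp
qed

lemma translated_ball:
  assumes "g \<in> carrier H" shows "L g \<in> Y \<inter> cball b r \<rightarrow> Y \<inter> cball (L g b) r"
  using assms L_in L_isom[OF assms base_in] by auto

lemma connect_path:
  assumes "x \<in> Y" "y \<in> Y" shows "path (connect x y) \<and> path_image (connect x y) \<subseteq> Y \<inter> cball x (A * dist x y) \<and>
    pathstart (connect x y) = x \<and> pathfinish (connect x y) = y"
proof -
  note s = sect[OF assms(1)] sect[OF assms(2)]
  define u where "u = inv (sect x) \<otimes> sect y"
  have u: "u \<in> carrier H" and xu: "sect x \<otimes> u = sect y" using s by (simp_all add: u_def m_assoc[symmetric])
  note w = word_path[OF u]
  have d: "dist b (L u b) = dist x y" unfolding u_def by (rule dist_sect[OF assms])
  have im: "path_image (snd (w u)) \<subseteq> Y \<inter> cball b (A * dist x y)" using path_ok_image[of "A * dist x y" "w u"] w by (simp add: d)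
  have "path_image (connect x y) \<subseteq> Y \<inter> cball x (A * dist x y)"
    unfolding connect_def path_image_compose u_def[symmetric] using im translated_ball[OF s(1)] s(2) by fastforce
  moreover have "path (connect x y)" unfolding connect_def u_def[symmetric] using im w by (intro translate_path s) (auto simp: path_ok_def)
  moreover have "pathstart (connect x y) = x" "pathfinish (connect x y) = y"
    unfolding connect_def u_def[symmetric] using translate_ends[of _ "w u" "sect x"] w s xu by auto
  ultimately show ?thesis by simp
qed

lemma connect_triangle:
  assumes "x \<in> Y" "y \<in> Y" "z \<in> Y"
  shows "homotopic_paths (Y \<inter> cball x (B * (dist x y + dist y z))) (connect x z) (connect x y +++ connect y z)"
proof -
  note s = sect[OF assms(1)] sect[OF assms(2)] sect[OF assms(3)]
  define u v where "u = inv (sect x) \<otimes> sect y" and "v = inv (sect y) \<otimes> sect z"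
  have u: "u \<in> carrier H" "v \<in> carrier H" "sect x \<otimes> u = sect y" using s by (simp_all add: u_def v_def m_assoc[symmetric])
  have uv: "u \<otimes> v = inv (sect x) \<otimes> sect z"
  proof -
    have "sect y \<otimes> v = sect z" using s by (simp add: v_def m_assoc[symmetric])
    then show ?thesis using s u by (simp add: u_def m_assoc)
  qed
  have d: "dist b (L u b) = dist x y" "dist b (L v b) = dist y z" unfolding u_def v_def by (simp_all add: dist_sect assms)
  have h: "homotopic_paths (Y \<inter> cball b (B * (dist x y + dist y z))) (snd (w u) +++ (L u o snd (w v))) (snd (w (u \<otimes> v)))"
    using word_mult[OF u(1,2)] word_path[OF u(1)] by (simp add: phom_def d pmult_def)
  have "homotopic_paths (Y \<inter> cball (L (sect x) b) (B * (dist x y + dist y z))) (L (sect x) o (snd (w u) +++ (L u o snd (w v)))) (L (sect x) o snd (w (u \<otimes> v)))"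
    by (rule homotopic_paths_continuous_image[OF h _ translated_ball[OF s(1)]]) (rule continuous_on_subset[OF L_cont[OF s(1)]], blast)
  moreover have "L (sect x) o (snd (w u) +++ (L u o snd (w v))) = connect x y +++ connect y z"
    using word_path[OF u(2)] s u by (simp add: path_compose_join connect_def translate_twice path_ok_def flip: u_def v_def)
  ultimately show ?thesis using s by (simp add: connect_def uv homotopic_paths_sym)
qed

theorem null_homotopic_if_words:
  assumes "path f" "path_image f \<subseteq> Y" "pathfinish f = pathstart f" shows "homotopic_paths Y f (%_. pathstart f)"
proof (rule null_homotopic_if_triangles_fill[OF _ _ _ assms])
  show "0 <= A + B" using A B by simp
  have mono: "D * d <= (A + B) * d" if "D = A \<or> D = B" "0 <= d" for D d using that A B by (auto intro!: mult_right_mono)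
  show "path (connect x y) \<and> path_image (connect x y) \<subseteq> Y \<inter> cball x ((A + B) * dist x y) \<and>
      pathstart (connect x y) = x \<and> pathfinish (connect x y) = y" if "x \<in> Y" "y \<in> Y" for x y
    using connect_path[OF that] subset_cball[OF mono[of A "dist x y"], of x] by auto
  show "homotopic_paths (Y \<inter> cball x ((A + B) * (dist x y + dist y z))) (connect x z) (connect x y +++ connect y z)"
    if "x \<in> Y" "y \<in> Y" "z \<in> Y" for x y z
  proof (rule homotopic_paths_subset[OF connect_triangle[OF that]])
    have "B * (dist x y + dist y z) <= (A + B) * (dist x y + dist y z)" by (rule mono) auto
    then show "Y \<inter> cball x (B * (dist x y + dist y z)) \<subseteq> Y \<inter> cball x ((A + B) * (dist x y + dist y z))"
      using subset_cball by blast
  qed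
qed

lemma connected_by_words: "[|x \<in> Y; y \<in> Y|] ==> \<exists>g. path g \<and> path_image g \<subseteq> Y \<and> pathstart g = x \<and> pathfinish g = y"
  using connect_path by blast

end

end

context abels_cone
begin

lemma reindex_Phi:
  fixes rho :: "'i => real" and rho' :: "'j => real"
  assumes rho: "!!i. 0 <= rho i" "!!j. 0 <= rho' j" "0 <= C" "!!i. rho' (\<phi> i) <= C * rho i" and g: "okf rho' g"
  shows "reindex \<phi> rho (Phi rho' g) = Phi rho (%i. g (\<phi> i))"
proof -
  interpret h: group_hom "path_group rho'" "path_group rho" "reindex \<phi> rho" by (rule reindex_hom[where rho' = rho', OF rho])
  note b = okf_bnd(2-7)[where rho = rho', OF rho(2) g]
  have one: "bnd rho' 1" by (rule bnd_one[where rho = rho', OF rho(2)])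
  note X = reindex_X(1)[where rho = rho and rho' = rho', OF rho]
  note cl = X_closed[where rho = rho', OF rho(2)]
  have f: "(%i. f12 g (\<phi> i)) = f12 (%i. g (\<phi> i))" "(%i. f13 g (\<phi> i)) = f13 (%i. g (\<phi> i))" "(%i. f14 g (\<phi> i)) = f14 (%i. g (\<phi> i))"
    "(%i. f23 g (\<phi> i)) = f23 (%i. g (\<phi> i))" "(%i. f24 g (\<phi> i)) = f24 (%i. g (\<phi> i))" "(%i. f34 g (\<phi> i)) = f34 (%i. g (\<phi> i))"
    by (simp_all add: coords_def fun_eq_iff)
  have Z: "reindex \<phi> rho (ZZ rho' v r) = ZZ rho v (%i. r (\<phi> i))" if r: "bnd rho' r" for v r
  proof -
    have "(%i. (1 :: ('j, 'k) fam) (\<phi> i)) = 1" by (simp add: fun_eq_iff)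
    then show ?thesis unfolding ZZ_def reindex_commutator[where rho' = rho', OF rho cl[OF r] cl[OF one]] X[OF r] X[OF one] by simp
  qed
  note c = cl[OF b(1)] cl[OF b(2)] cl[OF b(3)] cl[OF b(4)] cl[OF b(5)] cl[OF b(6)] ZZ_closed[where rho = rho', OF rho(2) b(3)]
    psi_closed[where rho = rho', OF rho(2) b] Psi_closed[where rho = rho', OF rho(2) b] T_closed[where rho = rho', OF rho(2) g] h.G.m_closed
  have t: "reindex \<phi> rho (T rho' g) = T rho (%i. g (\<phi> i))"
    unfolding T_def by (rule reindex_straight[where rho' = rho', OF rho dpart_translates(1)[OF okf_seqs[OF g]] okf_dvec[OF g]])
  have p: "reindex \<phi> rho (psi rho' v (f12 g) (f13 g) (f14 g) (f23 g) (f24 g) (f34 g)) =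
     psi rho v (f12 (%i. g (\<phi> i))) (f13 (%i. g (\<phi> i))) (f14 (%i. g (\<phi> i))) (f23 (%i. g (\<phi> i))) (f24 (%i. g (\<phi> i))) (f34 (%i. g (\<phi> i)))" for v
    unfolding psi_def by (simp only: h.hom_mult c Z[OF b(3)] X[OF b(1)] X[OF b(2)] X[OF b(4)] X[OF b(5)] X[OF b(6)] f)
  have P: "reindex \<phi> rho (Psi rho' (f12 g) (f13 g) (f14 g) (f23 g) (f24 g) (f34 g)) =
     Psi rho (f12 (%i. g (\<phi> i))) (f13 (%i. g (\<phi> i))) (f14 (%i. g (\<phi> i))) (f23 (%i. g (\<phi> i))) (f24 (%i. g (\<phi> i))) (f34 (%i. g (\<phi> i)))"
    unfolding Psi_def by (simp only: h.hom_mult c p)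
  show ?thesis unfolding Phi_def by (simp only: h.hom_mult c P t)
qed

lemma dist_base: "g \<in> \<S> ==> dist (point \<one>\<^bsub>seqs\<^esub>) (move g (point \<one>\<^bsub>seqs\<^esub>)) = size g"
  by (simp add: move_point dist_point sdist_def)

text \<open>Indexing families by all functions and not only by the elements of the group avoids subtypes; arguments outside are sent to the identity.\<close>

definition gen :: "('k tseq) => 'k tseq" where
  "gen h = (if h \<in> \<S> then h else \<one>\<^bsub>seqs\<^esub>)"

lemma gen: "gen h \<in> \<S>" "h \<in> \<S> ==> gen h = h" by (simp_all add: gen_def)

text \<open>The section Phi is applied to the tautological family, indexed by the group itself, and to its pullbacks along the projections and the
multiplication, indexed by pairs. Naturality under reindexing makes the paths w for g, h and g h the same ones.\<close>

lemma words_exist: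
  "\<exists>A B w. 0 <= A \<and> 0 <= B \<and> (\<forall>g\<in>\<S>. path_ok (A * size g) (w g) \<and> fst (w g) = g) \<and>
    (\<forall>g\<in>\<S>. \<forall>h\<in>\<S>. phom (B * (size g + size h)) (pmult (w g) (w h)) (w (g \<cdot> h)))"
proof -
  define rho1 where "rho1 h = size (gen h)" for h
  define rho2 where "rho2 p = rho1 (fst p) + rho1 (snd p)" for p
  have r1: "!!h. 0 <= rho1 h" by (simp add: rho1_def size_nonneg gen)
  have r2: "!!p. 0 <= rho2 p" using r1 by (simp add: rho2_def)
  have ok1: "okf rho1 gen" unfolding okf_def by (auto simp: rho1_def gen intro!: exI[of _ 1])
  obtain F where F: "F \<in> families rho1" "Phi rho1 gen = family_rel rho1 `` {F}"
    using path_group_cases[OF Phi_closed[where rho = rho1, OF r1 ok1]] .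
  have e: "fst (F h) = gen h" for h
    using endpoint_Phi[where rho = rho1, OF r1 ok1] endpoint_class[where rho = rho1, OF r1 F(1)] unfolding F(2) by metis
  obtain A where A: "A \<ge> 0" "!!h. path_ok (A * rho1 h) (F h)" using F(1) unfolding families_def by blast
  let ?m = "%p. gen (fst p) \<cdot> gen (snd p)"
  have \<phi>: "rho1 (fst p) <= 1 * rho2 p" "rho1 (snd p) <= 1 * rho2 p" "rho1 (?m p) <= 1 * rho2 p" for p
    using r1 size_mult[OF gen(1) gen(1), of "fst p" "snd p"] by (simp_all add: rho2_def) (simp add: rho1_def gen)
  note one = zero_le_one[where ?'a = real]
  have ok: "okf rho2 (%p. gen (fst p))" "okf rho2 (%p. gen (snd p))"
    unfolding okf_def using \<phi>(1,2) by (auto simp: gen intro!: exI[of _ 1]) (simp_all add: rho1_def)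
  have "reindex fst rho2 (Phi rho1 gen) \<otimes>\<^bsub>path_group rho2\<^esub> reindex snd rho2 (Phi rho1 gen) = reindex ?m rho2 (Phi rho1 gen)"
    unfolding reindex_Phi[where rho' = rho1 and \<phi> = fst and rho = rho2, OF r2 r1 one \<phi>(1) ok1] reindex_Phi[where rho' = rho1 and \<phi> = snd and rho = rho2, OF r2 r1 one \<phi>(2) ok1]
      reindex_Phi[where rho' = rho1 and \<phi> = ?m and rho = rho2, OF r2 r1 one \<phi>(3) ok1] Phi_mult[where rho = rho2, OF r2 ok]
    by (simp add: gen)
  note fr = families_reindex[where rho' = rho1 and \<phi> = fst and rho = rho2, OF r2 r1 one \<phi>(1) F(1)]
     families_reindex[where rho' = rho1 and \<phi> = snd and rho = rho2, OF r2 r1 one \<phi>(2) F(1)]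
     families_reindex[where rho' = rho1 and \<phi> = ?m and rho = rho2, OF r2 r1 one \<phi>(3) F(1)]
  have "family_rel rho2 `` {%p. pmult (F (fst p)) (F (snd p))} = family_rel rho2 `` {%p. F (?m p)}"
    using \<open>_ = reindex ?m rho2 (Phi rho1 gen)\<close>
    unfolding F(2) reindex_class[where rho' = rho1 and \<phi> = fst and rho = rho2, OF r2 r1 one \<phi>(1) F(1)] reindex_class[where rho' = rho1 and \<phi> = snd and rho = rho2, OF r2 r1 one \<phi>(2) F(1)]
      reindex_class[where rho' = rho1 and \<phi> = ?m and rho = rho2, OF r2 r1 one \<phi>(3) F(1)] path_group_mult[where rho = rho2, OF r2 fr(1,2)] .
  from path_group_eqD[where rho = rho2, OF r2 families_mult[where rho = rho2, OF r2 fr(1,2)] fr(3) this]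
  obtain B where B: "B \<ge> 0" "!!p. phom (B * rho2 p) (pmult (F (fst p)) (F (snd p))) (F (?m p))" by blast
  show ?thesis
  proof (intro exI conjI ballI)
    show "0 <= A" "0 <= B" by (rule A(1), rule B(1))
    show "path_ok (A * size g) (F g)" "fst (F g) = g" if "g \<in> \<S>" for g using A(2)[of g] e[of g] that by (simp_all add: rho1_def gen)
    show "phom (B * (size g + size h)) (pmult (F g) (F h)) (F (g \<cdot> h))" if "g \<in> \<S>" "h \<in> \<S>" for g h
      using B(2)[of "(g, h)"] that by (simp add: rho1_def rho2_def gen)
  qed
qed

lemma cone_transitive: "y \<in> cone ==> \<exists>g\<in>\<S>. move g (point \<one>\<^bsub>seqs\<^esub>) = y"
proof -
  assume "y \<in> cone"
  then obtain g where g: "g \<in> \<S>" "y = point g" unfolding cone_def by blast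
  then have "move g (point \<one>\<^bsub>seqs\<^esub>) = y" using move_point[OF g(1) S.one_closed] S.r_one[OF g(1)] by simp
  then show ?thesis using g(1) by blast
qed

theorem cone_null_homotopic:
  assumes "path f" "path_image f \<subseteq> cone" "pathfinish f = pathstart f" shows "homotopic_paths cone f (%_. pathstart f)"
proof -
  from words_exist obtain A B w where w: "0 <= A" "0 <= B"
    and w1: "\<forall>g\<in>\<S>. path_ok (A * size g) (w g) \<and> fst (w g) = g"
    and w2: "\<forall>g\<in>\<S>. \<forall>h\<in>\<S>. phom (B * (size g + size h)) (pmult (w g) (w h)) (w (g \<cdot> h))" by (elim exE conjE)
  show ?thesis
    by (rule null_homotopic_if_words[OF w(1,2) cone_transitive _ _ assms, of w]) (simp_all only: dist_base w1[rule_format] w2[rule_format] simp_thms)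
qed

theorem cone_path_connected:
  assumes "x \<in> cone" "y \<in> cone" shows "\<exists>g. path g \<and> path_image g \<subseteq> cone \<and> pathstart g = x \<and> pathfinish g = y"
proof -
  from words_exist obtain A B w where w: "0 <= A" "0 <= B"
    and w1: "\<forall>g\<in>\<S>. path_ok (A * size g) (w g) \<and> fst (w g) = g"
    and w2: "\<forall>g\<in>\<S>. \<forall>h\<in>\<S>. phom (B * (size g + size h)) (pmult (w g) (w h)) (w (g \<cdot> h))" by (elim exE conjE)
  show ?thesis
    by (rule connected_by_words[OF w(1,2) cone_transitive _ _ assms, of w]) (simp_all only: dist_base w1[rule_format] w2[rule_format] simp_thms)
qed

end

section \<open>Cones of coarse quotients\<close>

lemma basepoint_in_cone:
  assumes "nonprincipal_ultrafilter \<omega>" "x0 \<in> mspace M"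
  shows "cone_basepoint M x0 \<omega> \<in> topspace (mtopology_of (asymptotic_cone M x0 \<omega>))"
proof -
  interpret C: Metric_space "cone_points M x0 \<omega>" "cone_dist M x0 \<omega>" by (rule asymptotic_cone_is_metric[OF assms])
  have "limsup (%n. ereal (0 / real n)) <= ereal 0" by (rule Limsup_bounded) simp
  also have "... < \<infinity>" by simp
  finally have l: "limsup (%n. ereal (0 / real n)) < \<infinity>" .
  have z: "mdist M x0 x0 = 0" using assms(2) by simp
  have "(%n. x0) \<in> precone M x0" using assms(2) l unfolding precone_def mem_Collect_eq z by simp
  then have "cone_basepoint M x0 \<omega> \<in> cone_points M x0 \<omega>" by (simp add: cone_basepoint_def cone_points_def quotientI)
  then show ?thesis by (simp add: asymptotic_cone_def mtopology_of_def)
qed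

lemma homeomorphic_maps_lipschitz:
  fixes X :: "'x::metric_space set"
  assumes M: "Metric_space N d" and hh': "!!a. a \<in> N ==> h a \<in> X \<and> h' (h a) = a" "!!x. x \<in> X ==> h' x \<in> N \<and> h (h' x) = x"
    and C: "0 < C" and up: "!!a b. [|a \<in> N; b \<in> N|] ==> dist (h a) (h b) <= C * d a b"
    and lo: "!!a b. [|a \<in> N; b \<in> N|] ==> d a b <= C * dist (h a) (h b)"
  shows "homeomorphic_maps (mtopology_of (metric (N, d))) (top_of_set X) h h'"
proof -
  interpret M: Metric_space N d by (rule M)
  have m: "mspace (metric (N, d)) = N" "mdist (metric (N, d)) = d" "mtopology_of (metric (N, d)) = M.mtopology" by (simp_all add: mtopology_of_def)
  interpret X: Submetric UNIV "dist :: 'x => 'x => real" X by unfold_locales auto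
  have tX: "top_of_set X = X.sub.mtopology" by (simp add: X.mtopology_submetric)
  have 1: "continuous_map M.mtopology X.sub.mtopology h" unfolding M.metric_continuous_map[OF X.sub.Metric_space_axioms]
  proof (intro conjI ballI allI impI)
    show "h ` N \<subseteq> X" using hh' by blast
    fix a and e :: real assume a: "a \<in> N" "0 < e"
    have "dist (h a) (h b) < e" if "b \<in> N" "d a b < e / C" for b using up[OF a(1) that(1)] that(2) C by (simp add: field_simps)
    then show "\<exists>\<delta>>0. \<forall>x. x \<in> N \<and> d a x < \<delta> \<longrightarrow> dist (h a) (h x) < e"
      using a C by (intro exI[of _ "e / C"]) auto
  qed
  have 2: "continuous_map X.sub.mtopology M.mtopology h'" unfolding X.sub.metric_continuous_map[OF M.Metric_space_axioms]
  proof (intro conjI ballI allI impI)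
    show "h' ` X \<subseteq> N" using hh' by blast
    fix a and e :: real assume a: "a \<in> X" "0 < e"
    have "d (h' a) (h' b) < e" if "b \<in> X" "dist a b < e / C" for b
      using lo[of "h' a" "h' b"] hh'(2)[OF a(1)] hh'(2)[OF that(1)] that(2) C by (simp add: field_simps)
    then show "\<exists>\<delta>>0. \<forall>x. x \<in> X \<and> dist a x < \<delta> \<longrightarrow> d (h' a) (h' x) < e"
      using a C by (intro exI[of _ "e / C"]) auto
  qed
  show ?thesis unfolding m(3) tX homeomorphic_maps_def using 1 2 hh' by auto
qed

text \<open>A metric space that looks from far away like the quotient of G by a subset Z, with \<open>\<theta>\<close> choosing representatives. The elements z j represent all
sequences in Z up to size zero.\<close>

locale coarse_quotient = central_deck +
  fixes M :: "'pt metric" and x0 :: 'pt and \<theta> :: "'pt => 'a" and Z :: "'a set" and L :: real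
  assumes x0: "x0 \<in> mspace M" and L: "0 <= L" and Z_in: "Z \<subseteq> carrier G"
    and \<theta>_in: "!!x. x \<in> mspace M ==> \<theta> x \<in> carrier G"
    and \<theta>_len: "!!x. x \<in> mspace M ==> len (\<theta> x) <= L * (mdist M x x0 + 1)"
    and lower: "!!x y \<zeta>. [|x \<in> mspace M; y \<in> mspace M; \<zeta> \<in> Z|] ==> mdist M x y <= L * (len (inv (\<theta> x) \<otimes> \<theta> y \<otimes> \<zeta>) + 1)"
    and upper: "!!x y. [|x \<in> mspace M; y \<in> mspace M|] ==> \<exists>\<zeta>\<in>Z. len (inv (\<theta> x) \<otimes> \<theta> y \<otimes> \<zeta>) <= L * (mdist M x y + 1)"
    and dense: "!!g. g \<in> carrier G ==> \<exists>x\<in>mspace M. \<exists>\<zeta>\<in>Z. len (inv g \<otimes> (\<theta> x \<otimes> \<zeta>)) <= L"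
    and z_Z: "!!j n. j \<in> carrier D ==> z j n \<in> Z"
    and deck: "!!\<zeta>. [|\<zeta> \<in> \<S>; !!n. \<zeta> n \<in> Z|] ==> \<exists>j\<in>carrier D. size (inv\<^sub>s \<zeta> \<cdot> z j) = 0"
begin

lemma len_factor: "[|g \<in> carrier G; h \<in> carrier G|] ==> len h <= len g + len (inv g \<otimes> h)"
  using len_mult[of g "inv g \<otimes> h"] by (simp add: m_assoc[symmetric])

lemma tail_len:
  assumes "g \<in> carrier G" "h \<in> carrier G" "\<zeta> \<in> carrier G"
  shows "len \<zeta> <= len g + len h + len (inv g \<otimes> h \<otimes> \<zeta>)"
proof -
  have "len \<zeta> <= len (inv (inv g \<otimes> h)) + len (inv g \<otimes> h \<otimes> \<zeta>)"
    using len_factor[of "inv (inv g \<otimes> h)" \<zeta>] assms by simp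
  moreover have "len (inv g \<otimes> h) <= len g + len h" using len_mult[of "inv g" h] assms by (simp add: len_inv)
  ultimately show ?thesis using assms by (simp add: len_inv)
qed

abbreviation lift :: "(nat => 'pt) => nat => 'a" where
  "lift x \<equiv> %n. \<theta> (x n)"

lemma precone_space: "x \<in> precone M x0 ==> x n \<in> mspace M" by (simp add: precone_def)

text \<open>Finitely many terms are not controlled by the limsup; they are absorbed into the constant.\<close>

lemma precone_linear:
  assumes x: "x \<in> precone M x0" obtains B where "0 <= B" "!!n. mdist M (x n) x0 <= B * real (n + 1)"
proof -
  have "limsup (%n. ereal (mdist M (x n) x0 / real n)) < \<infinity>" using x by (simp add: precone_def)
  then obtain B where "limsup (%n. ereal (mdist M (x n) x0 / real n)) < ereal B" by (metis ereal_dense2 less_ereal.simps(1))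
  then have "eventually (%n. ereal (mdist M (x n) x0 / real n) < ereal B) sequentially" by (rule Limsup_lessD)
  then obtain N where N: "!!n. n \<ge> N ==> mdist M (x n) x0 / real n < B" by (auto simp: eventually_sequentially)
  define B' where "B' = \<bar>B\<bar> + (\<Sum>n\<le>N. mdist M (x n) x0)"
  have nn: "0 <= (\<Sum>n\<le>N. mdist M (x n) x0)" by (intro sum_nonneg) auto
  have "mdist M (x n) x0 <= B' * real (n + 1)" for n
  proof (cases "n <= N")
    case True
    then have "mdist M (x n) x0 <= (\<Sum>n\<le>N. mdist M (x n) x0)" by (intro member_le_sum) auto
    also have "... <= B' * 1" by (simp add: B'_def)
    also have "... <= B' * real (n + 1)" using nn by (intro mult_left_mono) (auto simp: B'_def)
    finally show ?thesis .
  next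
    case False
    then have "mdist M (x n) x0 <= B * real n" using N[of n] by (simp add: field_simps)
    also have "... <= B' * real (n + 1)" using nn by (intro mult_mono) (auto simp: B'_def)
    finally show ?thesis .
  qed
  moreover have "0 <= B'" using nn by (simp add: B'_def)
  ultimately show ?thesis using that by blast
qed

lemma preconeI:
  assumes "!!n. x n \<in> mspace M" "0 <= B" "!!n. mdist M (x n) x0 <= B * real (n + 1)" shows "x \<in> precone M x0"
proof -
  have "\<forall>\<^sub>F n in sequentially. ereal (mdist M (x n) x0 / real n) <= ereal (2 * B)" using eventually_gt_at_top[of 0]
  proof eventually_elim
    case (elim n)
    have "mdist M (x n) x0 <= B * real (n + 1)" by (rule assms)
    also have "... <= B * (2 * real n)" using elim assms(2) by (intro mult_left_mono) auto
    finally show ?case using elim by (simp add: field_simps)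
  qed
  then have "limsup (%n. ereal (mdist M (x n) x0 / real n)) <= ereal (2 * B)" by (rule Limsup_bounded)
  also have "... < \<infinity>" by simp
  finally show ?thesis using assms(1) by (simp add: precone_def)
qed

lemma lift_in: assumes x: "x \<in> precone M x0" shows "lift x \<in> \<S>"
proof -
  obtain B where B: "0 <= B" "!!n. mdist M (x n) x0 <= B * real (n + 1)" using precone_linear[OF x] by blast
  show ?thesis
  proof (rule seqsI)
    show "\<theta> (x n) \<in> carrier G" for n using x by (simp add: precone_space \<theta>_in)
    show "len (\<theta> (x n)) <= (L * (B + 1)) * real (n + 1)" for n
    proof -
      have "mdist M (x n) x0 + 1 <= (B + 1) * real (n + 1)" using B(2)[of n] by (simp add: distrib_right)
      then have "L * (mdist M (x n) x0 + 1) <= L * ((B + 1) * real (n + 1))" using L by (intro mult_left_mono)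
      then show ?thesis using \<theta>_len[OF precone_space[OF x, of n]] by (simp add: mult.assoc)
    qed
  qed
qed

lemma Z_seq:
  assumes g: "g \<in> \<S>" "h \<in> \<S>" and \<zeta>: "!!n. \<zeta> n \<in> Z" and B: "!!n. len (inv (g n) \<otimes> h n \<otimes> \<zeta> n) <= B * real (n + 1)"
  shows "\<zeta> \<in> \<S>"
proof -
  obtain B1 where B1: "!!n. len (g n) <= B1 * real (n + 1)" using seqs_bound[OF g(1)] by blast
  obtain B2 where B2: "!!n. len (h n) <= B2 * real (n + 1)" using seqs_bound[OF g(2)] by blast
  show ?thesis
  proof (rule seqsI)
    show \<zeta>c: "\<zeta> n \<in> carrier G" for n using \<zeta> Z_in by blast
    show "len (\<zeta> n) <= (B1 + B2 + B) * real (n + 1)" for n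
      using tail_len[OF seqs_in[OF g(1), of n] seqs_in[OF g(2), of n] \<zeta>c[of n]] B1[of n] B2[of n] B[of n] by (simp only: distrib_right)
  qed
qed

lemma qdist_le_by_Z:
  assumes g: "g \<in> \<S>" "h \<in> \<S>" and \<zeta>: "!!n. \<zeta> n \<in> Z" "\<zeta> \<in> \<S>"
  shows "qdist g h <= size (inv\<^sub>s g \<cdot> h \<cdot> \<zeta>)"
proof -
  obtain j where j: "j \<in> carrier D" "size (inv\<^sub>s \<zeta> \<cdot> z j) = 0" using deck[OF \<zeta>(2,1)] by blast
  have "inv\<^sub>s g \<cdot> (h \<cdot> z j) = (inv\<^sub>s g \<cdot> h \<cdot> \<zeta>) \<cdot> (inv\<^sub>s \<zeta> \<cdot> z j)"
  proof -
    have "\<zeta> \<cdot> (inv\<^sub>s \<zeta> \<cdot> z j) = z j" using \<zeta>(2) z_in[OF j(1)] by (simp flip: S.m_assoc)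
    then show ?thesis using g \<zeta>(2) z_in[OF j(1)] by (simp add: S.m_assoc)
  qed
  then have "sdist g (h \<cdot> z j) <= size (inv\<^sub>s g \<cdot> h \<cdot> \<zeta>) + size (inv\<^sub>s \<zeta> \<cdot> z j)"
    unfolding sdist_def using size_mult g \<zeta>(2) z_in[OF j(1)] by simp
  then show ?thesis using qdist_le[OF j(1), of g h] j(2) by simp
qed

lemma tendsto_linear_bound:
  assumes "!!n. f n <= L * (g n + 1)" "((%n. g n / real n) \<longlongrightarrow> a) \<omega>" "((%n. f n / real n) \<longlongrightarrow> a') \<omega>"
  shows "a' <= L * a"
proof (rule tendsto_le[OF nb _ assms(3)])
  have "((%n. 1 / real n) \<longlongrightarrow> 0) \<omega>"
    using lim_1_over_n nonprincipal_ultrafilter_le_sequentially[OF ultra] by (rule tendsto_mono[rotated])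
  then have "((%n. L * (g n / real n + 1 / real n)) \<longlongrightarrow> L * (a + 0)) \<omega>" by (intro tendsto_intros assms(2))
  then show "((%n. L * (g n / real n + 1 / real n)) \<longlongrightarrow> L * a) \<omega>" by simp
  show "\<forall>\<^sub>F n in \<omega>. f n / real n <= L * (g n / real n + 1 / real n)"
  proof (intro always_eventually allI)
    fix n show "f n / real n <= L * (g n / real n + 1 / real n)"
      using divide_right_mono[OF assms(1)[of n], of "real n"] by (simp flip: add_divide_distrib)
  qed
qed

lemma mdist_tendsto: "[|x \<in> precone M x0; y \<in> precone M x0|] ==> ((%n. mdist M (x n) (y n) / real n) \<longlongrightarrow> precone_dist M \<omega> x y) \<omega>"
  using precone_dist_tendsto[OF ultra x0, of x y] by (simp add: field_simps)

lemma qdist_upper: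
  assumes x: "x \<in> precone M x0" and y: "y \<in> precone M x0" shows "qdist (lift x) (lift y) <= L * precone_dist M \<omega> x y"
proof -
  note g = lift_in[OF x] and h = lift_in[OF y]
  have "\<exists>\<zeta>. \<zeta> \<in> Z \<and> len (inv (\<theta> (x n)) \<otimes> \<theta> (y n) \<otimes> \<zeta>) <= L * (mdist M (x n) (y n) + 1)" for n
    using upper[OF precone_space[OF x] precone_space[OF y]] by blast
  then obtain \<zeta> where \<zeta>: "!!n. \<zeta> n \<in> Z" "!!n. len (inv (\<theta> (x n)) \<otimes> \<theta> (y n) \<otimes> \<zeta> n) <= L * (mdist M (x n) (y n) + 1)" by metis
  obtain B where B: "0 <= B" "!!n. mdist M (x n) x0 <= B * real (n + 1)" using precone_linear[OF x] by blast
  obtain B' where B': "0 <= B'" "!!n. mdist M (y n) x0 <= B' * real (n + 1)" using precone_linear[OF y] by blast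
  have "len (inv (\<theta> (x n)) \<otimes> \<theta> (y n) \<otimes> \<zeta> n) <= (L * (B + B' + 1)) * real (n + 1)" for n
  proof -
    have "mdist M (x n) (y n) <= mdist M (x n) x0 + mdist M x0 (y n)" using precone_space[OF x] precone_space[OF y] x0 by (intro mdist_triangle) auto
    then have "mdist M (x n) (y n) + 1 <= (B + B' + 1) * real (n + 1)" using B(2)[of n] B'(2)[of n] by (simp add: distrib_right mdist_commute)
    then have "L * (mdist M (x n) (y n) + 1) <= L * ((B + B' + 1) * real (n + 1))" using L by (intro mult_left_mono)
    then show ?thesis using \<zeta>(2)[of n] by (simp add: mult.assoc)
  qed
  then have \<zeta>s: "\<zeta> \<in> \<S>" by (rule Z_seq[OF g h \<zeta>(1)])
  have e: "(inv\<^sub>s (lift x) \<cdot> lift y \<cdot> \<zeta>) n = inv (\<theta> (x n)) \<otimes> \<theta> (y n) \<otimes> \<zeta> n" for n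
    by (simp add: seqs_inv[OF g])
  have "size (inv\<^sub>s (lift x) \<cdot> lift y \<cdot> \<zeta>) <= L * precone_dist M \<omega> x y"
    using \<zeta>(2) by (intro tendsto_linear_bound[OF _ mdist_tendsto[OF x y] size_tendsto]) (simp_all add: e g h \<zeta>s del: seqs_mult)
  then show ?thesis using qdist_le_by_Z[OF g h \<zeta>(1) \<zeta>s] by simp
qed

lemma qdist_lower:
  assumes x: "x \<in> precone M x0" and y: "y \<in> precone M x0" shows "precone_dist M \<omega> x y <= L * qdist (lift x) (lift y)"
proof -
  note g = lift_in[OF x] and h = lift_in[OF y]
  obtain j where j: "j \<in> carrier D" "qdist (lift x) (lift y) = sdist (lift x) (lift y \<cdot> z j)" using qdist_ex by blast
  have e: "(inv\<^sub>s (lift x) \<cdot> (lift y \<cdot> z j)) n = inv (\<theta> (x n)) \<otimes> \<theta> (y n) \<otimes> z j n" for n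
    using \<theta>_in[OF precone_space[OF x, of n]] \<theta>_in[OF precone_space[OF y, of n]] seqs_in[OF z_in[OF j(1)], of n] by (simp add: seqs_inv[OF g] m_assoc)
  show ?thesis unfolding j(2) sdist_def
  proof (rule tendsto_linear_bound[OF _ size_tendsto mdist_tendsto[OF x y]])
    show "inv\<^sub>s (lift x) \<cdot> (lift y \<cdot> z j) \<in> \<S>" using g h z_in[OF j(1)] by simp
    show "mdist M (x n) (y n) <= L * (len ((inv\<^sub>s (lift x) \<cdot> (lift y \<cdot> z j)) n) + 1)" for n
      unfolding e by (rule lower[OF precone_space[OF x] precone_space[OF y] z_Z[OF j(1)]])
  qed
qed

text \<open>Choosing for each n a point near g n up to Z gives a sequence at sublinear distance.\<close>

lemma lift_dense:
  assumes g: "g \<in> \<S>" shows "\<exists>x\<in>precone M x0. qpoint (lift x) = qpoint g"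
proof -
  have "\<exists>x \<zeta>. x \<in> mspace M \<and> \<zeta> \<in> Z \<and> len (inv (g n) \<otimes> (\<theta> x \<otimes> \<zeta>)) <= L" for n
    using dense[OF seqs_in[OF g, of n]] by blast
  then obtain x \<zeta> where x: "!!n. x n \<in> mspace M" "!!n. \<zeta> n \<in> Z" "!!n. len (inv (g n) \<otimes> (\<theta> (x n) \<otimes> \<zeta> n)) <= L" by metis
  have c: "g n \<in> carrier G" "\<theta> (x n) \<in> carrier G" "\<zeta> n \<in> carrier G" "\<theta> x0 \<in> carrier G" for n
    using seqs_in[OF g] \<theta>_in x x0 Z_in by auto
  obtain B where B: "0 <= B" "!!n. len (g n) <= B * real (n + 1)" using seqs_bound[OF g] by blast
  let ?B = "L * (len (\<theta> x0) + B + L + 1)"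
  have xp: "x \<in> precone M x0"
  proof (rule preconeI[OF x(1)])
    show "0 <= ?B" using L B(1) len_nonneg[OF c(4)] by simp
    fix n
    have "len (\<theta> (x n) \<otimes> \<zeta> n) <= len (g n) + L" using len_factor[of "g n" "\<theta> (x n) \<otimes> \<zeta> n"] x(3)[of n] c by simp
    moreover have "len (inv (\<theta> x0) \<otimes> \<theta> (x n) \<otimes> \<zeta> n) <= len (\<theta> x0) + len (\<theta> (x n) \<otimes> \<zeta> n)"
      using len_mult[of "inv (\<theta> x0)" "\<theta> (x n) \<otimes> \<zeta> n"] c by (simp add: len_inv m_assoc)
    ultimately have "len (inv (\<theta> x0) \<otimes> \<theta> (x n) \<otimes> \<zeta> n) + 1 <= B * real (n + 1) + (len (\<theta> x0) + L + 1) * 1" using B(2)[of n] by simp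
    also have "... <= B * real (n + 1) + (len (\<theta> x0) + L + 1) * real (n + 1)"
      using L len_nonneg[OF c(4)] by (intro add_left_mono mult_left_mono) auto
    finally have "len (inv (\<theta> x0) \<otimes> \<theta> (x n) \<otimes> \<zeta> n) + 1 <= (len (\<theta> x0) + B + L + 1) * real (n + 1)" by (simp add: algebra_simps)
    then have "L * (len (inv (\<theta> x0) \<otimes> \<theta> (x n) \<otimes> \<zeta> n) + 1) <= L * ((len (\<theta> x0) + B + L + 1) * real (n + 1))" using L by (intro mult_left_mono)
    then show "mdist M (x n) x0 <= ?B * real (n + 1)" using lower[OF x0 x(1)[of n] x(2)[of n]] by (simp add: mdist_commute mult.assoc)
  qed
  note h = lift_in[OF xp]
  have e: "inv (g n) \<otimes> \<theta> (x n) \<otimes> \<zeta> n = inv (g n) \<otimes> (\<theta> (x n) \<otimes> \<zeta> n)" for n using c by (simp add: m_assoc)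
  have "len (inv (g n) \<otimes> \<theta> (x n) \<otimes> \<zeta> n) <= L * real (n + 1)" for n
    using x(3)[of n] mult_left_mono[of 1 "real (n + 1)" L] L by (simp add: e)
  then have \<zeta>s: "\<zeta> \<in> \<S>" by (rule Z_seq[OF g h x(2)])
  have "size (inv\<^sub>s g \<cdot> lift x \<cdot> \<zeta>) <= L * 0"
  proof (rule tendsto_linear_bound[OF _ _ size_tendsto])
    show "inv\<^sub>s g \<cdot> lift x \<cdot> \<zeta> \<in> \<S>" using g h \<zeta>s by simp
    show "((%n. 0 / real n) \<longlongrightarrow> 0) \<omega>" by simp
    show "len ((inv\<^sub>s g \<cdot> lift x \<cdot> \<zeta>) n) <= L * (0 + 1)" for n using x(3)[of n] by (simp add: seqs_inv[OF g] e)
  qed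
  then have "qdist g (lift x) = 0" using qdist_le_by_Z[OF g h x(2) \<zeta>s] qdist_nonneg[OF g h] by simp
  then have "qpoint (lift x) = qpoint g" using dist_qpoint[OF g h] by simp
  then show ?thesis using xp by blast
qed

text \<open>The two distances are comparable up to the factor L, because additive constants vanish after division by n.\<close>

theorem cone_homeomorphic_quotient:
  "\<exists>h h'. homeomorphic_maps (mtopology_of (asymptotic_cone M x0 \<omega>)) (top_of_set (qpoint ` \<S>)) h h' \<and>
     h (cone_basepoint M x0 \<omega>) = qpoint (%n. \<theta> x0) \<and> (%n. \<theta> x0) \<in> \<S>"
proof -
  let ?c = "%x. cone_rel M x0 \<omega> `` {x}"
  note E = equiv_cone_rel[OF ultra x0] and cd = cone_dist_class[OF ultra x0]
  define h where "h a = qpoint (lift (SOME x. x \<in> a))" for a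
  define h' where "h' p = ?c (SOME x. x \<in> precone M x0 \<and> qpoint (lift x) = p)" for p
  have zero: "qpoint (lift x) = qpoint (lift y) \<longleftrightarrow> (x, y) \<in> cone_rel M x0 \<omega>" if "x \<in> precone M x0" "y \<in> precone M x0" for x y
  proof -
    have "qpoint (lift x) = qpoint (lift y) \<longleftrightarrow> qdist (lift x) (lift y) = 0"
      using dist_qpoint[OF lift_in[OF that(1)] lift_in[OF that(2)]] by (metis dist_eq_0_iff)
    also have "... \<longleftrightarrow> precone_dist M \<omega> x y = 0"
      using qdist_upper[OF that] qdist_lower[OF that] qdist_nonneg[OF lift_in[OF that(1)] lift_in[OF that(2)]]
        precone_dist_pseudometric(1)[OF ultra x0 that that(1)] by auto
    finally show ?thesis using that by (simp add: cone_rel_def)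
  qed
  have h: "h (?c x) = qpoint (lift x)" if x: "x \<in> precone M x0" for x
  proof -
    have "(SOME y. y \<in> ?c x) \<in> ?c x" using equiv_class_self[OF E x] by (rule someI[where P = "%y. y \<in> ?c x"])
    then obtain y where y: "y = (SOME y. y \<in> ?c x)" "(x, y) \<in> cone_rel M x0 \<omega>" by blast
    from y(2) have yp: "y \<in> precone M x0" by (simp add: cone_rel_def)
    show ?thesis unfolding h_def y(1)[symmetric] by (rule iffD2[OF zero[OF x yp] y(2), symmetric])
  qed
  have h': "h' (qpoint (lift x)) = ?c x" if x: "x \<in> precone M x0" for x
  proof -
    let ?y = "SOME y. y \<in> precone M x0 \<and> qpoint (lift y) = qpoint (lift x)"
    have "?y \<in> precone M x0 \<and> qpoint (lift ?y) = qpoint (lift x)"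
      using x by (intro someI[where P = "%y. y \<in> precone M x0 \<and> qpoint (lift y) = qpoint (lift x)"]) auto
    then show ?thesis unfolding h'_def using zero[of ?y x] x equiv_class_eq[OF E] by blast
  qed
  have rep: "\<exists>x \<in> precone M x0. a = ?c x" if "a \<in> cone_points M x0 \<omega>" for a
    using that by (auto simp: cone_points_def quotient_def)
  have cp: "?c x \<in> cone_points M x0 \<omega>" if "x \<in> precone M x0" for x using that by (simp add: cone_points_def quotientI)
  have "homeomorphic_maps (mtopology_of (asymptotic_cone M x0 \<omega>)) (top_of_set (qpoint ` \<S>)) h h'" unfolding asymptotic_cone_def
  proof (rule homeomorphic_maps_lipschitz[OF asymptotic_cone_is_metric[OF ultra x0], of _ _ _ "L + 1"])
    show "0 < L + 1" using L by simp
    have big: "c <= (L + 1) * d" if "c <= L * d" "0 <= d" for c d using that by (simp add: distrib_right)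
    show "h a \<in> qpoint ` \<S> \<and> h' (h a) = a" if a: "a \<in> cone_points M x0 \<omega>" for a
    proof -
      obtain x where x: "x \<in> precone M x0" "a = ?c x" using rep[OF a] by blast
      show ?thesis unfolding x(2) h[OF x(1)] h'[OF x(1)] using lift_in[OF x(1)] by blast
    qed
    show "h' p \<in> cone_points M x0 \<omega> \<and> h (h' p) = p" if p: "p \<in> qpoint ` \<S>" for p
    proof -
      obtain g where g: "g \<in> \<S>" "p = qpoint g" using p by blast
      obtain x where x: "x \<in> precone M x0" "p = qpoint (lift x)" using lift_dense[OF g(1)] g(2) by metis
      show ?thesis unfolding x(2) h'[OF x(1)] h[OF x(1)] using cp[OF x(1)] by blast
    qed
    show "dist (h a) (h b) <= (L + 1) * cone_dist M x0 \<omega> a b" if ab: "a \<in> cone_points M x0 \<omega>" "b \<in> cone_points M x0 \<omega>" for a b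
    proof -
      obtain x where x: "x \<in> precone M x0" "a = ?c x" using rep[OF ab(1)] by blast
      obtain y where y: "y \<in> precone M x0" "b = ?c y" using rep[OF ab(2)] by blast
      show ?thesis unfolding x(2) y(2) cd[OF x(1) y(1)] h[OF x(1)] h[OF y(1)] dist_qpoint[OF lift_in[OF x(1)] lift_in[OF y(1)]]
        by (rule big[OF qdist_upper[OF x(1) y(1)] precone_dist_pseudometric(1)[OF ultra x0 x(1) y(1) x(1)]])
    qed
    show "cone_dist M x0 \<omega> a b <= (L + 1) * dist (h a) (h b)" if ab: "a \<in> cone_points M x0 \<omega>" "b \<in> cone_points M x0 \<omega>" for a b
    proof -
      obtain x where x: "x \<in> precone M x0" "a = ?c x" using rep[OF ab(1)] by blast
      obtain y where y: "y \<in> precone M x0" "b = ?c y" using rep[OF ab(2)] by blast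
      show ?thesis unfolding x(2) y(2) cd[OF x(1) y(1)] h[OF x(1)] h[OF y(1)] dist_qpoint[OF lift_in[OF x(1)] lift_in[OF y(1)]]
        by (rule big[OF qdist_lower[OF x(1) y(1)] qdist_nonneg[OF lift_in[OF x(1)] lift_in[OF y(1)]]])
    qed
  qed
  moreover have c0: "(%n. x0) \<in> precone M x0" by (rule preconeI[of _ 0]) (simp_all add: x0 mdist_zero[OF x0 x0, THEN iffD2])
  ultimately show ?thesis using h[OF c0] lift_in[OF c0] unfolding cone_basepoint_def by blast
qed

theorem fundamental_group_of_cone:
  assumes pc: "!!x y. [|x \<in> cone; y \<in> cone|] ==> \<exists>g. path g \<and> path_image g \<subseteq> cone \<and> pathstart g = x \<and> pathfinish g = y"
    and sc: "!!g. [|path g; path_image g \<subseteq> cone; pathfinish g = pathstart g|] ==> homotopic_paths cone g (%_. pathstart g)"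
  shows "fundamental_group (mtopology_of (asymptotic_cone M x0 \<omega>)) (cone_basepoint M x0 \<omega>) \<cong> D"
proof -
  obtain h h' where h: "homeomorphic_maps (mtopology_of (asymptotic_cone M x0 \<omega>)) (top_of_set (qpoint ` \<S>)) h h'"
    "h (cone_basepoint M x0 \<omega>) = qpoint (%n. \<theta> x0)" "(%n. \<theta> x0) \<in> \<S>" using cone_homeomorphic_quotient by blast
  have y0: "point (%n. \<theta> x0) \<in> cone" by (rule point_in[OF h(3)])
  show ?thesis
    by (rule Q.fundamental_group_of_quotient[OF h(1) y0 basepoint_in_cone[OF ultra x0] _ pc[OF y0] sc]) (simp_all add: h(2) qmap_point[OF h(3)])
qed

end

section \<open>Length functions on the matrix group\<close>

definition TR :: "'k::field rf tri set" where
  "TR = {a. d2 a \<in> units \<and> d3 a \<in> units \<and> (\<forall>e\<in>{e12, e13, e14, e23, e24, e34}. e a \<in> \<R>)}"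

lemma TR_tri: "Tri p q a b c d e f \<in> TR \<longleftrightarrow> p \<in> units \<and> q \<in> units \<and> a \<in> \<R> \<and> b \<in> \<R> \<and>
    c \<in> \<R> \<and> d \<in> \<R> \<and> e \<in> \<R> \<and> f \<in> \<R>" by (simp add: TR_def)

lemma TR_sel:
  assumes "a \<in> TR" shows "d2 a \<in> units" "d3 a \<in> units" "e12 a \<in> \<R>" "e13 a \<in> \<R>"
  "e14 a \<in> \<R>" "e23 a \<in> \<R>" "e24 a \<in> \<R>" "e34 a \<in> \<R>" using assms by (auto simp: TR_def)

lemma TR_mult: assumes "a \<in> TR" "b \<in> TR" shows "tmul a b \<in> TR"
  unfolding tmul_def TR_tri using TR_sel[OF assms(1)] TR_sel[OF assms(2)] by (intro conjI R_add R_mult units_mult) (auto intro: units_R)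

lemma TR_inv: assumes "a \<in> TR" shows "tinv a \<in> TR"
proof -
  note s = TR_sel[OF assms]
  have i: "inverse (d2 a) \<in> \<R>" "inverse (d3 a) \<in> \<R>" using s units_R units_inverse by blast+
  show ?thesis unfolding tinv_def TR_tri divide_inverse inverse_mult_distrib using s i by (intro conjI R_add R_diff R_mult R_uminus units_inverse)
qed

lemma TR_ut: "ut a b c d e f \<in> TR \<longleftrightarrow> a \<in> \<R> \<and> b \<in> \<R> \<and>
    c \<in> \<R> \<and> d \<in> \<R> \<and> e \<in> \<R> \<and> f \<in> \<R>" by (simp add: ut_def TR_tri one_units)

lemma TR_diag: "diag p q \<in> TR \<longleftrightarrow> p \<in> units \<and> q \<in> units" by (simp add: diag_def TR_tri R_0)

lemma TR_PG: "a \<in> TR ==> (%v. a) \<in> carrier PG" by (rule PGI[of _ "d2 a" "d3 a"]) (auto simp: TR_sel)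

fun rt :: "root => 'f => 'f::field tri" where
  "rt R12 r = ut r 0 0 0 0 0"
| "rt R13 r = ut 0 r 0 0 0 0"
| "rt R23 r = ut 0 0 0 r 0 0"
| "rt R24 r = ut 0 0 0 0 r 0"
| "rt R34 r = ut 0 0 0 0 0 r"

fun tor :: "root => 'f => 'f::field tri" where
  "tor R12 p = diag (inverse p) 1"
| "tor R13 p = diag 1 (inverse p)"
| "tor R23 p = diag p 1"
| "tor R24 p = diag p 1"
| "tor R34 p = diag 1 p"

lemma rt_add: "rt \<alpha> (r + s) = tmul (rt \<alpha> r) (rt \<alpha> s)" by (cases \<alpha>) (simp_all add: tmul_ut add.commute)

lemma tor_mult: "tor \<alpha> (p * q) = tmul (tor \<alpha> p) (tor \<alpha> q)" by (cases \<alpha>) (simp_all add: tmul_diag)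

lemma tor_rt: "p ~= 0 ==> tmul (tor \<alpha> p) (rt \<alpha> r) = tmul (rt \<alpha> (p * r)) (tor \<alpha> p)"
  by (cases \<alpha>) (simp_all add: tmul_def diag_def ut_def)

lemma rt_TR: "r \<in> \<R> ==> rt \<alpha> r \<in> TR" by (cases \<alpha>) (simp_all add: TR_ut R_0)

lemma tor_TR: "p \<in> units ==> tor \<alpha> p \<in> TR" by (cases \<alpha>) (simp_all add: TR_diag one_units units_inverse)

text \<open>Besides the constants, only monomials with exponents between -1 and 1, so the set is finite if the field is.\<close>

definition gens :: "'k::field rf tri set" where
  "gens = (%((c, d), (i, j, k, l)). diag (cst c * tmono i j) (cst d * tmono k l)) ` (({c. c ~= 0} \<times> {d. d ~= 0}) \<times> ({-1..1} \<times> {-1..1} \<times> {-1..1} \<times> {-1..1}))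
     \<union> (%(\<alpha>, c). rt \<alpha> (cst c)) ` ({R12, R13, R23, R24, R34} \<times> UNIV)"

lemma finite_gens: "finite (UNIV :: 'k::field set) ==> finite (gens :: 'k rf tri set)"
  unfolding gens_def by (intro finite_UnI finite_imageI finite_cartesian_product) (auto intro: finite_subset)

lemma gens_diag: "[|c ~= 0; d ~= 0; i \<in> {-1..1}; j \<in> {-1..1}; k \<in> {-1..1}; l \<in> {-1..1}|] ==> diag (cst c * tmono i j) (cst d * tmono k l) \<in> gens"
  unfolding gens_def by (rule UnI1, rule image_eqI[of _ _ "((c, d), (i, j, k, l))"]) auto

lemma gens_mono: "[|i \<in> {-1..1}; j \<in> {-1..1}; k \<in> {-1..1}; l \<in> {-1..1}|] ==> diag (tmono i j) (tmono k l) \<in> gens"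
  using gens_diag[of 1 1 i j k l] by (simp add: cst_hom)

lemma gens_rt: "rt \<alpha> (cst c) \<in> gens" unfolding gens_def by (rule UnI2, rule image_eqI[of _ _ "(\<alpha>, c)"], simp, cases \<alpha>) auto

lemma gens_TR: "gens \<subseteq> TR" unfolding gens_def by (auto simp: TR_diag cst_tmono_units simp del: rt.simps intro!: rt_TR R_cst)

lemma uniformizer_mono: "uniformizer At0 = tmono (-1) 0" "uniformizer At1 = tmono 0 (-1)" "uniformizer AtInf = tmono 1 0"
  by (simp_all add: uniformizer_def tmono_def power_int_minus)

lemma uniformizer_units: "uniformizer v \<in> units" by (cases v) (simp_all add: uniformizer_mono tmono_units)

lemma tmono_00: "tmono 0 0 = 1" by (simp add: tmono_def)

lemma gens_tor: "tor \<alpha> (uniformizer v) \<in> gens" "tor \<alpha> 1 \<in> gens" "tone \<in> gens"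
proof -
  have a: "diag (tmono i j) 1 \<in> gens" "diag 1 (tmono i j) \<in> gens" if "i \<in> {-1..1}" "j \<in> {-1..1}" for i j
    using gens_mono[of i j 0 0] gens_mono[of 0 0 i j] that by (simp_all add: tmono_00)
  show "tor \<alpha> (uniformizer v) \<in> gens" by (cases \<alpha>; cases v) (simp_all add: uniformizer_mono a flip: tmono_minus)
  show "tor \<alpha> 1 \<in> gens" using a[of 0 0] by (cases \<alpha>) (simp_all add: tmono_00)
  show "tone \<in> gens" using a(1)[of 0 0] by (simp add: tmono_00 diag_def tone_def)
qed

lemma units_power: "p \<in> units ==> p ^ k \<in> units" by (induction k) (auto simp: one_units units_mult)

text \<open>Adding the principal parts at the two other places does not spoil the approximation at v.\<close>

lemma fnorm_diff_three:
  fixes s :: "place => 'k::field rf"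
  assumes v: "fnorm v (x - s v) <= 1" and o: "!!w. w ~= v ==> fnorm v (s w) <= 1" shows "fnorm v (x - (s At0 + s At1 + s AtInf)) <= 1"
proof -
  obtain y z where yz: "fnorm v y <= 1" "fnorm v z <= 1" "x - (s At0 + s At1 + s AtInf) = (x - s v) - (y + z)"
  proof (cases v)
    case At0
    show thesis by (rule that[of "s At1" "s AtInf"]) (simp_all add: At0 o[unfolded At0] algebra_simps)
  next
    case At1
    show thesis by (rule that[of "s At0" "s AtInf"]) (simp_all add: At1 o[unfolded At1] algebra_simps)
  next
    case AtInf
    show thesis by (rule that[of "s At0" "s At1"]) (simp_all add: AtInf o[unfolded AtInf] algebra_simps)
  qed
  show ?thesis unfolding yz(3) by (intro fnorm_diff_le fnorm_add_le v yz(1,2))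
qed

text \<open>Partial fractions: after subtracting the principal parts at the three places the rest is regular everywhere, hence constant.\<close>

lemma R_horner_decomposition:
  assumes r: "r \<in> \<R>" and b: "!!v. fnorm v r <= exp (real k)"
  shows "\<exists>s c. (\<forall>v. s v \<in> horner v k) \<and> r = s At0 + s At1 + s AtInf + cst c"
proof -
  have "\<forall>v. \<exists>s\<in>horner v k. fnorm v (r - s) <= exp (-1)" using horner_approx b by blast
  then obtain s where s: "!!v. s v \<in> horner v k" "!!v. fnorm v (r - s v) <= exp (-1)" by metis
  have s1: "fnorm v (r - s v) <= 1" for v using s(2)[of v] by (rule order_trans) simp
  let ?r = "r - (s At0 + s At1 + s AtInf)"
  have "?r \<in> \<R>" using r R_horner[OF s(1)] by (intro R_diff R_add)
  moreover have "fnorm v ?r <= 1" for v by (rule fnorm_diff_three[where s = s, OF s1 horner_norm[OF s(1)]]) blast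
  ultimately obtain c where "?r = cst c" using R_bounded_is_constant by blast
  then have "r = s At0 + s At1 + s AtInf + cst c" by (simp add: diff_eq_eq add.commute)
  then show ?thesis using s(1) by blast
qed

locale length_on_TR =
  fixes W :: "'k::field rf tri => real" and M :: real
  assumes W_mult: "!!a b. [|a \<in> TR; b \<in> TR|] ==> W (tmul a b) <= W a + W b"
    and W_inv: "!!a. a \<in> TR ==> W (tinv a) = W a"
    and W_gens: "!!a. a \<in> gens ==> W a <= M" and M_nonneg: "0 <= M"
begin

lemma W_power:
  assumes "p \<in> units" "q \<in> units" "diag p q \<in> gens" shows "W (diag (p ^ n) (q ^ n)) <= (real n + 1) * M"
proof (induction n)
  case 0
  show ?case using W_gens[OF gens_tor(3)] by (simp add: diag_def tone_def)
next
  case (Suc n)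
  have "W (diag (p ^ Suc n) (q ^ Suc n)) = W (tmul (diag p q) (diag (p ^ n) (q ^ n)))" by (simp add: tmul_diag)
  also have "... <= W (diag p q) + W (diag (p ^ n) (q ^ n))" using assms by (intro W_mult) (auto simp: TR_diag units_power)
  finally show ?case using Suc W_gens[OF assms(3)] by (simp add: algebra_simps)
qed

lemma W_tor: "W (tor \<alpha> (uniformizer v ^ n)) <= (real n + 1) * M"
  using W_power[of "inverse (uniformizer v)" 1 n] W_power[of 1 "inverse (uniformizer v)" n] W_power[of "uniformizer v" 1 n] W_power[of 1 "uniformizer v" n]
    gens_tor(1)[of \<alpha> v] uniformizer_units[of v] units_inverse[OF uniformizer_units[of v]] by (cases \<alpha>) (simp_all add: one_units power_inverse)

text \<open>By Horner's scheme, conjugating by the torus element tor once per coefficient writes an elementary matrix of degree k as a product of O(k)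
generators.\<close>

lemma W_horner:
  assumes "r \<in> horner v k" shows "W (rt \<alpha> r) <= (3 * real k + 2) * M"
proof -
  let ?D = "%k. tor \<alpha> (uniformizer v ^ k)"
  have DT: "?D k \<in> TR" for k by (intro tor_TR units_power uniformizer_units)
  have "W (tmul (rt \<alpha> r) (?D k)) <= (2 * real k + 1) * M" using assms
  proof (induction k arbitrary: r)
    case 0
    have t: "tor \<alpha> 1 = (tone :: 'k rf tri)" by (cases \<alpha>) (simp_all add: diag_def tone_def)
    show ?case using 0 by (auto simp: t W_gens[OF gens_rt])
  next
    case (Suc k)
    then obtain c s where s: "r = cst c + uniformizer v * s" "s \<in> horner v k" by auto
    let ?u = "tor \<alpha> (uniformizer v)"
    have "tmul (rt \<alpha> r) (?D (Suc k)) = tmul (rt \<alpha> (cst c)) (tmul ?u (tmul (rt \<alpha> s) (?D k)))"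
      unfolding s(1) rt_add power_Suc tor_mult by (simp add: tmul_assoc) (simp add: tor_rt flip: tmul_assoc)
    also have "W ... <= W (rt \<alpha> (cst c)) + W (tmul ?u (tmul (rt \<alpha> s) (?D k)))"
      by (intro W_mult TR_mult DT rt_TR[OF R_horner[OF s(2)]] subsetD[OF gens_TR gens_tor(1)] subsetD[OF gens_TR gens_rt])
    also have "W (tmul ?u (tmul (rt \<alpha> s) (?D k))) <= W ?u + W (tmul (rt \<alpha> s) (?D k))"
      by (intro W_mult TR_mult DT rt_TR[OF R_horner[OF s(2)]] subsetD[OF gens_TR gens_tor(1)])
    finally show ?case using Suc.IH[OF s(2)] W_gens[OF gens_rt[of \<alpha> c]] W_gens[OF gens_tor(1)[of \<alpha> v]] by (simp add: algebra_simps)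
  qed
  moreover have "W (rt \<alpha> r) <= W (tmul (rt \<alpha> r) (?D k)) + W (tinv (?D k))"
  proof -
    have nz: "uniformizer v ^ k ~= 0" by simp
    have "tmul (?D k) (tinv (?D k)) = (tone :: 'k rf tri)"
      using nz by (cases \<alpha>) (simp_all add: tinv_diag tmul_diag, simp_all add: diag_def tone_def)
    then have "rt \<alpha> r = tmul (tmul (rt \<alpha> r) (?D k)) (tinv (?D k))" by (simp add: tmul_assoc)
    then show ?thesis using W_mult[of "tmul (rt \<alpha> r) (?D k)" "tinv (?D k)"] DT rt_TR[OF R_horner[OF assms]] by (metis TR_inv TR_mult)
  qed
  ultimately show ?thesis using W_tor[of \<alpha> v k] W_inv[OF DT] by (simp add: algebra_simps)
qed

lemma W_rt:
  assumes r: "r \<in> \<R>" and b: "!!v. fnorm v r <= exp s" and s: "0 <= s" shows "W (rt \<alpha> r) <= (9 * s + 16) * M"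
proof -
  define k where "k = nat \<lceil>s\<rceil>"
  have k: "s <= real k" "real k <= s + 1" using s by (auto simp: k_def)
  have "fnorm v r <= exp (real k)" for v by (rule order_trans[OF b]) (use k in simp)
  then obtain q c where q: "!!v. q v \<in> horner v k" "r = q At0 + q At1 + q AtInf + cst c" using R_horner_decomposition[OF r, of k] by blast
  have t: "rt \<alpha> (q v) \<in> TR" "rt \<alpha> (cst c) \<in> TR" for v using q by (auto intro: rt_TR R_horner R_cst)
  have "W (rt \<alpha> r) <= W (rt \<alpha> (q At0)) + W (rt \<alpha> (q At1)) + W (rt \<alpha> (q AtInf)) + W (rt \<alpha> (cst c))"
    unfolding q(2) rt_add
    using W_mult[OF TR_mult[OF TR_mult[OF t(1) t(1)] t(1)] t(2), of At0 At1 AtInf] W_mult[OF TR_mult[OF t(1) t(1)] t(1), of At0 At1 AtInf] W_mult[OF t(1) t(1), of At0 At1] by linarith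
  also have "... <= 3 * ((3 * real k + 2) * M) + M"
    using W_horner[OF q(1), of \<alpha> At0] W_horner[OF q(1), of \<alpha> At1] W_horner[OF q(1), of \<alpha> AtInf] W_gens[OF gens_rt[of \<alpha> c]] by linarith
  also have "... = (9 * real k + 7) * M" by (simp add: algebra_simps)
  also have "... <= (9 * s + 16) * M" using k M_nonneg by (intro mult_right_mono) auto
  finally show ?thesis .
qed

lemma W_mono:
  assumes "i \<in> {-1..1}" "j \<in> {-1..1}" shows "W (diag (tmono i j ^ n) 1) <= (real n + 1) * M" "W (diag 1 (tmono i j ^ n)) <= (real n + 1) * M"
  using W_power[of "tmono i j" 1 n] W_power[of 1 "tmono i j" n] gens_mono[OF assms, of 0 0] gens_mono[of 0 0 i j] assms
  by (simp_all add: tmono_00 tmono_units one_units)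

lemma tmono_power: "tmono i j ^ n = tmono (i * int n) (j * int n)" by (induction n) (simp_all add: tmono_00 ring_distribs tmono_add)

lemma tmono_split: "\<exists>i\<in>{-1..1}. \<exists>j\<in>{-1..1}. tmono a b = tmono i 0 ^ nat \<bar>a\<bar> * tmono 0 j ^ nat \<bar>b\<bar>"
proof -
  have "tmono a b = tmono (sgn a) 0 ^ nat \<bar>a\<bar> * tmono 0 (sgn b) ^ nat \<bar>b\<bar>" by (simp add: tmono_power sgn_mult_abs flip: tmono_add)
  moreover have "sgn x \<in> {-1..1}" for x :: int by (simp add: sgn_if)
  ultimately show ?thesis by blast
qed

lemma W_diag:
  assumes "p \<in> units" "q \<in> units" and s: "len (%v. diag p q) <= s" shows "W (diag p q) <= (4 * s + 5) * M"
proof -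
  obtain c i j where p: "c ~= 0" "p = cst c * tmono i j" using unitsE[OF assms(1)] .
  obtain d k l where q: "d ~= 0" "q = cst d * tmono k l" using unitsE[OF assms(2)] .
  have le: "\<bar>real_of_int i\<bar> <= len (%v. diag p q)" "\<bar>real_of_int j\<bar> <= len (%v. diag p q)"
    "\<bar>real_of_int k\<bar> <= len (%v. diag p q)" "\<bar>real_of_int l\<bar> <= len (%v. diag p q)"
    unfolding p(2) q(2) by (rule len_ge_diag[OF refl p(1) q(1)])+
  obtain i' j' where ij: "i' \<in> {-1..1}" "j' \<in> {-1..1}" "tmono i j = (tmono i' 0 :: 'k rf) ^ nat \<bar>i\<bar> * tmono 0 j' ^ nat \<bar>j\<bar>" using tmono_split by blast
  obtain k' l' where kl: "k' \<in> {-1..1}" "l' \<in> {-1..1}" "tmono k l = (tmono k' 0 :: 'k rf) ^ nat \<bar>k\<bar> * tmono 0 l' ^ nat \<bar>l\<bar>" using tmono_split by blast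
  let ?a = "diag (cst c) (cst d)" and ?b = "diag (tmono i' 0 ^ nat \<bar>i\<bar>) 1" and ?c = "diag (tmono 0 j' ^ nat \<bar>j\<bar>) 1"
    and ?d = "diag 1 (tmono k' 0 ^ nat \<bar>k\<bar>)" and ?e = "diag 1 (tmono 0 l' ^ nat \<bar>l\<bar>)"
  have ag: "?a \<in> gens" using gens_diag[OF p(1) q(1), of 0 0 0 0] by (simp add: tmono_00)
  have t: "?a \<in> TR" "?b \<in> TR" "?c \<in> TR" "?d \<in> TR" "?e \<in> TR"
    using ag gens_TR by (auto simp: TR_diag one_units intro!: units_power tmono_units)
  have "diag p q = tmul ?a (tmul ?b (tmul ?c (tmul ?d ?e)))" by (simp add: p q ij(3) kl(3) tmul_diag mult_ac)
  also have "W ... <= W ?a + (W ?b + (W ?c + (W ?d + W ?e)))"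
    using W_mult[OF t(1) TR_mult[OF t(2) TR_mult[OF t(3) TR_mult[OF t(4) t(5)]]]] W_mult[OF t(2) TR_mult[OF t(3) TR_mult[OF t(4) t(5)]]]
      W_mult[OF t(3) TR_mult[OF t(4) t(5)]] W_mult[OF t(4) t(5)] by linarith
  also have "... <= M + ((s + 1) * M + ((s + 1) * M + ((s + 1) * M + (s + 1) * M)))"
  proof -
    have r: "(real (nat \<bar>x\<bar>) + 1) * M <= (s + 1) * M" if "\<bar>real_of_int x\<bar> <= len (%v. diag p q)" for x
      using that s M_nonneg by (intro mult_right_mono) auto
    show ?thesis by (intro add_mono W_gens[OF ag] order_trans[OF W_mono(1)[OF ij(1)] r[OF le(1)]] order_trans[OF W_mono(1)[OF _ ij(2)] r[OF le(2)]]
        order_trans[OF W_mono(2)[OF kl(1)] r[OF le(3)]] order_trans[OF W_mono(2)[OF _ kl(2)] r[OF le(4)]]) simp_all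
  qed
  also have "... = (4 * s + 5) * M" by (simp add: algebra_simps)
  finally show ?thesis .
qed

text \<open>The corner entry is not contracted by the torus, so it is produced as the commutator of the roots 13 and 34.\<close>

lemma W_ut:
  assumes r: "a \<in> \<R>" "b \<in> \<R>" "c \<in> \<R>" "d \<in> \<R>" "e \<in> \<R>" "f \<in> \<R>"
    and n: "!!v. fnorm v a <= exp s" "!!v. fnorm v b <= exp s" "!!v. fnorm v c <= exp s" "!!v. fnorm v d <= exp s" "!!v. fnorm v e <= exp s" "!!v. fnorm v f <= exp s"
    and s: "0 <= s" shows "W (ut a b c d e f) <= (63 * s + 115) * M"
proof -
  let ?w = "(9 * s + 16) * M"
  have mc: "- c \<in> \<R>" "!!v. fnorm v (- c) <= exp s" using r n by (auto intro: R_uminus)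
  have neg1: "- 1 = cst (- 1)" by (simp add: cst_hom)
  let ?l = "[rt R13 c, rt R34 1, rt R13 (- c), rt R34 (- 1), rt R24 e, rt R34 f, rt R13 b, rt R23 d, rt R12 a]"
  have T: "set ?l \<subseteq> TR" unfolding list.set insert_subset using r mc R_1 by (auto simp del: rt.simps intro!: rt_TR R_uminus)
  have fold: "W (foldr tmul l tone) <= sum_list (map W l) + M \<and> foldr tmul l tone \<in> TR" if "set l \<subseteq> TR" for l using that
  proof (induction l)
    case Nil
    show ?case using W_gens[OF gens_tor(3)] gens_tor(3) gens_TR by auto
  next
    case (Cons x l)
    then show ?case using W_mult[of x "foldr tmul l tone"] TR_mult[of x "foldr tmul l tone"] by auto
  qed
  have "ut a b c d e f = foldr tmul ?l tone" by (simp add: tmul_ut algebra_simps)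
  also have "W ... <= sum_list (map W ?l) + M" using fold[OF T] by blast
  also have "... <= (7 * ?w + 2 * M) + M"
    using W_rt[OF r(3) n(3) s, of R13] W_rt[OF mc s, of R13] W_rt[OF r(5) n(5) s, of R24] W_rt[OF r(6) n(6) s, of R34] W_rt[OF r(2) n(2) s, of R13]
      W_rt[OF r(4) n(4) s, of R23] W_rt[OF r(1) n(1) s, of R12] W_gens[OF gens_rt[of R34 1]] W_gens[OF gens_rt[of R34 "-1"]] M_nonneg s
    unfolding neg1[symmetric] cst_hom(2) by (simp del: rt.simps)
  also have "... = (63 * s + 115) * M" by (simp add: algebra_simps)
  finally show ?thesis .
qed

text \<open>A matrix is a unipotent one times a diagonal one, and passing to the unipotent factor at most doubles the logarithmic size of the entries.\<close>

theorem W_le_len: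
  assumes a: "a \<in> TR" shows "W a <= 130 * (len (%v. a) + 1) * M"
proof -
  let ?s = "len (%v. a)"
  note s = TR_sel[OF a]
  have nz: "d2 a ~= 0" "d3 a ~= 0" using s units_nonzero by auto
  have n: "nrm (%v. a) <= exp ?s" "nrm (%v. tinv a) <= exp ?s" using len_le_iff[of "%v. a" ?s] by auto
  have e: "fnorm v (d2 a) <= exp ?s" "fnorm v (d3 a) <= exp ?s" "fnorm v (e12 a) <= exp ?s" "fnorm v (e13 a) <= exp ?s" "fnorm v (e14 a) <= exp ?s"
     "fnorm v (e23 a) <= exp ?s" "fnorm v (e24 a) <= exp ?s" "fnorm v (e34 a) <= exp ?s" for v using n(1) unfolding nrm_le_iff by auto
  have i: "fnorm v (inverse (d2 a)) <= exp ?s" "fnorm v (inverse (d3 a)) <= exp ?s" for v using n(2) unfolding nrm_le_iff by (auto simp: tinv_def)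
  have s0: "0 <= ?s" by (rule len_nonneg)
  have "len (%v. diag (d2 a) (d3 a)) <= ?s" unfolding len_le_iff tinv_diag nrm_le_iff using e i s0 by (auto simp: diag_def)
  then have D: "W (diag (d2 a) (d3 a)) <= (4 * ?s + 5) * M" by (rule W_diag[OF s(1,2)])
  let ?u = "ut (e12 a / d2 a) (e13 a / d3 a) (e14 a) (e23 a / d3 a) (e24 a) (e34 a)"
  have up: "x <= exp (2 * ?s)" if "x <= exp ?s" for x using that s0 order_trans[of x "exp ?s" "exp (2 * ?s)"] by simp
  have m: "fnorm v (x / y) <= exp (2 * ?s)" if "fnorm v x <= exp ?s" "fnorm v (inverse y) <= exp ?s" for x y v
    using fnorm_mult_le[OF that] by (simp only: divide_inverse mult_2 exp_add)
  have q: "x / y \<in> \<R>" if "x \<in> \<R>" "y \<in> units" for x y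
    unfolding divide_inverse by (rule R_mult[OF that(1) units_R[OF units_inverse[OF that(2)]]])
  have U: "W ?u <= (63 * (2 * ?s) + 115) * M" using s0 by (intro W_ut q s m up e i) simp
  have "a = tmul ?u (diag (d2 a) (d3 a))" using nz by (cases a) (simp add: ut_def diag_def tmul_def)
  then have "W a <= W ?u + W (diag (d2 a) (d3 a))" using W_mult[of ?u "diag (d2 a) (d3 a)"] s q by (metis TR_ut TR_diag)
  also have "... <= (63 * (2 * ?s) + 115) * M + (4 * ?s + 5) * M" using U D by (rule add_mono)
  also have "... = (130 * ?s + 120) * M" by (simp add: algebra_simps)
  also have "... <= (130 * (?s + 1)) * M" using M_nonneg by (intro mult_right_mono) auto
  finally show ?thesis .
qed

end

text \<open>Approximating the principal part at each place separately and adding the results.\<close>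

lemma R_dense:
  fixes x :: "place => 'k::field rf" shows "\<exists>r\<in>\<R>. \<forall>v. fnorm v (r - x v) <= 1"
proof -
  have "\<exists>k. fnorm v (x v) <= exp (real k)" for v
  proof -
    obtain k where "fnorm v (x v) <= real k" using real_arch_simple by blast
    also have "... <= exp (real k)" using exp_ge_add_one_self[of "real k"] by linarith
    finally show ?thesis by blast
  qed
  then obtain k where k: "!!v. fnorm v (x v) <= exp (real (k v))" by metis
  have "\<forall>v. \<exists>s\<in>horner v (k v). fnorm v (x v - s) <= exp (-1)" using horner_approx k by blast
  then obtain s where s: "!!v. s v \<in> horner v (k v)" "!!v. fnorm v (x v - s v) <= exp (-1)" by metis
  have s1: "fnorm v (x v - s v) <= 1" for v using s(2)[of v] by (rule order_trans) simp
  let ?r = "s At0 + s At1 + s AtInf"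
  have "?r \<in> \<R>" using R_horner[OF s(1)] by (intro R_add)
  moreover have "fnorm v (?r - x v) <= 1" for v
  proof -
    have "fnorm v (x v - ?r) <= 1" by (rule fnorm_diff_three[where s = s, OF s1 horner_norm[OF s(1)]]) blast
    then show ?thesis using fnorm_uminus[of v "x v - ?r"] by simp
  qed
  ultimately show ?thesis by blast
qed

text \<open>The entries are corrected one diagonal above the other; the error terms w23, w34, w24 of the lower ones enter the targets for the next.\<close>

theorem TR_coarsely_dense:
  fixes g :: "place => 'k::field rf tri"
  assumes g: "g \<in> carrier PG" shows "\<exists>a\<in>TR. len (inv\<^bsub>PG\<^esub> g \<star> (%v. a)) <= 0"
proof -
  interpret G: group "PG :: (place => 'k rf tri) monoid" by (rule PG_group)
  define p q where "p = d2 (g At0)" and "q = d3 (g At0)"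
  have pq: "p \<in> units" "q \<in> units" "p ~= 0" "q ~= 0" and d: "!!v. d2 (g v) = p" "!!v. d3 (g v) = q"
    using g PG_diag[OF g, of At0] units_nonzero unfolding p_def q_def PG_iff by auto
  obtain r12 where r12: "r12 \<in> \<R>" "!!v. fnorm v (r12 - e12 (g v)) <= 1" using R_dense[of "%v. e12 (g v)"] by blast
  obtain r23 where r23: "r23 \<in> \<R>" "!!v. fnorm v (r23 - e23 (g v) / p) <= 1" using R_dense[of "%v. e23 (g v) / p"] by blast
  obtain r34 where r34: "r34 \<in> \<R>" "!!v. fnorm v (r34 - e34 (g v) / q) <= 1" using R_dense[of "%v. e34 (g v) / q"] by blast
  define w23 w34 where "w23 v = r23 - e23 (g v) / p" and "w34 v = r34 - e34 (g v) / q" for v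
  obtain r13 where r13: "r13 \<in> \<R>" "!!v. fnorm v (r13 - (e13 (g v) + e12 (g v) * w23 v)) <= 1" using R_dense[of "%v. e13 (g v) + e12 (g v) * w23 v"] by blast
  obtain r24 where r24: "r24 \<in> \<R>" "!!v. fnorm v (r24 - (e24 (g v) / p + e23 (g v) / p * w34 v)) <= 1" using R_dense[of "%v. e24 (g v) / p + e23 (g v) / p * w34 v"] by blast
  define w24 where "w24 v = r24 - (e24 (g v) / p + e23 (g v) / p * w34 v)" for v
  obtain r14 where r14: "r14 \<in> \<R>" "!!v. fnorm v (r14 - (e14 (g v) + e12 (g v) * w24 v + e13 (g v) * w34 v)) <= 1" using R_dense[of "%v. e14 (g v) + e12 (g v) * w24 v + e13 (g v) * w34 v"] by blast
  define w where "w = (%v. ut (r12 - e12 (g v)) (r13 - (e13 (g v) + e12 (g v) * w23 v)) (r14 - (e14 (g v) + e12 (g v) * w24 v + e13 (g v) * w34 v)) (w23 v) (w24 v) (w34 v))"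
  define a where "a = tmul (diag p q) (ut r12 r13 r14 r23 r24 r34)"
  have a: "a \<in> TR" unfolding a_def using pq r12 r13 r14 r23 r24 r34 by (intro TR_mult) (auto simp: TR_diag TR_ut)
  have wc: "w \<in> carrier PG" unfolding w_def by (rule ut_PG)
  have "(g \<star> w) v = a" for v
  proof -
    have "p * (e23 (g v) / p) = e23 (g v)" "p * (e24 (g v) / p) = e24 (g v)" "q * (e34 (g v) / q) = e34 (g v)" using pq(3,4) by simp_all
    then show ?thesis using pq(3,4) by (simp add: a_def w_def tmul_def ut_def diag_def d w23_def w34_def w24_def right_diff_distrib distrib_left)
  qed
  then have "g \<star> w = (%v. a)" by (rule ext)
  then have e: "inv\<^bsub>PG\<^esub> g \<star> (%v. a) = w" using g wc by (simp add: G.inv_solve_left' TR_PG[OF a])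
  have "nrm w <= exp 0" unfolding nrm_le_iff w_def using r12(2) r13(2) r14(2) r23(2) r24(2) r34(2) by (simp add: ut_def w23_def w34_def w24_def)
  then have "len w <= 3 * 0" unfolding w_def by (rule len_ut[OF refl])
  then show ?thesis using a e by auto
qed

section \<open>Polynomials supported on factorials\<close>

definition x14 :: "'f => 'f::field tri" where
  "x14 r = ut 0 0 r 0 0 0"

lemma x14_add: "tmul (x14 r) (x14 s) = x14 (r + s)" by (simp add: x14_def ut_def tmul_def add.commute)

lemma x14_central: "tmul (x14 r) a = tmul a (x14 r)" by (simp add: x14_def ut_def tmul_def add.commute)

lemma tinv_x14: "tinv (x14 r) = x14 (- r)" by (simp add: x14_def ut_def tinv_def)

lemma x14_0: "x14 0 = tone" by (simp add: x14_def ut_def tone_def)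

lemma Fract_add1: "Fract f 1 + Fract g 1 = Fract (f + g) (1 :: 'k::field poly)" by simp

definition factorial_polys :: "'k::field poly set" where
  "factorial_polys = {f. \<forall>i. poly.coeff f i ~= 0 \<longrightarrow> i \<in> range fact}"

lemma factorial_polys_diff: "f \<in> factorial_polys ==> g \<in> factorial_polys ==> f - g \<in> factorial_polys"
proof -
  assume f: "f \<in> factorial_polys" and g: "g \<in> factorial_polys"
  have "poly.coeff f i ~= 0 \<or> poly.coeff g i ~= 0" if "poly.coeff (f - g) i ~= 0" for i using that by auto
  then show ?thesis using f g unfolding factorial_polys_def by blast
qed

lemma factorial_polys_monom: "Polynomial.monom a (fact k) \<in> factorial_polys" by (simp add: factorial_polys_def)

lemma factorial_polys_0: "0 \<in> factorial_polys" by (simp add: factorial_polys_def)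

lemma pnorm_le_degree: "pnorm v f <= exp (real (degree f))"
proof -
  have "exp (- real m) <= exp (real n)" for m n by simp
  then show ?thesis by (cases v) auto
qed

lemma len_x14: "len (%v. x14 (Fract f 1)) = real (degree f)"
proof (rule antisym)
  have n: "fnorm v (Fract f 1) <= exp (real (degree f))" for v using pnorm_le_degree[of v f] by (simp add: fnorm_Fract)
  have n': "fnorm v (Fract (- f) 1) <= exp (real (degree f))" for v using pnorm_le_degree[of v "- f"] by (simp add: fnorm_Fract)
  show "len (%v. x14 (Fract f 1)) <= real (degree f)" unfolding len_le_iff tinv_x14 nrm_le_iff using n n' by (simp add: x14_def ut_def)
  show "real (degree f) <= len (%v. x14 (Fract f 1))"
  proof (cases "f = 0")
    case False
    have "exp (real (degree f)) = fnorm AtInf (Fract f 1)" using False by (simp add: fnorm_Fract)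
    also have "... <= exp (len (%v. x14 (Fract f 1)))"
      using nrm_ge(6)[of AtInf "%v. x14 (Fract f 1)"] nrm_le_exp_len[of "%v. x14 (Fract f 1)"] by (simp add: x14_def ut_def)
    finally show ?thesis by simp
  qed (simp add: len_nonneg)
qed

definition ZP :: "(place => 'k::field rf tri) set" where
  "ZP = {%v. x14 (Fract f 1) | f. f \<in> factorial_polys}"

definition additive :: "'k::ab_group_add set => 'k monoid" where
  "additive A = \<lparr>carrier = A, monoid.mult = (+), one = 0\<rparr>"

lemma additive_simps [simp]: "carrier (additive A) = A" "x \<otimes>\<^bsub>additive A\<^esub> y = x + y" "\<one>\<^bsub>additive A\<^esub> = 0"
  by (simp_all add: additive_def)

lemma additive_group: "A = UNIV \<or> A = {0} ==> group (additive A)"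
proof (rule groupI)
  fix x assume "A = UNIV \<or> A = {0}" "x \<in> carrier (additive A)"
  then show "\<exists>y\<in>carrier (additive A). y \<otimes>\<^bsub>additive A\<^esub> x = \<one>\<^bsub>additive A\<^esub>" by (intro bexI[of _ "- x"]) auto
qed (auto simp: add.assoc)

text \<open>Every other factorial differs from \<open>k!\<close> by a factor of at least k, so for large k at most one of them is at scale n.\<close>

lemma fact_separated:
  fixes k :: nat
  assumes "fact j ~= (fact k :: nat)" shows "real k * fact j <= fact k \<or> (real k + 1) * fact k <= (fact j :: real)"
proof (cases "j < k")
  case True
  then have "(fact j :: nat) <= fact (k - 1)" by (intro fact_mono) simp
  then have "k * fact j <= k * (fact (k - 1) :: nat)" by (rule mult_le_mono2)
  also have "... = fact k" using True fact_reduce[of k, where 'a = nat] by simp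
  finally have "k * fact j <= (fact k :: nat)" .
  then have "real (k * fact j) <= real (fact k)" by (rule of_nat_mono)
  then show ?thesis by simp
next
  case False
  then have "k < j" using assms by (cases "j = k") auto
  then have "(fact (Suc k) :: nat) <= fact j" by (intro fact_mono) simp
  then have "real (fact (Suc k)) <= real (fact j)" by (rule of_nat_mono)
  then show ?thesis by (simp add: add.commute distrib_right)
qed

context abels_cone
begin

text \<open>An ultrafilter selects one of finitely many colours.\<close>

lemma ultrafilter_choice:
  assumes fin: "finite (UNIV :: 'c set)" shows "\<exists>a::'c. \<forall>\<^sub>F n in \<omega>. f n = a"
proof (rule ccontr)
  assume "\<nexists>a. \<forall>\<^sub>F n in \<omega>. f n = a"
  then have "\<forall>a\<in>UNIV. \<forall>\<^sub>F n in \<omega>. f n ~= a" using ultra unfolding nonprincipal_ultrafilter_def by metis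
  then have "\<forall>\<^sub>F n in \<omega>. \<forall>a\<in>UNIV. f n ~= a" by (rule eventually_ball_finite[OF fin])
  then have "\<forall>\<^sub>F n in \<omega>. False" by eventually_elim auto
  then show False using nb by (simp add: eventually_False)
qed

lemma ZP_seq:
  assumes \<zeta>: "!!n. \<zeta> n \<in> ZP" "\<zeta> \<in> \<S>"
  obtains f B where "!!n. f n \<in> factorial_polys" "\<zeta> = (%n v. x14 (Fract (f n) 1))" "0 <= B" "!!n. real (degree (f n)) <= B * real (n + 1)"
proof -
  have "\<exists>f. f \<in> factorial_polys \<and> \<zeta> n = (%v. x14 (Fract f 1))" for n using \<zeta>(1)[of n] by (auto simp: ZP_def)
  then obtain f where f: "!!n. f n \<in> factorial_polys" "!!n. \<zeta> n = (%v. x14 (Fract (f n) 1))" by metis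
  obtain B where B: "0 <= B" "!!n. len (\<zeta> n) <= B * real (n + 1)" using seqs_bound[OF \<zeta>(2)] by blast
  show thesis
  proof (rule that[OF f(1) _ B(1)])
    show "\<zeta> = (%n v. x14 (Fract (f n) 1))" by (rule ext) (rule f(2))
    show "real (degree (f n)) <= B * real (n + 1)" for n using B(2)[of n] unfolding f(2) len_x14 .
  qed
qed

lemma x14_seqs:
  assumes "!!n. real (degree (f n)) <= B * real (n + 1)" shows "(%n v. x14 (Fract (f n) 1)) \<in> \<S>"
proof (rule seqsI)
  show "(%v. x14 (Fract (f n) 1)) \<in> carrier PG" for n unfolding x14_def by (rule ut_PG)
  show "len (%v. x14 (Fract (f n) 1)) <= B * real (n + 1)" for n unfolding len_x14 by (rule assms)
qed

lemma x14_seqs_mult: "(%n v. x14 (Fract (f n) 1)) \<cdot> (%n v. x14 (Fract (g n) 1)) = (%n v. x14 (Fract (f n + g n) 1))"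
  by (intro ext) (simp only: seqs_mult PG_mult x14_add Fract_add1)

lemma x14_seqs_inv: 
  assumes "(%n v. x14 (Fract (f n) 1)) \<in> \<S>" shows "inv\<^sub>s (%n v. x14 (Fract (f n) 1)) = (%n v. x14 (Fract (- f n) 1))"
  using seqs_inv_PG[OF assms] by (simp add: tinv_x14 fun_eq_iff minus_fract)

context
  fixes k :: "nat => nat" and c C :: real
  assumes c: "0 < c" and scale: "\<forall>\<^sub>F n in \<omega>. c * real n <= fact (k n) \<and> fact (k n) <= C * real n"
    and fin: "finite (UNIV :: 'k set)"
begin

text \<open>The exponents are only controlled along \<open>\<omega>\<close>; outside they are reset to have linear size for all n.\<close>

definition kk :: "nat => nat" where
  "kk n = (if fact (k n) <= C * real n then k n else 0)"

definition zz :: "'k => 'k tseq" where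
  "zz a = (%n v. x14 (Fract (Polynomial.monom a (fact (kk n))) 1))"

lemma kk_scale: "\<forall>\<^sub>F n in \<omega>. c * real n <= fact (kk n) \<and> fact (kk n) <= C * real n"
  using scale by eventually_elim (simp add: kk_def)

lemma kk_large: "\<forall>\<^sub>F n in \<omega>. m <= kk n"
proof -
  obtain N where N: "fact m / c < real N" using reals_Archimedean2 by blast
  have "\<forall>\<^sub>F n in sequentially. N <= n" by (rule eventually_ge_at_top)
  then have "\<forall>\<^sub>F n in \<omega>. N <= n" using nonprincipal_ultrafilter_le_sequentially[OF ultra] by (simp add: le_filter_def)
  then show ?thesis using kk_scale
  proof eventually_elim
    case (elim n)
    have "fact m < c * real N" using N c by (simp add: field_simps)
    also have "... <= c * real n" using elim c by simp
    also have "... <= fact (kk n)" using elim by simp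
    finally have "real (fact m) < real (fact (kk n))" by simp
    then have "(fact m :: nat) < fact (kk n)" by (simp only: of_nat_less_iff)
    then show "m <= kk n" using fact_mono_nat[of "kk n" m] by (meson leD nat_le_linear)
  qed
qed

lemma monom_degree: "real (degree (Polynomial.monom a (fact (kk n)))) <= (\<bar>C\<bar> + 1) * real (n + 1)"
proof -
  have "real (degree (Polynomial.monom a (fact (kk n)))) <= real (fact (kk n))" using degree_monom_le[of a "fact (kk n)"] by (simp only: of_nat_le_iff)
  also have "... <= \<bar>C\<bar> * real n + 1"
  proof (cases "fact (k n) <= C * real n")
    case True
    have "C * real n <= \<bar>C\<bar> * real n" by (intro mult_right_mono) auto
    then show ?thesis using True by (simp add: kk_def)
  qed (simp add: kk_def)
  also have "... <= (\<bar>C\<bar> + 1) * real (n + 1)" by (simp add: algebra_simps)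
  finally show ?thesis .
qed

lemma zz_in: "zz a \<in> \<S>" unfolding zz_def by (rule x14_seqs) (rule monom_degree)

lemma zz_deck: "central_deck PG len \<omega> (additive UNIV) zz c"
proof -
  interpret A: group "additive (UNIV :: 'k set)" by (rule additive_group) simp
  show ?thesis
  proof (unfold_locales)
    show "finite (carrier (additive (UNIV :: 'k set)))" using fin by simp
    show "zz a \<in> \<S>" for a by (rule zz_in)
    show "zz a \<cdot> g = g \<cdot> zz a" for a g by (intro ext) (simp add: zz_def x14_central)
    show "zz \<one>\<^bsub>additive UNIV\<^esub> = \<one>\<^bsub>seqs\<^esub>" by (intro ext) (simp add: zz_def x14_0 flip: Zero_fract_def)
    show "zz (a \<otimes>\<^bsub>additive UNIV\<^esub> b) = zz a \<cdot> zz b" for a b unfolding zz_def x14_seqs_mult by (simp add: add_monom)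
    show "0 < c" by (rule c)
    show "c <= size (zz a)" if a: "a ~= \<one>\<^bsub>additive UNIV\<^esub>" for a
    proof (rule tendsto_lowerbound[OF size_tendsto[OF zz_in] _ nb])
      show "\<forall>\<^sub>F n in \<omega>. c <= len (zz a n) / real n" using kk_scale pos
      proof eventually_elim
        case (elim n)
        have "len (zz a n) = fact (kk n)" using a by (simp add: zz_def len_x14 degree_monom_eq)
        then show ?case using elim by (simp add: field_simps)
      qed
    qed
  qed
qed

lemma zz_ZP: "zz a n \<in> ZP" unfolding ZP_def zz_def using factorial_polys_monom by blast

text \<open>The coefficient at the exponent \<open>k(n)!\<close> is constant along \<open>\<omega>\<close>, say a. Any other exponent of a polynomial of linear degree is a factorial that is
by fact_separated much smaller than n, so removing one monomial leaves sublinear degree.\<close>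

lemma ZP_near_zz:
  assumes \<zeta>: "!!n. \<zeta> n \<in> ZP" "\<zeta> \<in> \<S>" shows "\<exists>a. size (inv\<^sub>s \<zeta> \<cdot> zz a) = 0"
proof -
  obtain f B where f: "!!n. f n \<in> factorial_polys" "\<zeta> = (%n v. x14 (Fract (f n) 1))" and B: "0 <= B" "!!n. real (degree (f n)) <= B * real (n + 1)"
    using ZP_seq[OF \<zeta>] by blast
  obtain a where a: "\<forall>\<^sub>F n in \<omega>. poly.coeff (f n) (fact (kk n)) = a"
    using ultrafilter_choice[OF fin, of "%n. poly.coeff (f n) (fact (kk n))"] by blast
  define g where "g n = - f n + Polynomial.monom a (fact (kk n))" for n
  have e: "inv\<^sub>s \<zeta> \<cdot> zz a = (%n v. x14 (Fract (g n) 1))"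
    using \<zeta>(2) unfolding f(2) zz_def g_def by (simp only: x14_seqs_inv x14_seqs_mult)
  have s: "inv\<^sub>s \<zeta> \<cdot> zz a \<in> \<S>" using \<zeta>(2) zz_in by simp
  have "size (inv\<^sub>s \<zeta> \<cdot> zz a) <= 0"
  proof (rule size_le[OF s])
    fix \<epsilon> :: real assume \<epsilon>: "0 < \<epsilon>"
    obtain m :: nat where "max (C / \<epsilon>) (2 * B / c) < real m" using reals_Archimedean2 by blast
    then have m: "C / \<epsilon> < real m" "2 * B / c < real m" by simp_all
    show "\<forall>\<^sub>F n in \<omega>. len ((inv\<^sub>s \<zeta> \<cdot> zz a) n) <= (0 + \<epsilon>) * real n"
      using kk_scale pos a kk_large[of "m + 1"]
    proof eventually_elim
      case (elim n)
      let ?k = "kk n"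
      have k: "real m + 1 <= real ?k" using elim(4) by simp
      have "degree (g n) <= nat \<lfloor>\<epsilon> * real n\<rfloor>"
      proof (rule degree_le, intro allI impI)
        fix i assume i: "nat \<lfloor>\<epsilon> * real n\<rfloor> < i"
        then have i: "\<epsilon> * real n < real i" by linarith
        show "poly.coeff (g n) i = 0"
        proof (rule ccontr)
          assume nz: "poly.coeff (g n) i ~= 0"
          have ik: "i ~= fact ?k" using nz elim(3) by (auto simp: g_def)
          then have fi: "poly.coeff (f n) i ~= 0" using nz by (auto simp: g_def)
          then obtain j where j: "i = fact j" using f(1)[of n] by (auto simp: factorial_polys_def)
          have "real i <= B * real (n + 1)" using le_degree[OF fi] B(2)[of n] by linarith
          also have "... <= B * (2 * real n)" using elim(2) B(1) by (intro mult_left_mono) auto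
          finally have up: "real i <= 2 * B * real n" by simp
          consider "real ?k * fact j <= fact ?k" | "(real ?k + 1) * fact ?k <= (fact j :: real)" using fact_separated[of j ?k] ik j by auto
          then show False
          proof cases
            case 1
            have "real m * (\<epsilon> * real n) <= real ?k * (\<epsilon> * real n)" using k \<epsilon> by (intro mult_right_mono) auto
            also have "... < real ?k * real i" using i k by (intro mult_strict_left_mono) auto
            also have "... <= C * real n" using 1 elim(1) j by simp
            also have "... < (real m * \<epsilon>) * real n" using m(1) \<epsilon> elim(2) by (intro mult_strict_right_mono) (auto simp: field_simps)
            finally show False by (simp add: mult.assoc)
          next
            case 2
            have "real m * (c * real n) <= (real ?k + 1) * fact ?k" using k elim(1) c by (intro mult_mono) auto
            also have "... <= 2 * B * real n" using 2 up j by simp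
            also have "... < (real m * c) * real n" using m(2) c elim(2) by (intro mult_strict_right_mono) (auto simp: field_simps)
            finally show False by (simp add: mult.assoc)
          qed
        qed
      qed
      then have "real (degree (g n)) <= real (nat \<lfloor>\<epsilon> * real n\<rfloor>)" by (simp only: of_nat_le_iff)
      also have "... <= \<epsilon> * real n" using \<epsilon> by simp
      finally show ?case unfolding e len_x14 by simp
    qed
  qed
  then show ?thesis using size_nonneg[OF s] by (intro exI[of _ a]) simp
qed

end

text \<open>A sequence of positive size would have degrees \<open>k(n)!\<close> comparable to n.\<close>

lemma ZP_small:
  assumes none: "\<nexists>k c C. 0 < c \<and> (\<forall>\<^sub>F n in \<omega>. c * real n <= fact (k n) \<and> fact (k n) <= C * real n)"
    and \<zeta>: "!!n. \<zeta> n \<in> ZP" "\<zeta> \<in> \<S>" shows "size \<zeta> = 0"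
proof (rule ccontr)
  assume "size \<zeta> ~= 0"
  then have s: "0 < size \<zeta>" using size_nonneg[OF \<zeta>(2)] by simp
  obtain f B where f: "!!n. f n \<in> factorial_polys" "\<zeta> = (%n v. x14 (Fract (f n) 1))"
    and B: "0 <= B" "!!n. real (degree (f n)) <= B * real (n + 1)" using ZP_seq[OF \<zeta>] by blast
  have "\<exists>k. f n ~= 0 \<longrightarrow> fact k = degree (f n)" for n
  proof (cases "f n = 0")
    case False
    then have "poly.coeff (f n) (degree (f n)) ~= 0" by (rule leading_coeff_neq_0)
    then have "degree (f n) \<in> range fact" using f(1)[of n] unfolding factorial_polys_def by blast
    then show ?thesis by (metis imageE)
  qed simp
  then obtain k where k: "!!n. f n ~= 0 ==> fact (k n) = degree (f n)" by metis
  have "\<forall>\<^sub>F n in \<omega>. size \<zeta> / 2 < len (\<zeta> n) / real n" "\<forall>\<^sub>F n in \<omega>. len (\<zeta> n) / real n < 2 * size \<zeta>"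
    using s by (intro order_tendstoD[OF size_tendsto[OF \<zeta>(2)]], simp)+
  then have "\<forall>\<^sub>F n in \<omega>. (size \<zeta> / 2) * real n <= fact (k n) \<and> fact (k n) <= (2 * size \<zeta>) * real n" using pos
  proof eventually_elim
    case (elim n)
    have d: "len (\<zeta> n) = real (degree (f n))" unfolding f(2) len_x14 ..
    have "0 < real (degree (f n)) / real n" using elim(1) s unfolding d by linarith
    then have "f n ~= 0" by auto
    then have "fact (k n) = real (degree (f n))" using k by (metis of_nat_fact)
    then show ?case using elim unfolding d by (simp add: field_simps)
  qed
  then show False using none s half_gt_zero by blast
qed

text \<open>The two cases are whether some factorial follows n up to a bounded factor along \<open>\<omega>\<close>.\<close>

theorem deck_exists:
  assumes fin: "finite (UNIV :: 'k set)"
  shows "\<exists>(A :: 'k set) z c. (A = UNIV \<or> A = {0}) \<and> central_deck PG len \<omega> (additive A) z c \<and> (\<forall>a\<in>A. \<forall>n. z a n \<in> ZP) \<and>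
    (\<forall>\<zeta>\<in>\<S>. (\<forall>n. \<zeta> n \<in> ZP) \<longrightarrow> (\<exists>a\<in>A. size (inv\<^sub>s \<zeta> \<cdot> z a) = 0)) \<and>
    ((\<forall>\<^sub>F n in \<omega>. n \<in> range fact) \<longrightarrow> A = UNIV)"
proof (cases "\<exists>k c C. 0 < c \<and> (\<forall>\<^sub>F n in \<omega>. c * real n <= fact (k n) \<and> fact (k n) <= C * real n)")
  case True
  then obtain k c C where kc: "0 < c" "\<forall>\<^sub>F n in \<omega>. c * real n <= fact (k n) \<and> fact (k n) <= C * real n" by blast
  show ?thesis using zz_deck[OF kc fin] zz_ZP[OF kc fin] ZP_near_zz[OF kc fin] by (intro exI[of _ UNIV] exI[of _ "zz k C"] exI[of _ c]) auto
next
  case False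
  have "central_deck PG len \<omega> (additive {0 :: 'k}) (%_. \<one>\<^bsub>seqs\<^esub>) 1"
  proof -
    interpret A: group "additive {0 :: 'k}" by (rule additive_group) simp
    show ?thesis by unfold_locales auto
  qed
  moreover have "\<one>\<^bsub>seqs\<^esub> n \<in> ZP" for n
  proof -
    have "\<one>\<^bsub>seqs\<^esub> n = (%v. x14 (Fract 0 1))" by (rule ext) (simp add: x14_0 flip: Zero_fract_def)
    then show ?thesis unfolding ZP_def using factorial_polys_0 by blast
  qed
  moreover have "size (inv\<^sub>s \<zeta> \<cdot> \<one>\<^bsub>seqs\<^esub>) = 0" if "\<zeta> \<in> \<S>" "!!n. \<zeta> n \<in> ZP" for \<zeta>
    using ZP_small[OF False that(2,1)] that by (simp add: size_inv)
  moreover have "\<not> (\<forall>\<^sub>F n in \<omega>. n \<in> range fact)"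
  proof
    assume "\<forall>\<^sub>F n in \<omega>. n \<in> range fact"
    then have "\<forall>\<^sub>F n in \<omega>. 1 * real n <= fact (inv_into UNIV fact n) \<and> fact (inv_into UNIV fact n) <= 1 * real n"
    proof eventually_elim
      case (elim n)
      then have "fact (inv_into UNIV fact n) = n" by (rule f_inv_into_f)
      then have "(fact (inv_into UNIV fact n) :: real) = real n" by (metis of_nat_fact)
      then show ?case by simp
    qed
    then have "\<exists>k c C. 0 < c \<and> (\<forall>\<^sub>F n in \<omega>. c * real n <= fact (k n) \<and> fact (k n) <= C * real n)"
      by (intro exI[of _ "inv_into UNIV fact"] exI[of _ "1 :: real"] conjI) simp_all
    with False show False by contradiction
  qed
  ultimately show ?thesis by (intro exI[of _ "{0}"] exI[of _ "%_. \<one>\<^bsub>seqs\<^esub>"] exI[of _ 1]) auto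
qed

end

section \<open>The quotient group\<close>

definition mt :: "'f::field tri => 'f mat" where
  "mt a = mat 4 4 (%(i, j). [[1, e12 a, e13 a, e14 a], [0, d2 a, e23 a, e24 a], [0, 0, d3 a, e34 a], [0, 0, 0, 1]] ! i ! j)"

lemma less_4: "i < 4 \<longleftrightarrow> i = 0 \<or> i = 1 \<or> i = 2 \<or> i = (3::nat)" by auto

lemma mt_mult: "mt a * mt b = mt (tmul a b)"
proof (rule eq_matI)
  fix i j assume "i < dim_row (mt (tmul a b))" "j < dim_col (mt (tmul a b))"
  then have ij: "i < 4" "j < 4" by (simp_all add: mt_def)
  have "(mt a * mt b) $$ (i, j) = (\<Sum>k\<in>{0, 1, 2, 3}. mt a $$ (i, k) * mt b $$ (k, j))"
  proof -
    have "{0..<4} = {0, 1, 2, 3 :: nat}" by auto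
    then show ?thesis using ij by (simp add: mt_def scalar_prod_def)
  qed
  also have "... = mt (tmul a b) $$ (i, j)" using ij unfolding less_4 by (elim disjE) (simp_all add: mt_def tmul_def)
  finally show "(mt a * mt b) $$ (i, j) = mt (tmul a b) $$ (i, j)" .
qed (simp_all add: mt_def)

lemma mt_one: "mt tone = 1\<^sub>m 4"
proof (rule eq_matI)
  fix i j assume "i < dim_row (1\<^sub>m 4)" "j < dim_col (1\<^sub>m 4)"
  then have ij: "i < 4" "j < 4" by simp_all
  then show "mt tone $$ (i, j) = 1\<^sub>m 4 $$ (i, j)" unfolding less_4 by (elim disjE) (simp_all add: mt_def tone_def)
qed (simp_all add: mt_def)

lemma mt_inj: "mt a = mt b ==> a = b"
proof -
  assume e: "mt a = mt b"
  have "mt a $$ (i, j) = mt b $$ (i, j)" for i j by (simp add: e)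
  from this[of 0 1] this[of 0 2] this[of 0 3] this[of 1 1] this[of 1 2] this[of 1 3] this[of 2 2] this[of 2 3]
  show "a = b" by (simp add: mt_def tri.expand)
qed

text \<open>The definition asks for diagonal entries invertible in the ring, which are the monomials by R_units.\<close>

lemma A4_carrier: "carrier (A4 \<R>) = mt ` (TR :: 'k::field rf tri set)"
proof (intro equalityI subsetI)
  fix A assume "A \<in> carrier (A4 (\<R> :: 'k rf set))"
  then have A: "A \<in> carrier_mat 4 4" "upper_triangular A" "!!i j. i < 4 ==> j < 4 ==> A $$ (i, j) \<in> \<R>"
    "A $$ (0, 0) = 1" "A $$ (3, 3) = 1" "\<exists>u\<in>\<R>. A $$ (1, 1) * u = 1" "\<exists>u\<in>\<R>. A $$ (2, 2) * u = 1" by (auto simp: A4_def)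
  let ?a = "Tri (A $$ (1, 1)) (A $$ (2, 2)) (A $$ (0, 1)) (A $$ (0, 2)) (A $$ (0, 3)) (A $$ (1, 2)) (A $$ (1, 3)) (A $$ (2, 3))"
  have "A $$ (1, 1) \<in> units" "A $$ (2, 2) \<in> units" using A(6,7) A(3)[of 1 1] A(3)[of 2 2] R_units by fastforce+
  then have a: "?a \<in> TR" unfolding TR_tri using A(3) by simp
  have z: "A $$ (i, j) = 0" if "j < i" "i < 4" for i j using A(1,2) that by (auto simp: upper_triangular_def)
  have "A = mt ?a"
  proof (rule eq_matI)
    fix i j assume "i < dim_row (mt ?a)" "j < dim_col (mt ?a)"
    then have ij: "i < 4" "j < 4" by (simp_all add: mt_def)
    then show "A $$ (i, j) = mt ?a $$ (i, j)" unfolding less_4 by (elim disjE) (simp_all add: mt_def A(4,5) z)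
  qed (use A(1) in \<open>auto simp: mt_def\<close>)
  then show "A \<in> mt ` TR" using a by blast
next
  fix A assume "A \<in> mt ` (TR :: 'k rf tri set)"
  then obtain a where a: "a \<in> TR" "A = mt a" by blast
  note s = TR_sel[OF a(1)]
  have e: "\<forall>i<4. \<forall>j<4. A $$ (i, j) \<in> \<R>" unfolding less_4 using s by (auto simp: a(2) mt_def R_0 R_1 units_R)
  have "upper_triangular A" unfolding upper_triangular_def by (auto simp: a(2) mt_def less_4 less_Suc_eq numeral_2_eq_2 numeral_3_eq_3)
  moreover have "\<exists>u\<in>\<R>. A $$ (1, 1) * u = 1"
    using s(1) units_nonzero[OF s(1)] units_R[OF units_inverse[OF s(1)]] by (intro bexI[of _ "inverse (d2 a)"]) (auto simp: a(2) mt_def)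
  moreover have "\<exists>u\<in>\<R>. A $$ (2, 2) * u = 1"
    using s(2) units_nonzero[OF s(2)] units_R[OF units_inverse[OF s(2)]] by (intro bexI[of _ "inverse (d3 a)"]) (auto simp: a(2) mt_def)
  ultimately show "A \<in> carrier (A4 \<R>)" using e by (simp add: A4_def) (simp add: a(2) mt_def)
qed

definition tgrp :: "'f::field tri set => 'f tri monoid" where
  "tgrp A = \<lparr>carrier = A, monoid.mult = tmul, one = tone\<rparr>"

lemma tgrp_simps [simp]: "carrier (tgrp A) = A" "x \<otimes>\<^bsub>tgrp A\<^esub> y = tmul x y" "\<one>\<^bsub>tgrp A\<^esub> = tone"
  by (simp_all add: tgrp_def)

lemma tgrp_group:
  assumes "!!a b. [|a \<in> A; b \<in> A|] ==> tmul a b \<in> A" "!!a. a \<in> A ==> tinv a \<in> A" "tone \<in> A" "!!a. a \<in> A ==> d2 a ~= 0 \<and> d3 a ~= 0"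
  shows "group (tgrp A)" "!!a. a \<in> A ==> inv\<^bsub>tgrp A\<^esub> a = tinv a"
proof -
  show g: "group (tgrp A)"
  proof (rule groupI)
    show "\<exists>y\<in>carrier (tgrp A). y \<otimes>\<^bsub>tgrp A\<^esub> x = \<one>\<^bsub>tgrp A\<^esub>" if "x \<in> carrier (tgrp A)" for x
      using that assms tinv_left[of x] by auto
  qed (auto simp: assms tmul_assoc)
  show "inv\<^bsub>tgrp A\<^esub> a = tinv a" if "a \<in> A" for a using group.inv_equality[OF g, of "tinv a" a] that assms tinv_left[of a] by simp
qed

lemma tone_TR: "tone \<in> TR" using gens_tor(3) gens_TR by blast

lemma TG_group: "group (tgrp (TR :: 'k::field rf tri set))" "a \<in> TR ==> inv\<^bsub>tgrp TR\<^esub> a = tinv (a :: 'k rf tri)"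
  by (rule tgrp_group; auto simp: TR_mult TR_inv tone_TR TR_sel units_nonzero)+

lemma TR_inverse: "a \<in> TR ==> tmul (tinv a) a = tone" by (rule tinv_left; rule units_nonzero; rule TR_sel; assumption)

lemma A4_ops [simp]: "A \<otimes>\<^bsub>A4 S\<^esub> B = A * B" "\<one>\<^bsub>A4 S\<^esub> = 1\<^sub>m 4" by (simp_all add: A4_def)

lemma A4_group: "group (A4 (\<R> :: 'k::field rf set))"
proof (rule groupI)
  let ?G = "A4 (\<R> :: 'k rf set)"
  show "x \<otimes>\<^bsub>?G\<^esub> y \<in> carrier ?G" if "x \<in> carrier ?G" "y \<in> carrier ?G" for x y
    using that unfolding A4_carrier A4_ops by (auto simp: mt_mult TR_mult)
  show "\<one>\<^bsub>?G\<^esub> \<in> carrier ?G" unfolding A4_carrier A4_ops using tone_TR mt_one by (metis image_eqI)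
  show "x \<otimes>\<^bsub>?G\<^esub> y \<otimes>\<^bsub>?G\<^esub> z = x \<otimes>\<^bsub>?G\<^esub> (y \<otimes>\<^bsub>?G\<^esub> z)" if "x \<in> carrier ?G" "y \<in> carrier ?G" "z \<in> carrier ?G" for x y z
    using that unfolding A4_carrier A4_ops by (auto simp: mt_mult tmul_assoc)
  show "\<one>\<^bsub>?G\<^esub> \<otimes>\<^bsub>?G\<^esub> x = x" if "x \<in> carrier ?G" for x
    using that unfolding A4_carrier A4_ops mt_one[symmetric] by (auto simp: mt_mult)
  show "\<exists>y\<in>carrier ?G. y \<otimes>\<^bsub>?G\<^esub> x = \<one>\<^bsub>?G\<^esub>" if x: "x \<in> carrier ?G" for x
  proof -
    obtain a where a: "a \<in> TR" "x = mt a" using x unfolding A4_carrier by blast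
    then have "tmul (tinv a) a = tone" using TR_inverse by blast
    then have "mt (tinv a) \<otimes>\<^bsub>?G\<^esub> x = \<one>\<^bsub>?G\<^esub>" by (simp add: a(2) mt_mult mt_one)
    then show ?thesis using TR_inv[OF a(1)] unfolding A4_carrier by blast
  qed
qed

definition ZT :: "'k::field rf tri set" where
  "ZT = {x14 (Fract f 1) | f. f \<in> factorial_polys}"

lemma x14_TR: "x14 (Fract f 1) \<in> TR" by (simp add: x14_def TR_ut R_0 R_poly)

lemma ZT_TR: "ZT \<subseteq> TR" using x14_TR by (auto simp: ZT_def)

lemma ZT_ZP: "\<zeta> \<in> ZT \<longleftrightarrow> (%v. \<zeta>) \<in> ZP" by (auto simp: ZT_def ZP_def fun_eq_iff)

lemma ZP_ZT: "\<zeta> \<in> ZP ==> \<exists>a\<in>ZT. \<zeta> = (%v. a)" by (auto simp: ZT_def ZP_def)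

lemma ZT_central: "\<zeta> \<in> ZT ==> tmul \<zeta> a = tmul a \<zeta>" by (auto simp: ZT_def x14_central)

definition ZM :: "'k::field rf mat set" where
  "ZM = mt ` ZT"

lemma ZM_subgroup: "subgroup ZM (A4 (\<R> :: 'k::field rf set))"
proof -
  interpret G: group "A4 (\<R> :: 'k rf set)" by (rule A4_group)
  have m: "tmul (x14 (Fract f 1)) (tinv (x14 (Fract g 1))) \<in> ZT" if "f \<in> factorial_polys" "g \<in> factorial_polys" for f g :: "'k poly"
  proof -
    have "tmul (x14 (Fract f 1)) (tinv (x14 (Fract g 1))) = x14 (Fract (f - g) 1)" by (simp add: tinv_x14 x14_add)
    then show ?thesis using factorial_polys_diff[OF that] unfolding ZT_def by blast
  qed
  have one: "tone \<in> (ZT :: 'k rf tri set)" using factorial_polys_0 unfolding ZT_def by (force simp: x14_0 simp flip: Zero_fract_def)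
  have inv: "tinv a \<in> ZT" if "a \<in> ZT" for a :: "'k rf tri"
    using that m[OF factorial_polys_0] by (auto simp: ZT_def[of ] x14_0 simp flip: Zero_fract_def)
  show ?thesis
  proof (rule G.subgroupI)
    show "ZM \<subseteq> carrier (A4 (\<R> :: 'k rf set))" unfolding A4_carrier ZM_def using ZT_TR by blast
    show "ZM ~= ({} :: 'k rf mat set)" using one unfolding ZM_def by blast
    show "inv\<^bsub>A4 \<R>\<^esub> A \<in> ZM" if A: "A \<in> ZM" for A :: "'k rf mat"
    proof -
      obtain a where a: "a \<in> ZT" "A = mt a" using A unfolding ZM_def by blast
      have t: "a \<in> TR" using a ZT_TR by blast
      have "tmul (tinv a) a = tone" by (rule TR_inverse[OF t])
      then have "inv\<^bsub>A4 \<R>\<^esub> A = mt (tinv a)"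
        using t TR_inv[OF t] by (intro G.inv_equality) (auto simp: a(2) mt_mult mt_one A4_carrier)
      then show ?thesis using inv[OF a(1)] unfolding ZM_def by blast
    qed
    show "A \<otimes>\<^bsub>A4 \<R>\<^esub> B \<in> ZM" if AB: "A \<in> ZM" "B \<in> ZM" for A B :: "'k rf mat"
    proof -
      obtain a b where a: "a \<in> ZT" "A = mt a" "b \<in> ZT" "B = mt b" using AB unfolding ZM_def by blast
      obtain f g where fg: "f \<in> factorial_polys" "a = x14 (Fract f 1)" "g \<in> factorial_polys" "b = x14 (Fract g 1)" using a unfolding ZT_def by blast
      have "tmul a b = x14 (Fract (f - (0 - g)) 1)" by (simp add: fg x14_add)
      moreover have "f - (0 - g) \<in> factorial_polys" by (intro factorial_polys_diff factorial_polys_0 fg)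
      ultimately have "tmul a b \<in> ZT" unfolding ZT_def by blast
      then show ?thesis unfolding ZM_def A4_ops a mt_mult by blast
    qed
  qed
qed

lemma ZM_central: "central_subgroup ZM (A4 (\<R> :: 'k::field rf set))" unfolding central_subgroup_def
proof (intro conjI ballI ZM_subgroup)
  fix z g :: "'k rf mat" assume "z \<in> ZM" "g \<in> carrier (A4 \<R>)"
  then obtain \<zeta> a where "\<zeta> \<in> ZT" "z = mt \<zeta>" "g = mt a" unfolding ZM_def A4_carrier by blast
  then show "z \<otimes>\<^bsub>A4 \<R>\<^esub> g = g \<otimes>\<^bsub>A4 \<R>\<^esub> z" using ZT_central[of \<zeta> a] by (simp add: mt_mult)
qed

definition Gam :: "'k::field rf mat set monoid" where
  "Gam = A4 \<R> Mod ZM"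

definition pj :: "'k::field rf tri => 'k rf mat set" where
  "pj a = ZM #>\<^bsub>A4 \<R>\<^esub> mt a"

lemma ZM_normal: "ZM \<lhd> A4 (\<R> :: 'k::field rf set)"
proof -
  interpret G: group "A4 (\<R> :: 'k rf set)" by (rule A4_group)
  have "x \<otimes>\<^bsub>A4 \<R>\<^esub> h \<otimes>\<^bsub>A4 \<R>\<^esub> inv\<^bsub>A4 \<R>\<^esub> x = h"
    if "x \<in> carrier (A4 (\<R> :: 'k rf set))" "h \<in> ZM" for x h :: "'k rf mat"
  proof -
    have h: "h \<in> carrier (A4 \<R>)" using that(2) subgroup.subset[OF ZM_subgroup] by blast
    have "h \<otimes>\<^bsub>A4 \<R>\<^esub> x = x \<otimes>\<^bsub>A4 \<R>\<^esub> h" using ZM_central that unfolding central_subgroup_def by blast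
    then show ?thesis using that(1) h by (metis G.inv_solve_right' G.m_closed)
  qed
  then show ?thesis unfolding G.normal_inv_iff using ZM_subgroup by auto
qed

lemma Gam_group: "group (Gam :: 'k::field rf mat set monoid)" unfolding Gam_def by (rule normal.factorgroup_is_group[OF ZM_normal])

lemma pj_hom: "group_hom (tgrp TR) Gam (pj :: 'k::field rf tri => _)"
proof -
  interpret G: group "A4 (\<R> :: 'k rf set)" by (rule A4_group)
  have "mt \<in> hom (tgrp TR) (A4 (\<R> :: 'k rf set))" by (rule homI) (auto simp: A4_carrier mt_mult)
  then have "(%A. ZM #>\<^bsub>A4 \<R>\<^esub> A) o mt \<in> hom (tgrp TR) (A4 (\<R> :: 'k rf set) Mod ZM)"
    by (rule hom_compose[OF _ normal.r_coset_hom_Mod[OF ZM_normal]])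
  then have "pj \<in> hom (tgrp TR) (Gam :: 'k rf mat set monoid)" by (simp add: Gam_def pj_def[abs_def] comp_def)
  then show ?thesis by (intro group_hom.intro TG_group Gam_group group_hom_axioms.intro)
qed

lemma pj_surj: "carrier Gam = pj ` TR" unfolding Gam_def carrier_FactGroup A4_carrier pj_def image_image ..

text \<open>Elements with the same image differ by an element of the kernel, on the right because the kernel is central.\<close>

lemma pj_eqD:
  fixes a b :: "'k::field rf tri"
  assumes "a \<in> TR" "b \<in> TR" "pj a = pj b" shows "\<exists>\<zeta>\<in>ZT. a = tmul b \<zeta>"
proof -
  interpret G: group "A4 (\<R> :: 'k rf set)" by (rule A4_group)
  have "mt a \<in> ZM #>\<^bsub>A4 \<R>\<^esub> mt b" using G.rcos_self[OF _ ZM_subgroup, of "mt a"] assms unfolding pj_def A4_carrier by blast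
  then obtain \<zeta> where "\<zeta> \<in> ZT" "mt a = mt (tmul \<zeta> b)" unfolding r_coset_def ZM_def by (auto simp: mt_mult)
  then show ?thesis using mt_inj ZT_central by metis
qed

lemma pj_ZT:
  fixes a :: "'k::field rf tri"
  assumes "a \<in> TR" "\<zeta> \<in> ZT" shows "pj (tmul a \<zeta>) = pj a"
proof -
  interpret G: group "A4 (\<R> :: 'k rf set)" by (rule A4_group)
  have c: "mt a \<in> carrier (A4 \<R>)" "mt \<zeta> \<in> carrier (A4 \<R>)" using assms ZT_TR unfolding A4_carrier by blast+
  have "mt (tmul a \<zeta>) \<in> ZM #>\<^bsub>A4 \<R>\<^esub> mt a"
    unfolding ZT_central[OF assms(2), symmetric] mt_mult[symmetric] r_coset_def ZM_def using assms(2) by auto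
  then show ?thesis unfolding pj_def using G.repr_independence[OF _ c(1) ZM_subgroup] by blast
qed

section \<open>Words and word length\<close>

context
  fixes G :: "('a, 'b) monoid_scheme" (structure) and S :: "'a set"
  assumes G: "group G" and S: "S \<subseteq> carrier G" and gen: "generate G S = carrier G"
begin

interpretation G: group G by (rule G)

interpretation W: Metric_space "carrier G" "word_dist G S" by (rule word_metric_is_metric[OF G S gen])

lemma word_metric_simps: "mspace (word_metric G S) = carrier G" "mdist (word_metric G S) = word_dist G S" by (simp_all add: word_metric_def)

lemma word_dist_eq: "[|x \<in> carrier G; y \<in> carrier G|] ==> word_dist G S x y = real (word_length G S (inv x \<otimes> y))"
  by (simp add: word_dist_def)

lemma word_length_inv: "x \<in> carrier G ==> word_length G S (inv x) = word_length G S x" using W.commute[of x \<one>] by (simp add: word_dist_eq)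

lemma word_length_mult:
  assumes x: "x \<in> carrier G" and y: "y \<in> carrier G"
  shows "real (word_length G S (x \<otimes> y)) <= real (word_length G S x) + real (word_length G S y)"
proof -
  have "inv x \<otimes> (x \<otimes> y) = y" using x y by (simp add: G.m_assoc[symmetric])
  then show ?thesis using W.triangle[of \<one> x "x \<otimes> y"] x y by (simp add: word_dist_eq)
qed

lemma word_exists: "g \<in> generate G S ==> \<exists>ws. is_word_for G S ws g"
proof (induction rule: generate.induct)
  case one
  show ?case by (rule exI[of _ "[]"]) (simp add: is_word_for_def)
next
  case (incl h)
  then show ?case using S by (intro exI[of _ "[h]"]) (auto simp: is_word_for_def)
next
  case (inv h)
  then show ?case using S by (intro exI[of _ "[inv h]"]) (auto simp: is_word_for_def)
next
  case (eng g h)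
  then obtain us vs where w: "is_word_for G S us g" "is_word_for G S vs h" by blast
  have vs: "foldr (\<otimes>) vs \<one> \<in> carrier G" using eng(2) gen w(2) by (simp add: is_word_for_def)
  have "foldr (\<otimes>) (us @ vs) \<one> = foldr (\<otimes>) us \<one> \<otimes> foldr (\<otimes>) vs \<one> \<and> foldr (\<otimes>) us \<one> \<in> carrier G" if "set us \<subseteq> S \<union> (m_inv G) ` S" for us
    using that
  proof (induction us)
    case (Cons a us)
    then have "a \<in> carrier G" using S by auto
    then show ?case using Cons vs by (simp add: G.m_assoc)
  qed (use vs in simp)
  then have "is_word_for G S (us @ vs) (g \<otimes> h)" using w by (auto simp: is_word_for_def)
  then show ?case by blast
qed

lemma word_length_attained:
  assumes "g \<in> carrier G" shows "\<exists>ws. length ws = word_length G S g \<and> is_word_for G S ws g" unfolding word_length_def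
  by (rule LeastI_ex[where P = "%n. \<exists>ws. length ws = n \<and> is_word_for G S ws g"]) (use word_exists[of g] assms gen in blast)

end

section \<open>The lower central series of the unitriangular part\<close>

text \<open>The filtration of the unitriangular group by the distance to the diagonal of the first nonzero entries.\<close>

definition UT :: "nat => 'k::field rf tri set" where
  "UT n = {a \<in> TR. d2 a = 1 \<and> d3 a = 1 \<and> (1 <= n \<longrightarrow> e12 a = 0 \<and> e23 a = 0 \<and> e34 a = 0) \<and> (2 <= n \<longrightarrow> e13 a = 0 \<and> e24 a = 0) \<and> (3 <= n \<longrightarrow> e14 a = 0)}"

lemma UT_TR: "UT n \<subseteq> TR" and UT_0: "UT n \<subseteq> UT 0" by (auto simp: UT_def)

lemma diag_tmul: "d2 (tmul a b) = d2 a * d2 b" "d3 (tmul a b) = d3 a * d3 b" "d2 (tinv a) = inverse (d2 a)" "d3 (tinv a) = inverse (d3 a)"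
  by (simp_all add: tmul_def tinv_def)

lemma UT_mult:
  assumes a: "a \<in> UT n" and b: "b \<in> UT n" shows "tmul a b \<in> UT n"
proof -
  have t: "tmul a b \<in> TR" using a b UT_TR TR_mult by blast
  show ?thesis unfolding UT_def mem_Collect_eq using a b by (intro conjI impI t) (simp_all add: UT_def tmul_def)
qed

lemma UT_inv:
  assumes a: "a \<in> UT n" shows "tinv a \<in> UT n"
proof -
  have t: "tinv a \<in> TR" using a UT_TR TR_inv by blast
  show ?thesis unfolding UT_def mem_Collect_eq using a by (intro conjI impI t) (simp_all add: UT_def tinv_def)
qed

lemma UT_one: "tone \<in> UT n" unfolding UT_def mem_Collect_eq by (intro conjI impI tone_TR) (simp_all add: tone_def)

lemma UT_commutator:
  assumes a: "a \<in> UT 0" and b: "b \<in> UT n" shows "tmul (tmul (tmul a b) (tinv a)) (tinv b) \<in> UT (Suc n)"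
proof -
  let ?c = "tmul (tmul (tmul a b) (tinv a)) (tinv b)"
  have t: "?c \<in> TR" using a b UT_TR by (intro TR_mult TR_inv) auto
  have 1: "d2 a = 1" "d3 a = 1" "d2 b = 1" "d3 b = 1" using a b by (auto simp: UT_def)
  have "d2 ?c = 1 \<and> d3 ?c = 1 \<and> e12 ?c = 0 \<and> e23 ?c = 0 \<and> e34 ?c = 0" by (simp add: tmul_def tinv_def 1)
  moreover have "e13 ?c = 0 \<and> e24 ?c = 0" if "1 <= n"
  proof -
    have "e12 b = 0" "e23 b = 0" "e34 b = 0" using that b by (auto simp: UT_def)
    then show ?thesis by (simp add: tmul_def tinv_def 1 algebra_simps)
  qed
  moreover have "e14 ?c = 0" if "2 <= n"
  proof -
    have "e12 b = 0" "e23 b = 0" "e34 b = 0" "e13 b = 0" "e24 b = 0" using that b by (auto simp: UT_def)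
    then show ?thesis by (simp add: tmul_def tinv_def 1 algebra_simps)
  qed
  ultimately show ?thesis using t by (auto simp: UT_def)
qed

lemma UT_group: "group (tgrp (UT n))" "a \<in> UT n ==> inv\<^bsub>tgrp (UT n)\<^esub> a = tinv a"
  by (rule tgrp_group; auto simp: UT_mult UT_inv UT_one; simp add: UT_def)+

lemma UT_subgroup: "subgroup (UT n) (tgrp (UT 0 :: 'k::field rf tri set))"
proof -
  interpret group "tgrp (UT 0 :: 'k rf tri set)" by (rule UT_group)
  show ?thesis
  proof (rule subgroupI)
    show "UT n \<subseteq> carrier (tgrp (UT 0 :: 'k rf tri set))" using UT_0 by simp
    show "UT n ~= ({} :: 'k rf tri set)" using UT_one by blast
    show "inv\<^bsub>tgrp (UT 0)\<^esub> a \<in> UT n" if "a \<in> UT n" for a :: "'k rf tri"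
      using UT_inv[OF that] UT_group(2)[OF subsetD[OF UT_0 that]] by simp
  qed (simp add: UT_mult)
qed

lemma lower_central_UT:
  assumes h: "group_hom (tgrp (UT 0)) H h" and surj: "carrier H = h ` UT 0" shows "lower_central H n \<subseteq> h ` UT n"
proof (induction n)
  case 0
  then show ?case using surj by simp
next
  case (Suc n)
  interpret h: group_hom "tgrp (UT 0)" H h by (rule h)
  have "subgroup (h ` UT (Suc n)) H" by (rule h.subgroup_img_is_subgroup[OF UT_subgroup])
  moreover have "{x \<otimes>\<^bsub>H\<^esub> y \<otimes>\<^bsub>H\<^esub> inv\<^bsub>H\<^esub> x \<otimes>\<^bsub>H\<^esub> inv\<^bsub>H\<^esub> y | x y. x \<in> carrier H \<and> y \<in> lower_central H n} \<subseteq> h ` UT (Suc n)"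
  proof safe
    fix x y assume x: "x \<in> carrier H" and y: "y \<in> lower_central H n"
    obtain a where a: "a \<in> UT 0" "x = h a" using x surj by blast
    obtain b where b: "b \<in> UT n" "y = h b" using y Suc by blast
    have b0: "b \<in> UT 0" using b(1) UT_0 by blast
    have "x \<otimes>\<^bsub>H\<^esub> y \<otimes>\<^bsub>H\<^esub> inv\<^bsub>H\<^esub> x \<otimes>\<^bsub>H\<^esub> inv\<^bsub>H\<^esub> y = h (tmul (tmul (tmul a b) (tinv a)) (tinv b))"
      using h.hom_mult[of a b] h.hom_mult[of "tmul a b" "tinv a"] h.hom_mult[of "tmul (tmul a b) (tinv a)" "tinv b"] h.hom_inv[of a] h.hom_inv[of b] a b b0
      by (simp add: UT_group UT_mult UT_inv)
    then show "x \<otimes>\<^bsub>H\<^esub> y \<otimes>\<^bsub>H\<^esub> inv\<^bsub>H\<^esub> x \<otimes>\<^bsub>H\<^esub> inv\<^bsub>H\<^esub> y \<in> h ` UT (Suc n)" using UT_commutator[OF a(1) b(1)] by simp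
  qed
  ultimately show ?case by (simp add: h.H.generate_subgroup_incl)
qed

text \<open>The images of the unitriangular matrices form the normal subgroup; the quotient is abelian since commutators have diagonal 1.\<close>

theorem Gam_nilpotent_by_abelian: "nilpotent_by_abelian 3 (Gam :: 'k::field rf mat set monoid)"
proof -
  interpret p: group_hom "tgrp TR" "Gam :: 'k rf mat set monoid" pj by (rule pj_hom)
  let ?N = "pj ` UT 0 :: 'k rf mat set set"
  let ?H = "Gam\<lparr>carrier := ?N\<rparr>"
  have sub: "subgroup (UT 0) (tgrp (TR :: 'k rf tri set))"
  proof (rule p.G.subgroupI)
    show "UT 0 \<subseteq> carrier (tgrp (TR :: 'k rf tri set))" using UT_TR by simp
    show "UT 0 ~= ({} :: 'k rf tri set)" using UT_one by blast
    show "inv\<^bsub>tgrp TR\<^esub> a \<in> UT 0" if "a \<in> UT 0" for a :: "'k rf tri"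
      using UT_inv[OF that] TG_group(2)[OF subsetD[OF UT_TR that]] by simp
  qed (simp add: UT_mult)
  have subN: "subgroup ?N Gam" by (rule p.subgroup_img_is_subgroup[OF sub])
  have normal: "?N \<lhd> Gam" unfolding p.H.normal_inv_iff
  proof (intro conjI subN ballI)
    fix x h assume "x \<in> carrier (Gam :: 'k rf mat set monoid)" "h \<in> ?N"
    then obtain a u where a: "a \<in> TR" "x = pj a" and u: "u \<in> UT 0" "h = pj u" unfolding pj_surj by blast
    have uT: "u \<in> TR" using u(1) UT_TR by blast
    have nz: "d2 a ~= 0" "d3 a ~= 0" using TR_sel[OF a(1)] units_nonzero by auto
    have "tmul (tmul a u) (tinv a) \<in> UT 0" using TR_mult[OF TR_mult[OF a(1) uT] TR_inv[OF a(1)]] u(1) nz by (simp add: UT_def diag_tmul)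
    moreover have "x \<otimes>\<^bsub>Gam\<^esub> h \<otimes>\<^bsub>Gam\<^esub> inv\<^bsub>Gam\<^esub> x = pj (tmul (tmul a u) (tinv a))"
      using p.hom_mult[of a u] p.hom_mult[of "tmul a u" "tinv a"] p.hom_inv[of a] a u uT by (simp add: TG_group TR_mult TR_inv)
    ultimately show "x \<otimes>\<^bsub>Gam\<^esub> h \<otimes>\<^bsub>Gam\<^esub> inv\<^bsub>Gam\<^esub> x \<in> ?N" by simp
  qed
  have gH: "group ?H" by (rule subgroup.subgroup_is_group[OF subN p.H.group_axioms])
  have "group_hom (tgrp (UT 0)) ?H pj"
    by (intro group_hom.intro UT_group gH group_hom_axioms.intro homI) (use UT_TR[of 0] p.hom_mult in \<open>auto simp: subset_iff\<close>)
  from lower_central_UT[OF this, of 3] have "lower_central ?H 3 \<subseteq> pj ` UT 3" by simp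
  moreover have "UT 3 = {tone :: 'k rf tri}" using UT_one[of 3] by (auto simp: UT_def tone_def tri.expand)
  moreover have "pj tone = \<one>\<^bsub>?H\<^esub>" using p.hom_one by simp
  moreover have "\<one>\<^bsub>?H\<^esub> \<in> lower_central ?H 3" unfolding numeral_3_eq_3 lower_central.simps by (rule generate.one)
  ultimately have "lower_central ?H 3 = {\<one>\<^bsub>?H\<^esub>}" by auto
  then have nil: "nilpotent_of_class_at_most 3 ?H" using gH by (simp add: nilpotent_of_class_at_most_def)
  interpret Q: group "Gam Mod ?N" by (rule normal.factorgroup_is_group[OF normal])
  have "comm_group (Gam Mod ?N)"
  proof (rule Q.group_comm_groupI)
    fix X Y assume "X \<in> carrier (Gam Mod ?N)" "Y \<in> carrier (Gam Mod ?N)"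
    then obtain x y where xy: "x \<in> carrier Gam" "y \<in> carrier Gam" "X = ?N #>\<^bsub>Gam\<^esub> x" "Y = ?N #>\<^bsub>Gam\<^esub> y" unfolding carrier_FactGroup by blast
    obtain a b where ab: "a \<in> TR" "x = pj a" "b \<in> TR" "y = pj b" using xy unfolding pj_surj by blast
    let ?c = "tmul (tmul a b) (tinv (tmul b a))"
    have nz: "d2 a ~= 0" "d3 a ~= 0" "d2 b ~= 0" "d3 b ~= 0" using TR_sel[OF ab(1)] TR_sel[OF ab(3)] units_nonzero by auto
    have T: "tmul a b \<in> TR" "tmul b a \<in> TR" "?c \<in> TR" using ab by (auto intro: TR_mult TR_inv)
    have "d2 ?c = 1" "d3 ?c = 1" unfolding diag_tmul using nz by (simp_all add: field_simps)
    then have c: "?c \<in> UT 0" using T(3) by (simp add: UT_def)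
    have "tmul ?c (tmul b a) = tmul a b" using TR_inverse[OF T(2)] by (simp add: tmul_assoc)
    then have e: "x \<otimes>\<^bsub>Gam\<^esub> y = pj ?c \<otimes>\<^bsub>Gam\<^esub> (y \<otimes>\<^bsub>Gam\<^esub> x)"
      using p.hom_mult[of a b] p.hom_mult[of b a] p.hom_mult[of ?c "tmul b a"] ab T by simp
    have "?N #>\<^bsub>Gam\<^esub> (x \<otimes>\<^bsub>Gam\<^esub> y) = (?N #>\<^bsub>Gam\<^esub> pj ?c) #>\<^bsub>Gam\<^esub> (y \<otimes>\<^bsub>Gam\<^esub> x)"
      unfolding e using subgroup.subset[OF subN] c xy by (intro p.H.coset_mult_assoc[symmetric]) auto
    also have "?N #>\<^bsub>Gam\<^esub> pj ?c = ?N" using c subgroup.subset[OF subN] by (intro p.H.coset_join2 subN) auto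
    finally show "X \<otimes>\<^bsub>Gam Mod ?N\<^esub> Y = Y \<otimes>\<^bsub>Gam Mod ?N\<^esub> X"
      unfolding mult_FactGroup xy(3,4) normal.rcos_sum[OF normal xy(1,2)] normal.rcos_sum[OF normal xy(2,1)] .
  qed
  then show ?thesis unfolding nilpotent_by_abelian_def using normal nil by blast
qed

section \<open>Finite generation\<close>

text \<open>The function that is 0 on the subgroup generated by gens and 1 elsewhere is a length function vanishing on gens. The bound on length
functions makes it vanish everywhere.\<close>

theorem Gam_finitely_generated:
  assumes fin: "finite (UNIV :: 'k::field set)" shows "finitely_generated_group (Gam :: 'k rf mat set monoid)"
proof -
  interpret p: group_hom "tgrp TR" "Gam :: 'k rf mat set monoid" pj by (rule pj_hom)
  let ?S = "pj ` gens :: 'k rf mat set set"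
  have S: "?S \<subseteq> carrier Gam" using gens_TR unfolding pj_surj by blast
  define W :: "'k rf tri => real" where "W a = (if pj a \<in> generate Gam ?S then 0 else 1)" for a
  have "length_on_TR W 0"
  proof
    show "W (tmul a b) <= W a + W b" if "a \<in> TR" "b \<in> TR" for a b
      using p.hom_mult[of a b] that generate.eng[of "pj a" Gam ?S "pj b"] by (auto simp: W_def)
    show "W (tinv a) = W a" if a: "a \<in> TR" for a
    proof -
      have "pj (tinv a) = inv\<^bsub>Gam\<^esub> (pj a)" using p.hom_inv[of a] a by (simp add: TG_group)
      moreover have "pj a \<in> carrier Gam" using a pj_surj by blast
      ultimately show ?thesis using p.H.generate_m_inv_closed[OF S] by (metis W_def p.H.inv_inv)
    qed
    show "W a <= 0" if "a \<in> gens" for a using generate.incl[of "pj a" ?S Gam] that by (simp add: W_def)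
  qed simp
  then have "W a <= 0" if "a \<in> TR" for a using length_on_TR.W_le_len[of W 0 a] that by simp
  then have "pj a \<in> generate Gam ?S" if "a \<in> TR" for a using that by (force simp: W_def split: if_splits)
  then have "generate Gam ?S = carrier Gam" using p.H.generate_incl[OF S] unfolding pj_surj by blast
  then have "finite_generating_set Gam ?S" using S finite_gens[OF fin] by (simp add: finite_generating_set_def)
  then show ?thesis unfolding finitely_generated_group_def using Gam_group by blast
qed

section \<open>Ultrafilters containing the factorials\<close>

text \<open>Zorn's lemma for proper filters; a minimal one decides every predicate, as otherwise it could be refined by the predicate.\<close>

lemma ultrafilter_exists:
  fixes F :: "'a filter"
  assumes F: "F ~= bot" shows "\<exists>U\<le>F. U ~= bot \<and> (\<forall>P. eventually P U \<or> eventually (%x. \<not> P x) U)"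
proof -
  let ?A = "{U. U <= F \<and> U ~= bot}"
  have "\<exists>m\<in>?A. \<forall>a\<in>?A. a <= m \<longrightarrow> a = m"
  proof (rule predicate_Zorn[where P = "%a b. b <= a"])
    show "partial_order_on ?A (relation_of (%a b. b <= a) ?A)" by (rule partial_order_on_relation_ofI) auto
    fix C assume C: "C \<in> Chains (relation_of (%a b. b <= a) ?A)"
    have CA: "U <= F" "U ~= bot" if "U \<in> C" for U using C that by (auto simp: Chains_def relation_of_def)
    have lin: "U <= V \<or> V <= U" if "U \<in> C" "V \<in> C" for U V using C that by (auto simp: Chains_def relation_of_def)
    show "\<exists>u\<in>?A. \<forall>a\<in>C. u <= a"
    proof (cases "C = {}")
      case True
      then show ?thesis using F by blast
    next
      case False
      have "eventually (%x. False) (Inf C) \<longleftrightarrow> (\<exists>U\<in>C. eventually (%x. False) U)"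
      proof (rule eventually_Inf_base[OF False])
        fix U V assume UV: "U \<in> C" "V \<in> C"
        from lin[OF UV] show "\<exists>x\<in>C. x <= inf U V"
        proof
          assume "U <= V" then have "U <= inf U V" by simp
          then show ?thesis using UV(1) by blast
        next
          assume "V <= U" then have "V <= inf U V" by simp
          then show ?thesis using UV(2) by blast
        qed
      qed
      then have "Inf C ~= bot" using CA(2) by (auto simp: eventually_False)
      moreover have "Inf C <= F"
      proof -
        obtain U where "U \<in> C" using False by blast
        then show ?thesis using CA(1)[of U] by (intro Inf_lower2)
      qed
      moreover have "\<forall>a\<in>C. Inf C <= a" by (simp add: Inf_lower)
      ultimately show ?thesis by (intro bexI[of _ "Inf C"]) auto
    qed
  qed
  then obtain U where U: "U <= F" "U ~= bot" and min: "!!V. [|V <= F; V ~= bot; V <= U|] ==> V = U" by auto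
  have "eventually P U \<or> eventually (%x. \<not> P x) U" for P
  proof (rule ccontr)
    assume n: "\<not> (eventually P U \<or> eventually (%x. \<not> P x) U)"
    let ?V = "inf U (principal {x. P x})"
    have "?V ~= bot"
    proof
      assume "?V = bot"
      then have "eventually (%x. False) ?V" by simp
      then have "eventually (%x. \<not> P x) U" by (simp add: eventually_inf_principal)
      then show False using n by blast
    qed
    then have "?V = U" using U(1) by (intro min) (auto intro: le_infI1)
    moreover have "eventually P ?V" by (simp add: eventually_inf_principal)
    ultimately show False using n by simp
  qed
  then show ?thesis using U by blast
qed

lemma factorial_ultrafilter_exists: "\<exists>\<omega>. nonprincipal_ultrafilter \<omega> \<and> (\<forall>\<^sub>F n in \<omega>. n \<in> range fact)"
proof -
  let ?F = "filtermap (fact :: nat => nat) sequentially"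
  obtain U where U: "U <= ?F" "U ~= bot" "!!P. eventually P U \<or> eventually (%x. \<not> P x) U"
    using ultrafilter_exists[of ?F] by (auto simp: filtermap_bot_iff)
  have ev: "eventually P U" if "!!n. n \<ge> N ==> P (fact n)" for P N
  proof -
    have "eventually P ?F" unfolding eventually_filtermap using that by (auto simp: eventually_sequentially)
    then show ?thesis using U(1) by (simp add: le_filter_def)
  qed
  have "U ~= principal {m}" for m
  proof
    assume p: "U = principal {m}"
    have "eventually (%n. n ~= m) U"
    proof (rule ev[of "Suc m"])
      fix n assume "Suc m <= n"
      then show "fact n ~= m" using fact_ge_self[of n] by linarith
    qed
    then show False unfolding p by (simp add: eventually_principal)
  qed
  then have "nonprincipal_ultrafilter U" unfolding nonprincipal_ultrafilter_def using U ev[of 0 "%n. 0 < n"] by simp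
  moreover have "\<forall>\<^sub>F n in U. n \<in> range fact" by (rule ev[of 0]) simp
  ultimately show ?thesis by blast
qed

lemma len_mult_PG:
  fixes g h :: "place => 'k::field rf tri"
  assumes "g \<in> carrier PG" "h \<in> carrier PG" shows "len (g \<star> h) <= len g + len h"
proof -
  obtain \<omega> where "nonprincipal_ultrafilter \<omega>" using factorial_ultrafilter_exists by blast
  then interpret length_group "PG :: (place => 'k rf tri) monoid" len \<omega> by (rule length_group_PG)
  show ?thesis by (rule len_mult[OF assms])
qed

section \<open>The cone of the quotient group\<close>

text \<open>Lifting the letters of a shortest word gives a representative of linear length.\<close>

lemma short_representatives:
  assumes S: "finite_generating_set (Gam :: 'k::field rf mat set monoid) S"
  shows "\<exists>K\<ge>0. \<forall>\<gamma>\<in>carrier Gam. \<exists>a\<in>TR. pj a = \<gamma> \<and> len (%v. a) <= K * real (word_length Gam S \<gamma>)"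
proof -
  interpret p: group_hom "tgrp TR" "Gam :: 'k rf mat set monoid" pj by (rule pj_hom)
  have S': "finite S" "S \<subseteq> carrier Gam" "generate Gam S = carrier Gam" using S by (auto simp: finite_generating_set_def)
  let ?A = "S \<union> m_inv Gam ` S"
  have A: "?A \<subseteq> carrier Gam" "finite ?A" using S' by auto
  then have "\<forall>s\<in>?A. \<exists>a. a \<in> TR \<and> pj a = s" unfolding pj_surj by blast
  then obtain r where r: "!!s. s \<in> ?A ==> r s \<in> TR \<and> pj (r s) = s" by metis
  define K where "K = (\<Sum>s\<in>?A. len (%v. r s))"
  have K: "0 <= K" "!!s. s \<in> ?A ==> len (%v. r s) <= K" unfolding K_def using A by (auto intro!: sum_nonneg member_le_sum len_nonneg)
  have w: "\<exists>a\<in>TR. pj a = foldr (\<otimes>\<^bsub>Gam\<^esub>) ws \<one>\<^bsub>Gam\<^esub> \<and> len (%v. a) <= K * real (length ws)" if "set ws \<subseteq> ?A" for ws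
    using that
  proof (induction ws)
    case Nil
    have "len (%v. tone :: 'k rf tri) <= 0" unfolding len_le_iff nrm_le_iff by (simp add: tone_def tinv_def)
    then show ?case using tone_TR p.hom_one by (intro bexI[of _ tone]) auto
  next
    case (Cons s ws)
    then obtain a where a: "a \<in> TR" "pj a = foldr (\<otimes>\<^bsub>Gam\<^esub>) ws \<one>\<^bsub>Gam\<^esub>" "len (%v. a) <= K * real (length ws)" by auto
    have s: "r s \<in> TR" "pj (r s) = s" "len (%v. r s) <= K" using r K Cons.prems by auto
    have "len (%v. tmul (r s) a) <= len (%v. r s) + len (%v. a)" using len_mult_PG[OF TR_PG[OF s(1)] TR_PG[OF a(1)]] by (simp add: PG_def)
    then show ?case using s a TR_mult[OF s(1) a(1)] p.hom_mult[of "r s" a] by (intro bexI[of _ "tmul (r s) a"]) (auto simp: algebra_simps)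
  qed
  have "\<exists>a\<in>TR. pj a = \<gamma> \<and> len (%v. a) <= K * real (word_length Gam S \<gamma>)" if "\<gamma> \<in> carrier Gam" for \<gamma>
    using word_length_attained[OF Gam_group S'(2,3) that] w unfolding is_word_for_def by metis
  then show ?thesis using K(1) by blast
qed

lemma word_length_upper:
  assumes fin: "finite (UNIV :: 'k::field set)" and S: "finite_generating_set (Gam :: 'k rf mat set monoid) S"
  shows "\<exists>K\<ge>0. \<forall>a\<in>TR. real (word_length Gam S (pj a)) <= K * (len (%v. a) + 1)"
proof -
  interpret p: group_hom "tgrp TR" "Gam :: 'k rf mat set monoid" pj by (rule pj_hom)
  have S': "S \<subseteq> carrier Gam" "generate Gam S = carrier Gam" using S by (auto simp: finite_generating_set_def)
  note wl = word_length_mult[OF Gam_group S'] word_length_inv[OF Gam_group S']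
  define M where "M = (\<Sum>a\<in>gens. real (word_length Gam S (pj a)))"
  have pc: "pj a \<in> carrier Gam" if "a \<in> TR" for a using that pj_surj by blast
  have "length_on_TR (%a. real (word_length Gam S (pj a))) M"
  proof
    show "real (word_length Gam S (pj (tmul a b))) <= real (word_length Gam S (pj a)) + real (word_length Gam S (pj b))" if "a \<in> TR" "b \<in> TR" for a b
      using wl(1)[OF pc[OF that(1)] pc[OF that(2)]] p.hom_mult[of a b] that by simp
    show "real (word_length Gam S (pj (tinv a))) = real (word_length Gam S (pj a))" if "a \<in> TR" for a
      using wl(2)[OF pc[OF that]] p.hom_inv[of a] that by (simp add: TG_group)
    show "real (word_length Gam S (pj a)) <= M" if "a \<in> gens" for a unfolding M_def using that finite_gens[OF fin] by (intro member_le_sum) auto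
    show "0 <= M" unfolding M_def by (intro sum_nonneg) auto
  qed
  then have "real (word_length Gam S (pj a)) <= (130 * M) * (len (%v. a) + 1)" if "a \<in> TR" for a
    using length_on_TR.W_le_len[of "%a. real (word_length Gam S (pj a))" M a] that by (simp add: mult_ac)
  moreover have "0 <= 130 * M" unfolding M_def by (simp add: sum_nonneg)
  ultimately show ?thesis by blast
qed

context abels_cone
begin

text \<open>The word metric satisfies the hypotheses of coarse_quotient: short words lift to short matrices, and conversely every word length is
a length function on the matrix group, bounded by a multiple of len.\<close>

theorem pi1_cone_Gam:
  assumes fin: "finite (UNIV :: 'k set)" and S: "finite_generating_set (Gam :: 'k rf mat set monoid) S"
  shows "\<exists>A :: 'k set. (A = UNIV \<or> A = {0}) \<and> pi1_cone Gam S \<omega> \<cong> additive A \<and> ((\<forall>\<^sub>F n in \<omega>. n \<in> range fact) \<longrightarrow> A = UNIV)"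
proof -
  interpret p: group_hom "tgrp TR" "Gam :: 'k rf mat set monoid" pj by (rule pj_hom)
  have S': "S \<subseteq> carrier Gam" "generate Gam S = carrier Gam" using S by (auto simp: finite_generating_set_def)
  note wm = word_metric_simps[OF Gam_group S']
  note wd = word_dist_eq[OF Gam_group S']
  obtain A z c where A: "A = (UNIV :: 'k set) \<or> A = {0}" and deck: "central_deck PG len \<omega> (additive A) z c" and zZ: "\<forall>a\<in>A. \<forall>n. z a n \<in> ZP"
    and near: "\<forall>\<zeta>\<in>\<S>. (\<forall>n. \<zeta> n \<in> ZP) \<longrightarrow> (\<exists>a\<in>A. size (inv\<^sub>s \<zeta> \<cdot> z a) = 0)"
    and fact: "(\<forall>\<^sub>F n in \<omega>. n \<in> range fact) \<longrightarrow> A = UNIV" using deck_exists[OF fin] by (elim exE conjE)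
  interpret D: central_deck PG len \<omega> "additive A" z c by (rule deck)
  obtain K where K: "0 <= K" "\<forall>\<gamma>\<in>carrier Gam. \<exists>a\<in>TR. pj a = \<gamma> \<and> len (%v. a) <= K * real (word_length Gam S \<gamma>)"
    using short_representatives[OF S] by blast
  obtain K' where K': "0 <= K'" "\<forall>a\<in>TR. real (word_length Gam S (pj a)) <= K' * (len (%v. a) + 1)"
    using word_length_upper[OF fin S] by blast
  have "\<exists>r. \<forall>\<gamma>\<in>carrier Gam. r \<gamma> \<in> TR \<and> pj (r \<gamma>) = \<gamma> \<and> len (%v. r \<gamma>) <= K * real (word_length Gam S \<gamma>)"
    using K(2) by (intro bchoice) blast
  then obtain r where "\<forall>\<gamma>\<in>carrier Gam. r \<gamma> \<in> TR \<and> pj (r \<gamma>) = \<gamma> \<and> len (%v. r \<gamma>) <= K * real (word_length Gam S \<gamma>)"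
    by (elim exE)
  then have r: "!!\<gamma>. \<gamma> \<in> carrier Gam ==> r \<gamma> \<in> TR" "!!\<gamma>. \<gamma> \<in> carrier Gam ==> pj (r \<gamma>) = \<gamma>"
    "!!\<gamma>. \<gamma> \<in> carrier Gam ==> len (%v. r \<gamma>) <= K * real (word_length Gam S \<gamma>)" by blast+
  have pc: "pj a \<in> carrier Gam" if "a \<in> TR" for a using that pj_surj by blast
  have quot: "inv\<^bsub>PG\<^esub> (%v. a) \<star> (%v. b) = (%v. tmul (tinv a) b)" "pj (tmul (tinv a) b) = inv\<^bsub>Gam\<^esub> (pj a) \<otimes>\<^bsub>Gam\<^esub> pj b" if "a \<in> TR" "b \<in> TR" for a b :: "'k rf tri"
    using PG_inv[OF TR_PG[OF that(1)]] p.hom_mult[of "tinv a" b] p.hom_inv[of a] that by (simp_all add: PG_def TG_group TR_inv)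
  have right: "(%v. a) \<star> (%v. b) = (%v. tmul a b)" for a b :: "'k rf tri" by (simp add: PG_def)
  define N where "N = K + K'"
  have up1: "x <= N * (y + 1)" if "x <= K * y" "0 <= y" for x y
    by (rule order_trans[OF that(1)], rule mult_mono) (use that K(1) K'(1) in \<open>auto simp: N_def\<close>)
  have up2: "x <= N * y" if "x <= K' * y" "0 <= y" for x y
    by (rule order_trans[OF that(1)], rule mult_right_mono) (use that K(1) in \<open>auto simp: N_def\<close>)
  interpret Q: coarse_quotient PG len \<omega> "additive A" z c "word_metric Gam S" "\<one>\<^bsub>Gam\<^esub>" "%\<gamma> v. r \<gamma>" ZP N
  proof (unfold_locales, unfold wm)
    show "\<one>\<^bsub>Gam\<^esub> \<in> carrier (Gam :: 'k rf mat set monoid)" by (rule p.H.one_closed)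
    show "0 <= N" using K(1) K'(1) by (simp add: N_def)
    show "ZP \<subseteq> carrier (PG :: (place => 'k rf tri) monoid)" using ZP_ZT ZT_TR TR_PG by blast
    show "(%v. r \<gamma>) \<in> carrier PG" if "\<gamma> \<in> carrier Gam" for \<gamma> using r(1)[OF that] by (rule TR_PG)
    show "len (%v. r \<gamma>) <= N * (word_dist Gam S \<gamma> \<one>\<^bsub>Gam\<^esub> + 1)" if "\<gamma> \<in> carrier Gam" for \<gamma>
      using up1[OF r(3)[OF that]] that by (simp add: wd word_length_inv[OF Gam_group S'])
    show "word_dist Gam S x y <= N * (len (inv\<^bsub>PG\<^esub> (%v. r x) \<star> (%v. r y) \<star> \<zeta>) + 1)"
      if xy: "x \<in> carrier Gam" "y \<in> carrier Gam" "\<zeta> \<in> ZP" for x y \<zeta>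
    proof -
      obtain a where a: "a \<in> ZT" "\<zeta> = (%v. a)" using ZP_ZT[OF xy(3)] by blast
      have t: "tmul (tinv (r x)) (r y) \<in> TR" using r(1) xy by (intro TR_mult TR_inv) auto
      have "word_dist Gam S x y = real (word_length Gam S (pj (tmul (tmul (tinv (r x)) (r y)) a)))" using xy r by (simp add: wd pj_ZT[OF t a(1)] quot)
      also have "... <= K' * (len (%v. tmul (tmul (tinv (r x)) (r y)) a) + 1)" using K'(2) t a(1) ZT_TR TR_mult by blast
      finally have "word_dist Gam S x y <= K' * (len (%v. tmul (tmul (tinv (r x)) (r y)) a) + 1)" .
      then show ?thesis using len_nonneg[OF TR_PG[OF TR_mult[OF t subsetD[OF ZT_TR a(1)]]]] by (simp only: a(2) quot(1)[OF r(1)[OF xy(1)] r(1)[OF xy(2)]] right) (intro up2, auto)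
    qed
    show "\<exists>\<zeta>\<in>ZP. len (inv\<^bsub>PG\<^esub> (%v. r x) \<star> (%v. r y) \<star> \<zeta>) <= N * (word_dist Gam S x y + 1)"
      if xy: "x \<in> carrier Gam" "y \<in> carrier Gam" for x y
    proof -
      let ?g = "inv\<^bsub>Gam\<^esub> x \<otimes>\<^bsub>Gam\<^esub> y" and ?t = "tmul (tinv (r x)) (r y)"
      have g: "?g \<in> carrier Gam" using xy by simp
      have t: "?t \<in> TR" using r(1) xy by (intro TR_mult TR_inv) auto
      have "pj (r ?g) = pj ?t" using r xy g by (simp add: quot)
      then obtain \<zeta> where \<zeta>: "\<zeta> \<in> ZT" "r ?g = tmul ?t \<zeta>" using pj_eqD[OF r(1)[OF g] t] by blast
      have "len (%v. tmul ?t \<zeta>) <= N * (word_dist Gam S x y + 1)" using up1[OF r(3)[OF g]] xy unfolding \<zeta>(2) by (simp add: wd)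
      then show ?thesis using \<zeta>(1) unfolding ZT_ZP by (intro bexI[of _ "%v. \<zeta>"]) (simp_all only: quot(1)[OF r(1)[OF xy(1)] r(1)[OF xy(2)]] right)
    qed
    show "\<exists>\<gamma>\<in>carrier Gam. \<exists>\<zeta>\<in>ZP. len (inv\<^bsub>PG\<^esub> g \<star> ((%v. r \<gamma>) \<star> \<zeta>)) <= N" if g: "g \<in> carrier PG" for g
    proof -
      obtain a where a: "a \<in> TR" "len (inv\<^bsub>PG\<^esub> g \<star> (%v. a)) <= 0" using TR_coarsely_dense[OF g] by blast
      obtain \<zeta> where \<zeta>: "\<zeta> \<in> ZT" "a = tmul (r (pj a)) \<zeta>" using pj_eqD[OF a(1) r(1)[OF pc[OF a(1)]]] r(2)[OF pc[OF a(1)]] by metis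
      have "len (inv\<^bsub>PG\<^esub> g \<star> ((%v. r (pj a)) \<star> (%v. \<zeta>))) <= N"
        unfolding right \<zeta>(2)[symmetric] using a(2) K(1) K'(1) by (simp add: N_def)
      then show ?thesis using \<zeta>(1) pc[OF a(1)] unfolding ZT_ZP by blast
    qed
    show "z j n \<in> ZP" if "j \<in> carrier (additive A)" for j n using zZ that by simp
    show "\<exists>j\<in>carrier (additive A). size (inv\<^sub>s \<zeta> \<cdot> z j) = 0" if "\<zeta> \<in> \<S>" "!!n. \<zeta> n \<in> ZP" for \<zeta>
      using near that by simp
  qed
  have "pi1_cone Gam S \<omega> \<cong> additive A"
    unfolding pi1_cone_def by (rule Q.fundamental_group_of_cone[OF cone_path_connected cone_null_homotopic])
  then show ?thesis using A fact by blast
qed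

end

section \<open>The two possible fundamental groups\<close>

lemma additive_mod_ring_iso: "additive (UNIV :: 'p::prime_card mod_ring set) \<cong> integer_mod_group CARD('p)"
proof -
  have p: "CARD('p) > 0" by simp
  have "(%x :: 'p mod_ring. to_int_mod_ring x) \<in> iso (additive UNIV) (integer_mod_group CARD('p))"
  proof (rule isoI)
    have r: "range (to_int_mod_ring :: 'p mod_ring => int) = carrier (integer_mod_group CARD('p))"
      using range_to_int_mod_ring[where 'a = 'p] p by (simp add: carrier_integer_mod_group)
    show "(%x :: 'p mod_ring. to_int_mod_ring x) \<in> hom (additive UNIV) (integer_mod_group CARD('p))"
      using r by (intro homI) (auto simp: to_int_mod_ring_add)
    show "bij_betw (%x :: 'p mod_ring. to_int_mod_ring x) (carrier (additive UNIV)) (carrier (integer_mod_group CARD('p)))"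
      using r by (auto simp: bij_betw_def inj_def)
  qed
  then show ?thesis by (auto simp: is_iso_def)
qed

text \<open>The isomorphism is only a bijective multiplicative map, so the group axioms are verified directly on the single class.\<close>

lemma trivial_fundamental_group:
  assumes b: "b \<in> topspace T" and iso: "fundamental_group T b \<cong> D" and D: "carrier D = {d}" shows "trivial_group (fundamental_group T b)"
proof -
  let ?G = "fundamental_group T b" and ?R = "loop_homotopy_rel T b" and ?k = "%s :: real. b"
  have refl: "(f, f) \<in> ?R" if "f \<in> loops_at T b" for f using that by (auto simp: loop_homotopy_rel_def loops_at_def pathin_def)
  have k: "?k \<in> loops_at T b" using b by (simp add: loops_at_def pathin_const)
  obtain h where "bij_betw h (carrier ?G) (carrier D)" using iso unfolding is_iso_def iso_def by blast
  then have "card (carrier ?G) = 1" using bij_betw_same_card[of h "carrier ?G" "carrier D"] D by simp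
  moreover have "\<one>\<^bsub>?G\<^esub> \<in> carrier ?G" using k by (simp add: fundamental_group_def quotientI)
  ultimately have c: "carrier ?G = {\<one>\<^bsub>?G\<^esub>}" by (metis card_1_singletonE singletonD)
  have one: "f \<in> \<one>\<^bsub>?G\<^esub>" if f: "f \<in> loops_at T b" for f
  proof -
    have m: "?R `` {f} \<in> carrier ?G" using f by (simp add: fundamental_group_def quotientI)
    have "?R `` {f} = \<one>\<^bsub>?G\<^esub>" by (rule singletonD[OF m[unfolded c]])
    moreover have "f \<in> ?R `` {f}" using refl[OF f] by blast
    ultimately show ?thesis by (simp only:)
  qed
  have one_eq: "\<one>\<^bsub>?G\<^esub> = ?R `` {?k}" by (simp add: fundamental_group_def)
  have k1: "?k \<in> \<one>\<^bsub>?G\<^esub>" by (rule one[OF k])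
  have kk: "loop_concat ?k ?k = ?k" by (simp add: loop_concat_def fun_eq_iff)
  have mult: "\<one>\<^bsub>?G\<^esub> \<otimes>\<^bsub>?G\<^esub> \<one>\<^bsub>?G\<^esub> = \<one>\<^bsub>?G\<^esub>"
  proof
    have e: "\<one>\<^bsub>?G\<^esub> \<otimes>\<^bsub>?G\<^esub> \<one>\<^bsub>?G\<^esub> = ?R `` {loop_concat f g | f g. f \<in> \<one>\<^bsub>?G\<^esub> \<and> g \<in> \<one>\<^bsub>?G\<^esub>}"
      by (simp add: fundamental_group_def)
    show "\<one>\<^bsub>?G\<^esub> \<otimes>\<^bsub>?G\<^esub> \<one>\<^bsub>?G\<^esub> \<subseteq> \<one>\<^bsub>?G\<^esub>" unfolding e using one by (auto simp: loop_homotopy_rel_def)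
    have "?k \<in> {loop_concat f g | f g. f \<in> \<one>\<^bsub>?G\<^esub> \<and> g \<in> \<one>\<^bsub>?G\<^esub>}" using k1 kk by force
    then show "\<one>\<^bsub>?G\<^esub> \<subseteq> \<one>\<^bsub>?G\<^esub> \<otimes>\<^bsub>?G\<^esub> \<one>\<^bsub>?G\<^esub>" unfolding e by (subst one_eq) blast
  qed
  have "group ?G" by (rule groupI) (simp_all add: c mult)
  then show ?thesis using c by (simp add: trivial_group_def)
qed

theorem corollary1p9:
  fixes p :: nat
  assumes "prime p" and "CARD('p::prime_card) = p"
  shows "\<exists>(\<Gamma> :: 'p mod_ring poly fract mat set monoid) Z.
           central_subgroup Z (A4 (localized_polys :: 'p mod_ring poly fract set)) \<and>
           \<Gamma> = A4 localized_polys Mod Z \<and>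
           finitely_generated_group \<Gamma> \<and>
           nilpotent_by_abelian 3 \<Gamma> \<and>
           (\<forall>S. finite_generating_set \<Gamma> S \<longrightarrow>
              (\<forall>\<omega>. nonprincipal_ultrafilter \<omega> \<longrightarrow>
                 trivial_group (pi1_cone \<Gamma> S \<omega>) \<or> pi1_cone \<Gamma> S \<omega> \<cong> integer_mod_group p) \<and>
              (\<exists>\<omega>. nonprincipal_ultrafilter \<omega> \<and> pi1_cone \<Gamma> S \<omega> \<cong> integer_mod_group p))"
proof (intro exI[of _ "Gam :: 'p mod_ring poly fract mat set monoid"] exI[of _ ZM] conjI allI impI)
  have fin: "finite (UNIV :: 'p mod_ring set)" by simp
  show "central_subgroup ZM (A4 (localized_polys :: 'p mod_ring poly fract set))" by (rule ZM_central)
  show "Gam = A4 localized_polys Mod ZM" by (rule Gam_def)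
  show "finitely_generated_group (Gam :: 'p mod_ring poly fract mat set monoid)" by (rule Gam_finitely_generated[OF fin])
  show "nilpotent_by_abelian 3 (Gam :: 'p mod_ring poly fract mat set monoid)" by (rule Gam_nilpotent_by_abelian)
  fix S assume S: "finite_generating_set (Gam :: 'p mod_ring poly fract mat set monoid) S"
  have iso: "X \<cong> integer_mod_group p" if "X \<cong> additive (UNIV :: 'p mod_ring set)" for X :: "(real \<Rightarrow> (nat \<Rightarrow> 'p mod_ring poly fract mat set) set) set monoid"
    using iso_trans[OF that additive_mod_ring_iso] assms(2) by simp
  show "trivial_group (pi1_cone Gam S \<omega>) \<or> pi1_cone Gam S \<omega> \<cong> integer_mod_group p" if \<omega>: "nonprincipal_ultrafilter \<omega>" for \<omega>
  proof -
    obtain A where A: "A = (UNIV :: 'p mod_ring set) \<or> A = {0}" "pi1_cone Gam S \<omega> \<cong> additive A" using abels_cone.pi1_cone_Gam[OF abels_cone.intro[OF length_group_PG[OF \<omega>]] fin S] by blast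
    have S': "S \<subseteq> carrier Gam" "generate Gam S = carrier Gam" using S by (auto simp: finite_generating_set_def)
    have "\<one>\<^bsub>Gam\<^esub> \<in> mspace (word_metric Gam S)"
      unfolding word_metric_simps[OF Gam_group S'] using group.is_monoid[OF Gam_group] monoid.one_closed by blast
    note b = basepoint_in_cone[OF \<omega> this]
    from A(1) show ?thesis
    proof
      assume "A = UNIV"
      then show ?thesis using iso A(2) by blast
    next
      assume "A = {0}"
      then have "carrier (additive A) = {0}" by simp
      then show ?thesis using trivial_fundamental_group[OF b A(2)[unfolded pi1_cone_def]] unfolding pi1_cone_def by blast
    qed
  qed
  obtain \<omega> where \<omega>: "nonprincipal_ultrafilter \<omega>" "\<forall>\<^sub>F n in \<omega>. n \<in> range fact" using factorial_ultrafilter_exists by blast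
  obtain A where A: "pi1_cone Gam S \<omega> \<cong> additive A" "(\<forall>\<^sub>F n in \<omega>. n \<in> range fact) \<longrightarrow> A = (UNIV :: 'p mod_ring set)"
    using abels_cone.pi1_cone_Gam[OF abels_cone.intro[OF length_group_PG[OF \<omega>(1)]] fin S] by (elim exE conjE)
  have "pi1_cone Gam S \<omega> \<cong> integer_mod_group p" by (rule iso) (use A(1) mp[OF A(2) \<omega>(2)] in simp)
  with \<omega>(1) show "\<exists>\<omega>. nonprincipal_ultrafilter \<omega> \<and> pi1_cone Gam S \<omega> \<cong> integer_mod_group p" by (intro exI[of _ \<omega>] conjI)
qed

end
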